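(* Let $\mathbf{E}^0(t,\mathbf{x})=\mathbf{q}f(t+\frac{x_3}{c})$ with $q_3=0$, and let $I_j^2$, $j\in\{1,2\}$, be the second order approximated measurement data (defined in the context) for a medium of the form $\hat{\boldsymbol\chi}(\omega,\mathbf{x})=\boldsymbol\chi_0+\epsilon\,\boldsymbol\psi(\mathbf{x})$, $\mathbf{x}\in\Omega$, as specified in the context, with data $I_j^2(l,\boldsymbol\xi)=I_0+\epsilon M_j(l,\boldsymbol\xi)$, where $I_0$ is the (known) data for $\epsilon=0$ and $M_j$ is the (known) term of first order in $\epsilon$. Let $\omega>0$ with $\hat f(\omega)\ne0$, let $\boldsymbol\vartheta\in\mathbb{S}^2_+:=\{\boldsymbol\mu\in\mathbb{S}^2\mid\mu_3>0\}$, let $\rho>0$ be such that $\rho\boldsymbol\vartheta\in\mathcal{D}$, and define $\mathbf{v}=\frac{\omega}{c}(\boldsymbol\vartheta+\mathbf{e}_3)$. Then the spatial Fourier transform $\tilde{\boldsymbol\psi}$ of the matrix-valued function $\boldsymbol\psi:\mathbb{R}^3\to\mathbb{C}^{3\times3}$ satisfies the equations $$\eta_j\Big[\boldsymbol\vartheta\times\Big(\boldsymbol\vartheta\times\Big(\big(\tilde{\boldsymbol\psi}(\mathbf{v})+\boldsymbol\chi_0\,\boldsymbol{\mathcal{K}}[\tilde{\boldsymbol\psi}](\mathbf{v})+\boldsymbol{\mathcal{K}}^\dagger[\tilde{\boldsymbol\psi}](\mathbf{v})\,\boldsymbol\chi_0\big)\mathbf{p}\Big)\Big)\Big]_j=\tilde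 m_j(\mathbf{v}),\qquad j\in\{1,2\},$$ where $$\tilde m_j(\mathbf{v}):=m_j(\omega,\boldsymbol\vartheta)=-\frac{4\pi\rho c}{\omega^2|\hat f(\omega)|^2}\int_{\mathbb{R}}M_j(l,\rho\boldsymbol\vartheta)\,e^{-i\frac{\omega}{c}(2l-\rho(\vartheta_3-1))}\,dl .$$ Here, for functions $\mathbf{f}:\mathbb{R}^3\to\mathbb{C}^{3\times3}$, $$\boldsymbol{\mathcal{K}}[\mathbf{f}](\mathbf{v}):=\int_{\mathbb{R}^3}\mathbf{K}^{\mathbf{z}}(\mathbf{v};\mathbf{k})\,\mathbf{f}(\mathbf{k})\,d\mathbf{k},\qquad \boldsymbol{\mathcal{K}}^\dagger[\mathbf{f}](\mathbf{v}):=\int_{\mathbb{R}^3}\mathbf{f}(\mathbf{k})\,\mathbf{K}^{\mathbf{y}}(\mathbf{v};\mathbf{k})\,d\mathbf{k},$$ with kernels $$\mathbf{K}^{\boldsymbol\alpha}\big(\tfrac{\omega}{c}(\boldsymbol\vartheta+\mathbf{e}_3);\mathbf{k}\big)=\frac{\omega^2}{c^2(2\pi)^3}\int_\Omega\int_\Omega\mathbf{G}(\omega,\mathbf{y}-\mathbf{z})\,e^{-i\frac{\omega}{c}(z_3+\langle\boldsymbol\vartheta,\mathbf{y}\rangle)}\,e^{i\langle\mathbf{k},\boldsymbol\alpha\rangle}\,d\mathbf{z}\,d\mathbf{y},\qquad\boldsymbol\alpha\in\{\mathbf{z},\mathbf{y}\}.$$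
   Context: The constant $c>0$ is the speed of light; $\hat f(\omega)=\int_{\mathbb{R}}f(t)e^{i\omega t}\,dt$ (time), $\tilde g(\mathbf{k})=\int_{\mathbb{R}^3}g(\mathbf{x})e^{-i\langle\mathbf{k},\mathbf{x}\rangle}\,d\mathbf{x}$ (space, entrywise). The detector is $\mathcal{D}=\mathbb{R}^2\times\{d\}$ with $d>0$ sufficiently large. $\mathbf{e}_3=(0,0,1)^T$. $\Omega\subset\mathbb{R}^3$ is a bounded open set containing the medium. Medium: for the frequencies $\omega>0$ considered (those of the small spectrum of the illumination, over which the optical parameters are taken constant in frequency), $\hat{\boldsymbol\chi}(\omega,\mathbf{x})=\boldsymbol\chi_0+\epsilon\boldsymbol\psi(\mathbf{x})$ for $\mathbf{x}\in\Omega$ and $\hat{\boldsymbol\chi}=0$ outside $\Omega$, where $$\boldsymbol\chi_0=\chi_0\begin{pmatrix}1&1&0\\1&1&0\\0&0&1\end{pmatrix},\qquad\boldsymbol\psi=\begin{pmatrix}\psi_{11}&\psi_{12}&0\\\psi_{12}&\psi_{22}&0\\0&0&\psi_{33}\end{pmatrix},$$ with known $\chi_0\in\mathbb{R}$, a small parameter $\epsilon>0$, and $\psi_{ij}\in C_c^\infty(\mathbb{R}^3;\mathbb{C})$ supported in $\Omega$. Illumination: $f\in C_c^\infty(\mathbb{R})$ is real valued, $\mathbf{q}\in\mathbb{R}^2\times\{0\}$, $\operatorname{supp}\mathbf{E}^0(t,\cdot)\cap\Omega=\emptyset$ for $t\le0$, and $\mathbf{E}^0(t,\mathbf{x})=0$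 for $t\ge0$, $\mathbf{x}\in\mathcal{D}$. Polarization: $\mathbf{J}(\phi)=R(\phi)\,\mathrm{diag}(1,-i,1)\,R(\phi)^T$ with $R(\phi)=\begin{pmatrix}\cos\phi&-\sin\phi&0\\\sin\phi&\cos\phi&0\\0&0&1\end{pmatrix}$; $\boldsymbol\eta=\mathbf{J}^2(\pi/8)\mathbf{q}$, $\mathbf{p}=\mathbf{J}(\pi/4)\mathbf{q}$. For $\omega>0$, $\hat{\mathbf{E}}^{0,inc}(\omega,\mathbf{x})=\mathbf{p}\hat f(\omega)e^{-i\frac{\omega}{c}x_3}$. Operators: $G(\omega,\mathbf{x})=\frac{e^{i\frac{\omega}{c}|\mathbf{x}|}}{4\pi|\mathbf{x}|}$; the Green tensor is $\mathbf{G}(\omega,\mathbf{x}-\mathbf{y})=G(\omega,\mathbf{x}-\mathbf{y})\mathrm{Id}+\frac{c^2}{\omega^2}\operatorname{grad}\operatorname{div}(G(\omega,\mathbf{x}-\mathbf{y})\mathrm{Id})$, where integrals against the strongly singular $\mathbf{G}$ are understood through $$\boldsymbol{\mathcal{G}}[\mathbf{f}](\omega,\mathbf{x})=\Big(\frac{\omega^2}{c^2}\mathrm{Id}+\operatorname{grad}\operatorname{div}\Big)\int_{\mathbb{R}^3}G(\omega,\mathbf{x}-\mathbf{y})\mathbf{f}(\omega,\mathbf{y})\,d\mathbf{y}=\frac{\omega^2}{c^2}\int_{\mathbb{R}^3}\mathbf{G}(\omega,\mathbf{x}-\mathbf{y})\mathbf{f}(\omega,\mathbf{y})\,d\mathbf{y};$$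 the far-field operator is $$\boldsymbol{\mathcal{G}}^\infty[\mathbf{f}](\omega,\rho\boldsymbol\vartheta)=-\frac{\omega^2e^{i\frac{\omega}{c}\rho}}{4\pi\rho c^2}\int_{\mathbb{R}^3}\boldsymbol\vartheta\times(\boldsymbol\vartheta\times\mathbf{f}(\omega,\mathbf{y}))e^{-i\frac{\omega}{c}\langle\boldsymbol\vartheta,\mathbf{y}\rangle}\,d\mathbf{y}.$$ Data: for $l\in\mathbb{R}$, $\boldsymbol\xi\in\mathcal{D}$, $j\in\{1,2\}$, $$I_j^2(l,\boldsymbol\xi)=\frac{\eta_j}{\pi}\operatorname{Re}\int_0^\infty(\hat E_j^2-\hat E_j^{0,inc})(\omega,\boldsymbol\xi)\hat f(-\omega)e^{i\frac{\omega}{c}(2l-\xi_3)}\,d\omega,$$ where, for $\omega>0$, $\hat{\mathbf{E}}^2$ on the detector is the far-field second order Born approximation $$\hat{\mathbf{E}}^2(\omega,\rho\boldsymbol\vartheta)=\hat{\mathbf{E}}^{0,inc}(\omega,\rho\boldsymbol\vartheta)+\boldsymbol{\mathcal{G}}^\infty[\hat{\boldsymbol\chi}\hat{\mathbf{E}}^{0,inc}](\omega,\rho\boldsymbol\vartheta)+\boldsymbol{\mathcal{G}}^\infty[\hat{\boldsymbol\chi}\boldsymbol{\mathcal{G}}[\hat{\boldsymbol\chi}\hat{\mathbf{E}}^{0,inc}]](\omega,\rho\boldsymbol\vartheta).$$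
   Formalization: The constant 4πρc in the definition of m_j is replaced by 8πρc: with the stated conventions for the data (real part of an integral over positive frequencies, factor η_j/π), the formula with 4π gives exactly half of the left-hand side. *)

theory Defs
  imports "HOL-Analysis.Analysis" "HOL-Library.Landau_Symbols"
begin

subsection \<open>Test functions\<close>

definition tsupp :: "('a::topological_space \<Rightarrow> 'b::zero) \<Rightarrow> 'a set" where
  "tsupp f = closure {x. f x \<noteq> 0}"

definition dir_deriv :: "'a::real_normed_vector \<Rightarrow> ('a \<Rightarrow> 'b::real_normed_vector) \<Rightarrow> 'a \<Rightarrow> 'b" where
  "dir_deriv b g x = vector_derivative (\<lambda>t::real. g (x + t *\<^sub>R b)) (at 0)"

text \<open>All iterated partial derivatives are differentiable (hence continuous).\<close>

definition smooth :: "('a::euclidean_space \<Rightarrow> 'b::real_normed_vector) \<Rightarrow> bool" where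
  "smooth f \<longleftrightarrow> (\<forall>bs. set bs \<subseteq> Basis \<longrightarrow> foldr dir_deriv bs f differentiable_on UNIV)"

definition test_function :: "('a::euclidean_space \<Rightarrow> 'b::real_normed_vector) \<Rightarrow> bool" where
  "test_function f \<longleftrightarrow> smooth f \<and> compact (tsupp f)"


subsection \<open>Complex vectors and matrices in dimension three\<close>

definition cvec :: "real^3 \<Rightarrow> complex^3" where
  "cvec v = (\<chi> i. of_real (v $ i))"

definition cmat :: "real^3^3 \<Rightarrow> complex^3^3" where
  "cmat A = (\<chi> i j. of_real (A $ i $ j))"

text \<open>The library's cross product is restricted to real vectors; this is its bilinear
  extension.\<close>

definition ccross :: "complex^3 \<Rightarrow> complex^3 \<Rightarrow> complex^3" where
  "ccross a b = vector [a$2 * b$3 - a$3 * b$2, a$3 * b$1 - a$1 * b$3, a$1 * b$2 - a$2 * b$1]"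

definition e3 :: "real^3" where
  "e3 = axis 3 1"

definition upper_hemisphere :: "(real^3) set" where
  "upper_hemisphere = {\<theta>. norm \<theta> = 1 \<and> \<theta> $ 3 > 0}"

definition detector :: "real \<Rightarrow> (real^3) set" where
  "detector d = {x. x $ 3 = d}"


subsection \<open>Fourier transforms\<close>

definition time_fourier :: "(real \<Rightarrow> real) \<Rightarrow> real \<Rightarrow> complex" where
  "time_fourier f \<omega> = (LINT t|lborel. of_real (f t) * exp (\<i> * of_real (\<omega> * t)))"

definition space_fourier :: "(real^3 \<Rightarrow> complex^3^3) \<Rightarrow> real^3 \<Rightarrow> complex^3^3" where
  "space_fourier g k = (\<chi> i j. LINT x|lborel. g x $ i $ j * exp (- \<i> * of_real (k \<bullet> x)))"


subsection \<open>Medium\<close>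

definition chi0_mat :: "real \<Rightarrow> complex^3^3" where
  "chi0_mat \<chi>0 = cmat (\<chi>0 *\<^sub>R vector [vector [1, 1, 0], vector [1, 1, 0], vector [0, 0, 1]])"

definition psi_mat ::
  "(real^3 \<Rightarrow> complex) \<Rightarrow> (real^3 \<Rightarrow> complex) \<Rightarrow> (real^3 \<Rightarrow> complex) \<Rightarrow> (real^3 \<Rightarrow> complex)
    \<Rightarrow> real^3 \<Rightarrow> complex^3^3" where
  "psi_mat \<psi>11 \<psi>12 \<psi>22 \<psi>33 x =
     vector [vector [\<psi>11 x, \<psi>12 x, 0], vector [\<psi>12 x, \<psi>22 x, 0], vector [0, 0, \<psi>33 x]]"

text \<open>The susceptibility does not depend on the (positive) frequency.\<close>

definition chi_hat :: "(real^3) set \<Rightarrow> real \<Rightarrow> (real^3 \<Rightarrow> complex^3^3) \<Rightarrow> real \<Rightarrow> real^3 \<Rightarrow> complex^3^3" where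
  "chi_hat \<Omega> \<chi>0 \<psi> \<epsilon> x = (if x \<in> \<Omega> then chi0_mat \<chi>0 + \<epsilon> *\<^sub>R \<psi> x else 0)"


subsection \<open>Illumination and polarization\<close>

definition E0 :: "real \<Rightarrow> real^3 \<Rightarrow> (real \<Rightarrow> real) \<Rightarrow> real \<Rightarrow> real^3 \<Rightarrow> real^3" where
  "E0 c q f t x = f (t + x $ 3 / c) *\<^sub>R q"

definition rot :: "real \<Rightarrow> real^3^3" where
  "rot \<phi> = vector [vector [cos \<phi>, - sin \<phi>, 0], vector [sin \<phi>, cos \<phi>, 0], vector [0, 0, 1]]"

definition jones :: "real \<Rightarrow> complex^3^3" where
  "jones \<phi> = cmat (rot \<phi>)
     ** vector [vector [1, 0, 0], vector [0, - \<i>, 0], vector [0, 0, 1]]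
     ** transpose (cmat (rot \<phi>))"

definition eta :: "real^3 \<Rightarrow> complex^3" where
  "eta q = (jones (pi/8) ** jones (pi/8)) *v cvec q"

definition pol :: "real^3 \<Rightarrow> complex^3" where
  "pol q = jones (pi/4) *v cvec q"

definition E_inc :: "real \<Rightarrow> real^3 \<Rightarrow> (real \<Rightarrow> real) \<Rightarrow> real \<Rightarrow> real^3 \<Rightarrow> complex^3" where
  "E_inc c q f \<omega> x = (time_fourier f \<omega> * exp (- \<i> * of_real (\<omega> / c * x $ 3))) *s pol q"


subsection \<open>Scattering operators\<close>

definition green :: "real \<Rightarrow> real \<Rightarrow> real^3 \<Rightarrow> complex" where
  "green c \<omega> x = exp (\<i> * of_real (\<omega> / c * norm x)) / of_real (4 * pi * norm x)"

definition divergence :: "(real^3 \<Rightarrow> complex^3) \<Rightarrow> real^3 \<Rightarrow> complex" where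
  "divergence u x = (\<Sum>i\<in>UNIV. dir_deriv (axis i 1) (\<lambda>y. u y $ i) x)"

definition gradient :: "(real^3 \<Rightarrow> complex) \<Rightarrow> real^3 \<Rightarrow> complex^3" where
  "gradient g x = (\<chi> i. dir_deriv (axis i 1) g x)"

text \<open>The operators act on fields at a fixed frequency \<open>\<omega>\<close>.\<close>

definition green_op :: "real \<Rightarrow> real \<Rightarrow> (real^3 \<Rightarrow> complex^3) \<Rightarrow> real^3 \<Rightarrow> complex^3" where
  "green_op c \<omega> F x =
     (let u = (\<lambda>x. LINT y|lborel. green c \<omega> (x - y) *s F y)
      in (\<omega>\<^sup>2 / c\<^sup>2) *\<^sub>R u x + gradient (divergence u) x)"

text \<open>The integral of \<open>F\<close> against the strongly singular Green tensor
  \<open>G Id + (c\<^sup>2/\<omega>\<^sup>2) grad div (G Id)\<close>. This integral is not absolutely convergent and is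
  understood through \<open>green_op\<close>, that is, with the derivatives taken outside.\<close>

definition green_tensor_int :: "real \<Rightarrow> real \<Rightarrow> (real^3 \<Rightarrow> complex^3) \<Rightarrow> real^3 \<Rightarrow> complex^3" where
  "green_tensor_int c \<omega> F x = (c\<^sup>2 / \<omega>\<^sup>2) *\<^sub>R green_op c \<omega> F x"

text \<open>The evaluation point \<open>x = \<rho>\<theta>\<close> has \<open>\<rho> = norm x\<close> and \<open>\<theta> = sgn x = x / norm x\<close>.\<close>

definition far_field :: "real \<Rightarrow> real \<Rightarrow> (real^3 \<Rightarrow> complex^3) \<Rightarrow> real^3 \<Rightarrow> complex^3" where
  "far_field c \<omega> F x =
     (let \<rho> = norm x; \<theta> = sgn x
      in (- (of_real (\<omega>\<^sup>2) * exp (\<i> * of_real (\<omega> / c * \<rho>)) / of_real (4 * pi * \<rho> * c\<^sup>2)))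
         *s (LINT y|lborel. exp (- \<i> * of_real (\<omega> / c * (\<theta> \<bullet> y)))
               *s ccross (cvec \<theta>) (ccross (cvec \<theta>) (F y))))"


subsection \<open>Measurement data\<close>

definition E2 ::
  "real \<Rightarrow> (real^3) set \<Rightarrow> real \<Rightarrow> (real^3 \<Rightarrow> complex^3^3) \<Rightarrow> real^3 \<Rightarrow> (real \<Rightarrow> real)
    \<Rightarrow> real \<Rightarrow> real \<Rightarrow> real^3 \<Rightarrow> complex^3" where
  "E2 c \<Omega> \<chi>0 \<psi> q f \<epsilon> \<omega> x =
     (let X = chi_hat \<Omega> \<chi>0 \<psi> \<epsilon>;
          E = E_inc c q f \<omega>
      in E x + far_field c \<omega> (\<lambda>y. X y *v E y) x
             + far_field c \<omega> (\<lambda>y. X y *v green_op c \<omega> (\<lambda>z. X z *v E z) y) x)"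

definition data2 ::
  "real \<Rightarrow> (real^3) set \<Rightarrow> real \<Rightarrow> (real^3 \<Rightarrow> complex^3^3) \<Rightarrow> real^3 \<Rightarrow> (real \<Rightarrow> real)
    \<Rightarrow> real \<Rightarrow> 3 \<Rightarrow> real \<Rightarrow> real^3 \<Rightarrow> complex" where
  "data2 c \<Omega> \<chi>0 \<psi> q f \<epsilon> j l \<xi> =
     eta q $ j / of_real pi *
     of_real (Re (LINT \<omega>:{0<..}|lborel.
       (E2 c \<Omega> \<chi>0 \<psi> q f \<epsilon> \<omega> \<xi> $ j - E_inc c q f \<omega> \<xi> $ j)
         * time_fourier f (- \<omega>) * exp (\<i> * of_real (\<omega> / c * (2 * l - \<xi> $ 3)))))"

text \<open>\<open>M\<close> is the first order term in the expansion of the data in the small parameter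
  \<open>\<epsilon> > 0\<close>; the data for \<open>\<epsilon> = 0\<close> is the zeroth order term.\<close>

definition first_order_data ::
  "real \<Rightarrow> (real^3) set \<Rightarrow> real \<Rightarrow> (real^3 \<Rightarrow> complex^3^3) \<Rightarrow> real^3 \<Rightarrow> (real \<Rightarrow> real)
    \<Rightarrow> real \<Rightarrow> (3 \<Rightarrow> real \<Rightarrow> real^3 \<Rightarrow> complex) \<Rightarrow> bool" where
  "first_order_data c \<Omega> \<chi>0 \<psi> q f d M \<longleftrightarrow>
     (\<forall>j\<in>{1, 2}. \<forall>l. \<forall>\<xi>\<in>detector d.
        (\<lambda>\<epsilon>. data2 c \<Omega> \<chi>0 \<psi> q f \<epsilon> j l \<xi>
              - (data2 c \<Omega> \<chi>0 \<psi> q f 0 j l \<xi> + of_real \<epsilon> * M j l \<xi>))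
        \<in> o[at_right 0](\<lambda>\<epsilon>. of_real \<epsilon>))"

text \<open>The factor \<open>8 \<pi>\<close> is the one belonging to the conventions above: since the data is a real
  part, it is half of an integral over all frequencies, and by Fourier inversion in \<open>2 l / c\<close>
  the integral over \<open>l\<close> of \<open>Re (\<integral>\<^sub>0\<^sup>\<infinity> F(\<omega>) exp (2 i \<omega> l / c) d\<omega>) / \<pi>\<close> against
  \<open>exp (- 2 i \<omega> l / c)\<close> equals \<open>(c / 2) F(\<omega>)\<close>. (With \<open>4 \<pi>\<close>, as sometimes written, \<open>m\<close>
  would be half of the stated combination of Fourier coefficients.)\<close>

definition m_data ::
  "real \<Rightarrow> (real \<Rightarrow> real) \<Rightarrow> (3 \<Rightarrow> real \<Rightarrow> real^3 \<Rightarrow> complex) \<Rightarrow> real \<Rightarrow> 3 \<Rightarrow> real \<Rightarrow> real^3 \<Rightarrow> complex" where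
  "m_data c f M \<rho> j \<omega> \<theta> =
     - of_real (8 * pi * \<rho> * c / (\<omega>\<^sup>2 * (cmod (time_fourier f \<omega>))\<^sup>2)) *
       (LINT l|lborel. M j l (\<rho> *\<^sub>R \<theta>)
          * exp (- \<i> * of_real (\<omega> / c * (2 * l - \<rho> * (\<theta> $ 3 - 1)))))"


subsection \<open>Integral operators in Fourier space\<close>

text \<open>The kernels and operators are functions of \<open>v = (\<omega>/c) (\<theta> + e3)\<close>. For \<open>\<omega> > 0\<close> and
  \<open>\<theta>\<close> in the upper hemisphere, \<open>v\<close> determines \<open>\<omega>\<close> and \<open>\<theta>\<close>, which are used as arguments
  instead. The argument \<open>\<alpha>\<close> selects the variable in the phase \<open>exp (i \<langle>k, \<alpha>\<rangle>)\<close> among the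
  integration variables \<open>y\<close> and \<open>z\<close>; column \<open>j\<close> of the kernel comes from the density
  along the \<open>j\<close>-th unit vector.\<close>

definition kern ::
  "real \<Rightarrow> (real^3) set \<Rightarrow> (real^3 \<Rightarrow> real^3 \<Rightarrow> real^3) \<Rightarrow> real \<Rightarrow> real^3 \<Rightarrow> real^3 \<Rightarrow> complex^3^3" where
  "kern c \<Omega> \<alpha> \<omega> \<theta> k =
     (\<chi> i j. of_real (\<omega>\<^sup>2 / (c\<^sup>2 * (2 * pi) ^ 3)) *
        (LINT y:\<Omega>|lborel.
           green_tensor_int c \<omega>
             (\<lambda>z. (indicator \<Omega> z * exp (- \<i> * of_real (\<omega> / c * (z $ 3 + \<theta> \<bullet> y)))
                    * exp (\<i> * of_real (k \<bullet> \<alpha> y z))) *s axis j 1) y $ i))"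

definition kern_z :: "real \<Rightarrow> (real^3) set \<Rightarrow> real \<Rightarrow> real^3 \<Rightarrow> real^3 \<Rightarrow> complex^3^3" where
  "kern_z c \<Omega> = kern c \<Omega> (\<lambda>y z. z)"

definition kern_y :: "real \<Rightarrow> (real^3) set \<Rightarrow> real \<Rightarrow> real^3 \<Rightarrow> real^3 \<Rightarrow> complex^3^3" where
  "kern_y c \<Omega> = kern c \<Omega> (\<lambda>y z. y)"

definition K_op ::
  "real \<Rightarrow> (real^3) set \<Rightarrow> (real^3 \<Rightarrow> complex^3^3) \<Rightarrow> real \<Rightarrow> real^3 \<Rightarrow> complex^3^3" where
  "K_op c \<Omega> F \<omega> \<theta> = (LINT k|lborel. kern_z c \<Omega> \<omega> \<theta> k ** F k)"

definition K_dagger ::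
  "real \<Rightarrow> (real^3) set \<Rightarrow> (real^3 \<Rightarrow> complex^3^3) \<Rightarrow> real \<Rightarrow> real^3 \<Rightarrow> complex^3^3" where
  "K_dagger c \<Omega> F \<omega> \<theta> = (LINT k|lborel. F k ** kern_y c \<Omega> \<omega> \<theta> k)"

end

theory Submission
  imports Defs "HOL-Probability.Characteristic_Functions" "HOL-Probability.Sinc_Integral"
begin

text \<open>Write \<open>\<kappa> = \<omega> / c\<close>. The first order term of the spectrum is a linear combination of integrals
  of \<open>\<psi>\<close> against plane waves and of \<open>\<psi>\<close> and \<open>1\<^sub>\<Omega>\<close> against the strongly singular Green tensor. The
  operators \<open>K\<close> and \<open>K\<^sup>\<dagger>\<close> arise from it by inserting Fourier's inversion formula for \<open>\<psi>\<close> and exchanging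
  the integrals. The exchange rests on an \<open>L\<^sup>1\<close> bound, uniform in \<open>\<xi>\<close>, for \<open>\<kappa>\<^sup>2 + grad div\<close> of the potential of
  \<open>1\<^sub>\<Omega> exp (i \<langle>\<xi>, z\<rangle>)\<close> on \<open>\<Omega>\<close>: the Green function is made \<open>C\<^sup>2\<close> inside a small ball, the integral of
  \<open>|\<partial>\<^sub>a \<partial>\<^sub>b u|\<^sup>2\<close> is controlled by that of \<open>|\<Delta> u|\<^sup>2\<close>, and the radius of the ball tends to zero.

  It remains to recover the spectrum at \<open>\<omega>\<close> from the data. The first order term of the spectrum is \<open>C\<^sup>2\<close> in
  \<open>\<omega>\<close> with rapid decay and vanishes to second order at \<open>\<omega> = 0\<close>, so its extension by zero to the negative
  frequencies has an integrable Fourier transform, which can be inverted; the conjugate part contributed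
  by taking the real part of the data lives on the negative frequencies. The zeroth order term is only
  known to be measurable in \<open>\<omega>\<close> with polynomial growth, which suffices since it cancels in the
  derivative with respect to \<open>\<epsilon>\<close>.\<close>

text \<open>Nothing is assumed about the boundary of \<Omega>: the potential of
  \<open>1_\<Omega>\<close> is under control at interior points only, and the second derivatives of
  the Green function grow like |x|^-3, just beyond local integrability. Two moves lead back to
  convergent integrals. Either both derivatives pass to the density, which must be smooth with
  support in \<Omega>; or the Green function is split, at a radius below the distance to the
  complement of \<Omega>, into a \<open>C^2\<close> kernel and an integrable remainder living in
  that small ball. Every first order term with a Green operator contains \<psi> once. If \<psi> is
  the density, the first move works; if it is the weight of the outer integral, one radius serves
  for its whole support. The zeroth order term has \<open>1_\<Omega>\<close> in both places, where
  neither move is uniform, so only the L^1 bound is left. The exponent 8 in that bound is a squared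
  4: \<kappa>^2 from the Helmholtz equation times \<open>(1 + \<bar>\<kappa>\<bar>)\<^sup>2\<close>
  from the kernel, squared by the L^2 estimate. The double zero at frequency 0 is the factor
  \<omega>^2 of the far field operator.\<close>

section \<open>Directional derivatives\<close>

lemma lborel_integral_translation:
  fixes f :: "'a::euclidean_space \<Rightarrow> 'b::{banach, second_countable_topology}"
  shows "(LINT x|lborel. f (x + a)) = (LINT x|lborel. f x)"
    and "integrable lborel (\<lambda>x. f (x + a)) \<longleftrightarrow> integrable lborel f"
proof -
  have *: "distr lborel lborel (\<lambda>x. x + a) = lborel" for a :: 'a
    using lborel_distr_plus[of a] by (simp add: add.commute[of _ a] cong: distr_cong)
  have int: "integrable lborel (\<lambda>x. f (x + a))" if "integrable lborel f" for a and f :: "'a \<Rightarrow> 'b"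
    using integrable_distr[of "\<lambda>x. x + a" lborel lborel f] * that by simp
  show iff: "integrable lborel (\<lambda>x. f (x + a)) \<longleftrightarrow> integrable lborel f"
    using int[of f a] int[of "\<lambda>x. f (x + a)" "- a"] by auto
  show "(LINT x|lborel. f (x + a)) = (LINT x|lborel. f x)"
  proof (cases "integrable lborel f")
    case True
    then show ?thesis
      using integral_distr[of "\<lambda>x. x + a" lborel lborel f] * by simp
  next
    case False
    then show ?thesis
      using iff by (simp add: not_integrable_integral_eq)
  qed
qed

lemma lborel_integrable_affine:
  fixes f :: "'a::euclidean_space \<Rightarrow> 'b::{banach, second_countable_topology}"
  assumes "c \<noteq> 0" and f: "integrable lborel f"
  shows "integrable lborel (\<lambda>x. f (t + c *\<^sub>R x))"
proof -
  have [measurable]: "f \<in> borel_measurable borel" using f by auto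
  have "integrable (density (distr lborel borel (\<lambda>x. t + c *\<^sub>R x)) (\<lambda>_. \<bar>c\<bar>^DIM('a))) f"
    using f lborel_affine[OF \<open>c \<noteq> 0\<close>, of t] by simp
  then have "integrable lborel (\<lambda>x. \<bar>c\<bar>^DIM('a) *\<^sub>R f (t + c *\<^sub>R x))"
    by (subst (asm) integrable_density) (auto simp: integrable_distr_eq)
  from integrable_scaleR_right[OF this, of "inverse (\<bar>c\<bar>^DIM('a))"] show ?thesis
    using \<open>c \<noteq> 0\<close> by simp
qed

lemma lborel_integral_affine:
  fixes f :: "'a::euclidean_space \<Rightarrow> 'b::{banach, second_countable_topology}"
  assumes "c \<noteq> 0" and f: "integrable lborel f"
  shows "(LINT x|lborel. f x) = \<bar>c\<bar> ^ DIM('a) *\<^sub>R (LINT x|lborel. f (t + c *\<^sub>R x))"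
proof -
  have [measurable]: "f \<in> borel_measurable borel" using f by auto
  have "(LINT x|lborel. f x) = (LINT x|density (distr lborel borel (\<lambda>x. t + c *\<^sub>R x)) (\<lambda>_. \<bar>c\<bar>^DIM('a)). f x)"
    using lborel_affine[of c t] assms by simp
  also have "\<dots> = (LINT x|distr lborel borel (\<lambda>x. t + c *\<^sub>R x). \<bar>c\<bar>^DIM('a) *\<^sub>R f x)"
    by (subst integral_density) auto
  also have "\<dots> = \<bar>c\<bar> ^ DIM('a) *\<^sub>R (LINT x|lborel. f (t + c *\<^sub>R x))"
    by (subst integral_distr) auto
  finally show ?thesis .
qed

lemma lborel_integrable_reflect:
  fixes f :: "'a::euclidean_space \<Rightarrow> 'b::{banach, second_countable_topology}"
  shows "integrable lborel (\<lambda>z. f (x - z)) \<longleftrightarrow> integrable lborel f"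
  using lborel_integrable_affine[of "-1" f x] lborel_integrable_affine[of "-1" "\<lambda>z. f (x - z)" x]
  by auto

lemma lborel_integral_reflect:
  fixes f :: "'a::euclidean_space \<Rightarrow> 'b::{banach, second_countable_topology}"
  shows "(LINT z|lborel. f (x - z)) = (LINT z|lborel. f z)"
proof (cases "integrable lborel f")
  case True
  then show ?thesis using lborel_integral_affine[of "-1" f x] by simp
next
  case False
  then show ?thesis using lborel_integrable_reflect[of f x] by (simp add: not_integrable_integral_eq)
qed

text \<open>\<open>dir_deriv\<close> has some arbitrary value where the derivative does not exist.
  The relational form also records existence, which the rules for sums, products and integrals
  need.\<close>

definition has_dir_deriv ::
  "'a::real_normed_vector \<Rightarrow> ('a \<Rightarrow> 'b::real_normed_vector) \<Rightarrow> 'b \<Rightarrow> 'a \<Rightarrow> bool" where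
  "has_dir_deriv b g g' x \<longleftrightarrow> ((\<lambda>t::real. g (x + t *\<^sub>R b)) has_vector_derivative g') (at 0)"

lemma has_dir_deriv_imp_dir_deriv: "has_dir_deriv b g g' x \<Longrightarrow> dir_deriv b g x = g'"
  unfolding has_dir_deriv_def dir_deriv_def by (rule vector_derivative_at)

lemma has_dir_deriv_line:
  assumes "has_dir_deriv b g g' (x + t *\<^sub>R b)"
  shows "((\<lambda>t. g (x + t *\<^sub>R b)) has_vector_derivative g') (at t)"
proof -
  have "((\<lambda>s. s - t) has_vector_derivative 1) (at t)"
    by (auto intro!: derivative_eq_intros)
  moreover have "((\<lambda>s. g (x + t *\<^sub>R b + s *\<^sub>R b)) has_vector_derivative g') (at (t - t))"
    using assms by (simp add: has_dir_deriv_def)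
  ultimately have "((\<lambda>s. g (x + t *\<^sub>R b + s *\<^sub>R b)) \<circ> (\<lambda>s. s - t) has_vector_derivative 1 *\<^sub>R g') (at t)"
    by (rule vector_diff_chain_at)
  then show ?thesis by (simp add: o_def algebra_simps)
qed

lemma has_dir_deriv_add:
  "has_dir_deriv b f f' x \<Longrightarrow> has_dir_deriv b g g' x \<Longrightarrow> has_dir_deriv b (\<lambda>x. f x + g x) (f' + g') x"
  unfolding has_dir_deriv_def by (rule has_vector_derivative_add)

lemma has_dir_deriv_diff:
  "has_dir_deriv b f f' x \<Longrightarrow> has_dir_deriv b g g' x \<Longrightarrow> has_dir_deriv b (\<lambda>x. f x - g x) (f' - g') x"
  unfolding has_dir_deriv_def by (rule has_vector_derivative_diff)

lemma has_dir_deriv_sum: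
  "(\<And>i. i \<in> I \<Longrightarrow> has_dir_deriv b (f i) (f' i) x) \<Longrightarrow> has_dir_deriv b (\<lambda>x. \<Sum>i\<in>I. f i x) (\<Sum>i\<in>I. f' i) x"
  unfolding has_dir_deriv_def by (rule has_vector_derivative_sum)

lemma has_dir_deriv_const: "has_dir_deriv b (\<lambda>x. c) 0 x"
  unfolding has_dir_deriv_def by (rule has_vector_derivative_const)

lemma has_dir_deriv_mult:
  fixes f g :: "'a::real_normed_vector \<Rightarrow> 'b::real_normed_algebra"
  shows "has_dir_deriv b f f' x \<Longrightarrow> has_dir_deriv b g g' x \<Longrightarrow>
    has_dir_deriv b (\<lambda>x. f x * g x) (f x * g' + f' * g x) x"
  unfolding has_dir_deriv_def using has_vector_derivative_mult[of "\<lambda>t. f (x + t *\<^sub>R b)" f' 0 UNIV "\<lambda>t. g (x + t *\<^sub>R b)" g'] by simp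

lemma has_dir_deriv_cmult:
  fixes g :: "'a::real_normed_vector \<Rightarrow> 'b::real_normed_algebra"
  shows "has_dir_deriv b g g' x \<Longrightarrow> has_dir_deriv b (\<lambda>x. c * g x) (c * g') x"
  using has_dir_deriv_mult[OF has_dir_deriv_const, of b g g' x c] by simp

lemma has_dir_deriv_bounded_linear:
  assumes "bounded_linear L"
  shows "has_dir_deriv b f f' x \<Longrightarrow> has_dir_deriv b (\<lambda>x. L (f x)) (L f') x"
  unfolding has_dir_deriv_def by (rule bounded_linear.has_vector_derivative[OF assms])

lemma has_dir_deriv_translate:
  assumes "has_dir_deriv b f f' (x - z)"
  shows "has_dir_deriv b (\<lambda>x. f (x - z)) f' x"
  using assms unfolding has_dir_deriv_def by (simp add: algebra_simps)

lemma has_dir_deriv_cong_open: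
  assumes "has_dir_deriv b f f' x" and "open S" and "x \<in> S" and "\<And>y. y \<in> S \<Longrightarrow> f y = g y"
  shows "has_dir_deriv b g f' x"
  unfolding has_dir_deriv_def
proof (rule has_vector_derivative_transform_within_open)
  show "((\<lambda>t. f (x + t *\<^sub>R b)) has_vector_derivative f') (at 0)"
    using assms(1) by (simp add: has_dir_deriv_def)
  show "open ((\<lambda>t. x + t *\<^sub>R b) -` S)"
    by (rule open_vimage) (use assms in \<open>auto intro!: continuous_intros\<close>)
qed (use assms in auto)

lemma differentiable_imp_has_dir_deriv:
  assumes "g differentiable (at x)"
  shows "has_dir_deriv b g (dir_deriv b g x) x"
proof -
  obtain g' where g': "(g has_derivative g') (at x)"
    using assms unfolding differentiable_def by blast
  have "((\<lambda>t. g (x + t *\<^sub>R b)) has_derivative (\<lambda>t. g' (t *\<^sub>R b))) (at 0)"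
    by (rule has_derivative_compose[of "\<lambda>t. x + t *\<^sub>R b" _ 0 UNIV g g'])
      (use g' in \<open>auto intro!: derivative_eq_intros\<close>)
  then have "((\<lambda>t. g (x + t *\<^sub>R b)) has_vector_derivative g' b) (at 0)"
    using has_derivative_linear[OF g'] by (simp add: has_vector_derivative_def linear_cmul)
  then show ?thesis
    using has_dir_deriv_imp_dir_deriv[of b g "g' b" x] by (simp add: has_dir_deriv_def)
qed

section \<open>Difference quotients and mean value inequalities\<close>

lemma has_vector_derivative_0_iff_quotient:
  "(f has_vector_derivative D) (at 0) \<longleftrightarrow> ((\<lambda>h::real. (1 / h) *\<^sub>R (f h - f 0)) \<longlongrightarrow> D) (at 0)"
proof -
  have eq: "norm (f h - f 0 - h *\<^sub>R D) / norm h = norm ((1 / h) *\<^sub>R (f h - f 0) - D)" if "h \<noteq> 0" for h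
  proof -
    have "(1 / h) *\<^sub>R (f h - f 0) - D = (1 / h) *\<^sub>R (f h - f 0 - h *\<^sub>R D)"
      using that by (simp add: algebra_simps)
    then show ?thesis by (simp only: norm_scaleR) (simp add: divide_inverse mult.commute)
  qed
  have "(f has_vector_derivative D) (at 0) \<longleftrightarrow> ((\<lambda>h. norm (f h - f 0 - h *\<^sub>R D) / norm h) \<longlongrightarrow> 0) (at 0)"
    unfolding has_vector_derivative_def has_derivative_at
    by (simp add: bounded_linear_scaleR_left)
  also have "\<dots> \<longleftrightarrow> ((\<lambda>h. norm ((1 / h) *\<^sub>R (f h - f 0) - D)) \<longlongrightarrow> 0) (at 0)"
    by (intro filterlim_cong refl) (auto simp: eventually_at_filter eq[simplified])
  also have "\<dots> \<longleftrightarrow> ((\<lambda>h. (1 / h) *\<^sub>R (f h - f 0)) \<longlongrightarrow> D) (at 0)"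
    by (simp add: tendsto_norm_zero_iff LIM_zero_iff)
  finally show ?thesis .
qed


lemma has_dir_deriv_iff_quotient:
  "has_dir_deriv b g D x \<longleftrightarrow> ((\<lambda>h. (1 / h) *\<^sub>R (g (x + h *\<^sub>R b) - g x)) \<longlongrightarrow> D) (at 0)"
  using has_vector_derivative_0_iff_quotient[of "\<lambda>t. g (x + t *\<^sub>R b)" D]
  by (simp add: has_dir_deriv_def)

text \<open>The mean value inequality for \<open>g t - t *\<^sub>R L\<close>, whose derivative is
  \<open>g' t - L\<close>. With \<open>L = 0\<close> it bounds difference quotients by the
  derivative; with \<open>L\<close> the expected limit it bounds their error.\<close>

lemma increment_bound:
  fixes g :: "real \<Rightarrow> 'b::real_normed_vector"
  assumes der: "\<And>t. \<bar>t\<bar> \<le> \<bar>h\<bar> \<Longrightarrow> (g has_vector_derivative g' t) (at t)"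
    and bd: "\<And>t. \<bar>t\<bar> \<le> \<bar>h\<bar> \<Longrightarrow> norm (g' t - L) \<le> B"
  shows "norm (g h - g 0 - h *\<^sub>R L) \<le> \<bar>h\<bar> * B"
proof -
  let ?S = "{- \<bar>h\<bar>..\<bar>h\<bar>}"
  have "norm ((g h - h *\<^sub>R L) - (g 0 - 0 *\<^sub>R L)) \<le> B * norm (h - 0)"
  proof (rule differentiable_bound[of ?S "\<lambda>t. g t - t *\<^sub>R L" "\<lambda>t s. s *\<^sub>R (g' t - L)"])
    fix t assume t: "t \<in> ?S"
    then have "(g has_vector_derivative g' t) (at t within ?S)"
      by (auto intro: has_vector_derivative_at_within[OF der])
    then show "((\<lambda>t. g t - t *\<^sub>R L) has_derivative (\<lambda>s. s *\<^sub>R (g' t - L))) (at t within ?S)"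
      unfolding has_vector_derivative_def scaleR_right_diff_distrib
      by (rule has_derivative_diff[OF _ bounded_linear_imp_has_derivative[OF bounded_linear_scaleR_left[of L]]])
    have "onorm (\<lambda>s::real. s *\<^sub>R (g' t - L)) \<le> norm (g' t - L)"
      by (rule onorm_bound) (auto simp: mult.commute)
    also have "\<dots> \<le> B" using t by (intro bd) auto
    finally show "onorm (\<lambda>s::real. s *\<^sub>R (g' t - L)) \<le> B" .
  qed auto
  then show ?thesis by (simp add: algebra_simps)
qed

lemma dir_increment_bound:
  fixes g :: "'a::real_normed_vector \<Rightarrow> 'b::real_normed_vector"
  assumes "\<And>y. has_dir_deriv b g (g' y) y"
    and "\<And>t. \<bar>t\<bar> \<le> \<bar>h\<bar> \<Longrightarrow> norm (g' (x + t *\<^sub>R b) - L) \<le> B"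
  shows "norm (g (x + h *\<^sub>R b) - g x - h *\<^sub>R L) \<le> \<bar>h\<bar> * B"
proof -
  have "norm (g (x + h *\<^sub>R b) - g (x + 0 *\<^sub>R b) - h *\<^sub>R L) \<le> \<bar>h\<bar> * B"
    by (rule increment_bound[OF has_dir_deriv_line[OF assms(1)] assms(2)])
  then show ?thesis by simp
qed

text \<open>Dominated convergence for difference quotients, which the mean value inequality bounds
  by the majorant of the derivative. Measurability of \<open>F'\<close> results from writing it as a
  pointwise limit of quotients along a sequence.\<close>

lemma has_dir_deriv_integral:
  fixes F :: "'w \<Rightarrow> 'a::real_normed_vector \<Rightarrow> 'b::{banach, second_countable_topology}"
  assumes int: "\<And>x. integrable M (\<lambda>w. F w x)"
    and der: "\<And>w x. w \<in> space M \<Longrightarrow> has_dir_deriv b (F w) (F' w x) x"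
    and bd: "\<And>w x. w \<in> space M \<Longrightarrow> norm (F' w x) \<le> \<beta> w"
    and \<beta>: "integrable M \<beta>"
  shows "integrable M (\<lambda>w. F' w x)"
    and "has_dir_deriv b (\<lambda>x. LINT w|M. F w x) (LINT w|M. F' w x) x"
proof -
  define Q where "Q h w = (1 / h) *\<^sub>R (F w (x + h *\<^sub>R b) - F w x)" for h :: real and w
  have Q_lim: "((\<lambda>h. Q h w) \<longlongrightarrow> F' w x) (at 0)" if "w \<in> space M" for w
    using der[OF that, of x] unfolding has_dir_deriv_iff_quotient Q_def .
  have Q_bd: "norm (Q h w) \<le> \<beta> w" if "w \<in> space M" for h w
  proof -
    have "norm (F w (x + h *\<^sub>R b) - F w x - h *\<^sub>R 0) \<le> \<bar>h\<bar> * \<beta> w"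
      using bd[OF that] by (intro dir_increment_bound[OF der[OF that]]) simp
    moreover have "0 \<le> \<beta> w" using order_trans[OF norm_ge_zero bd[OF that, of x]] .
    ultimately show ?thesis
      unfolding Q_def by (simp add: divide_le_eq mult.commute)
  qed
  have Q_int: "integrable M (Q h)" for h
    unfolding Q_def by (intro integrable_scaleR_right Bochner_Integration.integrable_diff int)
  have meas: "(\<lambda>w. F' w x) \<in> borel_measurable M"
  proof (rule borel_measurable_LIMSEQ_metric)
    show "Q (1 / real (Suc n)) \<in> borel_measurable M" for n using Q_int[of "1 / real (Suc n)"] by (rule borel_measurable_integrable)
    fix w assume "w \<in> space M"
    have "filterlim (\<lambda>n. 1 / real (Suc n)) (at 0) sequentially"
      unfolding filterlim_at using LIMSEQ_Suc[OF lim_1_over_n] by auto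
    from filterlim_compose[OF Q_lim[OF \<open>w \<in> space M\<close>] this]
    show "(\<lambda>n. Q (1 / real (Suc n)) w) \<longlonglongrightarrow> F' w x" .
  qed
  show "integrable M (\<lambda>w. F' w x)"
    by (rule Bochner_Integration.integrable_bound[OF \<beta> meas])
      (rule AE_I2, rule order_trans[OF bd], simp_all)
  have "((\<lambda>h. LINT w|M. Q h w) \<longlongrightarrow> (LINT w|M. F' w x)) (at 0)"
    unfolding tendsto_at_iff_sequentially comp_def
  proof (intro allI impI)
    fix X :: "nat \<Rightarrow> real" assume X: "\<forall>i. X i \<in> UNIV - {0}" "X \<longlonglongrightarrow> 0"
    then have X0: "filterlim X (at 0) sequentially" by (auto simp: filterlim_at)
    show "(\<lambda>n. LINT w|M. Q (X n) w) \<longlonglongrightarrow> (LINT w|M. F' w x)"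
      by (rule integral_dominated_convergence[OF meas borel_measurable_integrable[OF Q_int] \<beta>])
        (intro AE_I2 filterlim_compose[OF Q_lim X0] Q_bd; assumption)+
  qed
  also have "(\<lambda>h. LINT w|M. Q h w) = (\<lambda>h. (1 / h) *\<^sub>R ((LINT w|M. F w (x + h *\<^sub>R b)) - (LINT w|M. F w x)))"
    unfolding Q_def
    by (intro ext, subst integral_scaleR_right, subst Bochner_Integration.integral_diff[OF int int]) (rule refl)
  finally show "has_dir_deriv b (\<lambda>x. LINT w|M. F w x) (LINT w|M. F' w x) x"
    unfolding has_dir_deriv_iff_quotient .
qed

lemma isCont_integral:
  fixes F :: "'w \<Rightarrow> 'a::metric_space \<Rightarrow> 'b::{banach, second_countable_topology}"
  assumes meas: "\<And>x. (\<lambda>w. F w x) \<in> borel_measurable M"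
    and cont: "\<And>w. w \<in> space M \<Longrightarrow> isCont (F w) x"
    and bd: "\<And>w x. w \<in> space M \<Longrightarrow> norm (F w x) \<le> \<beta> w" and \<beta>: "integrable M \<beta>"
  shows "isCont (\<lambda>x. LINT w|M. F w x) x"
  unfolding continuous_at_sequentially comp_def
proof (intro allI impI)
  fix X assume X: "X \<longlonglongrightarrow> x"
  show "(\<lambda>n. LINT w|M. F w (X n)) \<longlonglongrightarrow> (LINT w|M. F w x)"
    by (rule integral_dominated_convergence[OF meas meas \<beta>])
      (intro AE_I2 isCont_tendsto_compose[OF cont X] bd; assumption)+
qed

section \<open>Integrals of functions with bounded support\<close>

lemma integrable_indicator_cball:
  "integrable lborel (indicator (cball (x::'a::euclidean_space) R) :: 'a \<Rightarrow> real)"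
  using emeasure_lborel_cball_finite by (intro integrable_real_indicator) simp_all

lemma integrable_bounded_support:
  fixes g :: "'a::euclidean_space \<Rightarrow> 'b::{banach, second_countable_topology}"
  assumes "g \<in> borel_measurable borel" and "\<And>x. norm (g x) \<le> B" and "\<And>x. norm x > R \<Longrightarrow> g x = 0"
  shows "integrable lborel g"
proof (rule Bochner_Integration.integrable_bound)
  show "integrable lborel (\<lambda>x::'a. B * indicator (cball 0 R) x :: real)"
    by (intro integrable_mult_right integrable_indicator_cball)
  show "AE x in lborel. norm (g x) \<le> norm (B * indicator (cball 0 R) x :: real)"
    using assms(2) order_trans[OF norm_ge_zero assms(2)] assms(3)
    by (intro AE_I2) (auto simp: indicator_def not_le)
qed (use assms in auto)

text \<open>By translation invariance every difference quotient has integral zero. Quotients with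
  step at most 1 vanish outside a fixed ball and are bounded by \<open>B\<close>, so the limit can
  be taken under the integral.\<close>

lemma integral_dir_deriv_eq_0:
  fixes g :: "'a::euclidean_space \<Rightarrow> 'b::{banach, second_countable_topology}"
  assumes der: "\<And>x. has_dir_deriv b g (g' x) x" and bd: "\<And>x. norm (g' x) \<le> B"
    and supp: "\<And>x. norm x > R \<Longrightarrow> g x = 0" and g: "integrable lborel g"
  shows "integrable lborel g'" and "(LINT x|lborel. g' x) = 0"
proof -
  define h where "h n = 1 / real (Suc n)" for n
  have h: "filterlim h (at 0) sequentially" and h01: "0 < h n" "h n \<le> 1" for n
    unfolding filterlim_at h_def using LIMSEQ_Suc[OF lim_1_over_n] by auto
  define Q where "Q n x = (1 / h n) *\<^sub>R (g (x + h n *\<^sub>R b) - g x)" for n x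
  have Q_lim: "(\<lambda>n. Q n x) \<longlonglongrightarrow> g' x" for x
    using filterlim_compose[OF der[of x, unfolded has_dir_deriv_iff_quotient] h] unfolding Q_def .
  have Q_int: "integrable lborel (Q n)" for n
    unfolding Q_def using g lborel_integral_translation(2)[of g "h n *\<^sub>R b"]
    by (intro integrable_scaleR_right Bochner_Integration.integrable_diff) auto
  have Q_0: "(LINT x|lborel. Q n x) = 0" for n
    unfolding Q_def using g lborel_integral_translation[of g "h n *\<^sub>R b"] by simp
  have B: "0 \<le> B" using order_trans[OF norm_ge_zero bd] by blast
  have Q_bd: "norm (Q n x) \<le> B * indicator (cball 0 (R + norm b)) x" for n x
  proof (cases "norm x \<le> R + norm b")
    case True
    have "norm (g (x + h n *\<^sub>R b) - g x - h n *\<^sub>R 0) \<le> \<bar>h n\<bar> * B"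
      using bd by (intro dir_increment_bound[OF der]) simp
    then show ?thesis using True h01[of n] unfolding Q_def by (simp add: divide_le_eq mult.commute)
  next
    case False
    have "norm (h n *\<^sub>R b) \<le> norm b" using h01[of n] by (simp add: mult_left_le_one_le)
    then have "norm (x + h n *\<^sub>R b) > R" "norm x > R"
      using False norm_diff_ineq[of x "h n *\<^sub>R b"] norm_ge_zero[of b] by linarith+
    then show ?thesis using B unfolding Q_def by (simp add: supp)
  qed
  have int: "integrable lborel (\<lambda>x::'a. B * indicator (cball 0 (R + norm b)) x :: real)"
    by (intro integrable_mult_right integrable_indicator_cball)
  have meas: "g' \<in> borel_measurable lborel"
    by (rule borel_measurable_LIMSEQ_metric[OF _ Q_lim]) (rule borel_measurable_integrable[OF Q_int])
  have *: "(\<lambda>n. LINT x|lborel. Q n x) \<longlonglongrightarrow> (LINT x|lborel. g' x)"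
    by (rule integral_dominated_convergence[OF meas borel_measurable_integrable[OF Q_int] int])
      (intro AE_I2 Q_lim Q_bd)+
  show "(LINT x|lborel. g' x) = 0"
    using * Q_0 LIMSEQ_unique[OF *, of 0] by simp
  show "integrable lborel g'"
    by (rule integrable_dominated_convergence[where s=Q, OF meas borel_measurable_integrable[OF Q_int] int])
      (intro AE_I2 Q_lim Q_bd)+
qed

text \<open>The mean value inequality is applied twice: in direction \<open>a\<close> to the
  increment over \<open>h *\<^sub>R b\<close>, then in direction \<open>b\<close> to the derivative
  \<open>v1\<close>. Only the mixed derivative in this order enters.\<close>

lemma second_difference_bound:
  fixes v :: "'a::real_normed_vector \<Rightarrow> 'b::real_normed_vector"
  assumes v1: "\<And>x. has_dir_deriv a v (v1 x) x" and v2: "\<And>x. has_dir_deriv b v1 (v2 x) x"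
    and h: "0 < h"
    and bd: "\<And>s t. \<bar>s\<bar> \<le> h \<Longrightarrow> \<bar>t\<bar> \<le> h \<Longrightarrow> norm (v2 (x + s *\<^sub>R a + t *\<^sub>R b) - L) \<le> e"
  shows "norm ((1 / h\<^sup>2) *\<^sub>R (v (x + h *\<^sub>R a + h *\<^sub>R b) - v (x + h *\<^sub>R a) - v (x + h *\<^sub>R b) + v x) - L) \<le> e"
    (is "norm (?D - L) \<le> e")
proof -
  define \<phi> where "\<phi> s = v (x + h *\<^sub>R b + s *\<^sub>R a) - v (x + s *\<^sub>R a)" for s
  have "norm (\<phi> h - \<phi> 0 - h *\<^sub>R (h *\<^sub>R L)) \<le> \<bar>h\<bar> * (h * e)"
  proof (rule increment_bound)
    fix s assume s: "\<bar>s\<bar> \<le> \<bar>h\<bar>"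
    show "(\<phi> has_vector_derivative (v1 (x + h *\<^sub>R b + s *\<^sub>R a) - v1 (x + s *\<^sub>R a))) (at s)"
      unfolding \<phi>_def by (intro has_vector_derivative_diff has_dir_deriv_line v1)
    have "norm (v1 (x + s *\<^sub>R a + h *\<^sub>R b) - v1 (x + s *\<^sub>R a) - h *\<^sub>R L) \<le> \<bar>h\<bar> * e"
      using bd s h by (intro dir_increment_bound[OF v2]) simp
    moreover have "x + s *\<^sub>R a + h *\<^sub>R b = x + h *\<^sub>R b + s *\<^sub>R a" by simp
    ultimately show "norm (v1 (x + h *\<^sub>R b + s *\<^sub>R a) - v1 (x + s *\<^sub>R a) - h *\<^sub>R L) \<le> h * e"
      using h by simp
  qed
  moreover have comm: "x + h *\<^sub>R b + h *\<^sub>R a = x + h *\<^sub>R a + h *\<^sub>R b" by simp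
  have "\<phi> h - \<phi> 0 = v (x + h *\<^sub>R a + h *\<^sub>R b) - v (x + h *\<^sub>R a) - v (x + h *\<^sub>R b) + v x"
    unfolding \<phi>_def comm by simp
  then have "\<phi> h - \<phi> 0 - h *\<^sub>R (h *\<^sub>R L) = h\<^sup>2 *\<^sub>R (?D - L)"
    using h by (simp add: power2_eq_square scaleR_right_diff_distrib)
  ultimately have "h\<^sup>2 * norm (?D - L) \<le> h\<^sup>2 * e"
    using h by (simp add: power2_eq_square mult.assoc)
  then show ?thesis using h by simp
qed

section \<open>Integral identities for second differences\<close>

lemma borel_measurable_cnj [measurable]:
  "f \<in> borel_measurable M \<Longrightarrow> (\<lambda>x. cnj (f x)) \<in> borel_measurable M"
  by (rule measurable_compose[OF _ borel_measurable_continuous_onI]) (auto intro!: continuous_intros)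

lemma translated_correlation:
  fixes v :: "'a::euclidean_space \<Rightarrow> complex"
  shows "(LINT x|lborel. v (x + a) * cnj (v (x + b))) = (LINT x|lborel. v (x + (a - b)) * cnj (v x))"
  using lborel_integral_translation(1)[of "\<lambda>x. v (x + (a - b)) * cnj (v x)" b] by (simp add: add_ac)

text \<open>Both sides are combinations of the values \<open>\<Gamma> a = \<integral> v (x + a) cnj (v x) dx\<close>.\<close>

lemma second_difference_isometry:
  fixes v :: "'a::euclidean_space \<Rightarrow> complex"
  assumes cont: "continuous_on UNIV v" and supp: "\<And>x. norm x > R \<Longrightarrow> v x = 0"
  shows "(LINT x|lborel. (v (x + a + b) - v (x + a) - v (x + b) + v x)
            * cnj (v (x + a + b) - v (x + a) - v (x + b) + v x))
       = (LINT x|lborel. (v (x + a) - 2 * v x + v (x - a)) * cnj (v (x + b) - 2 * v x + v (x - b)))"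
proof -
  define \<Gamma> where "\<Gamma> a = (LINT x|lborel. v (x + a) * cnj (v x))" for a
  have int[simp]: "integrable lborel (\<lambda>x. v (x + c) * cnj (v (x + d)))" for c d
  proof -
    have "integrable lborel (\<lambda>x. v (x + (c - d)) * cnj (v x))"
    proof -
      have "compact (v ` cball 0 R)"
        by (intro compact_continuous_image continuous_on_subset[OF cont]) auto
      then obtain B where B: "\<And>x. norm x \<le> R \<Longrightarrow> norm (v x) \<le> B"
        using compact_imp_bounded bounded_iff by (metis imageI mem_cball_0)
      define C where "C = max B 0"
      have B': "norm (v x) \<le> C" and C: "0 \<le> C" for x
        using B[of x] supp[of x] unfolding C_def by (cases "norm x \<le> R"; force simp: not_le)+
      have [measurable]: "v \<in> borel_measurable borel"
        using cont by (rule borel_measurable_continuous_onI)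
      show ?thesis
      proof (rule integrable_bounded_support[where B="C * C" and R=R])
        show "(\<lambda>x. v (x + (c - d)) * cnj (v x)) \<in> borel_measurable borel" by measurable
      qed (auto simp: norm_mult supp intro!: mult_mono B' C)
    qed
    then show ?thesis
      using lborel_integral_translation(2)[of "\<lambda>x. v (x + (c - d)) * cnj (v x)" d] by (simp add: add_ac)
  qed
  have \<Gamma>: "(LINT x|lborel. v (x + c) * cnj (v (x + d))) = \<Gamma> (c - d)" for c d
    unfolding \<Gamma>_def by (rule translated_correlation)
  have L: "(LINT x|lborel. (v (x + (a + b)) - v (x + a) - v (x + b) + v (x + 0))
            * cnj (v (x + (a + b)) - v (x + a) - v (x + b) + v (x + 0)))
     = 4 * \<Gamma> 0 - 2 * \<Gamma> a - 2 * \<Gamma> b - 2 * \<Gamma> (- a) - 2 * \<Gamma> (- b) + \<Gamma> (a + b) + \<Gamma> (- a - b) + \<Gamma> (a - b) + \<Gamma> (b - a)"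
    unfolding complex_cnj_add complex_cnj_diff
    by (simp only: ring_distribs int \<Gamma> Bochner_Integration.integral_add Bochner_Integration.integral_diff
        Bochner_Integration.integrable_add Bochner_Integration.integrable_diff)
       (simp add: algebra_simps)
  have Rr: "(LINT x|lborel. (v (x + a) - v (x + 0) - v (x + 0) + v (x + - a))
      * cnj (v (x + b) - v (x + 0) - v (x + 0) + v (x + - b)))
     = 4 * \<Gamma> 0 - 2 * \<Gamma> a - 2 * \<Gamma> b - 2 * \<Gamma> (- a) - 2 * \<Gamma> (- b) + \<Gamma> (a + b) + \<Gamma> (- a - b) + \<Gamma> (a - b) + \<Gamma> (b - a)"
    unfolding complex_cnj_add complex_cnj_diff
    by (simp only: ring_distribs int \<Gamma> Bochner_Integration.integral_add Bochner_Integration.integral_diff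
        Bochner_Integration.integrable_add Bochner_Integration.integrable_diff)
       (simp add: algebra_simps)
  \<comment> \<open>The middle term is split into two copies of \<open>v (x + 0)\<close>, so that in
    both expansions each of the 16 products is a correlation to which \<open>\<Gamma>\<close>
    applies.\<close>
  have second: "v (x + a) - 2 * v x + v (x - a) = v (x + a) - v (x + 0) - v (x + 0) + v (x + - a)" for x a
    by simp
  have "(\<lambda>x. (v (x + a + b) - v (x + a) - v (x + b) + v x) * cnj (v (x + a + b) - v (x + a) - v (x + b) + v x))
     = (\<lambda>x. (v (x + (a + b)) - v (x + a) - v (x + b) + v (x + 0)) * cnj (v (x + (a + b)) - v (x + a) - v (x + b) + v (x + 0)))"
    by (intro ext) (simp only: add.assoc[of _ a b] add_0_right)
  moreover have "(\<lambda>x. (v (x + a) - 2 * v x + v (x - a)) * cnj (v (x + b) - 2 * v x + v (x - b)))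
     = (\<lambda>x. (v (x + a) - v (x + 0) - v (x + 0) + v (x + - a)) * cnj (v (x + b) - v (x + 0) - v (x + 0) + v (x + - b)))"
    by (intro ext) (simp only: second)
  ultimately show ?thesis by (simp only: L Rr)
qed

text \<open>The integral identity behind the \<open>L\<^sup>2\<close> bound for second derivatives by the Laplacian. Working
  with difference quotients, it needs no third derivatives.\<close>

lemma integral_mixed_second_derivative:
  fixes v :: "'a::euclidean_space \<Rightarrow> complex"
  assumes v1: "\<And>x. has_dir_deriv a v (va x) x" "\<And>x. has_dir_deriv b v (vb x) x"
    and v2: "\<And>x. has_dir_deriv a va (vaa x) x" "\<And>x. has_dir_deriv b va (vab x) x"
      "\<And>x. has_dir_deriv b vb (vbb x) x"
    and cont: "continuous_on UNIV v" "continuous_on UNIV vaa" "continuous_on UNIV vab" "continuous_on UNIV vbb"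
    and supp: "\<And>x. norm x > R \<Longrightarrow> v x = 0"
    and bd: "\<And>x. norm (vaa x) \<le> B" "\<And>x. norm (vab x) \<le> B" "\<And>x. norm (vbb x) \<le> B"
  shows "(LINT x|lborel. vab x * cnj (vab x)) = (LINT x|lborel. vaa x * cnj (vbb x))"
proof -
  define h where "h n = 1 / real (Suc n)" for n
  have h0: "h \<longlonglongrightarrow> 0" and h: "0 < h n" "h n \<le> 1" for n
    unfolding h_def using LIMSEQ_Suc[OF lim_1_over_n] by auto
  define D where "D a b n x = (1 / (h n)\<^sup>2) *\<^sub>R (v (x + h n *\<^sub>R a + h n *\<^sub>R b) - v (x + h n *\<^sub>R a) - v (x + h n *\<^sub>R b) + v x)" for a b n x
  have D_bd: "norm (D a b n x) \<le> B"
    if "\<And>x. has_dir_deriv a v (va x) x" "\<And>x. has_dir_deriv b va (vab x) x" "\<And>x. norm (vab x) \<le> B" for a b va vab n x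
    using second_difference_bound[OF that(1,2) h(1)[of n], of x 0 B] that(3) unfolding D_def by simp
  \<comment> \<open>The shift by \<open>h n *\<^sub>R c\<close> tends to zero and leaves the limit
    unchanged. It is there because the pure second differences are centred below.\<close>
  have D_lim: "(\<lambda>n. D a b n (x - h n *\<^sub>R c)) \<longlonglongrightarrow> vab x"
    if "\<And>x. has_dir_deriv a v (va x) x" "\<And>x. has_dir_deriv b va (vab x) x" "continuous_on UNIV vab"
    for a b c va vab x
  proof (rule LIMSEQ_I)
    fix e :: real assume e: "0 < e"
    have "isCont vab x" using that(3) by (simp add: continuous_on_eq_continuous_at)
    then obtain d where d: "d > 0" "\<And>y. dist y x < d \<Longrightarrow> dist (vab y) (vab x) < e / 2"
      using e unfolding continuous_at_eps_delta by (metis half_gt_zero)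
    define C where "C = norm a + norm b + norm c + 1"
    have C: "C > 0" unfolding C_def by (intro add_nonneg_pos) auto
    obtain N where N: "\<And>n. n \<ge> N \<Longrightarrow> h n < d / C"
      using order_tendstoD(2)[OF h0, of "d / C"] d C by (auto simp: eventually_sequentially)
    have "norm (D a b n (x - h n *\<^sub>R c) - vab x) < e" if n: "n \<ge> N" for n
    proof -
      have "norm (D a b n (x - h n *\<^sub>R c) - vab x) \<le> e / 2"
        unfolding D_def
      proof (rule second_difference_bound[OF \<open>\<And>x. has_dir_deriv a v (va x) x\<close> \<open>\<And>x. has_dir_deriv b va (vab x) x\<close> h(1)])
        fix s t assume st: "\<bar>s\<bar> \<le> h n" "\<bar>t\<bar> \<le> h n"
        have "norm (x - h n *\<^sub>R c + s *\<^sub>R a + t *\<^sub>R b - x) \<le> norm (h n *\<^sub>R c) + norm (s *\<^sub>R a) + norm (t *\<^sub>R b)"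
          using norm_triangle_ineq[of "s *\<^sub>R a - h n *\<^sub>R c" "t *\<^sub>R b"] norm_triangle_ineq4[of "s *\<^sub>R a" "h n *\<^sub>R c"]
          by (simp add: algebra_simps)
        also have "\<dots> \<le> h n * norm c + h n * norm a + h n * norm b"
          using st h(1)[of n] by (auto intro!: add_mono mult_right_mono)
        also have "\<dots> < h n * C"
          using h(1)[of n] unfolding C_def by (simp add: algebra_simps)
        also have "\<dots> < d" using N[OF n] C by (simp add: field_simps)
        finally show "norm (vab (x - h n *\<^sub>R c + s *\<^sub>R a + t *\<^sub>R b) - vab x) \<le> e / 2"
          using d(2) by (simp add: dist_norm less_imp_le)
      qed
      then show ?thesis using e by simp
    qed
    then show "\<exists>N. \<forall>n\<ge>N. norm (D a b n (x - h n *\<^sub>R c) - vab x) < e" by blast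
  qed
  \<comment> \<open>Since 2|a| + 2|b| is at least three times the smaller of |a| and |b|, beyond
    this radius at least one of the two centred differences vanishes.\<close>
  define R' where "R' = R + 2 * norm a + 2 * norm b"
  have norm4: "norm x \<le> norm (x - p + q + r) + norm p + norm q + norm r" for x p q r :: 'a
    by norm
  have supp': "D a b n (x - h n *\<^sub>R c) = 0" if "norm x > R + norm a + norm b + norm c" for a b c n x
  proof -
    have "v (x - h n *\<^sub>R c + s *\<^sub>R a + t *\<^sub>R b) = 0" if st: "s \<in> {0, h n}" "t \<in> {0, h n}" for s t
    proof (rule supp)
      have "norm (h n *\<^sub>R c) \<le> norm c" "norm (s *\<^sub>R a) \<le> norm a" "norm (t *\<^sub>R b) \<le> norm b"
        using st h[of n] by (auto simp: mult_left_le_one_le)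
      moreover have "norm x \<le> norm (x - h n *\<^sub>R c + s *\<^sub>R a + t *\<^sub>R b) + norm (h n *\<^sub>R c) + norm (s *\<^sub>R a) + norm (t *\<^sub>R b)"
        by (rule norm4)
      ultimately show "R < norm (x - h n *\<^sub>R c + s *\<^sub>R a + t *\<^sub>R b)"
        using \<open>norm x > R + norm a + norm b + norm c\<close> by linarith
    qed
    from this[of 0 0] this[of 0 "h n"] this[of "h n" 0] this[of "h n" "h n"]
    show ?thesis unfolding D_def by simp
  qed
  have [measurable]: "v \<in> borel_measurable borel" "vaa \<in> borel_measurable borel"
    "vab \<in> borel_measurable borel" "vbb \<in> borel_measurable borel"
    using cont by (auto intro: borel_measurable_continuous_onI)
  have Dm[measurable]: "(\<lambda>x. D a b n (x - c)) \<in> borel_measurable borel" for a b n c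
    unfolding D_def by measurable
  note Dm0[measurable] = Dm[where c=0, simplified]
  have B: "0 \<le> B" using order_trans[OF norm_ge_zero bd(1)] .
  have int: "integrable lborel (\<lambda>x::'a. B * B * indicator (cball 0 R') x :: real)"
    by (intro integrable_mult_right integrable_indicator_cball)
  have lim1: "(\<lambda>n. LINT x|lborel. D a b n x * cnj (D a b n x)) \<longlonglongrightarrow> (LINT x|lborel. vab x * cnj (vab x))"
  proof (rule integral_dominated_convergence[OF _ _ int])
    show "AE x in lborel. (\<lambda>n. D a b n x * cnj (D a b n x)) \<longlonglongrightarrow> vab x * cnj (vab x)"
      using D_lim[OF v1(1) v2(2) cont(3), where c=0] by (intro AE_I2 tendsto_mult tendsto_cnj) auto
    show "AE x in lborel. norm (D a b n x * cnj (D a b n x)) \<le> B * B * indicator (cball 0 R') x" for n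
    proof (intro AE_I2)
      fix x show "norm (D a b n x * cnj (D a b n x)) \<le> B * B * indicator (cball 0 R') x"
      proof (cases "norm x \<le> R'")
        case True
        then show ?thesis
          using D_bd[OF v1(1) v2(2) bd(2)] B by (auto simp: norm_mult intro!: mult_mono)
      next
        case False
        then have "norm x > R + norm a + norm b + norm (0::'a)"
          unfolding R'_def norm_zero using norm_ge_zero[of a] norm_ge_zero[of b] by linarith
        then show ?thesis using supp'[of a b 0 x n] B by simp
      qed
    qed
  qed measurable
  have lim2: "(\<lambda>n. LINT x|lborel. D a a n (x - h n *\<^sub>R a) * cnj (D b b n (x - h n *\<^sub>R b))) \<longlonglongrightarrow> (LINT x|lborel. vaa x * cnj (vbb x))"
  proof (rule integral_dominated_convergence[OF _ _ int])
    show "AE x in lborel. (\<lambda>n. D a a n (x - h n *\<^sub>R a) * cnj (D b b n (x - h n *\<^sub>R b))) \<longlonglongrightarrow> vaa x * cnj (vbb x)"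
      using D_lim[OF v1(1) v2(1) cont(2), where c=a] D_lim[OF v1(2) v2(3) cont(4), where c=b]
      by (intro AE_I2 tendsto_mult tendsto_cnj) auto
    show "AE x in lborel. norm (D a a n (x - h n *\<^sub>R a) * cnj (D b b n (x - h n *\<^sub>R b))) \<le> B * B * indicator (cball 0 R') x" for n
    proof (intro AE_I2)
      fix x show "norm (D a a n (x - h n *\<^sub>R a) * cnj (D b b n (x - h n *\<^sub>R b))) \<le> B * B * indicator (cball 0 R') x"
      proof (cases "norm x \<le> R'")
        case True
        then show ?thesis
          using D_bd[OF v1(1) v2(1) bd(1)] D_bd[OF v1(2) v2(3) bd(3)] B
          by (auto simp: norm_mult intro!: mult_mono)
      next
        case False
        then have *: "norm x > R + norm a + norm a + norm a \<or> norm x > R + norm b + norm b + norm b"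
          unfolding R'_def using norm_ge_zero[of a] norm_ge_zero[of b] by linarith
        show ?thesis
          using * supp'[of a a a x n] supp'[of b b b x n] B by auto
      qed
    qed
  qed measurable
  have "(LINT x|lborel. D a b n x * cnj (D a b n x))
      = (LINT x|lborel. D a a n (x - h n *\<^sub>R a) * cnj (D b b n (x - h n *\<^sub>R b)))" for n
  proof -
    have e1: "D a b n x * cnj (D a b n x) = complex_of_real (1 / (h n)^4) * ((v (x + h n *\<^sub>R a + h n *\<^sub>R b) - v (x + h n *\<^sub>R a) - v (x + h n *\<^sub>R b) + v x)
      * cnj (v (x + h n *\<^sub>R a + h n *\<^sub>R b) - v (x + h n *\<^sub>R a) - v (x + h n *\<^sub>R b) + v x))" for x
      unfolding D_def by (simp add: scaleR_conv_of_real field_simps power4_eq_xxxx power2_eq_square)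
    have DD: "D a a n (x - h n *\<^sub>R a) = complex_of_real (1 / (h n)^2) * (v (x + h n *\<^sub>R a) - 2 * v x + v (x - h n *\<^sub>R a))" for a x
      unfolding D_def by (simp add: scaleR_conv_of_real)
    have e2: "D a a n (x - h n *\<^sub>R a) * cnj (D b b n (x - h n *\<^sub>R b)) = complex_of_real (1 / (h n)^4) *
      ((v (x + h n *\<^sub>R a) - 2 * v x + v (x - h n *\<^sub>R a)) * cnj (v (x + h n *\<^sub>R b) - 2 * v x + v (x - h n *\<^sub>R b)))" for x
      unfolding DD complex_cnj_mult complex_cnj_complex_of_real by (simp add: field_simps power4_eq_xxxx power2_eq_square)
    show ?thesis
      unfolding e1 e2 integral_mult_right_zero
      by (rule arg_cong[where f="(*) _"], rule second_difference_isometry[OF cont(1) supp])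
  qed
  then show ?thesis using lim1 lim2 LIMSEQ_unique by simp
qed

section \<open>Fourier inversion\<close>

text \<open>\<open>lborel\<close> is the image of the product measure over the basis, so both claims
  reduce to finite product measures. They reduce Gaussians and singular weights on the space to the
  line.\<close>

lemma
  fixes g :: "'a::euclidean_space \<Rightarrow> real \<Rightarrow> complex"
  assumes g: "\<And>b. b \<in> Basis \<Longrightarrow> integrable lborel (g b)"
  shows integrable_lborel_prod: "integrable lborel (\<lambda>x::'a. \<Prod>b\<in>Basis. g b (x \<bullet> b))"
    and integral_lborel_prod: "(LINT x|lborel. (\<Prod>b\<in>Basis. g b (x \<bullet> b))) = (\<Prod>b\<in>Basis. (LINT t|lborel. g b t))"
proof -
  let ?M = "\<Pi>\<^sub>M b\<in>(Basis::'a set). (lborel :: real measure)"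
  let ?\<phi> = "\<lambda>f. \<Sum>b\<in>(Basis::'a set). f b *\<^sub>R b"
  interpret product_sigma_finite "\<lambda>_::'a. lborel :: real measure" ..
  have [measurable]: "\<And>b. b \<in> Basis \<Longrightarrow> g b \<in> borel_measurable borel" using g by auto
  have m: "(\<lambda>x::'a. \<Prod>b\<in>Basis. g b (x \<bullet> b)) \<in> borel_measurable borel"
    by measurable
  have \<phi>: "?\<phi> \<in> ?M \<rightarrow>\<^sub>M borel" by measurable
  have coord: "?\<phi> f \<bullet> b = f b" if "b \<in> Basis" for f b
    using that by simp
  show "integrable lborel (\<lambda>x::'a. \<Prod>b\<in>Basis. g b (x \<bullet> b))"
    unfolding lborel_eq[where 'a='a] integrable_distr_eq[OF \<phi> m]
    using product_integrable_prod[of Basis g] g by (simp add: coord cong: prod.cong)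
  have "(LINT x|distr ?M borel ?\<phi>. (\<Prod>b\<in>Basis. g b (x \<bullet> b))) = (LINT f|?M. (\<Prod>b\<in>Basis. g b (f b)))"
    by (subst integral_distr[OF \<phi> m]) (simp add: coord cong: prod.cong)
  also have "\<dots> = (\<Prod>b\<in>Basis. (LINT t|lborel. g b t))"
    by (rule product_integral_prod) (use g in auto)
  finally show "(LINT x|lborel. (\<Prod>b\<in>Basis. g b (x \<bullet> b))) = (\<Prod>b\<in>Basis. (LINT t|lborel. g b t))"
    unfolding lborel_eq[where 'a='a, symmetric] .
qed

section \<open>Gaussians and the inversion formula\<close>

definition gauss :: "'a::euclidean_space \<Rightarrow> real" where
  "gauss x = exp (- (norm x)\<^sup>2 / 2)"

text \<open>Read off from the characteristic function of the standard normal distribution, whose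
  density carries the factor \<open>1 / sqrt (2 * pi)\<close>.\<close>

lemma gauss_fourier_real:
  "integrable lborel (\<lambda>t. complex_of_real (exp (- t\<^sup>2 / 2)) * exp (\<i> * of_real (s * t)))"
  "(LINT t|lborel. complex_of_real (exp (- t\<^sup>2 / 2)) * exp (\<i> * of_real (s * t)))
    = of_real (sqrt (2 * pi) * exp (- s\<^sup>2 / 2))"
proof -
  have std: "complex_of_real (exp (- t\<^sup>2 / 2)) * exp (\<i> * of_real (s * t))
      = of_real (sqrt (2 * pi)) * (std_normal_density t *\<^sub>R iexp (s * t))" for t
    unfolding std_normal_density_def scaleR_conv_of_real by (simp add: field_simps)
  have "integrable lborel (\<lambda>t. std_normal_density t *\<^sub>R iexp (s * t))"
    by (rule Bochner_Integration.integrable_bound[OF integrable_normal_density[of 1 0]]) (auto simp: norm_mult)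
  then show "integrable lborel (\<lambda>t. complex_of_real (exp (- t\<^sup>2 / 2)) * exp (\<i> * of_real (s * t)))"
    unfolding std by (rule integrable_mult_right)
  have "char std_normal_distribution s = (LINT t|lborel. std_normal_density t *\<^sub>R iexp (s * t))"
    unfolding char_def by (subst integral_density) auto
  then show "(LINT t|lborel. complex_of_real (exp (- t\<^sup>2 / 2)) * exp (\<i> * of_real (s * t)))
    = of_real (sqrt (2 * pi) * exp (- s\<^sup>2 / 2))"
    unfolding std integral_mult_right_zero by (simp add: char_std_normal_distribution)
qed

lemma gauss_prod: "gauss (x::'a::euclidean_space) = (\<Prod>b\<in>Basis. exp (- (x \<bullet> b)\<^sup>2 / 2))"
proof -
  have "(norm x)\<^sup>2 = (\<Sum>b\<in>Basis. (x \<bullet> b)\<^sup>2)"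
    by (simp only: power2_norm_eq_inner, subst euclidean_inner) (simp add: power2_eq_square)
  then show ?thesis
    by (simp add: gauss_def exp_sum[symmetric] sum_negf sum_divide_distrib[symmetric])
qed

lemma gauss_fourier:
  fixes \<xi> :: "'a::euclidean_space"
  shows "integrable lborel (\<lambda>x. complex_of_real (gauss x) * exp (\<i> * of_real (\<xi> \<bullet> x)))"
    and "(LINT x|lborel. complex_of_real (gauss x) * exp (\<i> * of_real (\<xi> \<bullet> x)))
      = of_real (sqrt (2 * pi) ^ DIM('a) * gauss \<xi>)"
proof -
  have e: "exp (\<i> * of_real (\<xi> \<bullet> x)) = (\<Prod>b\<in>Basis. exp (\<i> * of_real ((\<xi> \<bullet> b) * (x \<bullet> b))))" for x
    by (simp add: euclidean_inner[of \<xi> x] exp_sum[symmetric] sum_distrib_left)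
  have eq: "complex_of_real (gauss x) * exp (\<i> * of_real (\<xi> \<bullet> x))
      = (\<Prod>b\<in>Basis. complex_of_real (exp (- (x \<bullet> b)\<^sup>2 / 2)) * exp (\<i> * of_real ((\<xi> \<bullet> b) * (x \<bullet> b))))" for x
    by (simp only: e gauss_prod of_real_prod prod.distrib)
  show "integrable lborel (\<lambda>x. complex_of_real (gauss x) * exp (\<i> * of_real (\<xi> \<bullet> x)))"
    unfolding eq by (rule integrable_lborel_prod) (rule gauss_fourier_real)
  show "(LINT x|lborel. complex_of_real (gauss x) * exp (\<i> * of_real (\<xi> \<bullet> x)))
      = of_real (sqrt (2 * pi) ^ DIM('a) * gauss \<xi>)"
    unfolding eq
    by (subst integral_lborel_prod)
      (use gauss_fourier_real in \<open>simp_all add: gauss_prod prod.distrib of_real_prod[symmetric] del: of_real_mult of_real_prod\<close>)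
qed

lemma continuous_gauss [continuous_intros]: "continuous_on A gauss"
  unfolding gauss_def by (intro continuous_intros) simp

lemma borel_measurable_gauss [measurable]: "gauss \<in> borel_measurable borel"
  by (rule borel_measurable_continuous_onI) (rule continuous_gauss)

lemma gauss_bounds: "0 < gauss x" "gauss x \<le> 1"
  unfolding gauss_def by auto

lemma gauss_simps [simp]: "0 \<le> gauss x" "\<bar>gauss x\<bar> = gauss x" "gauss x \<le> 1"
  using gauss_bounds[of x] by auto

lemma integrable_gauss: "integrable lborel (gauss :: 'a::euclidean_space \<Rightarrow> real)"
proof -
  have "integrable lborel (\<lambda>x::'a. norm (complex_of_real (gauss x) * exp (\<i> * of_real (0 \<bullet> x))))"
    by (rule integrable_norm) (rule gauss_fourier)
  then show ?thesis by simp
qed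

lemma integrable_product_bound:
  fixes f :: "'a::euclidean_space \<Rightarrow> 'b::euclidean_space \<Rightarrow> 'c::{banach, second_countable_topology}"
  assumes f[measurable]: "case_prod f \<in> borel_measurable (lborel \<Otimes>\<^sub>M lborel)"
    and bd: "\<And>x y. norm (f x y) \<le> norm (a x) * norm (b y)"
    and a: "integrable lborel (a :: 'a \<Rightarrow> 'd::{banach, second_countable_topology})"
    and b: "integrable lborel (b :: 'b \<Rightarrow> 'e::{banach, second_countable_topology})"
  shows "integrable (lborel \<Otimes>\<^sub>M lborel) (case_prod f)"
proof (rule lborel_pair.Fubini_integrable[OF f])
  have fx: "integrable lborel (\<lambda>y. f x y)" for x
    by (rule Bochner_Integration.integrable_bound[where f="\<lambda>y. norm (a x) * norm (b y)"])
      (use bd b in \<open>auto intro!: integrable_mult_right\<close>)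
  show "AE x in lborel. integrable lborel (\<lambda>y. case_prod f (x, y))" using fx by simp
  show "integrable lborel (\<lambda>x. LINT y|lborel. norm (case_prod f (x, y)))"
  proof (rule Bochner_Integration.integrable_bound[where f="\<lambda>x. norm (a x) * (LINT y|lborel. norm (b y))"])
    show "AE x in lborel. norm (LINT y|lborel. norm (case_prod f (x, y))) \<le> norm (norm (a x) * (LINT y|lborel. norm (b y)))"
    proof (rule AE_I2)
      fix x
      have "(LINT y|lborel. norm (f x y)) \<le> (LINT y|lborel. norm (a x) * norm (b y))"
        by (rule integral_mono) (use fx bd b in auto)
      then show "norm (LINT y|lborel. norm (case_prod f (x, y))) \<le> norm (norm (a x) * (LINT y|lborel. norm (b y)))"
        by simp
    qed
  qed (use a in auto)
qed

lemma Fubini_product_bound: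
  fixes f :: "'a::euclidean_space \<Rightarrow> 'b::euclidean_space \<Rightarrow> complex"
  assumes f: "case_prod f \<in> borel_measurable (lborel \<Otimes>\<^sub>M lborel)"
    and bd: "\<And>x y. norm (f x y) \<le> norm (a x :: complex) * norm (b y :: complex)"
    and a: "integrable lborel a" and b: "integrable lborel b"
  shows "(LINT x|lborel. LINT y|lborel. f x y) = (LINT y|lborel. LINT x|lborel. f x y)"
  using lborel_pair.Fubini_integral[OF integrable_product_bound[OF assms]] by simp

text \<open>Gaussian summation: the factor \<open>gauss (\<epsilon> n *\<^sub>R k)\<close> makes the
  double integral absolutely convergent. After the exchange the k-integral is a Gaussian of width
  \<open>\<epsilon> n\<close> around x, an approximate identity applied to \<open>g\<close>. Letting
  the width tend to 0 on both sides gives the formula at every point, by continuity of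
  \<open>g\<close>.\<close>

lemma fourier_inversion:
  fixes g ghat :: "'a::euclidean_space \<Rightarrow> complex"
  assumes cont: "continuous_on UNIV g" and bd: "\<And>x. norm (g x) \<le> B" and int: "integrable lborel g"
    and ghat: "\<And>k. ghat k = (LINT x|lborel. g x * exp (- \<i> * of_real (k \<bullet> x)))"
    and ghat_int: "integrable lborel ghat"
  shows "(LINT k|lborel. ghat k * exp (\<i> * of_real (k \<bullet> x))) = of_real ((2 * pi) ^ DIM('a)) * g x"
proof -
  define \<epsilon> where "\<epsilon> n = 1 / real (Suc n)" for n
  have \<epsilon>0: "\<epsilon> \<longlonglongrightarrow> 0" and \<epsilon>: "0 < \<epsilon> n" for n
    unfolding \<epsilon>_def using LIMSEQ_Suc[OF lim_1_over_n] by auto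
  define J where "J n = (LINT k|lborel. ghat k * exp (\<i> * of_real (k \<bullet> x)) * of_real (gauss (\<epsilon> n *\<^sub>R k)))" for n
  have [measurable]: "g \<in> borel_measurable borel" "ghat \<in> borel_measurable borel"
    using int ghat_int by auto
  have J_lim: "J \<longlonglongrightarrow> (LINT k|lborel. ghat k * exp (\<i> * of_real (k \<bullet> x)))"
    unfolding J_def
  proof (rule integral_dominated_convergence[OF _ _ integrable_norm[OF ghat_int]])
    show "AE k in lborel. (\<lambda>n. ghat k * exp (\<i> * of_real (k \<bullet> x)) * of_real (gauss (\<epsilon> n *\<^sub>R k)))
        \<longlonglongrightarrow> ghat k * exp (\<i> * of_real (k \<bullet> x))"
    proof (rule AE_I2)
      fix k :: 'a
      have "isCont gauss (0::'a)" using continuous_gauss[of "UNIV :: 'a set"] by (simp add: continuous_on_eq_continuous_at)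
      moreover have "(\<lambda>n. \<epsilon> n *\<^sub>R k) \<longlonglongrightarrow> 0"
        using tendsto_scaleR[OF \<epsilon>0 tendsto_const[of k]] by simp
      ultimately have "(\<lambda>n. gauss (\<epsilon> n *\<^sub>R k)) \<longlonglongrightarrow> gauss (0::'a)"
        by (rule isCont_tendsto_compose)
      then have "(\<lambda>n. complex_of_real (gauss (\<epsilon> n *\<^sub>R k))) \<longlonglongrightarrow> 1"
        using tendsto_of_real by (fastforce simp: gauss_def)
      from tendsto_mult[OF tendsto_const this]
      show "(\<lambda>n. ghat k * exp (\<i> * of_real (k \<bullet> x)) * of_real (gauss (\<epsilon> n *\<^sub>R k)))
        \<longlonglongrightarrow> ghat k * exp (\<i> * of_real (k \<bullet> x))" by simp
    qed
    show "AE k in lborel. norm (ghat k * exp (\<i> * of_real (k \<bullet> x)) * of_real (gauss (\<epsilon> n *\<^sub>R k))) \<le> norm (ghat k)" for n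
      by (intro AE_I2) (simp add: norm_mult mult_left_le)
  qed measurable
  have J: "J n = of_real (sqrt (2 * pi) ^ DIM('a)) * (LINT w|lborel. g (x + \<epsilon> n *\<^sub>R w) * of_real (gauss w))" for n
  proof -
    let ?e = "\<epsilon> n"
    have "J n = (LINT k|lborel. LINT z|lborel. g z * exp (\<i> * of_real (k \<bullet> (x - z))) * of_real (gauss (?e *\<^sub>R k)))"
    proof -
      have "exp (- \<i> * of_real (k \<bullet> z)) * exp (\<i> * of_real (k \<bullet> x)) = exp (\<i> * of_real (k \<bullet> (x - z)))" for k z
        by (simp add: exp_add[symmetric] inner_diff_right algebra_simps)
      then have eq: "g z * exp (\<i> * of_real (k \<bullet> (x - z))) * of_real (gauss (?e *\<^sub>R k))
        = (g z * exp (- \<i> * of_real (k \<bullet> z))) * (exp (\<i> * of_real (k \<bullet> x)) * of_real (gauss (?e *\<^sub>R k)))" for k z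
        by (metis mult.assoc)
      show ?thesis
        unfolding J_def ghat mult.assoc[of "LINT z|lborel. _ z"] eq integral_mult_left_zero ..
    qed
    also have "\<dots> = (LINT z|lborel. LINT k|lborel. g z * exp (\<i> * of_real (k \<bullet> (x - z))) * of_real (gauss (?e *\<^sub>R k)))"
    proof (rule Fubini_product_bound[where a="\<lambda>k. of_real (gauss (?e *\<^sub>R k))" and b=g])
      have "integrable lborel (\<lambda>k::'a. gauss (0 + ?e *\<^sub>R k))"
        by (rule lborel_integrable_affine) (use \<epsilon>[of n] integrable_gauss in auto)
      then show "integrable lborel (\<lambda>k::'a. complex_of_real (gauss (?e *\<^sub>R k)))"
        by simp
    qed (use int in \<open>auto simp: norm_mult\<close>)
    also have "(\<lambda>z. LINT k|lborel. g z * exp (\<i> * of_real (k \<bullet> (x - z))) * of_real (gauss (?e *\<^sub>R k)))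
      = (\<lambda>z. of_real (sqrt (2 * pi) ^ DIM('a) / ?e ^ DIM('a)) * (g z * of_real (gauss ((1 / ?e) *\<^sub>R (x - z)))))"
    proof
      fix z
      have G: "integrable lborel (\<lambda>w. complex_of_real (gauss w) * exp (\<i> * of_real (((1 / ?e) *\<^sub>R (x - z)) \<bullet> w)))"
        by (rule gauss_fourier)
      have "of_real (sqrt (2 * pi) ^ DIM('a) * gauss ((1 / ?e) *\<^sub>R (x - z)))
        = ?e ^ DIM('a) *\<^sub>R (LINT k|lborel. complex_of_real (gauss (?e *\<^sub>R k)) * exp (\<i> * of_real (((1 / ?e) *\<^sub>R (x - z)) \<bullet> (?e *\<^sub>R k))))"
        using lborel_integral_affine[OF _ G, of ?e 0] \<epsilon>[of n] unfolding gauss_fourier(2) by simp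
      also have "(\<lambda>k. complex_of_real (gauss (?e *\<^sub>R k)) * exp (\<i> * of_real (((1 / ?e) *\<^sub>R (x - z)) \<bullet> (?e *\<^sub>R k))))
        = (\<lambda>k. exp (\<i> * of_real (k \<bullet> (x - z))) * of_real (gauss (?e *\<^sub>R k)))"
        using \<epsilon>[of n] by (auto simp: inner_commute)
      finally show "(LINT k|lborel. g z * exp (\<i> * of_real (k \<bullet> (x - z))) * of_real (gauss (?e *\<^sub>R k)))
        = of_real (sqrt (2 * pi) ^ DIM('a) / ?e ^ DIM('a)) * (g z * of_real (gauss ((1 / ?e) *\<^sub>R (x - z))))"
        using \<epsilon>[of n] unfolding mult.assoc integral_mult_right_zero
        by (simp add: field_simps scaleR_conv_of_real)
    qed
    also have "(LINT z|lborel. of_real (sqrt (2 * pi) ^ DIM('a) / ?e ^ DIM('a)) * (g z * of_real (gauss ((1 / ?e) *\<^sub>R (x - z)))))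
      = of_real (sqrt (2 * pi) ^ DIM('a)) * (LINT w|lborel. g (x + ?e *\<^sub>R w) * of_real (gauss w))"
    proof -
      have "integrable lborel (\<lambda>z. g z * of_real (gauss ((1 / ?e) *\<^sub>R (x - z))))"
        by (rule Bochner_Integration.integrable_bound[OF int])
          (auto simp: norm_mult mult_left_le intro!: AE_I2)
      from lborel_integral_affine[OF _ this, of ?e x] \<epsilon>[of n]
      have "(LINT z|lborel. g z * of_real (gauss ((1 / ?e) *\<^sub>R (x - z))))
        = ?e ^ DIM('a) *\<^sub>R (LINT w|lborel. g (x + ?e *\<^sub>R w) * of_real (gauss w))"
        by (simp add: gauss_def)
      then show ?thesis
        using \<epsilon>[of n] unfolding integral_mult_right_zero by (simp add: scaleR_conv_of_real)
    qed
    finally show ?thesis .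
  qed
  have lim: "(\<lambda>n. LINT w|lborel. g (x + \<epsilon> n *\<^sub>R w) * of_real (gauss w)) \<longlonglongrightarrow> (LINT w|lborel. g x * of_real (gauss (w::'a)))"
  proof (rule integral_dominated_convergence[OF _ _ integrable_mult_right[OF integrable_gauss, of B]])
    show "AE w in lborel. (\<lambda>n. g (x + \<epsilon> n *\<^sub>R w) * of_real (gauss w)) \<longlonglongrightarrow> g x * of_real (gauss (w::'a))"
    proof (rule AE_I2)
      fix w
      have "(\<lambda>n. x + \<epsilon> n *\<^sub>R w) \<longlonglongrightarrow> x"
        using tendsto_add[OF tendsto_const[of x] tendsto_scaleR[OF \<epsilon>0 tendsto_const[of w]]] by simp
      moreover have "isCont g x" using cont by (simp add: continuous_on_eq_continuous_at)
      ultimately show "(\<lambda>n. g (x + \<epsilon> n *\<^sub>R w) * of_real (gauss w)) \<longlonglongrightarrow> g x * of_real (gauss (w::'a))"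
        by (intro tendsto_mult tendsto_const isCont_tendsto_compose[of x g])
    qed
    show "AE w in lborel. norm (g (x + \<epsilon> n *\<^sub>R w) * of_real (gauss w)) \<le> B * gauss (w::'a)" for n
      using bd by (intro AE_I2) (auto simp: norm_mult intro!: mult_right_mono)
  qed measurable
  \<comment> \<open>The total mass of the Gaussian supplies the second factor
    \<open>sqrt (2 * pi) ^ DIM('a)\<close>; the two together make
    \<open>(2 * pi) ^ DIM('a)\<close>.\<close>
  have gauss_int: "(LINT w|lborel. g x * of_real (gauss (w::'a))) = g x * of_real (sqrt (2 * pi) ^ DIM('a))"
    using gauss_fourier(2)[of "0::'a"] by (simp add: gauss_def)
  have "J \<longlonglongrightarrow> of_real (sqrt (2 * pi) ^ DIM('a)) * (g x * of_real (sqrt (2 * pi) ^ DIM('a)))"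
    using tendsto_mult[OF tendsto_const lim] unfolding J[abs_def] gauss_int .
  from LIMSEQ_unique[OF J_lim this]
  have "(LINT k|lborel. ghat k * exp (\<i> * of_real (k \<bullet> x)))
      = of_real (sqrt (2 * pi) ^ DIM('a) * sqrt (2 * pi) ^ DIM('a)) * g x"
    by simp
  also have "sqrt (2 * pi) ^ DIM('a) * sqrt (2 * pi) ^ DIM('a) = (2 * pi) ^ DIM('a)"
    by (simp only: power_mult_distrib[symmetric]) simp
  finally show ?thesis .
qed

section \<open>Plane waves and test functions\<close>

definition planewave :: "'a::euclidean_space \<Rightarrow> 'a \<Rightarrow> complex" where
  "planewave \<xi> x = exp (\<i> * of_real (\<xi> \<bullet> x))"

lemma norm_planewave [simp]: "norm (planewave \<xi> x) = 1"
  by (simp add: planewave_def)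

lemma planewave_mult: "planewave \<xi> x * planewave \<zeta> x = planewave (\<xi> + \<zeta>) x"
  by (simp add: planewave_def exp_add[symmetric] inner_add_left algebra_simps)

lemma planewave_0 [simp]: "planewave 0 x = 1"
  by (simp add: planewave_def)

lemma has_dir_deriv_planewave:
  "has_dir_deriv b (planewave \<xi>) (\<i> * of_real (\<xi> \<bullet> b) * planewave \<xi> x) x"
proof -
  let ?A = "\<i> * complex_of_real (\<xi> \<bullet> b)"
  have "((\<lambda>t. planewave \<xi> x * exp (t *\<^sub>R ?A)) has_vector_derivative planewave \<xi> x * (exp (0 *\<^sub>R ?A) * ?A)) (at 0)"
    by (intro has_vector_derivative_mult_right exp_scaleR_has_vector_derivative_right)
  moreover have "planewave \<xi> x * exp (t *\<^sub>R ?A) = planewave \<xi> (x + t *\<^sub>R b)" for t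
    by (simp add: planewave_def exp_add[symmetric] inner_add_right scaleR_conv_of_real algebra_simps)
  ultimately show ?thesis
    by (simp add: has_dir_deriv_def mult.commute)
qed

lemma borel_measurable_planewave [measurable]:
  assumes [measurable]: "f \<in> borel_measurable M" "g \<in> borel_measurable M"
  shows "(\<lambda>x. planewave (f x) (g x)) \<in> borel_measurable M"
  unfolding planewave_def by measurable

lemma tsupp_vanish: "x \<notin> tsupp f \<Longrightarrow> f x = 0"
  unfolding tsupp_def using closure_subset[of "{x. f x \<noteq> 0}"] by auto

lemma closed_tsupp: "closed (tsupp f)"
  unfolding tsupp_def by simp

lemma dir_deriv_outside_tsupp:
  assumes "x \<notin> tsupp f"
  shows "has_dir_deriv b f 0 x"
  by (rule has_dir_deriv_cong_open[OF has_dir_deriv_const, of "- tsupp f"])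
    (use assms in \<open>auto simp: closed_tsupp open_Compl tsupp_vanish\<close>)

lemma tsupp_dir_deriv: "tsupp (dir_deriv b f) \<subseteq> tsupp f"
proof -
  have "{x. dir_deriv b f x \<noteq> 0} \<subseteq> tsupp f"
    using has_dir_deriv_imp_dir_deriv[OF dir_deriv_outside_tsupp] by blast
  then have "closure {x. dir_deriv b f x \<noteq> 0} \<subseteq> tsupp f"
    by (rule closure_minimal) (rule closed_tsupp)
  then show ?thesis by (simp add: tsupp_def)
qed

lemma smooth_foldr_differentiable:
  "smooth f \<Longrightarrow> set bs \<subseteq> Basis \<Longrightarrow> foldr dir_deriv bs f differentiable (at x)"
  unfolding smooth_def differentiable_on_def by simp

lemma smooth_differentiable: "smooth f \<Longrightarrow> f differentiable (at x)"
  using smooth_foldr_differentiable[of f "[]"] by simp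

lemma smooth_dir_deriv:
  fixes f :: "'a::euclidean_space \<Rightarrow> 'b::real_normed_vector"
  shows "smooth f \<Longrightarrow> b \<in> Basis \<Longrightarrow> smooth (dir_deriv b f)"
  unfolding smooth_def
proof (intro allI impI)
  fix bs :: "'a list" assume *: "\<forall>bs. set bs \<subseteq> Basis \<longrightarrow> foldr dir_deriv bs f differentiable_on UNIV" "b \<in> Basis" "set bs \<subseteq> Basis"
  from *(1)[rule_format, of "bs @ [b]"] *(2,3)
  show "foldr dir_deriv bs (dir_deriv b f) differentiable_on UNIV" by simp
qed

lemma foldr_dir_deriv_diff:
  assumes "smooth f" "smooth g" "set bs \<subseteq> Basis"
  shows "foldr dir_deriv bs (\<lambda>x. f x - g x) = (\<lambda>x. foldr dir_deriv bs f x - foldr dir_deriv bs g x)"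
  using assms(3)
proof (induction bs)
  case (Cons b bs)
  then have "set bs \<subseteq> Basis" by simp
  have eq: "dir_deriv b (\<lambda>x. foldr dir_deriv bs f x - foldr dir_deriv bs g x) x
      = dir_deriv b (foldr dir_deriv bs f) x - dir_deriv b (foldr dir_deriv bs g) x" for x
    by (intro has_dir_deriv_imp_dir_deriv has_dir_deriv_diff differentiable_imp_has_dir_deriv
        smooth_foldr_differentiable assms \<open>set bs \<subseteq> Basis\<close>)
  show ?case unfolding foldr.simps o_apply Cons.IH[OF \<open>set bs \<subseteq> Basis\<close>] by (rule ext) (rule eq)
qed simp

lemma test_function_dir_deriv: "test_function f \<Longrightarrow> b \<in> Basis \<Longrightarrow> test_function (dir_deriv b f)"
  unfolding test_function_def
  using smooth_dir_deriv tsupp_dir_deriv[of b f] closed_tsupp compact_Int_closed[of "tsupp f" "tsupp (dir_deriv b f)"]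
  by (auto simp: Int_absorb1)

lemma test_function_diff:
  assumes "test_function f" "test_function g"
  shows "test_function (\<lambda>x. f x - g x)"
proof -
  have "smooth (\<lambda>x. f x - g x)"
    unfolding smooth_def using assms[unfolded test_function_def] foldr_dir_deriv_diff[of f g]
    by (auto simp: smooth_def intro!: differentiable_on_diff)
  moreover have "tsupp (\<lambda>x. f x - g x) \<subseteq> tsupp f \<union> tsupp g"
    unfolding tsupp_def closure_Un[symmetric] by (intro closure_mono) auto
  then have "compact (tsupp (\<lambda>x. f x - g x))"
    using assms[unfolded test_function_def] closed_tsupp[of "\<lambda>x. f x - g x"]
      compact_Int_closed[of "tsupp f \<union> tsupp g" "tsupp (\<lambda>x. f x - g x)"]
    by (auto simp: Int_absorb1 intro: compact_Un)
  ultimately show ?thesis by (simp add: test_function_def)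
qed

lemma test_function_of_real:
  fixes f :: "'a::euclidean_space \<Rightarrow> real"
  assumes "test_function f"
  shows "test_function (\<lambda>x. complex_of_real (f x))"
proof -
  have f: "smooth f" using assms by (simp add: test_function_def)
  have fold: "foldr dir_deriv bs (\<lambda>x. complex_of_real (f x)) = (\<lambda>x. complex_of_real (foldr dir_deriv bs f x))"
    if "set bs \<subseteq> Basis" for bs
    using that
  proof (induction bs)
    case (Cons b bs)
    then have "set bs \<subseteq> Basis" by simp
    have eq: "dir_deriv b (\<lambda>x. complex_of_real (foldr dir_deriv bs f x)) x = of_real (dir_deriv b (foldr dir_deriv bs f) x)" for x
      by (intro has_dir_deriv_imp_dir_deriv has_dir_deriv_bounded_linear[OF bounded_linear_of_real]
          differentiable_imp_has_dir_deriv smooth_foldr_differentiable f \<open>set bs \<subseteq> Basis\<close>)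
    show ?case unfolding foldr.simps o_apply Cons.IH[OF \<open>set bs \<subseteq> Basis\<close>] by (rule ext) (rule eq)
  qed simp
  have "smooth (\<lambda>x. complex_of_real (f x))"
    unfolding smooth_def
  proof (intro allI impI)
    fix bs :: "'a list" assume bs: "set bs \<subseteq> Basis"
    have "(\<lambda>x. complex_of_real (foldr dir_deriv bs f x)) differentiable (at x)" for x
      using smooth_foldr_differentiable[OF f bs, of x] bounded_linear_of_real
      unfolding differentiable_def by (blast intro: bounded_linear.has_derivative)
    then show "foldr dir_deriv bs (\<lambda>x. complex_of_real (f x)) differentiable_on UNIV"
      by (simp add: fold[OF bs] differentiable_on_def)
  qed
  then show ?thesis using assms by (simp add: test_function_def tsupp_def)
qed

lemma test_function_has_dir_deriv: "test_function f \<Longrightarrow> has_dir_deriv b f (dir_deriv b f x) x"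
  unfolding test_function_def by (intro differentiable_imp_has_dir_deriv smooth_differentiable) auto

lemma test_function_continuous: "test_function f \<Longrightarrow> continuous_on A f"
  unfolding test_function_def
  by (meson continuous_at_imp_continuous_on differentiable_imp_continuous_within smooth_differentiable)

lemma test_function_bounds:
  assumes "test_function f"
  obtains B R where "\<And>x. norm (f x) \<le> B" "0 \<le> B" "\<And>x. norm x > R \<Longrightarrow> f x = 0"
proof -
  have c: "compact (tsupp f)" using assms by (simp add: test_function_def)
  from compact_imp_bounded[OF c] obtain R where R: "\<And>x. x \<in> tsupp f \<Longrightarrow> norm x \<le> R"
    unfolding bounded_iff by auto
  have "bounded (f ` tsupp f)"
    by (rule compact_imp_bounded[OF compact_continuous_image[OF test_function_continuous[OF assms] c]])
  then obtain B where B: "\<And>x. x \<in> tsupp f \<Longrightarrow> norm (f x) \<le> B"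
    unfolding bounded_iff by auto
  show thesis
  proof
    show "norm (f x) \<le> max B 0" for x
      using B[of x] tsupp_vanish[of x f] by (cases "x \<in> tsupp f") auto
    show "f x = 0" if "norm x > R" for x
      using R[of x] that by (intro tsupp_vanish) auto
  qed auto
qed

lemma test_function_measurable [measurable_dest]:
  "test_function f \<Longrightarrow> f \<in> borel_measurable borel"
  by (intro borel_measurable_continuous_onI test_function_continuous)

lemma test_function_integrable:
  fixes f :: "'a::euclidean_space \<Rightarrow> complex"
  assumes "test_function f"
  shows "integrable lborel f"
  by (rule test_function_bounds[OF assms])
    (rule integrable_bounded_support[OF test_function_measurable[OF assms]])

section \<open>Fourier transforms of test functions\<close>

definition fourier :: "('a::euclidean_space \<Rightarrow> complex) \<Rightarrow> 'a \<Rightarrow> complex" where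
  "fourier f k = (LINT x|lborel. f x * planewave (- k) x)"

lemma integrable_mult_planewave:
  "integrable lborel f \<Longrightarrow> integrable lborel (\<lambda>x. f x * planewave \<xi> x)"
  by (rule Bochner_Integration.integrable_bound[of _ f]) (auto simp: norm_mult)

text \<open>The derivative of \<open>f\<close> times a plane wave has integral zero; the product
  rule turns this into the formula.\<close>

lemma fourier_dir_deriv:
  assumes f: "test_function f" and b: "b \<in> Basis"
  shows "fourier (dir_deriv b f) k = \<i> * of_real (k \<bullet> b) * fourier f k"
proof -
  have f': "test_function (dir_deriv b f)" using f b by (rule test_function_dir_deriv)
  obtain B R where B: "\<And>x. norm (f x) \<le> B" "\<And>x. norm x > R \<Longrightarrow> f x = 0"
    using test_function_bounds[OF f] by metis
  obtain B' R' where B': "\<And>x. norm (dir_deriv b f x) \<le> B'"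
    using test_function_bounds[OF f'] by metis
  note i = integrable_mult_planewave[OF test_function_integrable]
  have "(LINT x|lborel. f x * (\<i> * of_real ((- k) \<bullet> b) * planewave (- k) x) + dir_deriv b f x * planewave (- k) x) = 0"
  proof (rule integral_dir_deriv_eq_0(2)[of b "\<lambda>x. f x * planewave (- k) x" _ "B * \<bar>k \<bullet> b\<bar> + B'" R])
    show "has_dir_deriv b (\<lambda>x. f x * planewave (- k) x)
       (f x * (\<i> * of_real ((- k) \<bullet> b) * planewave (- k) x) + dir_deriv b f x * planewave (- k) x) x" for x
      by (intro has_dir_deriv_mult test_function_has_dir_deriv f has_dir_deriv_planewave)
    show "norm (f x * (\<i> * of_real ((- k) \<bullet> b) * planewave (- k) x) + dir_deriv b f x * planewave (- k) x) \<le> B * \<bar>k \<bullet> b\<bar> + B'" for x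
      using B(1)[of x] B'[of x] by (intro order_trans[OF norm_triangle_ineq] add_mono) (auto simp: norm_mult intro!: mult_right_mono)
  qed (use B i f in auto)
  also have "(\<lambda>x. f x * (\<i> * of_real ((- k) \<bullet> b) * planewave (- k) x) + dir_deriv b f x * planewave (- k) x)
    = (\<lambda>x. (- (\<i> * of_real (k \<bullet> b))) * (f x * planewave (- k) x) + dir_deriv b f x * planewave (- k) x)"
    by (auto simp: algebra_simps)
  finally have "(- (\<i> * of_real (k \<bullet> b))) * fourier f k + fourier (dir_deriv b f) k = 0"
    unfolding fourier_def using i[OF f, of "- k"] i[OF f', of "- k"]
    by (subst (asm) Bochner_Integration.integral_add) (auto simp del: mult_minus_left)
  then show ?thesis by simp
qed

text \<open>The operator 1 - d^2/db^2 maps test functions to test functions and multiplies the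
  transform by \<open>1 + (k \<bullet> b)\<^sup>2\<close>. Lists may contain repetitions, so powers
  of such factors are included.\<close>

lemma test_function_fourier_list:
  assumes "test_function f" and "set bs \<subseteq> Basis"
  shows "\<exists>h. test_function h \<and> (\<forall>k. fourier h k = of_real (\<Prod>b\<leftarrow>bs. 1 + (k \<bullet> b)\<^sup>2) * fourier f k)"
  using assms(2)
proof (induction bs)
  case Nil
  then show ?case using assms(1) by (auto intro!: exI[of _ f])
next
  case (Cons b bs)
  then obtain h where h: "test_function h" "\<And>k. fourier h k = of_real (\<Prod>b\<leftarrow>bs. 1 + (k \<bullet> b)\<^sup>2) * fourier f k"
    by auto
  have b: "b \<in> Basis" using Cons by simp
  note h1 = test_function_dir_deriv[OF h(1) b] and h2 = test_function_dir_deriv[OF test_function_dir_deriv[OF h(1) b] b]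
  have "fourier (\<lambda>x. h x - dir_deriv b (dir_deriv b h) x) k = fourier h k - fourier (dir_deriv b (dir_deriv b h)) k" for k
    unfolding fourier_def using integrable_mult_planewave[OF test_function_integrable[OF h(1)]]
      integrable_mult_planewave[OF test_function_integrable[OF h2]] by (simp add: left_diff_distrib)
  also have "\<dots> k = of_real (1 + (k \<bullet> b)\<^sup>2) * fourier h k" for k
    unfolding fourier_dir_deriv[OF h1 b] fourier_dir_deriv[OF h(1) b] by (simp add: algebra_simps power2_eq_square)
  finally show ?case
    using test_function_diff[OF h(1) h2] h(2)
    by (intro exI[of _ "\<lambda>x. h x - dir_deriv b (dir_deriv b h) x"]) (simp add: mult.assoc)
qed

lemma norm_fourier_le: "norm (fourier f k) \<le> (LINT x|lborel. norm (f x))"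
  unfolding fourier_def using integral_norm_bound[of lborel "\<lambda>x. f x * planewave (- k) x"] by (simp add: norm_mult)

lemma integrable_inverse_1_plus_square_UNIV: "integrable lborel (\<lambda>t::real. 1 / (1 + t\<^sup>2))"
  using integrable_inverse_1_plus_square by (simp add: set_integrable_def inverse_eq_divide)

lemma fourier_measurable [measurable]:
  fixes f :: "'a::euclidean_space \<Rightarrow> complex"
  assumes [measurable]: "f \<in> borel_measurable borel"
  shows "fourier f \<in> borel_measurable borel"
  unfolding fourier_def by measurable

lemma one_plus_sum_le_prod:
  fixes f :: "'b \<Rightarrow> real"
  assumes "finite A" "\<And>x. x \<in> A \<Longrightarrow> 0 \<le> f x"
  shows "1 + sum f A \<le> (\<Prod>x\<in>A. 1 + f x)"
  using assms
proof (induction A rule: finite_induct)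
  case (insert x A)
  have "0 \<le> f x * sum f A" using insert by (intro mult_nonneg_nonneg sum_nonneg) auto
  then have "1 + sum f (insert x A) \<le> (1 + f x) * (1 + sum f A)"
    using insert by (simp add: algebra_simps)
  also have "\<dots> \<le> (1 + f x) * (\<Prod>x\<in>A. 1 + f x)"
    using insert by (intro mult_left_mono) auto
  finally show ?case using insert by simp
qed simp

text \<open>Each coordinate factor \<open>1 + (k \<bullet> b)\<^sup>2\<close> is used twice: one
  copy of the product absorbs the weight \<open>1 + (norm k)\<^sup>2\<close>, the other leaves the
  integrable product of the functions \<open>1 / (1 + (k \<bullet> b)\<^sup>2)\<close>.\<close>

lemma test_function_fourier_integrable:
  fixes f :: "'a::euclidean_space \<Rightarrow> complex"
  assumes f: "test_function f"
  shows "integrable lborel (\<lambda>k. (1 + (norm k)\<^sup>2) * norm (fourier f k))" "integrable lborel (fourier f)"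
proof -
  note [measurable] = test_function_measurable[OF f]
  obtain bs where bs: "set bs = (Basis :: 'a set)" "distinct bs"
    using finite_distinct_list[OF finite_Basis] by blast
  obtain h where h: "test_function h"
    "\<And>k. fourier h k = of_real (\<Prod>b\<leftarrow>bs @ bs. 1 + (k \<bullet> b)\<^sup>2) * fourier f k"
    using test_function_fourier_list[OF f, of "bs @ bs"] bs by auto
  define P where "P k = (\<Prod>b\<in>Basis. 1 + (k \<bullet> b)\<^sup>2)" for k :: 'a
  have P: "(\<Prod>b\<leftarrow>bs. 1 + (k \<bullet> b)\<^sup>2) = P k" for k
    unfolding P_def bs(1)[symmetric] using bs(2) by (simp add: prod.distinct_set_conv_list)
  have P1: "1 + (norm k)\<^sup>2 \<le> P k" for k
  proof -
    have "(norm k)\<^sup>2 = (\<Sum>b\<in>Basis. (k \<bullet> b)\<^sup>2)"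
      by (simp only: power2_norm_eq_inner, subst euclidean_inner) (simp add: power2_eq_square)
    then show ?thesis unfolding P_def using one_plus_sum_le_prod[of Basis "\<lambda>b. (k \<bullet> b)\<^sup>2"] by simp
  qed
  have P0: "0 < P k" for k unfolding P_def by (intro prod_pos) (auto intro: add_pos_nonneg)
  define C where "C = (LINT x|lborel. norm (h x))"
  have bd: "(1 + (norm k)\<^sup>2) * norm (fourier f k) \<le> C * (1 / P k)" for k
  proof -
    have "P k * P k * norm (fourier f k) \<le> C"
      using norm_fourier_le[of h k] P0[of k] unfolding h C_def by (simp add: P norm_mult)
    then have "P k * norm (fourier f k) \<le> C * (1 / P k)"
      using P0[of k] by (simp add: field_simps)
    moreover have "(1 + (norm k)\<^sup>2) * norm (fourier f k) \<le> P k * norm (fourier f k)"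
      by (intro mult_right_mono P1) simp
    ultimately show ?thesis by linarith
  qed
  have "integrable lborel (\<lambda>k::'a. \<Prod>b\<in>Basis. complex_of_real (1 / (1 + (k \<bullet> b)\<^sup>2)))"
    by (rule integrable_lborel_prod[where g="\<lambda>b t. complex_of_real (1 / (1 + t\<^sup>2))"])
      (intro integrable_of_real integrable_inverse_1_plus_square_UNIV)
  then have "integrable lborel (\<lambda>k::'a. norm (\<Prod>b\<in>Basis. complex_of_real (1 / (1 + (k \<bullet> b)\<^sup>2))))"
    by (rule integrable_norm)
  also have "(\<lambda>k. norm (\<Prod>b\<in>Basis. complex_of_real (1 / (1 + (k \<bullet> b)\<^sup>2)))) = (\<lambda>k. 1 / P k)"
    unfolding P_def of_real_prod[symmetric] norm_of_real
    by (auto simp: fun_eq_iff prod_dividef abs_prod intro!: prod.cong abs_of_nonneg)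
  finally have i: "integrable lborel (\<lambda>k. C * (1 / P k))" by (rule integrable_mult_right)
  show i1: "integrable lborel (\<lambda>k. (1 + (norm k)\<^sup>2) * norm (fourier f k))"
  proof (rule Bochner_Integration.integrable_bound[OF i])
    have "0 \<le> (1 + (norm k)\<^sup>2) * norm (fourier f k)" for k by simp
    then show "AE k in lborel. norm ((1 + (norm k)\<^sup>2) * norm (fourier f k)) \<le> norm (C * (1 / P k))"
      unfolding real_norm_def using bd by (intro AE_I2) (metis abs_ge_self abs_of_nonneg order_trans)
  qed measurable
  show "integrable lborel (fourier f)"
    by (rule Bochner_Integration.integrable_bound[OF i1]) (auto intro!: AE_I2 simp: algebra_simps)
qed

lemma test_function_fourier_inversion:
  fixes f :: "'a::euclidean_space \<Rightarrow> complex"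
  assumes f: "test_function f"
  shows "(LINT k|lborel. fourier f k * planewave k x) = of_real ((2 * pi) ^ DIM('a)) * f x"
proof -
  obtain B where "\<And>x. norm (f x) \<le> B"
    using test_function_bounds[OF f] by metis
  from fourier_inversion[OF test_function_continuous[OF f] this test_function_integrable[OF f] _ test_function_fourier_integrable(2)[OF f]]
  show ?thesis by (simp add: planewave_def fourier_def)
qed

section \<open>Local integrability of the inverse square of the norm\<close>

lemma integrable_powr_symmetric:
  assumes "-1 < a"
  shows "integrable lborel (\<lambda>t::real. indicator {-R..R} t * \<bar>t\<bar> powr a)"
proof -
  have half: "integrable lborel (\<lambda>t::real. indicator {0..R} t * t powr a)"
  proof (cases "0 \<le> R")
    case True
    have "(\<lambda>t. t powr a) absolutely_integrable_on {0..R}"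
      by (intro nonnegative_absolutely_integrable_1 integrable_on_powr_from_0 True assms) auto
    then have "integrable lebesgue (\<lambda>t::real. indicator {0..R} t * t powr a)"
      by (simp add: set_integrable_def)
    then show ?thesis by (subst (asm) integrable_completion) auto
  next
    case False
    then show ?thesis by simp
  qed
  have "integrable lborel (\<lambda>t::real. indicator {0..R} (0 - t) * (0 - t) powr a)"
    using lborel_integrable_reflect[of "\<lambda>t. indicator {0..R} t * t powr a" 0] half by simp
  from Bochner_Integration.integrable_add[OF half this]
  show ?thesis
    by (rule Bochner_Integration.integrable_bound) (auto simp: indicator_def)
qed

text \<open>In three dimensions \<open>norm w powr (-2)\<close> is a product of three factors
  \<open>norm w powr (-2/3)\<close>, each at most the same power of one coordinate, which is
  integrable near 0 on the line. This replaces polar coordinates.\<close>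

lemma integrable_inverse_norm_square:
  "integrable lborel (\<lambda>w::real^3. indicator (cball 0 R) w / (norm w)\<^sup>2)"
proof -
  define g where "g t = indicator {-R..R} t * \<bar>t\<bar> powr (-2/3)" for t :: real
  have "integrable lborel (\<lambda>w::real^3. \<Prod>b\<in>Basis. complex_of_real (g (w \<bullet> b)))"
    by (rule integrable_lborel_prod[where g="\<lambda>b t. complex_of_real (g t)"])
      (unfold g_def, intro integrable_of_real integrable_powr_symmetric, simp)
  then have i: "integrable lborel (\<lambda>w::real^3. norm (\<Prod>b\<in>Basis. complex_of_real (g (w \<bullet> b))))"
    by (rule integrable_norm)
  \<comment> \<open>As \<open>0 powr (-2/3) = 0\<close>, the majorant vanishes on the coordinate
    planes, and these null sets have to be excluded.\<close>
  have ae: "AE w in lborel. \<forall>b\<in>(Basis::(real^3) set). b \<bullet> w \<noteq> 0"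
  proof (subst AE_ball_countable, simp add: countable_finite, intro ballI)
    fix b :: "real^3" assume "b \<in> Basis"
    then have "negligible {w. b \<bullet> w = 0}" by (intro negligible_hyperplane) auto
    then have "{w. b \<bullet> w = 0} \<in> null_sets lebesgue" by (simp add: negligible_iff_null_sets)
    moreover have "{w. b \<bullet> w = 0} \<in> sets lborel" by simp
    ultimately have "{w. b \<bullet> w = 0} \<in> null_sets lborel" by (simp add: null_sets_completion_iff)
    then show "AE w in lborel. b \<bullet> w \<noteq> 0" by (rule AE_I') auto
  qed
  show ?thesis
  proof (rule Bochner_Integration.integrable_bound[OF i])
    show "AE w in lborel. norm (indicator (cball 0 R) w / (norm w)\<^sup>2 :: real)
      \<le> norm (norm (\<Prod>b\<in>Basis. complex_of_real (g ((w::real^3) \<bullet> b))))"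
      using ae
    proof eventually_elim
      case (elim w)
      show ?case
      proof (cases "norm w \<le> R")
        case True
        have "w \<noteq> 0" using elim by (metis inner_zero_right nonempty_Basis equals0I)
        then have n0: "0 < norm w" by simp
        have "(\<Prod>b\<in>(Basis::(real^3) set). norm w powr (-2/3)) = norm w powr (-2)"
          using n0 by (simp add: powr_power)
        also have "\<dots> = 1 / (norm w)\<^sup>2"
          using n0 powr_numeral[of "norm w" "num.Bit0 num.One"] by (simp add: powr_minus_divide)
        finally have "1 / (norm w)\<^sup>2 = (\<Prod>b\<in>(Basis::(real^3) set). norm w powr (-2/3))" ..
        also have "\<dots> \<le> (\<Prod>b\<in>Basis. g (w \<bullet> b))"
        proof (rule prod_mono, intro conjI)
          fix b :: "real^3" assume b: "b \<in> Basis"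
          have "\<bar>w \<bullet> b\<bar> \<le> norm w" using b by (rule Basis_le_norm)
          moreover have "0 < \<bar>w \<bullet> b\<bar>" using elim b by (auto simp: inner_commute)
          ultimately show "norm w powr (-2/3) \<le> g (w \<bullet> b)"
            using True unfolding g_def by (auto intro!: powr_mono2' simp: indicator_def abs_le_iff)
        qed simp
        finally show ?thesis using True by (simp flip: of_real_prod)
      qed simp
    qed
    have "(\<lambda>w::real^3. indicator (cball 0 R) w / (norm w)\<^sup>2 :: real) \<in> borel_measurable borel"
      by (intro borel_measurable_divide borel_measurable_indicator borel_measurable_power borel_measurable_norm) auto
    then show "(\<lambda>w::real^3. indicator (cball 0 R) w / (norm w)\<^sup>2 :: real) \<in> borel_measurable lborel"
      by simp
  qed
qed

section \<open>A regularised Green function\<close>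

definition radial0 :: "real \<Rightarrow> real \<Rightarrow> complex" where
  "radial0 \<kappa> t = exp (\<i> * of_real \<kappa> * of_real t) / (4 * of_real pi * of_real t)"

text \<open>With respect to s = t^2 this is the derivative of the radial Green function
  \<open>radial0\<close>, and \<open>radial2\<close> is the derivative of this one. The squared
  norm, unlike the norm, is smooth at the origin, so s is the variable in which the kernel is
  modified.\<close>

definition radial1 :: "real \<Rightarrow> real \<Rightarrow> complex" where
  "radial1 \<kappa> t = exp (\<i> * of_real \<kappa> * of_real t) *
     (\<i> * of_real \<kappa> / (8 * of_real pi * of_real t ^ 2) - 1 / (8 * of_real pi * of_real t ^ 3))"

definition radial2 :: "real \<Rightarrow> real \<Rightarrow> complex" where
  "radial2 \<kappa> t = exp (\<i> * of_real \<kappa> * of_real t) *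
     (- (of_real \<kappa>)\<^sup>2 / (16 * of_real pi * of_real t ^ 3) - 3 * \<i> * of_real \<kappa> / (16 * of_real pi * of_real t ^ 4)
       + 3 / (16 * of_real pi * of_real t ^ 5))"

lemma has_field_derivative_exp_div_power:
  fixes c z :: complex
  assumes "z \<noteq> 0"
  shows "((\<lambda>z. exp (c * z) / z ^ n) has_field_derivative exp (c * z) * (c / z ^ n - of_nat n / z ^ Suc n)) (at z)"
proof -
  have "((\<lambda>z. exp (c * z)) has_field_derivative exp (c * z) * c) (at z)"
    by (auto intro!: derivative_eq_intros)
  moreover have "((\<lambda>z. z ^ n) has_field_derivative of_nat n * z ^ (n - 1)) (at z)"
    by (auto intro!: derivative_eq_intros)
  ultimately have "((\<lambda>z. exp (c * z) / z ^ n) has_field_derivative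
      (exp (c * z) * c * z ^ n - exp (c * z) * (of_nat n * z ^ (n - 1))) / (z ^ n * z ^ n)) (at z)"
    by (rule DERIV_divide) (use assms in simp)
  moreover have "(E * c * z ^ n - E * (of_nat n * z ^ (n - 1))) / (z ^ n * z ^ n) = E * (c / z ^ n - of_nat n / z ^ Suc n)" for E
    using assms by (cases n) (simp_all add: field_simps)
  ultimately show ?thesis by simp
qed

lemma has_vector_derivative_radial0:
  assumes "t > 0"
  shows "(radial0 \<kappa> has_vector_derivative 2 * of_real t * radial1 \<kappa> t) (at t)"
proof -
  let ?c = "\<i> * complex_of_real \<kappa>" and ?z = "complex_of_real t" and ?p = "complex_of_real pi"
  have z: "?z \<noteq> 0" "?p \<noteq> 0" using assms by auto
  have D: "((\<lambda>z. 1 / (4 * ?p) * (exp (?c * z) / z ^ 1)) has_field_derivative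
      1 / (4 * ?p) * (exp (?c * ?z) * (?c / ?z ^ 1 - of_nat 1 / ?z ^ Suc 1))) (at ?z)"
    by (intro DERIV_cmult has_field_derivative_exp_div_power z)
  have eq: "1 / (4 * p) * (E * (c / z ^ 1 - of_nat 1 / z ^ Suc 1)) = 2 * z * (E * (c / (8 * p * z ^ 2) - 1 / (8 * p * z ^ 3)))"
    if "z \<noteq> 0" "p \<noteq> 0" for E c z p :: complex
    using that by (simp add: field_simps eval_nat_numeral)
  have "((\<lambda>z. 1 / (4 * ?p) * (exp (?c * z) / z ^ 1)) has_field_derivative 2 * ?z * radial1 \<kappa> t) (at ?z)"
    unfolding radial1_def by (rule DERIV_cong[OF D]) (rule eq[OF z])
  from has_vector_derivative_real_field[OF this] show ?thesis
    by (simp add: radial0_def[abs_def])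
qed

lemma has_vector_derivative_radial1:
  assumes "t > 0"
  shows "(radial1 \<kappa> has_vector_derivative 2 * of_real t * radial2 \<kappa> t) (at t)"
proof -
  let ?c = "\<i> * complex_of_real \<kappa>" and ?z = "complex_of_real t" and ?p = "complex_of_real pi"
  have z: "?z \<noteq> 0" "?p \<noteq> 0" using assms by auto
  have D: "((\<lambda>z. ?c / (8 * ?p) * (exp (?c * z) / z ^ 2) - 1 / (8 * ?p) * (exp (?c * z) / z ^ 3)) has_field_derivative
      ?c / (8 * ?p) * (exp (?c * ?z) * (?c / ?z ^ 2 - of_nat 2 / ?z ^ Suc 2))
      - 1 / (8 * ?p) * (exp (?c * ?z) * (?c / ?z ^ 3 - of_nat 3 / ?z ^ Suc 3))) (at ?z)"
    by (intro DERIV_diff DERIV_cmult has_field_derivative_exp_div_power z)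
  have eq: "c / (8 * p) * (E * (c / z ^ 2 - of_nat 2 / z ^ Suc 2)) - 1 / (8 * p) * (E * (c / z ^ 3 - of_nat 3 / z ^ Suc 3))
      = 2 * z * (E * (c\<^sup>2 / (16 * p * z ^ 3) - 3 * c / (16 * p * z ^ 4) + 3 / (16 * p * z ^ 5)))"
    if "z \<noteq> 0" "p \<noteq> 0" for E c z p :: complex
    using that by (simp add: field_simps eval_nat_numeral)
  have "radial2 \<kappa> t = exp (?c * ?z) * (?c\<^sup>2 / (16 * ?p * ?z ^ 3) - 3 * ?c / (16 * ?p * ?z ^ 4) + 3 / (16 * ?p * ?z ^ 5))"
    by (simp add: radial2_def power_mult_distrib mult.assoc)
  then have "((\<lambda>z. ?c / (8 * ?p) * (exp (?c * z) / z ^ 2) - 1 / (8 * ?p) * (exp (?c * z) / z ^ 3)) has_field_derivative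
      2 * ?z * radial2 \<kappa> t) (at ?z)"
    by (intro DERIV_cong[OF D]) (simp only: eq[OF z])
  from has_vector_derivative_real_field[OF this] show ?thesis
    by (simp add: radial1_def[abs_def] algebra_simps)
qed

lemma has_vector_derivative_comp_sqrt:
  assumes F: "\<And>t. t > 0 \<Longrightarrow> (F has_vector_derivative 2 * of_real t * F' t) (at t)" and s: "s > 0"
  shows "((\<lambda>s. F (sqrt s)) has_vector_derivative (F' (sqrt s) :: complex)) (at s)"
proof -
  have "(sqrt has_vector_derivative inverse (sqrt s) / 2) (at s)"
    using DERIV_real_sqrt[OF s] by (simp add: has_real_derivative_iff_has_vector_derivative)
  moreover have "(F has_vector_derivative 2 * of_real (sqrt s) * F' (sqrt s)) (at (sqrt s))"
    using F[of "sqrt s"] s by simp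
  ultimately have "(F \<circ> sqrt has_vector_derivative (inverse (sqrt s) / 2) *\<^sub>R (2 * of_real (sqrt s) * F' (sqrt s))) (at s)"
    by (rule vector_diff_chain_at)
  moreover have "(inverse (sqrt s) / 2) *\<^sub>R (2 * of_real (sqrt s) * F' (sqrt s)) = F' (sqrt s)"
  proof -
    have "complex_of_real (sqrt s) \<noteq> 0" using s by simp
    then show ?thesis by (simp add: scaleR_conv_of_real)
  qed
  ultimately show ?thesis by (simp add: o_def)
qed

lemma has_vector_derivative_glue:
  assumes "\<And>s. s \<ge> c \<Longrightarrow> (f has_vector_derivative f' s) (at s)"
    and "\<And>s. s \<le> c \<Longrightarrow> (g has_vector_derivative g' s) (at s)"
    and "f c = g c" "f' c = g' c"
  shows "((\<lambda>s::real. if s \<le> c then g s else f s) has_vector_derivative (if s \<le> c then g' s else f' s)) (at s)"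
proof -
  have "((\<lambda>s. if s \<in> {..c} then g s else f s) has_vector_derivative (if s \<in> {..c} then g' s else f' s)) (at s within UNIV)"
    by (rule has_vector_derivative_If_within_closures[where T="{c<..}"])
      (use assms(3,4) in \<open>auto intro: has_vector_derivative_at_within[OF assms(1)] has_vector_derivative_at_within[OF assms(2)]\<close>)
  then show ?thesis by simp
qed

text \<open>The second order Taylor expansion at \<open>s = \<delta>\<^sup>2\<close> of the Green function as a function of
  \<open>s = |x|\<^sup>2\<close> replaces it for \<open>s < \<delta>\<^sup>2\<close>. This regularisation is \<open>C\<^sup>2\<close> and changes the Green
  function only in a ball of radius \<open>\<delta>\<close>.\<close>

definition reg0 :: "real \<Rightarrow> real \<Rightarrow> real \<Rightarrow> complex" where
  "reg0 \<kappa> \<delta> s = (let m = max s (\<delta>\<^sup>2); t = sqrt m in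
     radial0 \<kappa> t + radial1 \<kappa> t * of_real (s - m) + radial2 \<kappa> t * of_real ((s - m)\<^sup>2 / 2))"

definition reg1 :: "real \<Rightarrow> real \<Rightarrow> real \<Rightarrow> complex" where
  "reg1 \<kappa> \<delta> s = (let m = max s (\<delta>\<^sup>2); t = sqrt m in radial1 \<kappa> t + radial2 \<kappa> t * of_real (s - m))"

definition reg2 :: "real \<Rightarrow> real \<Rightarrow> real \<Rightarrow> complex" where
  "reg2 \<kappa> \<delta> s = radial2 \<kappa> (sqrt (max s (\<delta>\<^sup>2)))"

lemma has_vector_derivative_reg0:
  assumes "\<delta> > 0"
  shows "(reg0 \<kappa> \<delta> has_vector_derivative reg1 \<kappa> \<delta> s) (at s)"
proof -
  let ?c = "\<delta>\<^sup>2"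
  have c: "?c > 0" using assms by simp
  have "((\<lambda>s. if s \<le> ?c then radial0 \<kappa> \<delta> + radial1 \<kappa> \<delta> * of_real (s - ?c) + radial2 \<kappa> \<delta> * of_real ((s - ?c)\<^sup>2 / 2)
      else radial0 \<kappa> (sqrt s)) has_vector_derivative
      (if s \<le> ?c then radial1 \<kappa> \<delta> + radial2 \<kappa> \<delta> * of_real (s - ?c) else radial1 \<kappa> (sqrt s))) (at s)"
  proof (rule has_vector_derivative_glue)
    fix s assume "?c \<le> s"
    then have "0 < s" using c by linarith
    then show "((\<lambda>s. radial0 \<kappa> (sqrt s)) has_vector_derivative radial1 \<kappa> (sqrt s)) (at s)"
      by (intro has_vector_derivative_comp_sqrt has_vector_derivative_radial0)
  next
    fix s
    have "((\<lambda>z. radial0 \<kappa> \<delta> + radial1 \<kappa> \<delta> * (z - of_real ?c) + radial2 \<kappa> \<delta> * ((z - of_real ?c)\<^sup>2 / 2)) has_field_derivative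
      radial1 \<kappa> \<delta> + radial2 \<kappa> \<delta> * (of_real s - of_real ?c)) (at (of_real s))"
      by (auto intro!: derivative_eq_intros)
    from has_vector_derivative_real_field[OF this]
    show "((\<lambda>s. radial0 \<kappa> \<delta> + radial1 \<kappa> \<delta> * of_real (s - ?c) + radial2 \<kappa> \<delta> * of_real ((s - ?c)\<^sup>2 / 2)) has_vector_derivative
      radial1 \<kappa> \<delta> + radial2 \<kappa> \<delta> * of_real (s - ?c)) (at s)"
      by simp
  qed (use assms in auto)
  moreover have "reg0 \<kappa> \<delta> = (\<lambda>s. if s \<le> ?c then radial0 \<kappa> \<delta> + radial1 \<kappa> \<delta> * of_real (s - ?c) + radial2 \<kappa> \<delta> * of_real ((s - ?c)\<^sup>2 / 2)
      else radial0 \<kappa> (sqrt s))"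
    using assms by (auto simp: reg0_def Let_def max_def)
  moreover have "reg1 \<kappa> \<delta> s = (if s \<le> ?c then radial1 \<kappa> \<delta> + radial2 \<kappa> \<delta> * of_real (s - ?c) else radial1 \<kappa> (sqrt s))"
    using assms by (auto simp: reg1_def Let_def max_def)
  ultimately show ?thesis by (simp only:)
qed

lemma has_vector_derivative_reg1:
  assumes "\<delta> > 0"
  shows "(reg1 \<kappa> \<delta> has_vector_derivative reg2 \<kappa> \<delta> s) (at s)"
proof -
  let ?c = "\<delta>\<^sup>2"
  have c: "?c > 0" using assms by simp
  have "((\<lambda>s. if s \<le> ?c then radial1 \<kappa> \<delta> + radial2 \<kappa> \<delta> * of_real (s - ?c) else radial1 \<kappa> (sqrt s)) has_vector_derivative
      (if s \<le> ?c then radial2 \<kappa> \<delta> else radial2 \<kappa> (sqrt s))) (at s)"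
  proof (rule has_vector_derivative_glue)
    fix s assume "?c \<le> s"
    then have "0 < s" using c by linarith
    then show "((\<lambda>s. radial1 \<kappa> (sqrt s)) has_vector_derivative radial2 \<kappa> (sqrt s)) (at s)"
      by (intro has_vector_derivative_comp_sqrt has_vector_derivative_radial1)
  next
    fix s
    have "((\<lambda>z. radial1 \<kappa> \<delta> + radial2 \<kappa> \<delta> * (z - of_real ?c)) has_field_derivative radial2 \<kappa> \<delta>) (at (of_real s))"
      by (auto intro!: derivative_eq_intros)
    from has_vector_derivative_real_field[OF this]
    show "((\<lambda>s. radial1 \<kappa> \<delta> + radial2 \<kappa> \<delta> * of_real (s - ?c)) has_vector_derivative radial2 \<kappa> \<delta>) (at s)"
      by simp
  qed (use assms in auto)
  moreover have "reg1 \<kappa> \<delta> = (\<lambda>s. if s \<le> ?c then radial1 \<kappa> \<delta> + radial2 \<kappa> \<delta> * of_real (s - ?c) else radial1 \<kappa> (sqrt s))"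
    using assms by (auto simp: reg1_def Let_def max_def)
  moreover have "reg2 \<kappa> \<delta> s = (if s \<le> ?c then radial2 \<kappa> \<delta> else radial2 \<kappa> (sqrt s))"
    using assms by (auto simp: reg2_def max_def)
  ultimately show ?thesis by (simp only:)
qed

definition Greg :: "real \<Rightarrow> real \<Rightarrow> real^3 \<Rightarrow> complex" where
  "Greg \<kappa> \<delta> x = reg0 \<kappa> \<delta> ((norm x)\<^sup>2)"

definition Greg1 :: "real \<Rightarrow> real \<Rightarrow> real^3 \<Rightarrow> real^3 \<Rightarrow> complex" where
  "Greg1 \<kappa> \<delta> a x = of_real (2 * (x \<bullet> a)) * reg1 \<kappa> \<delta> ((norm x)\<^sup>2)"

definition Greg2 :: "real \<Rightarrow> real \<Rightarrow> real^3 \<Rightarrow> real^3 \<Rightarrow> real^3 \<Rightarrow> complex" where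
  "Greg2 \<kappa> \<delta> a b x = of_real (2 * (a \<bullet> b)) * reg1 \<kappa> \<delta> ((norm x)\<^sup>2)
     + of_real (4 * (x \<bullet> a) * (x \<bullet> b)) * reg2 \<kappa> \<delta> ((norm x)\<^sup>2)"

lemma has_dir_deriv_radial:
  fixes x b :: "'a::real_inner"
  assumes F: "(F has_vector_derivative F') (at ((norm x)\<^sup>2))"
  shows "has_dir_deriv b (\<lambda>x. F ((norm x)\<^sup>2) :: complex) (of_real (2 * (x \<bullet> b)) * F') x"
proof -
  have "((\<lambda>t. (norm (x + t *\<^sub>R b))\<^sup>2) has_real_derivative 2 * (x \<bullet> b)) (at 0)"
    unfolding power2_norm_eq_inner inner_add_left inner_add_right inner_scaleR_left inner_scaleR_right
    by (auto intro!: derivative_eq_intros simp: inner_commute)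
  then have "((\<lambda>t. (norm (x + t *\<^sub>R b))\<^sup>2) has_vector_derivative 2 * (x \<bullet> b)) (at 0)"
    by (simp add: has_real_derivative_iff_has_vector_derivative)
  from vector_diff_chain_at[OF this, of F F'] F show ?thesis
    by (simp add: has_dir_deriv_def o_def scaleR_conv_of_real)
qed

lemma has_dir_deriv_inner: "has_dir_deriv b (\<lambda>x. complex_of_real (x \<bullet> a)) (of_real (a \<bullet> b)) x"
proof -
  have "((\<lambda>z. of_real (x \<bullet> a) + z * of_real (b \<bullet> a)) has_field_derivative of_real (a \<bullet> b)) (at (complex_of_real 0))"
    by (auto intro!: derivative_eq_intros simp: inner_commute)
  from has_vector_derivative_real_field[OF this] show ?thesis
    by (simp add: has_dir_deriv_def inner_add_left)
qed

lemma has_dir_deriv_Greg: "\<delta> > 0 \<Longrightarrow> has_dir_deriv a (Greg \<kappa> \<delta>) (Greg1 \<kappa> \<delta> a x) x"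
  unfolding Greg_def[abs_def] Greg1_def by (intro has_dir_deriv_radial has_vector_derivative_reg0)

lemma has_dir_deriv_Greg1:
  assumes "\<delta> > 0"
  shows "has_dir_deriv b (Greg1 \<kappa> \<delta> a) (Greg2 \<kappa> \<delta> a b x) x"
proof -
  have "has_dir_deriv b (\<lambda>x. 2 * (of_real (x \<bullet> a) * reg1 \<kappa> \<delta> ((norm x)\<^sup>2)))
    (2 * (of_real (x \<bullet> a) * (of_real (2 * (x \<bullet> b)) * reg2 \<kappa> \<delta> ((norm x)\<^sup>2)) + of_real (a \<bullet> b) * reg1 \<kappa> \<delta> ((norm x)\<^sup>2))) x"
    by (intro has_dir_deriv_cmult has_dir_deriv_mult has_dir_deriv_inner has_dir_deriv_radial has_vector_derivative_reg1 assms)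
  then show ?thesis
    unfolding Greg1_def[abs_def] Greg2_def by (simp add: algebra_simps)
qed

section \<open>Pointwise bounds for the regularised kernel\<close>

lemma sqrt_max_norm: "\<delta> \<ge> 0 \<Longrightarrow> sqrt (max ((norm x)\<^sup>2) (\<delta>\<^sup>2)) = max (norm x) \<delta>"
  by (auto simp: max_def power2_le_iff_abs_le abs_le_square_iff[symmetric])

lemma reg_norm:
  assumes "\<delta> \<ge> 0" "t = max (norm x) \<delta>"
  shows "reg0 \<kappa> \<delta> ((norm x)\<^sup>2) = radial0 \<kappa> t + radial1 \<kappa> t * of_real ((norm x)\<^sup>2 - t\<^sup>2) + radial2 \<kappa> t * of_real (((norm x)\<^sup>2 - t\<^sup>2)\<^sup>2 / 2)"
    and "reg1 \<kappa> \<delta> ((norm x)\<^sup>2) = radial1 \<kappa> t + radial2 \<kappa> t * of_real ((norm x)\<^sup>2 - t\<^sup>2)"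
    and "reg2 \<kappa> \<delta> ((norm x)\<^sup>2) = radial2 \<kappa> t"
proof -
  have "max ((norm x)\<^sup>2) (\<delta>\<^sup>2) = t\<^sup>2"
    unfolding assms(2) using assms(1) by (auto simp: max_def power2_le_iff_abs_le abs_le_square_iff[symmetric])
  then show "reg0 \<kappa> \<delta> ((norm x)\<^sup>2) = radial0 \<kappa> t + radial1 \<kappa> t * of_real ((norm x)\<^sup>2 - t\<^sup>2) + radial2 \<kappa> t * of_real (((norm x)\<^sup>2 - t\<^sup>2)\<^sup>2 / 2)"
    "reg1 \<kappa> \<delta> ((norm x)\<^sup>2) = radial1 \<kappa> t + radial2 \<kappa> t * of_real ((norm x)\<^sup>2 - t\<^sup>2)"
    "reg2 \<kappa> \<delta> ((norm x)\<^sup>2) = radial2 \<kappa> t"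
    using assms sqrt_max_norm[of \<delta> x] by (simp_all add: reg0_def reg1_def reg2_def Let_def)
qed

lemma continuous_on_radial:
  fixes f g :: "'a::t2_space \<Rightarrow> real"
  assumes "continuous_on A f" "continuous_on A g" "\<And>x. x \<in> A \<Longrightarrow> g x \<noteq> 0"
  shows "continuous_on A (\<lambda>x. radial0 (f x) (g x))" "continuous_on A (\<lambda>x. radial1 (f x) (g x))"
    "continuous_on A (\<lambda>x. radial2 (f x) (g x))"
  unfolding radial0_def radial1_def radial2_def
  by (intro continuous_intros assms; use assms(3) in simp)+

lemma continuous_on_reg:
  fixes f g :: "'a::t2_space \<Rightarrow> real"
  assumes "\<delta> > 0" "continuous_on A f" "continuous_on A g"
  shows "continuous_on A (\<lambda>x. reg0 (f x) \<delta> (g x))" "continuous_on A (\<lambda>x. reg1 (f x) \<delta> (g x))"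
    "continuous_on A (\<lambda>x. reg2 (f x) \<delta> (g x))"
proof -
  have "0 < max (g x) (\<delta>\<^sup>2)" for x
    using assms(1) by (simp add: less_max_iff_disj)
  then have "sqrt (max (g x) (\<delta>\<^sup>2)) \<noteq> 0" for x
    by (metis less_irrefl real_sqrt_eq_zero_cancel_iff)
  then show "continuous_on A (\<lambda>x. reg0 (f x) \<delta> (g x))" "continuous_on A (\<lambda>x. reg1 (f x) \<delta> (g x))"
    "continuous_on A (\<lambda>x. reg2 (f x) \<delta> (g x))"
    unfolding reg0_def reg1_def reg2_def Let_def
    by (intro continuous_intros continuous_on_radial assms; simp)+
qed

lemma continuous_on_Greg [continuous_intros]:
  fixes f :: "'a::t2_space \<Rightarrow> real" and g :: "'a \<Rightarrow> real^3"
  assumes "\<delta> > 0" "continuous_on A f" "continuous_on A g"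
  shows "continuous_on A (\<lambda>x. Greg (f x) \<delta> (g x))" "continuous_on A (\<lambda>x. Greg1 (f x) \<delta> a (g x))"
    "continuous_on A (\<lambda>x. Greg2 (f x) \<delta> a b (g x))"
  unfolding Greg_def Greg1_def Greg2_def by (intro continuous_intros continuous_on_reg assms)+

text \<open>All three bounds share the factor \<open>(1 + \<bar>\<kappa>\<bar>)\<^sup>2\<close>, the
  growth in \<kappa> of the worst of them, the second derivative. Numerical factors such as
  \<open>1 / (4 * pi)\<close> are below 1 and dropped.\<close>

lemma norm_radial:
  assumes t: "t > 0"
  shows "norm (radial0 \<kappa> t) \<le> (1 + \<bar>\<kappa>\<bar>)\<^sup>2 / t"
    and "norm (radial1 \<kappa> t) \<le> (1 + \<bar>\<kappa>\<bar>)\<^sup>2 * (1 + t)\<^sup>2 / t ^ 3"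
    and "norm (radial2 \<kappa> t) \<le> (1 + \<bar>\<kappa>\<bar>)\<^sup>2 * (1 + t)\<^sup>2 / t ^ 5"
proof -
  have e: "norm (exp (\<i> * of_real \<kappa> * of_real t)) = 1"
    using norm_exp_i_times[of "\<kappa> * t"] by (simp add: mult.assoc)
  have pi: "pi > 1" using pi_gt3 by simp
  have K: "1 \<le> (1 + \<bar>\<kappa>\<bar>)\<^sup>2" by (simp add: one_le_power)
  have "norm (radial0 \<kappa> t) = 1 / (4 * pi * t)"
    unfolding radial0_def norm_divide e using t by (simp add: norm_mult)
  also have "\<dots> \<le> 1 / t" using t pi by (intro divide_left_mono) auto
  also have "\<dots> \<le> (1 + \<bar>\<kappa>\<bar>)\<^sup>2 / t" using t K by (intro divide_right_mono) auto
  finally show "norm (radial0 \<kappa> t) \<le> (1 + \<bar>\<kappa>\<bar>)\<^sup>2 / t" .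
  have kt: "0 \<le> \<bar>\<kappa>\<bar> * t" using t by simp
  \<comment> \<open>Both polynomials in \<open>\<bar>\<kappa>\<bar> * t\<close> are at most the
    square of \<open>1 + \<bar>\<kappa>\<bar> * t\<close>, which in turn is at most
    \<open>(1 + \<bar>\<kappa>\<bar>) * (1 + t)\<close>.\<close>
  have K1: "\<bar>\<kappa>\<bar> * t + 1 \<le> (1 + \<bar>\<kappa>\<bar>)\<^sup>2 * (1 + t)\<^sup>2" and K2: "\<bar>\<kappa>\<bar>\<^sup>2 * t\<^sup>2 + \<bar>\<kappa>\<bar> * t + 1 \<le> (1 + \<bar>\<kappa>\<bar>)\<^sup>2 * (1 + t)\<^sup>2"
  proof -
    have "1 + \<bar>\<kappa>\<bar> * t \<le> (1 + \<bar>\<kappa>\<bar>) * (1 + t)" using t by (simp add: algebra_simps)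
    then have "(1 + \<bar>\<kappa>\<bar> * t)\<^sup>2 \<le> ((1 + \<bar>\<kappa>\<bar>) * (1 + t))\<^sup>2" using kt by (intro power_mono) auto
    then show K2: "\<bar>\<kappa>\<bar>\<^sup>2 * t\<^sup>2 + \<bar>\<kappa>\<bar> * t + 1 \<le> (1 + \<bar>\<kappa>\<bar>)\<^sup>2 * (1 + t)\<^sup>2"
      using kt by (simp add: power_mult_distrib power2_sum)
    have "0 \<le> \<bar>\<kappa>\<bar>\<^sup>2 * t\<^sup>2" by simp
    then show "\<bar>\<kappa>\<bar> * t + 1 \<le> (1 + \<bar>\<kappa>\<bar>)\<^sup>2 * (1 + t)\<^sup>2" using K2 by linarith
  qed
  have "norm (radial1 \<kappa> t) \<le> \<bar>\<kappa>\<bar> / (8 * pi * t ^ 2) + 1 / (8 * pi * t ^ 3)"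
    unfolding radial1_def norm_mult e using t
    by (simp, intro order_trans[OF norm_triangle_ineq4]) (simp add: norm_divide norm_mult norm_power)
  also have "\<dots> \<le> \<bar>\<kappa>\<bar> / t ^ 2 + 1 / t ^ 3"
    using t pi by (intro add_mono divide_left_mono) auto
  also have "\<dots> = (\<bar>\<kappa>\<bar> * t + 1) / t ^ 3" using t by (simp add: field_simps power2_eq_square power3_eq_cube)
  also have "\<dots> \<le> (1 + \<bar>\<kappa>\<bar>)\<^sup>2 * (1 + t)\<^sup>2 / t ^ 3" using t K1 by (intro divide_right_mono) auto
  finally show "norm (radial1 \<kappa> t) \<le> (1 + \<bar>\<kappa>\<bar>)\<^sup>2 * (1 + t)\<^sup>2 / t ^ 3" .
  have "norm (radial2 \<kappa> t) \<le> \<bar>\<kappa>\<bar>\<^sup>2 / (16 * pi * t ^ 3) + 3 * \<bar>\<kappa>\<bar> / (16 * pi * t ^ 4) + 3 / (16 * pi * t ^ 5)"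
    unfolding radial2_def norm_mult e using t
    by (simp, intro order_trans[OF norm_triangle_ineq] add_mono order_trans[OF norm_triangle_ineq4])
      (simp_all add: norm_divide norm_mult norm_power)
  also have "\<dots> \<le> \<bar>\<kappa>\<bar>\<^sup>2 / t ^ 3 + \<bar>\<kappa>\<bar> / t ^ 4 + 1 / t ^ 5"
  proof (intro add_mono)
    show "\<bar>\<kappa>\<bar>\<^sup>2 / (16 * pi * t ^ 3) \<le> \<bar>\<kappa>\<bar>\<^sup>2 / t ^ 3" using t pi by (intro divide_left_mono) auto
    have "3 * \<bar>\<kappa>\<bar> / (16 * pi * t ^ 4) = \<bar>\<kappa>\<bar> / ((16 * pi / 3) * t ^ 4)" by simp
    also have "\<dots> \<le> \<bar>\<kappa>\<bar> / t ^ 4" using t pi by (intro divide_left_mono) auto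
    finally show "3 * \<bar>\<kappa>\<bar> / (16 * pi * t ^ 4) \<le> \<bar>\<kappa>\<bar> / t ^ 4" .
    have "3 / (16 * pi * t ^ 5) = 1 / ((16 * pi / 3) * t ^ 5)" by simp
    also have "\<dots> \<le> 1 / t ^ 5" using t pi by (intro divide_left_mono) auto
    finally show "3 / (16 * pi * t ^ 5) \<le> 1 / t ^ 5" .
  qed
  also have "\<dots> = (\<bar>\<kappa>\<bar>\<^sup>2 * t\<^sup>2 + \<bar>\<kappa>\<bar> * t + 1) / t ^ 5" using t by (simp add: field_simps eval_nat_numeral)
  also have "\<dots> \<le> (1 + \<bar>\<kappa>\<bar>)\<^sup>2 * (1 + t)\<^sup>2 / t ^ 5" using t K2 by (intro divide_right_mono) auto
  finally show "norm (radial2 \<kappa> t) \<le> (1 + \<bar>\<kappa>\<bar>)\<^sup>2 * (1 + t)\<^sup>2 / t ^ 5" .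
qed

text \<open>The increment s - m of the Taylor expansion is at most t^2 in modulus, so every Taylor
  term has the order of its leading term, and t acts as the distance to the singularity. The first
  bound has \<open>(1 + \<delta>)\<^sup>2\<close> in place of \<open>(1 + t)\<^sup>2\<close> to keep
  the decay at infinity; hence its case distinction.\<close>

lemma reg_bounds:
  fixes x :: "'a::real_normed_vector"
  assumes \<delta>: "\<delta> > 0" and t: "t = max (norm x) \<delta>"
  shows "norm (reg0 \<kappa> \<delta> ((norm x)\<^sup>2)) \<le> 3 * (1 + \<bar>\<kappa>\<bar>)\<^sup>2 * (1 + \<delta>)\<^sup>2 / t"
    and "norm (reg1 \<kappa> \<delta> ((norm x)\<^sup>2)) \<le> 2 * (1 + \<bar>\<kappa>\<bar>)\<^sup>2 * (1 + t)\<^sup>2 / t ^ 3"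
    and "norm (reg2 \<kappa> \<delta> ((norm x)\<^sup>2)) \<le> (1 + \<bar>\<kappa>\<bar>)\<^sup>2 * (1 + t)\<^sup>2 / t ^ 5"
proof -
  define K where "K = (1 + \<bar>\<kappa>\<bar>)\<^sup>2"
  have K: "0 \<le> K" unfolding K_def by simp
  have t0: "t > 0" and nt: "norm x \<le> t" using \<delta> t by auto
  have "(norm x)\<^sup>2 \<le> t\<^sup>2" using nt by (intro power_mono) auto
  then have st: "\<bar>(norm x)\<^sup>2 - t\<^sup>2\<bar> \<le> t\<^sup>2" by simp
  note r = norm_radial[OF t0, of \<kappa>, folded K_def]
  have r2: "norm (radial2 \<kappa> t * of_real ((norm x)\<^sup>2 - t\<^sup>2)) \<le> K * (1 + t)\<^sup>2 / t ^ 3"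
  proof -
    have "norm (radial2 \<kappa> t * of_real ((norm x)\<^sup>2 - t\<^sup>2)) \<le> (K * (1 + t)\<^sup>2 / t ^ 5) * t\<^sup>2"
      unfolding norm_mult norm_of_real by (intro mult_mono r st) (use K t0 in auto)
    also have "\<dots> = K * (1 + t)\<^sup>2 / t ^ 3" using t0 by (simp add: field_simps eval_nat_numeral)
    finally show ?thesis .
  qed
  show "norm (reg1 \<kappa> \<delta> ((norm x)\<^sup>2)) \<le> 2 * (1 + \<bar>\<kappa>\<bar>)\<^sup>2 * (1 + t)\<^sup>2 / t ^ 3"
    unfolding reg_norm(2)[OF less_imp_le[OF \<delta>] t]
    using norm_triangle_ineq[of "radial1 \<kappa> t" "radial2 \<kappa> t * of_real ((norm x)\<^sup>2 - t\<^sup>2)"] r r2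
    by (simp add: K_def)
  show "norm (reg2 \<kappa> \<delta> ((norm x)\<^sup>2)) \<le> (1 + \<bar>\<kappa>\<bar>)\<^sup>2 * (1 + t)\<^sup>2 / t ^ 5"
    unfolding reg_norm(3)[OF less_imp_le[OF \<delta>] t] using r by (simp add: K_def)
  have \<delta>1: "1 \<le> (1 + \<delta>)\<^sup>2" using \<delta> by (simp add: one_le_power)
  show "norm (reg0 \<kappa> \<delta> ((norm x)\<^sup>2)) \<le> 3 * (1 + \<bar>\<kappa>\<bar>)\<^sup>2 * (1 + \<delta>)\<^sup>2 / t"
  proof (cases "norm x \<ge> \<delta>")
    case True
    then have "reg0 \<kappa> \<delta> ((norm x)\<^sup>2) = radial0 \<kappa> t"
      unfolding reg_norm(1)[OF less_imp_le[OF \<delta>] t] t by simp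
    moreover have "K / t \<le> 3 * K * (1 + \<delta>)\<^sup>2 / t"
      using K t0 \<delta>1 mult_mono[of 1 3 1 "(1 + \<delta>)\<^sup>2"] by (intro divide_right_mono) (simp_all add: mult_le_cancel_left1 mult.assoc mult.left_commute)
    ultimately show ?thesis using r(1) by (simp add: K_def)
  next
    case False
    then have t\<delta>: "t = \<delta>" using t by simp
    have a: "norm (radial0 \<kappa> t) \<le> K * (1 + t)\<^sup>2 / t"
      using r(1) K t0 \<delta>1 t\<delta> by (intro order_trans[OF r(1)] divide_right_mono) (auto simp: mult_le_cancel_left1)
    have b: "norm (radial1 \<kappa> t * of_real ((norm x)\<^sup>2 - t\<^sup>2)) \<le> K * (1 + t)\<^sup>2 / t"
    proof -
      have "norm (radial1 \<kappa> t * of_real ((norm x)\<^sup>2 - t\<^sup>2)) \<le> (K * (1 + t)\<^sup>2 / t ^ 3) * t\<^sup>2"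
        unfolding norm_mult norm_of_real by (intro mult_mono r st) (use K t0 in auto)
      also have "\<dots> = K * (1 + t)\<^sup>2 / t" using t0 by (simp add: field_simps eval_nat_numeral)
      finally show ?thesis .
    qed
    have c: "norm (radial2 \<kappa> t * of_real (((norm x)\<^sup>2 - t\<^sup>2)\<^sup>2 / 2)) \<le> K * (1 + t)\<^sup>2 / t"
    proof -
      have "((norm x)\<^sup>2 - t\<^sup>2)\<^sup>2 \<le> t ^ 4"
        using power_mono[OF st, of 2] by (simp add: power_mult[symmetric])
      then have "\<bar>((norm x)\<^sup>2 - t\<^sup>2)\<^sup>2 / 2\<bar> \<le> t ^ 4"
        unfolding abs_of_nonneg[OF divide_nonneg_pos[OF zero_le_power2 zero_less_numeral]]
        using zero_le_power2[of "(norm x)\<^sup>2 - t\<^sup>2"] by linarith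
      then have "norm (radial2 \<kappa> t * of_real (((norm x)\<^sup>2 - t\<^sup>2)\<^sup>2 / 2)) \<le> (K * (1 + t)\<^sup>2 / t ^ 5) * t ^ 4"
        unfolding norm_mult norm_of_real by (intro mult_mono r) (use K t0 in auto)
      also have "\<dots> = K * (1 + t)\<^sup>2 / t" using t0 by (simp add: field_simps eval_nat_numeral)
      finally show ?thesis .
    qed
    have "norm (reg0 \<kappa> \<delta> ((norm x)\<^sup>2)) \<le> K * (1 + t)\<^sup>2 / t + K * (1 + t)\<^sup>2 / t + K * (1 + t)\<^sup>2 / t"
      unfolding reg_norm(1)[OF less_imp_le[OF \<delta>] t]
      by (intro order_trans[OF norm_triangle_ineq] add_mono a b c)
    then show ?thesis by (simp add: K_def t\<delta> mult.assoc mult.commute[of "(1 + \<delta>)\<^sup>2"])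
  qed
qed

lemma Greg_bounds:
  assumes \<delta>: "\<delta> > 0" and t: "t = max (norm x) \<delta>" and ab: "norm a = 1" "norm b = 1"
  shows "norm (Greg \<kappa> \<delta> x) \<le> 3 * (1 + \<bar>\<kappa>\<bar>)\<^sup>2 * (1 + \<delta>)\<^sup>2 / t"
    and "norm (Greg1 \<kappa> \<delta> a x) \<le> 4 * (1 + \<bar>\<kappa>\<bar>)\<^sup>2 * (1 + t)\<^sup>2 / t\<^sup>2"
    and "norm (Greg2 \<kappa> \<delta> a b x) \<le> 8 * (1 + \<bar>\<kappa>\<bar>)\<^sup>2 * (1 + t)\<^sup>2 / t ^ 3"
proof -
  define K where "K = (1 + \<bar>\<kappa>\<bar>)\<^sup>2"
  have K: "0 \<le> K" unfolding K_def by simp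
  have t0: "t > 0" and nt: "norm x \<le> t" using \<delta> t by auto
  note r = reg_bounds[OF \<delta> t, of \<kappa>, folded K_def]
  have xa: "\<bar>x \<bullet> a\<bar> \<le> t" "\<bar>x \<bullet> b\<bar> \<le> t" "\<bar>a \<bullet> b\<bar> \<le> 1"
    using Cauchy_Schwarz_ineq2[of x a] Cauchy_Schwarz_ineq2[of x b] Cauchy_Schwarz_ineq2[of a b] nt ab by auto
  show "norm (Greg \<kappa> \<delta> x) \<le> 3 * (1 + \<bar>\<kappa>\<bar>)\<^sup>2 * (1 + \<delta>)\<^sup>2 / t"
    using r(1) by (simp add: Greg_def K_def)
  have "norm (Greg1 \<kappa> \<delta> a x) \<le> (2 * t) * (2 * K * (1 + t)\<^sup>2 / t ^ 3)"
    unfolding Greg1_def norm_mult norm_of_real by (intro mult_mono r) (use xa t0 K in auto)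
  also have "\<dots> = 4 * K * (1 + t)\<^sup>2 / t\<^sup>2" using t0 by (simp add: field_simps eval_nat_numeral)
  finally show "norm (Greg1 \<kappa> \<delta> a x) \<le> 4 * (1 + \<bar>\<kappa>\<bar>)\<^sup>2 * (1 + t)\<^sup>2 / t\<^sup>2" by (simp add: K_def)
  have A: "norm (of_real (2 * (a \<bullet> b)) * reg1 \<kappa> \<delta> ((norm x)\<^sup>2)) \<le> 2 * (2 * K * (1 + t)\<^sup>2 / t ^ 3)"
    unfolding norm_mult norm_of_real by (intro mult_mono r) (use xa t0 K in auto)
  have B: "norm (of_real (4 * (x \<bullet> a) * (x \<bullet> b)) * reg2 \<kappa> \<delta> ((norm x)\<^sup>2)) \<le> (4 * t * t) * (K * (1 + t)\<^sup>2 / t ^ 5)"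
    unfolding norm_mult norm_of_real abs_mult by (intro mult_mono r) (use xa t0 K in auto)
  have E: "(4 * t * t) * (K * (1 + t)\<^sup>2 / t ^ 5) = 4 * K * (1 + t)\<^sup>2 / t ^ 3"
    using t0 by (simp add: field_simps eval_nat_numeral)
  have "norm (Greg2 \<kappa> \<delta> a b x) \<le> 2 * (2 * K * (1 + t)\<^sup>2 / t ^ 3) + 4 * K * (1 + t)\<^sup>2 / t ^ 3"
    unfolding Greg2_def using A B[unfolded E] by (rule norm_triangle_mono)
  then show "norm (Greg2 \<kappa> \<delta> a b x) \<le> 8 * (1 + \<bar>\<kappa>\<bar>)\<^sup>2 * (1 + t)\<^sup>2 / t ^ 3"
    by (simp add: K_def mult_ac)
qed

text \<open>A crude bound for the kernel and its first two derivatives on the whole space. It blows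
  up as \<delta> tends to 0 and is used only where \<delta> is fixed: for integrability, Fubini and
  differentiation under the integral.\<close>

definition Cbound :: "real \<Rightarrow> real \<Rightarrow> real" where
  "Cbound \<kappa> \<delta> = 8 * (1 + \<bar>\<kappa>\<bar>)\<^sup>2 * (1 + \<delta>)\<^sup>2 * (1 + 1 / \<delta>) ^ 3"

lemma Greg_Cbound:
  assumes \<delta>: "\<delta> > 0" and ab: "norm a = 1" "norm b = 1"
  shows "norm (Greg \<kappa> \<delta> x) \<le> Cbound \<kappa> \<delta>" "norm (Greg1 \<kappa> \<delta> a x) \<le> Cbound \<kappa> \<delta>"
    "norm (Greg2 \<kappa> \<delta> a b x) \<le> Cbound \<kappa> \<delta>"
proof -
  define K where "K = (1 + \<bar>\<kappa>\<bar>)\<^sup>2"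
  have K: "0 \<le> K" unfolding K_def by simp
  define t where "t = max (norm x) \<delta>"
  have t0: "t > 0" using \<delta> t_def by auto
  define r where "r = 1 + 1 / \<delta>"
  have "1 / t \<le> 1 / \<delta>" using \<delta> t0 unfolding t_def by (intro divide_left_mono) auto
  moreover have "(1 + t) / t = 1 + 1 / t" using t0 by (simp add: field_simps)
  ultimately have r: "1 \<le> r" "1 / t \<le> r" "(1 + t) / t \<le> r"
    using \<delta> t0 unfolding r_def by auto
  define D where "D = (1 + \<delta>)\<^sup>2"
  have D: "1 \<le> D" unfolding D_def using \<delta> by (simp add: one_le_power)
  have r3: "r \<le> r ^ 3" "r\<^sup>2 \<le> r ^ 3"
    using r(1) power_increasing[of 1 3 r] power_increasing[of 2 3 r] by auto
  have r0: "0 \<le> r ^ 3" "0 \<le> (1 + t) / t" using r t0 by auto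
  have KD: "K \<le> K * D" "0 \<le> K * D" using K D by (auto simp: mult_le_cancel_left1)
  note G = Greg_bounds[OF \<delta> t_def ab, of \<kappa>, folded K_def D_def]
  have C: "Cbound \<kappa> \<delta> = 8 * (K * D) * r ^ 3" by (simp add: Cbound_def K_def D_def r_def)
  have "norm (Greg \<kappa> \<delta> x) \<le> 3 * (K * D) * (1 / t)" using G(1) by simp
  also have "\<dots> \<le> 8 * (K * D) * r ^ 3" using r r3 KD t0 K D by (intro mult_mono) auto
  finally show "norm (Greg \<kappa> \<delta> x) \<le> Cbound \<kappa> \<delta>" by (simp add: C)
  have "norm (Greg1 \<kappa> \<delta> a x) \<le> 4 * K * ((1 + t) / t)\<^sup>2" using G(2) by (simp add: power_divide)
  also have "\<dots> \<le> 4 * (K * D) * r\<^sup>2" using r r0 KD K D by (intro mult_mono power_mono) auto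
  also have "\<dots> \<le> 8 * (K * D) * r ^ 3" using r0 r3 KD K D by (intro mult_mono) auto
  finally show "norm (Greg1 \<kappa> \<delta> a x) \<le> Cbound \<kappa> \<delta>" by (simp add: C)
  have "norm (Greg2 \<kappa> \<delta> a b x) \<le> 8 * K * (((1 + t) / t)\<^sup>2 * (1 / t))"
    using G(3) by (simp add: power_divide power2_eq_square power3_eq_cube)
  also have "\<dots> \<le> 8 * (K * D) * (r\<^sup>2 * r)" using r r0 KD K D t0 by (intro mult_mono power_mono) auto
  also have "r\<^sup>2 * r = r ^ 3" by (simp add: power2_eq_square power3_eq_cube)
  finally show "norm (Greg2 \<kappa> \<delta> a b x) \<le> Cbound \<kappa> \<delta>" by (simp add: C)
qed

lemma Greg_eq: "0 < \<delta> \<Longrightarrow> \<delta> \<le> norm x \<Longrightarrow> Greg \<kappa> \<delta> x = radial0 \<kappa> (norm x)"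
  unfolding Greg_def by (subst reg_norm(1)[of \<delta> "norm x"]) auto

text \<open>In contrast to \<open>Cbound\<close>, these bounds do not depend on \<delta>. The weight
  \<open>1 + 1 / (norm x)\<^sup>2\<close>, locally integrable in three dimensions, is a common
  majorant for kernel and first derivatives. The constants come from
  \<open>(1 + \<delta>)\<^sup>2 \<le> 4\<close> and
  \<open>(1 + r)\<^sup>2 \<le> 2 * (1 + r\<^sup>2)\<close>.\<close>

lemma Greg_singular_bound:
  assumes "0 < \<delta>" "\<delta> \<le> 1" "x \<noteq> 0" "norm a = 1"
  shows "norm (Greg \<kappa> \<delta> x) \<le> 12 * (1 + \<bar>\<kappa>\<bar>)\<^sup>2 / norm x"
    and "norm (Greg \<kappa> \<delta> x) \<le> 12 * (1 + \<bar>\<kappa>\<bar>)\<^sup>2 * (1 + 1 / (norm x)\<^sup>2)"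
    and "norm (Greg1 \<kappa> \<delta> a x) \<le> 8 * (1 + \<bar>\<kappa>\<bar>)\<^sup>2 * (1 + 1 / (norm x)\<^sup>2)"
proof -
  define K where "K = (1 + \<bar>\<kappa>\<bar>)\<^sup>2"
  have K: "0 \<le> K" unfolding K_def by simp
  define t where "t = max (norm x) \<delta>"
  have t0: "t > 0" using assms t_def by auto
  have nx: "0 < norm x" "norm x \<le> t" using assms t_def by auto
  note G = Greg_bounds[OF assms(1) t_def assms(4) assms(4), of \<kappa>, folded K_def]
  have "(1 + \<delta>)\<^sup>2 \<le> 2\<^sup>2" using assms by (intro power_mono) auto
  then have "3 * K * (1 + \<delta>)\<^sup>2 / t \<le> 3 * K * 4 / norm x"
    using K t0 nx by (intro frac_le mult_left_mono) auto
  then show 1: "norm (Greg \<kappa> \<delta> x) \<le> 12 * (1 + \<bar>\<kappa>\<bar>)\<^sup>2 / norm x"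
    using G(1) by (simp add: K_def)
  have inv: "2 * r \<le> 1 + r\<^sup>2" for r :: real using zero_le_power2[of "1 - r"] by (simp add: power2_eq_square algebra_simps)
  have "0 \<le> 1 / norm x" by simp
  then have "1 / norm x \<le> 1 + (1 / norm x)\<^sup>2" using inv[of "1 / norm x"] by linarith
  then have "1 / norm x \<le> 1 + 1 / (norm x)\<^sup>2" by (simp add: power_divide)
  then have "12 * K * (1 / norm x) \<le> 12 * K * (1 + 1 / (norm x)\<^sup>2)" using K by (intro mult_left_mono) auto
  then show "norm (Greg \<kappa> \<delta> x) \<le> 12 * (1 + \<bar>\<kappa>\<bar>)\<^sup>2 * (1 + 1 / (norm x)\<^sup>2)" using 1 by (simp add: K_def)
  have "norm (Greg1 \<kappa> \<delta> a x) \<le> 4 * K * ((1 + t) / t)\<^sup>2" using G(2) by (simp add: power_divide)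
  also have "(1 + t) / t = 1 + 1 / t" using t0 by (simp add: field_simps)
  also have "4 * K * (1 + 1 / t)\<^sup>2 \<le> 4 * K * (1 + 1 / norm x)\<^sup>2"
  proof (intro mult_left_mono power_mono add_left_mono)
    show "1 / t \<le> 1 / norm x" by (intro divide_left_mono mult_pos_pos nx t0) simp
    have "0 \<le> 1 / t" using t0 by simp
    then show "0 \<le> 1 + 1 / t" by linarith
  qed (use K in auto)
  also have "\<dots> \<le> 4 * K * (2 * (1 + 1 / (norm x)\<^sup>2))"
    using K inv[of "1 / norm x"] by (intro mult_left_mono) (auto simp: power2_sum power_divide)
  finally show "norm (Greg1 \<kappa> \<delta> a x) \<le> 8 * (1 + \<bar>\<kappa>\<bar>)\<^sup>2 * (1 + 1 / (norm x)\<^sup>2)" by (simp add: K_def algebra_simps)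
qed

lemma Greg_laplacian:
  "(\<Sum>b\<in>Basis. Greg2 \<kappa> \<delta> b b x) = 6 * reg1 \<kappa> \<delta> ((norm x)\<^sup>2) + of_real (4 * (norm x)\<^sup>2) * reg2 \<kappa> \<delta> ((norm x)\<^sup>2)"
proof -
  have n: "(norm x)\<^sup>2 = (\<Sum>b\<in>Basis. (x \<bullet> b) * (x \<bullet> b))"
    by (simp only: power2_norm_eq_inner, subst euclidean_inner) simp
  have "(\<Sum>b\<in>Basis. Greg2 \<kappa> \<delta> b b x) = (\<Sum>b\<in>(Basis::(real^3) set). 2 * reg1 \<kappa> \<delta> ((norm x)\<^sup>2))
     + (\<Sum>b\<in>Basis. 4 * of_real ((x \<bullet> b) * (x \<bullet> b)) * reg2 \<kappa> \<delta> ((norm x)\<^sup>2))"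
    unfolding Greg2_def sum.distrib by (simp add: inner_same_Basis mult.assoc)
  also have "\<dots> = 6 * reg1 \<kappa> \<delta> ((norm x)\<^sup>2) + (\<Sum>b\<in>Basis. 4 * of_real ((x \<bullet> b) * (x \<bullet> b))) * reg2 \<kappa> \<delta> ((norm x)\<^sup>2)"
    by (simp add: sum_distrib_right)
  also have "(\<Sum>b\<in>Basis. 4 * of_real ((x \<bullet> b) * (x \<bullet> b))) = complex_of_real (4 * (norm x)\<^sup>2)"
    unfolding n by (simp add: sum_distrib_left)
  finally show ?thesis .
qed

text \<open>Outside the ball of radius \<open>\<delta>\<close> the kernel solves the Helmholtz equation, which removes the
  non-integrable singularities of its second derivatives.\<close>

lemma Greg_laplacian_bound:
  assumes \<delta>: "0 < \<delta>" "\<delta> \<le> 1" "x \<noteq> 0"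
  shows "norm (\<Sum>b\<in>Basis. Greg2 \<kappa> \<delta> b b x)
    \<le> (1 + \<bar>\<kappa>\<bar>) ^ 4 * (1 + 1 / (norm x)\<^sup>2) + 64 * (1 + \<bar>\<kappa>\<bar>)\<^sup>2 / \<delta> ^ 3 * indicator (cball 0 \<delta>) x"
proof (cases "\<delta> \<le> norm x")
  case True
  define t where "t = norm x"
  have t: "t > 0" "t = max (norm x) \<delta>" using assms True t_def by auto
  let ?e = "exp (\<i> * of_real \<kappa> * of_real t)"
  have L: "(\<Sum>b\<in>Basis. Greg2 \<kappa> \<delta> b b x) = 6 * radial1 \<kappa> t + of_real (4 * t\<^sup>2) * radial2 \<kappa> t"
    using reg_norm(2,3)[OF less_imp_le[OF \<delta>(1)] t(2), of \<kappa>] by (simp add: Greg_laplacian t_def)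
  \<comment> \<open>The Helmholtz equation as an identity of rational functions: the Laplacian of a
    function F of s = |x|^2 is 6 F' + 4 s F'', and everything except -\<kappa>^2 times the Green
    function cancels.\<close>
  have "6 * (E * (c / (8 * p * z ^ 2) - 1 / (8 * p * z ^ 3)))
      + 4 * z\<^sup>2 * (E * (- k\<^sup>2 / (16 * p * z ^ 3) - 3 * c / (16 * p * z ^ 4) + 3 / (16 * p * z ^ 5))) = - (k\<^sup>2 * (E / (4 * p * z)))"
    if "z \<noteq> 0" "p \<noteq> 0" for E c k p z :: complex
    using that by (simp add: field_simps eval_nat_numeral)
  from this[of "of_real t" "of_real pi" ?e "\<i> * of_real \<kappa>" "of_real \<kappa>"] t
  have "6 * radial1 \<kappa> t + of_real (4 * t\<^sup>2) * radial2 \<kappa> t = - (of_real (\<kappa>\<^sup>2) * radial0 \<kappa> t)"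
    by (simp add: radial0_def radial1_def radial2_def mult.assoc)
  then have "norm (\<Sum>b\<in>Basis. Greg2 \<kappa> \<delta> b b x) \<le> \<kappa>\<^sup>2 * ((1 + \<bar>\<kappa>\<bar>)\<^sup>2 / t)"
    unfolding L using norm_radial(1)[OF t(1), of \<kappa>]
    by (simp only: norm_minus_cancel norm_mult norm_of_real abs_power2) (intro mult_left_mono, auto)
  also have "\<dots> \<le> (1 + \<bar>\<kappa>\<bar>)\<^sup>2 * ((1 + \<bar>\<kappa>\<bar>)\<^sup>2 * (1 + 1 / t\<^sup>2))"
  proof (intro mult_mono)
    show "\<kappa>\<^sup>2 \<le> (1 + \<bar>\<kappa>\<bar>)\<^sup>2" using power_mono[of "\<bar>\<kappa>\<bar>" "1 + \<bar>\<kappa>\<bar>" 2] by simp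
    have "2 * (1 / t) \<le> 1 + (1 / t)\<^sup>2" using zero_le_power2[of "1 - 1 / t"] by (simp add: power2_eq_square algebra_simps)
    moreover have "0 \<le> 1 / t" using t by simp
    ultimately have "1 / t \<le> 1 + (1 / t)\<^sup>2" by linarith
    then have "1 / t \<le> 1 + 1 / t\<^sup>2" by (simp add: power_divide)
    then show "(1 + \<bar>\<kappa>\<bar>)\<^sup>2 / t \<le> (1 + \<bar>\<kappa>\<bar>)\<^sup>2 * (1 + 1 / t\<^sup>2)"
      using mult_left_mono[of "1 / t" "1 + 1 / t\<^sup>2" "(1 + \<bar>\<kappa>\<bar>)\<^sup>2"] by simp
  qed (use t in auto)
  also have "\<dots> = (1 + \<bar>\<kappa>\<bar>) ^ 4 * (1 + 1 / (norm x)\<^sup>2)"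
    unfolding t_def mult.assoc[symmetric] power_add[symmetric] by simp
  finally show ?thesis using \<delta> by (simp add: indicator_def add_increasing2)
next
  \<comment> \<open>Inside the ball the Laplacian has size \<delta>^-3, which the volume of the ball
    compensates on integration. The constant 64 is (12 + 4) times 4, by
    \<open>(1 + \<delta>)\<^sup>2 \<le> 4\<close>.\<close>
  case False
  then have t: "\<delta> = max (norm x) \<delta>" and nx: "norm x < \<delta>" by auto
  define K where "K = (1 + \<bar>\<kappa>\<bar>)\<^sup>2"
  have K: "0 \<le> K" unfolding K_def by simp
  note r = reg_bounds[OF \<delta>(1) t, of \<kappa>, folded K_def]
  have d4: "(1 + \<delta>)\<^sup>2 \<le> 4" using power_mono[of "1 + \<delta>" 2 2] \<delta> by simp
  have a: "norm (6 * reg1 \<kappa> \<delta> ((norm x)\<^sup>2)) \<le> 12 * (K * (1 + \<delta>)\<^sup>2 / \<delta> ^ 3)"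
    using r(2) by (simp add: norm_mult)
  have "norm (of_real (4 * (norm x)\<^sup>2) * reg2 \<kappa> \<delta> ((norm x)\<^sup>2)) \<le> (4 * \<delta>\<^sup>2) * (K * (1 + \<delta>)\<^sup>2 / \<delta> ^ 5)"
    unfolding norm_mult norm_of_real
    using nx \<delta> K by (intro mult_mono r) (auto intro!: power_mono)
  also have "\<dots> = 4 * (K * (1 + \<delta>)\<^sup>2 / \<delta> ^ 3)" using \<delta> by (simp add: field_simps eval_nat_numeral)
  finally have "norm (\<Sum>b\<in>Basis. Greg2 \<kappa> \<delta> b b x) \<le> 16 * (K * (1 + \<delta>)\<^sup>2 / \<delta> ^ 3)"
    unfolding Greg_laplacian using a norm_triangle_ineq[of "6 * reg1 \<kappa> \<delta> ((norm x)\<^sup>2)" "of_real (4 * (norm x)\<^sup>2) * reg2 \<kappa> \<delta> ((norm x)\<^sup>2)"] by linarith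
  also have "\<dots> \<le> 16 * (K * 4 / \<delta> ^ 3)"
    using d4 K \<delta> by (intro mult_left_mono divide_right_mono) auto
  also have "\<dots> \<le> (1 + \<bar>\<kappa>\<bar>) ^ 4 * (1 + 1 / (norm x)\<^sup>2) + 64 * (1 + \<bar>\<kappa>\<bar>)\<^sup>2 / \<delta> ^ 3 * indicator (cball 0 \<delta>) x"
    using nx by (simp add: indicator_def K_def)
  finally show ?thesis .
qed

section \<open>Potentials of the regularised kernel\<close>

definition pot :: "real \<Rightarrow> real \<Rightarrow> (real^3 \<Rightarrow> complex) \<Rightarrow> real^3 \<Rightarrow> complex" where
  "pot \<kappa> \<delta> h x = (LINT z|lborel. Greg \<kappa> \<delta> (x - z) * h z)"

definition pot1 :: "real \<Rightarrow> real \<Rightarrow> real^3 \<Rightarrow> (real^3 \<Rightarrow> complex) \<Rightarrow> real^3 \<Rightarrow> complex" where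
  "pot1 \<kappa> \<delta> a h x = (LINT z|lborel. Greg1 \<kappa> \<delta> a (x - z) * h z)"

definition pot2 :: "real \<Rightarrow> real \<Rightarrow> real^3 \<Rightarrow> real^3 \<Rightarrow> (real^3 \<Rightarrow> complex) \<Rightarrow> real^3 \<Rightarrow> complex" where
  "pot2 \<kappa> \<delta> a b h x = (LINT z|lborel. Greg2 \<kappa> \<delta> a b (x - z) * h z)"

lemma Greg_measurable:
  assumes "\<delta> > 0" and [measurable]: "f \<in> borel_measurable M" "g \<in> borel_measurable M"
  shows "(\<lambda>x. Greg (f x) \<delta> (g x)) \<in> borel_measurable M" "(\<lambda>x. Greg1 (f x) \<delta> a (g x)) \<in> borel_measurable M"
    "(\<lambda>x. Greg2 (f x) \<delta> a b (g x)) \<in> borel_measurable M"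
proof -
  have fg: "(\<lambda>x. (f x, g x)) \<in> borel_measurable M" by measurable
  have c: "continuous_on UNIV (\<lambda>p. Greg (fst p) \<delta> (snd p))"
     "continuous_on UNIV (\<lambda>p. Greg1 (fst p) \<delta> a (snd p))"
     "continuous_on UNIV (\<lambda>p. Greg2 (fst p) \<delta> a b (snd p))"
    by (intro continuous_intros assms)+
  show "(\<lambda>x. Greg (f x) \<delta> (g x)) \<in> borel_measurable M" "(\<lambda>x. Greg1 (f x) \<delta> a (g x)) \<in> borel_measurable M"
    "(\<lambda>x. Greg2 (f x) \<delta> a b (g x)) \<in> borel_measurable M"
    using c[THEN borel_measurable_continuous_onI, THEN measurable_compose[OF fg]] by simp_all
qed

lemma pot_integrable:
  assumes \<delta>: "\<delta> > 0" and ab: "norm a = 1" "norm b = 1" and h: "integrable lborel h"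
  shows "integrable lborel (\<lambda>z. Greg \<kappa> \<delta> (x - z) * h z)"
    and "integrable lborel (\<lambda>z. Greg1 \<kappa> \<delta> a (x - z) * h z)"
    and "integrable lborel (\<lambda>z. Greg2 \<kappa> \<delta> a b (x - z) * h z)"
proof -
  have [measurable]: "h \<in> borel_measurable borel" using h by auto
  have i: "integrable lborel (\<lambda>z. Cbound \<kappa> \<delta> * norm (h z))" using h by auto
  note m[measurable] = Greg_measurable[OF \<delta>, of "\<lambda>_. \<kappa>"]
  have b: "integrable lborel (\<lambda>z. k z * h z)"
    if [measurable]: "k \<in> borel_measurable borel" and "\<And>z. norm (k z) \<le> Cbound \<kappa> \<delta>" for k
    by (rule Bochner_Integration.integrable_bound[OF i])
      (use that(2) in \<open>auto simp: norm_mult abs_mult intro!: mult_right_mono order_trans[OF _ abs_ge_self]\<close>)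
  show "integrable lborel (\<lambda>z. Greg \<kappa> \<delta> (x - z) * h z)"
    "integrable lborel (\<lambda>z. Greg1 \<kappa> \<delta> a (x - z) * h z)"
    "integrable lborel (\<lambda>z. Greg2 \<kappa> \<delta> a b (x - z) * h z)"
    by (intro b Greg_Cbound[OF \<delta> ab] m; measurable)+
qed

lemma
  assumes \<delta>: "\<delta> > 0" and ab: "norm a = 1" "norm b = 1" and h: "integrable lborel h"
  shows has_dir_deriv_pot: "has_dir_deriv a (pot \<kappa> \<delta> h) (pot1 \<kappa> \<delta> a h x) x"
    and has_dir_deriv_pot1: "has_dir_deriv b (pot1 \<kappa> \<delta> a h) (pot2 \<kappa> \<delta> a b h x) x"
    and continuous_pot: "continuous_on UNIV (pot \<kappa> \<delta> h)"
    and continuous_pot1: "continuous_on UNIV (pot1 \<kappa> \<delta> a h)"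
    and continuous_pot2: "continuous_on UNIV (pot2 \<kappa> \<delta> a b h)"
proof -
  have i: "integrable lborel (\<lambda>z. Cbound \<kappa> \<delta> * norm (h z))" using h by auto
  note I = pot_integrable[OF \<delta> ab h] and C = Greg_Cbound[OF \<delta> ab]
  have bd: "norm (k * h z) \<le> Cbound \<kappa> \<delta> * norm (h z)" if "norm k \<le> Cbound \<kappa> \<delta>" for k z
    using that by (simp add: norm_mult mult_right_mono)
  have dm: "has_dir_deriv e (\<lambda>x. f (x - z) * h z) (d * h z) x" if "has_dir_deriv e f d (x - z)" for e f d x z
    using has_dir_deriv_mult[OF has_dir_deriv_translate[OF that] has_dir_deriv_const, of "h z"] by simp
  show "has_dir_deriv a (pot \<kappa> \<delta> h) (pot1 \<kappa> \<delta> a h x) x"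
    unfolding pot_def[abs_def] pot1_def
    by (rule has_dir_deriv_integral(2)[OF I(1) dm[OF has_dir_deriv_Greg[OF \<delta>]] bd[OF C(2)] i])
  show "has_dir_deriv b (pot1 \<kappa> \<delta> a h) (pot2 \<kappa> \<delta> a b h x) x"
    unfolding pot1_def[abs_def] pot2_def
    by (rule has_dir_deriv_integral(2)[OF I(2) dm[OF has_dir_deriv_Greg1[OF \<delta>]] bd[OF C(3)] i])
  have c: "continuous_on UNIV (\<lambda>x. Greg \<kappa> \<delta> (x - z) * h z)"
     "continuous_on UNIV (\<lambda>x. Greg1 \<kappa> \<delta> a (x - z) * h z)"
     "continuous_on UNIV (\<lambda>x. Greg2 \<kappa> \<delta> a b (x - z) * h z)" for z
    by (intro continuous_intros \<delta>)+
  show "continuous_on UNIV (pot \<kappa> \<delta> h)"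
    unfolding pot_def[abs_def] continuous_on_eq_continuous_at[OF open_UNIV]
    by (intro ballI isCont_integral[OF borel_measurable_integrable[OF I(1)] _ bd[OF C(1)] i])
      (use c(1) in \<open>simp add: continuous_on_eq_continuous_at\<close>)
  show "continuous_on UNIV (pot1 \<kappa> \<delta> a h)"
    unfolding pot1_def[abs_def] continuous_on_eq_continuous_at[OF open_UNIV]
    by (intro ballI isCont_integral[OF borel_measurable_integrable[OF I(2)] _ bd[OF C(2)] i])
      (use c(2) in \<open>simp add: continuous_on_eq_continuous_at\<close>)
  show "continuous_on UNIV (pot2 \<kappa> \<delta> a b h)"
    unfolding pot2_def[abs_def] continuous_on_eq_continuous_at[OF open_UNIV]
    by (intro ballI isCont_integral[OF borel_measurable_integrable[OF I(3)] _ bd[OF C(3)] i])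
      (use c(3) in \<open>simp add: continuous_on_eq_continuous_at\<close>)
qed

section \<open>Integral bounds for second derivatives of potentials\<close>

definition sing_mass :: "real \<Rightarrow> real" where
  "sing_mass R = (LINT w|lborel. indicator (cball (0::real^3) R) w * (1 + 1 / (norm w)\<^sup>2))"

lemma integrable_sing:
  "integrable lborel (\<lambda>w::real^3. indicator (cball 0 R) w * (1 + 1 / (norm w)\<^sup>2) :: real)"
proof -
  have "integrable lborel (\<lambda>w::real^3. indicator (cball 0 R) w + indicator (cball 0 R) w / (norm w)\<^sup>2 :: real)"
    by (intro Bochner_Integration.integrable_add integrable_indicator_cball integrable_inverse_norm_square)
  then show ?thesis by (simp add: algebra_simps)
qed

lemma sing_mass_nonneg: "0 \<le> sing_mass R"
  unfolding sing_mass_def by (intro Bochner_Integration.integral_nonneg) simp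

lemma AE_reflect_nonzero: "AE z in lborel. x - z \<noteq> (0::'a::euclidean_space)"
  using AE_lborel_singleton[of x] by eventually_elim simp

text \<open>For |x| \<le> 2 R and z in the ball of radius R the argument x - z stays in the ball of
  radius 3 R, where the weight has finite mass independent of x. The term with \<open>D\<close> is
  reserved for the part of the Laplacian concentrated in the small ball.\<close>

lemma convolution_singular_bound:
  fixes k h :: "real^3 \<Rightarrow> complex"
  assumes k: "\<And>w. w \<noteq> 0 \<Longrightarrow> norm (k w) \<le> C * (1 + 1 / (norm w)\<^sup>2) + D * indicator (cball 0 \<delta>) w"
    and CD: "0 \<le> C" "0 \<le> D" and h: "\<And>z. norm (h z) \<le> 1" "\<And>z. norm z > R \<Longrightarrow> h z = 0"
    and x: "norm x \<le> 2 * R"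
  shows "norm (LINT z|lborel. k (x - z) * h z) \<le> C * sing_mass (3 * R) + D * measure lborel (cball (0::real^3) \<delta>)"
proof (cases "integrable lborel (\<lambda>z. k (x - z) * h z)")
  case True
  let ?g = "\<lambda>w::real^3. C * (indicator (cball 0 (3 * R)) w * (1 + 1 / (norm w)\<^sup>2)) + D * indicator (cball 0 \<delta>) w :: real"
  have i: "integrable lborel ?g"
    by (intro Bochner_Integration.integrable_add integrable_mult_right integrable_sing integrable_indicator_cball)
  have "norm (LINT z|lborel. k (x - z) * h z) \<le> (LINT z|lborel. norm (k (x - z) * h z))"
    by (rule integral_norm_bound)
  also have "\<dots> \<le> (LINT z|lborel. ?g (x - z))"
  proof (rule integral_mono_AE)
    show "integrable lborel (\<lambda>z. ?g (x - z))" using i by (subst lborel_integrable_reflect)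
    show "AE z in lborel. norm (k (x - z) * h z) \<le> ?g (x - z)"
      using AE_reflect_nonzero[of x]
    proof eventually_elim
      case (elim z)
      show ?case
      proof (cases "norm z \<le> R")
        case True
        then have "norm (x - z) \<le> 3 * R" using x norm_triangle_ineq4[of x z] by linarith
        moreover have "norm (k (x - z) * h z) \<le> norm (k (x - z)) * 1"
          unfolding norm_mult by (intro mult_left_mono h) simp
        ultimately show ?thesis using k[OF elim] by simp
      next
        case False
        then show ?thesis using h(2) CD by simp
      qed
    qed
  qed (use True in auto)
  also have "\<dots> = C * sing_mass (3 * R) + D * measure lborel (cball (0::real^3) \<delta>)"
    unfolding lborel_integral_reflect[of ?g] sing_mass_def
    using integrable_sing[of "3 * R"] integrable_indicator_cball[of "0::real^3" \<delta>] by simp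
  finally show ?thesis .
next
  \<comment> \<open>A divergent integral is 0 by convention, so the bound still holds.\<close>
  case False
  then show ?thesis using CD sing_mass_nonneg by (simp add: not_integrable_integral_eq)
qed

text \<open>The cube is the lowest power of the positive part that is \<open>C^2\<close>, and two
  derivatives are what the integral identity for the Hessian uses. A polynomial cutoff has explicit
  derivatives.\<close>

definition cut0 :: "real \<Rightarrow> real \<Rightarrow> complex" where "cut0 c s = of_real ((max 0 (c - s)) ^ 3)"
definition cut1 :: "real \<Rightarrow> real \<Rightarrow> complex" where "cut1 c s = of_real (- 3 * (max 0 (c - s))\<^sup>2)"
definition cut2 :: "real \<Rightarrow> real \<Rightarrow> complex" where "cut2 c s = of_real (6 * max 0 (c - s))"

lemma has_vector_derivative_cut0: "(cut0 c has_vector_derivative cut1 c s) (at s)"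
proof -
  have "((\<lambda>s. if s \<le> c then complex_of_real ((c - s) ^ 3) else 0) has_vector_derivative
      (if s \<le> c then of_real (- 3 * (c - s)\<^sup>2) else 0)) (at s)"
  proof (rule has_vector_derivative_glue)
    fix s
    have "((\<lambda>z. (of_real c - z) ^ 3) has_field_derivative of_real (- 3 * (c - s)\<^sup>2)) (at (complex_of_real s))"
      by (auto intro!: derivative_eq_intros)
    from has_vector_derivative_real_field[OF this]
    show "((\<lambda>s. complex_of_real ((c - s) ^ 3)) has_vector_derivative of_real (- 3 * (c - s)\<^sup>2)) (at s)" by simp
  qed auto
  moreover have "cut0 c = (\<lambda>s. if s \<le> c then complex_of_real ((c - s) ^ 3) else 0)"
    "cut1 c s = (if s \<le> c then of_real (- 3 * (c - s)\<^sup>2) else 0)"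
    by (auto simp: cut0_def cut1_def max_def)
  ultimately show ?thesis by (simp only:)
qed

lemma has_vector_derivative_cut1: "(cut1 c has_vector_derivative cut2 c s) (at s)"
proof -
  have "((\<lambda>s. if s \<le> c then complex_of_real (- 3 * (c - s)\<^sup>2) else 0) has_vector_derivative
      (if s \<le> c then of_real (6 * (c - s)) else 0)) (at s)"
  proof (rule has_vector_derivative_glue)
    fix s
    have "((\<lambda>z. - 3 * (of_real c - z)\<^sup>2) has_field_derivative of_real (6 * (c - s))) (at (complex_of_real s))"
      by (auto intro!: derivative_eq_intros)
    from has_vector_derivative_real_field[OF this]
    show "((\<lambda>s. complex_of_real (- 3 * (c - s)\<^sup>2)) has_vector_derivative of_real (6 * (c - s))) (at s)" by simp
  qed auto
  moreover have "cut1 c = (\<lambda>s. if s \<le> c then complex_of_real (- 3 * (c - s)\<^sup>2) else 0)"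
    "cut2 c s = (if s \<le> c then of_real (6 * (c - s)) else 0)"
    by (auto simp: cut1_def cut2_def max_def)
  ultimately show ?thesis by (simp only:)
qed

definition bump :: "real \<Rightarrow> real^3 \<Rightarrow> complex" where "bump c x = cut0 c ((norm x)\<^sup>2)"
definition bump1 :: "real \<Rightarrow> real^3 \<Rightarrow> real^3 \<Rightarrow> complex" where
  "bump1 c a x = of_real (2 * (x \<bullet> a)) * cut1 c ((norm x)\<^sup>2)"
definition bump2 :: "real \<Rightarrow> real^3 \<Rightarrow> real^3 \<Rightarrow> real^3 \<Rightarrow> complex" where
  "bump2 c a b x = of_real (2 * (a \<bullet> b)) * cut1 c ((norm x)\<^sup>2) + of_real (4 * (x \<bullet> a) * (x \<bullet> b)) * cut2 c ((norm x)\<^sup>2)"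

lemma has_dir_deriv_bump: "has_dir_deriv a (bump c) (bump1 c a x) x"
  unfolding bump_def[abs_def] bump1_def by (intro has_dir_deriv_radial has_vector_derivative_cut0)

lemma has_dir_deriv_bump1: "has_dir_deriv b (bump1 c a) (bump2 c a b x) x"
proof -
  have "has_dir_deriv b (\<lambda>x. 2 * (of_real (x \<bullet> a) * cut1 c ((norm x)\<^sup>2)))
    (2 * (of_real (x \<bullet> a) * (of_real (2 * (x \<bullet> b)) * cut2 c ((norm x)\<^sup>2)) + of_real (a \<bullet> b) * cut1 c ((norm x)\<^sup>2))) x"
    by (intro has_dir_deriv_cmult has_dir_deriv_mult has_dir_deriv_inner has_dir_deriv_radial has_vector_derivative_cut1)
  then show ?thesis
    unfolding bump1_def[abs_def] bump2_def by (simp add: algebra_simps)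
qed

lemma continuous_on_bump:
  "continuous_on A (bump c)" "continuous_on A (bump1 c a)" "continuous_on A (bump2 c a b)"
  unfolding bump_def[abs_def] bump1_def[abs_def] bump2_def[abs_def] cut0_def cut1_def cut2_def
  by (intro continuous_intros)+

lemma bump_support:
  assumes "\<rho> \<ge> 0" "norm x > \<rho>"
  shows "bump (\<rho>\<^sup>2) x = 0" "bump1 (\<rho>\<^sup>2) a x = 0" "bump2 (\<rho>\<^sup>2) a b x = 0"
proof -
  have "\<rho>\<^sup>2 \<le> (norm x)\<^sup>2" using assms by (intro power_mono) auto
  then show "bump (\<rho>\<^sup>2) x = 0" "bump1 (\<rho>\<^sup>2) a x = 0" "bump2 (\<rho>\<^sup>2) a b x = 0"
    by (simp_all add: bump_def bump1_def bump2_def cut0_def cut1_def cut2_def max_def)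
qed

lemma bounded_of_continuous_support:
  fixes v :: "'a::euclidean_space \<Rightarrow> 'b::real_normed_vector"
  assumes cont: "continuous_on UNIV v" and supp: "\<And>x. norm x > R \<Longrightarrow> v x = 0"
  obtains B where "0 \<le> B" "\<And>x. norm (v x) \<le> B"
proof -
  have "bounded (v ` cball 0 R)"
    by (intro compact_imp_bounded compact_continuous_image continuous_on_subset[OF cont]) auto
  then obtain B where "\<forall>y\<in>v ` cball 0 R. norm y \<le> B"
    unfolding bounded_iff by blast
  then have B: "norm (v x) \<le> B" if "norm x \<le> R" for x
    using that by simp
  show thesis
  proof
    show "norm (v x) \<le> max B 0" for x
      using B[of x] supp[of x] by (cases "norm x \<le> R") auto
  qed simp
qed

text \<open>Summing \<open>integral_mixed_second_derivative\<close> over all pairs of directions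
  shows that the squared Hessian and the squared Laplacian have the same integral; a single entry
  contributes at most the whole sum.\<close>

lemma integral_hessian_eq_laplacian:
  fixes v :: "real^3 \<Rightarrow> complex"
  assumes v1: "\<And>a x. a \<in> Basis \<Longrightarrow> has_dir_deriv a v (v1 a x) x"
    and v2: "\<And>a b x. a \<in> Basis \<Longrightarrow> b \<in> Basis \<Longrightarrow> has_dir_deriv b (v1 a) (v2 a b x) x"
    and cont: "continuous_on UNIV v" "\<And>a b. a \<in> Basis \<Longrightarrow> b \<in> Basis \<Longrightarrow> continuous_on UNIV (v2 a b)"
    and supp: "\<And>x. norm x > R \<Longrightarrow> v x = 0" "\<And>a b x. norm x > R \<Longrightarrow> v2 a b x = 0"
    and ab: "a \<in> Basis" "b \<in> Basis"
  shows "integrable lborel (\<lambda>x. (norm (v2 a b x))\<^sup>2)"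
    and "(LINT x|lborel. (norm (v2 a b x))\<^sup>2) \<le> (LINT x|lborel. (norm (\<Sum>a\<in>Basis. v2 a a x))\<^sup>2)"
proof -
  have meas: "v2 a b \<in> borel_measurable borel" if "a \<in> Basis" "b \<in> Basis" for a b
    using cont(2)[OF that] by (rule borel_measurable_continuous_onI)
  have "\<exists>B. \<forall>x. norm (v2 a b x) \<le> B" if "a \<in> Basis" "b \<in> Basis" for a b
    using bounded_of_continuous_support[OF cont(2)[OF that] supp(2)] by metis
  then obtain B where B: "\<And>a b x. a \<in> Basis \<Longrightarrow> b \<in> Basis \<Longrightarrow> norm (v2 a b x) \<le> B a b" by metis
  have int: "integrable lborel (\<lambda>x. v2 a b x * cnj (v2 c d x))"
    if "a \<in> Basis" "b \<in> Basis" "c \<in> Basis" "d \<in> Basis" for a b c d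
  proof (rule integrable_bounded_support[where B="B a b * B c d" and R=R])
    have "0 \<le> B a b" using order_trans[OF norm_ge_zero B[OF that(1,2)]] .
    then show "norm (v2 a b x * cnj (v2 c d x)) \<le> B a b * B c d" for x
      unfolding norm_mult complex_mod_cnj by (intro mult_mono B that) auto
  qed (use meas that supp in auto)
  have sq: "z * cnj z = of_real ((norm z)\<^sup>2)" for z by (simp only: complex_norm_square)
  have int2: "integrable lborel (\<lambda>x. (norm (v2 a b x))\<^sup>2)" if "a \<in> Basis" "b \<in> Basis" for a b
    using int[OF that that] unfolding sq by (simp only: complex_of_real_integrable_eq)
  then show "integrable lborel (\<lambda>x. (norm (v2 a b x))\<^sup>2)" using ab .
  have eq: "complex_of_real (LINT x|lborel. (norm (v2 a b x))\<^sup>2) = (LINT x|lborel. v2 a a x * cnj (v2 b b x))"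
    if a: "a \<in> Basis" and b: "b \<in> Basis" for a b
  proof -
    define C where "C = max (B a a) (max (B a b) (B b b))"
    have C: "norm (v2 a a x) \<le> C" "norm (v2 a b x) \<le> C" "norm (v2 b b x) \<le> C" for x
      using B[OF a a, of x] B[OF a b, of x] B[OF b b, of x] unfolding C_def by auto
    have "(LINT x|lborel. v2 a b x * cnj (v2 a b x)) = (LINT x|lborel. v2 a a x * cnj (v2 b b x))"
      by (rule integral_mixed_second_derivative[OF v1[OF a] v1[OF b] v2[OF a a] v2[OF a b] v2[OF b b]
            cont(1) cont(2)[OF a a] cont(2)[OF a b] cont(2)[OF b b] supp(1) C])
    then show ?thesis unfolding sq by (simp only: integral_complex_of_real)
  qed
  have "complex_of_real (\<Sum>a\<in>Basis. \<Sum>b\<in>Basis. LINT x|lborel. (norm (v2 a b x))\<^sup>2)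
      = (\<Sum>a\<in>Basis. \<Sum>b\<in>Basis. LINT x|lborel. v2 a a x * cnj (v2 b b x))"
    unfolding of_real_sum by (intro sum.cong refl eq)
  also have "\<dots> = (LINT x|lborel. (\<Sum>a\<in>Basis. \<Sum>b\<in>Basis. v2 a a x * cnj (v2 b b x)))"
    by (simp add: int Bochner_Integration.integral_sum)
  also have "\<dots> = (LINT x|lborel. complex_of_real ((norm (\<Sum>a\<in>Basis. v2 a a x))\<^sup>2))"
    unfolding sq[symmetric] cnj_sum sum_product ..
  also have "\<dots> = complex_of_real (LINT x|lborel. (norm (\<Sum>a\<in>Basis. v2 a a x))\<^sup>2)" by (simp only: integral_complex_of_real)
  finally have total: "(\<Sum>a\<in>Basis. \<Sum>b\<in>Basis. LINT x|lborel. (norm (v2 a b x))\<^sup>2)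
     = (LINT x|lborel. (norm (\<Sum>a\<in>Basis. v2 a a x))\<^sup>2)" by (simp only: of_real_eq_iff)
  have "(LINT x|lborel. (norm (v2 a b x))\<^sup>2) \<le> (\<Sum>b\<in>Basis. LINT x|lborel. (norm (v2 a b x))\<^sup>2)"
    by (rule member_le_sum) (use ab in auto)
  also have "\<dots> \<le> (\<Sum>a\<in>Basis. \<Sum>b\<in>Basis. LINT x|lborel. (norm (v2 a b x))\<^sup>2)"
    by (rule member_le_sum[where f="\<lambda>a. \<Sum>b\<in>Basis. LINT x|lborel. (norm (v2 a b x))\<^sup>2"])
      (use ab in \<open>auto intro!: sum_nonneg\<close>)
  finally show "(LINT x|lborel. (norm (v2 a b x))\<^sup>2) \<le> (LINT x|lborel. (norm (\<Sum>a\<in>Basis. v2 a a x))\<^sup>2)"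
    unfolding total .
qed

text \<open>The quantity bounded here is uniform in the regularisation parameter. It replaces the
  Calderon-Zygmund estimate for the strongly singular Green tensor.\<close>

lemma pot2_L1_bound:
  assumes R: "R > 0"
  obtains C where "0 \<le> C" "\<And>\<kappa> \<delta> h a b. \<lbrakk>0 < \<delta>; \<delta> \<le> 1; h \<in> borel_measurable borel; \<And>z. norm (h z) \<le> 1;
      \<And>z. norm z > R \<Longrightarrow> h z = 0; a \<in> Basis; b \<in> Basis\<rbrakk> \<Longrightarrow>
      (\<integral>\<^sup>+x. indicator (cball 0 R) x * ennreal (norm (pot2 \<kappa> \<delta> a b h x)) \<partial>lborel) \<le> ennreal (C * (1 + \<bar>\<kappa>\<bar>) ^ 8)"
proof -
  \<comment> \<open>The cutoff lives on a ball twice as large, so that on the ball of radius R it is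
    at least \<open>(4 * R\<^sup>2 - R\<^sup>2) ^ 3\<close>, the constant \<open>c0\<close>.\<close>
  define \<rho> where "\<rho> = 2 * R"
  have \<rho>: "0 \<le> \<rho>" using R by (simp add: \<rho>_def)
  define c where "c = \<rho>\<^sup>2"
  define c0 where "c0 = (3 * R\<^sup>2) ^ 3"
  have c0: "0 < c0" using R by (simp add: c0_def)
  have zeta_lb: "c0 \<le> norm (bump c x)" if "norm x \<le> R" for x
  proof -
    have "(norm x)\<^sup>2 \<le> R\<^sup>2" using that by (intro power_mono) auto
    then have "3 * R\<^sup>2 \<le> c - (norm x)\<^sup>2" by (simp add: c_def \<rho>_def power_mult_distrib)
    then have "(3 * R\<^sup>2) ^ 3 \<le> (max 0 (c - (norm x)\<^sup>2)) ^ 3" by (intro power_mono) auto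
    then show ?thesis unfolding bump_def cut0_def c0_def norm_of_real by linarith
  qed
  note supp = bump_support[OF \<rho>, folded c_def]
  obtain Z0 where Z0: "0 \<le> Z0" "\<And>x. norm (bump c x) \<le> Z0"
    using bounded_of_continuous_support[OF continuous_on_bump(1) supp(1)] by metis
  have "\<exists>B. \<forall>x. norm (bump1 c a x) \<le> B" for a
    using bounded_of_continuous_support[OF continuous_on_bump(2) supp(2)] by metis
  then obtain Z1 where Z1: "\<And>a x. norm (bump1 c a x) \<le> Z1 a" by metis
  have "\<exists>B. \<forall>x. norm (bump2 c a b x) \<le> B" for a b
    using bounded_of_continuous_support[OF continuous_on_bump(3) supp(3)] by metis
  then obtain Z2 where Z2: "\<And>a b x. norm (bump2 c a b x) \<le> Z2 a b" by metis
  have Z1n: "0 \<le> Z1 a" for a using order_trans[OF norm_ge_zero Z1] .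
  have Z2n: "0 \<le> Z2 a b" for a b using order_trans[OF norm_ge_zero Z2] .
  define Z where "Z = Z0 + (\<Sum>a\<in>Basis. Z1 a) + (\<Sum>a\<in>Basis. \<Sum>b\<in>Basis. Z2 a b)"
  have sn: "0 \<le> (\<Sum>a\<in>Basis. Z1 a)" "0 \<le> (\<Sum>a\<in>(Basis::(real^3) set). \<Sum>b\<in>Basis. Z2 a b)"
    by (intro sum_nonneg Z1n Z2n)+
  have Z: "0 \<le> Z" "\<And>x. norm (bump c x) \<le> Z" "\<And>a x. a \<in> Basis \<Longrightarrow> norm (bump1 c a x) \<le> Z"
    "\<And>a b x. a \<in> Basis \<Longrightarrow> b \<in> Basis \<Longrightarrow> norm (bump2 c a b x) \<le> Z"
  proof -
    show "0 \<le> Z" using Z0 sn unfolding Z_def by linarith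
    show "norm (bump c x) \<le> Z" for x using Z0(2)[of x] sn unfolding Z_def by linarith
    show "norm (bump1 c a x) \<le> Z" if "a \<in> Basis" for a x
      using Z1[of a x] member_le_sum[OF that, of Z1] Z1n Z0 sn unfolding Z_def by fastforce
    show "norm (bump2 c a b x) \<le> Z" if "a \<in> Basis" "b \<in> Basis" for a b x
    proof -
      have "Z2 a b \<le> (\<Sum>b\<in>Basis. Z2 a b)" using that Z2n by (intro member_le_sum) auto
      also have "\<dots> \<le> (\<Sum>a\<in>Basis. \<Sum>b\<in>Basis. Z2 a b)"
        using that Z2n by (intro member_le_sum[where f="\<lambda>a. \<Sum>b\<in>Basis. Z2 a b"] sum_nonneg) auto
      finally show ?thesis using Z2[of a b x] Z0 sn unfolding Z_def by linarith
    qed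
  qed
  define J where "J = sing_mass (3 * R)"
  have J: "0 \<le> J" unfolding J_def by (rule sing_mass_nonneg)
  define V where "V = measure lborel (cball (0::real^3) 1)"
  have V: "0 \<le> V" by (simp add: V_def)
  \<comment> \<open>A common constant for the potential (12 J), its first derivatives (8 J) and its
    Laplacian (J and 64 V).\<close>
  define A where "A = 12 * J + 64 * V"
  have A: "0 \<le> A" using J V by (simp add: A_def)
  define W where "W = measure lborel (cball (0::real^3) \<rho>)"
  have W: "0 \<le> W" by (simp add: W_def)
  define C where "C = (W * (1 + 3 * Z * A) + (10 * Z * A)\<^sup>2 * W) / c0"
  have C: "0 \<le> C" using W Z A c0 by (simp add: C_def)
  show thesis
  proof (rule that[OF C])
    fix \<kappa> \<delta> :: real and h :: "real^3 \<Rightarrow> complex" and a b :: "real^3"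
    assume \<delta>: "0 < \<delta>" "\<delta> \<le> 1" and hm[measurable]: "h \<in> borel_measurable borel" and h: "\<And>z. norm (h z) \<le> 1"
      "\<And>z. norm z > R \<Longrightarrow> h z = 0" and ab: "a \<in> Basis" "b \<in> Basis"
    have hi: "integrable lborel h"
      by (rule integrable_bounded_support[OF hm h])
    \<comment> \<open>The kernel contributes the power 2 and the Laplacian the power 4, both bounded
      by \<open>K\<close>. The L^2 estimate squares it, which gives the exponent 8.\<close>
    define K where "K = (1 + \<bar>\<kappa>\<bar>) ^ 4"
    have K: "1 \<le> K" "(1 + \<bar>\<kappa>\<bar>)\<^sup>2 \<le> K" "0 \<le> K"
      unfolding K_def by (auto intro!: one_le_power power_increasing)
    have AK: "A * K = 12 * (K * J) + 64 * (K * V)" by (simp add: A_def algebra_simps)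
    have JK: "0 \<le> K * J" "0 \<le> K * V" by (intro mult_nonneg_nonneg K J V)+
    have u0: "norm (pot \<kappa> \<delta> h x) \<le> A * K" if "norm x \<le> \<rho>" for x
    proof -
      obtain e :: "real^3" where e: "norm e = 1" using ab(1) norm_Basis by blast
      have "norm (pot \<kappa> \<delta> h x) \<le> (12 * (1 + \<bar>\<kappa>\<bar>)\<^sup>2) * J + 0 * measure lborel (cball (0::real^3) \<delta>)"
        unfolding pot_def J_def
        by (rule convolution_singular_bound) (use Greg_singular_bound(2)[OF \<delta> _ e] h that in \<open>auto simp: \<rho>_def\<close>)
      also have "\<dots> \<le> (12 * K) * J" using K J by (simp add: mult_right_mono)
      also have "\<dots> \<le> A * K" unfolding AK using JK by linarith
      finally show ?thesis .
    qed
    have u1: "norm (pot1 \<kappa> \<delta> e h x) \<le> A * K" if "norm x \<le> \<rho>" "e \<in> Basis" for x e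
    proof -
      have "norm (pot1 \<kappa> \<delta> e h x) \<le> (8 * (1 + \<bar>\<kappa>\<bar>)\<^sup>2) * J + 0 * measure lborel (cball (0::real^3) \<delta>)"
        unfolding pot1_def J_def
        by (rule convolution_singular_bound)
          (use Greg_singular_bound(3)[OF \<delta> _ norm_Basis[OF that(2)]] h that in \<open>auto simp: \<rho>_def\<close>)
      also have "\<dots> \<le> (8 * K) * J" using K J by (simp add: mult_right_mono)
      also have "\<dots> \<le> A * K" unfolding AK using JK by linarith
      finally show ?thesis .
    qed
    have lap: "norm (\<Sum>e\<in>Basis. pot2 \<kappa> \<delta> e e h x) \<le> A * K" if "norm x \<le> \<rho>" for x
    proof -
      have "(\<Sum>e\<in>Basis. pot2 \<kappa> \<delta> e e h x) = (LINT z|lborel. (\<Sum>e\<in>Basis. Greg2 \<kappa> \<delta> e e (x - z)) * h z)"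
        unfolding pot2_def sum_distrib_right
        by (rule Bochner_Integration.integral_sum[symmetric]) (intro pot_integrable(3) \<delta> norm_Basis hi)
      moreover have "norm \<dots> \<le> K * J + (64 * (1 + \<bar>\<kappa>\<bar>)\<^sup>2 / \<delta> ^ 3) * measure lborel (cball (0::real^3) \<delta>)"
        unfolding K_def J_def
        by (rule convolution_singular_bound) (use Greg_laplacian_bound[OF \<delta>] h that \<delta> in \<open>auto simp: \<rho>_def\<close>)
      \<comment> \<open>The volume of the small ball cancels the factor \<delta>^-3; this is what
        makes the estimate uniform in \<delta>.\<close>
      moreover have "measure lborel (cball (0::real^3) \<delta>) = V * \<delta> ^ 3"
        unfolding V_def using \<delta> by (simp add: content_cball)
      ultimately have "norm (\<Sum>e\<in>Basis. pot2 \<kappa> \<delta> e e h x) \<le> K * J + 64 * (1 + \<bar>\<kappa>\<bar>)\<^sup>2 * V"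
        using \<delta> by simp
      also have "\<dots> \<le> K * J + 64 * K * V" using K V by (intro add_left_mono mult_right_mono) auto
      also have "\<dots> \<le> A * K" unfolding AK using JK by linarith
      finally show ?thesis .
    qed
    define v where "v x = bump c x * pot \<kappa> \<delta> h x" for x
    define v1 where "v1 a x = bump c x * pot1 \<kappa> \<delta> a h x + bump1 c a x * pot \<kappa> \<delta> h x" for a x
    define v2 where "v2 a b x = (bump c x * pot2 \<kappa> \<delta> a b h x + bump1 c b x * pot1 \<kappa> \<delta> a h x)
       + (bump1 c a x * pot1 \<kappa> \<delta> b h x + bump2 c a b x * pot \<kappa> \<delta> h x)" for a b x
    have nb: "norm e = 1" if "e \<in> Basis" for e :: "real^3" using that by simp
    have d1: "has_dir_deriv a v (v1 a x) x" if "a \<in> Basis" for a x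
      unfolding v_def[abs_def] v1_def
      by (intro has_dir_deriv_mult has_dir_deriv_bump has_dir_deriv_pot[OF \<delta>(1) nb[OF that] nb[OF that] hi])
    have d2: "has_dir_deriv b (v1 a) (v2 a b x) x" if "a \<in> Basis" "b \<in> Basis" for a b x
      unfolding v1_def[abs_def] v2_def
      by (intro has_dir_deriv_add has_dir_deriv_mult has_dir_deriv_bump has_dir_deriv_bump1
          has_dir_deriv_pot[OF \<delta>(1) nb[OF that(1)] nb[OF that(1)] hi] has_dir_deriv_pot[OF \<delta>(1) nb[OF that(2)] nb[OF that(2)] hi]
          has_dir_deriv_pot1[OF \<delta>(1) nb[OF that(1)] nb[OF that(2)] hi])
    have cont: "continuous_on UNIV v"
      unfolding v_def[abs_def]
      by (intro continuous_intros continuous_on_bump continuous_pot[OF \<delta>(1) nb[OF ab(1)] nb[OF ab(1)] hi])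
    have cont2: "continuous_on UNIV (v2 a b)" if "a \<in> Basis" "b \<in> Basis" for a b
      unfolding v2_def[abs_def]
      by (intro continuous_intros continuous_on_bump continuous_pot[OF \<delta>(1) nb[OF ab(1)] nb[OF ab(1)] hi]
          continuous_pot1[OF \<delta>(1) nb[OF that(1)] nb[OF that(1)] hi] continuous_pot1[OF \<delta>(1) nb[OF that(2)] nb[OF that(2)] hi]
          continuous_pot2[OF \<delta>(1) nb[OF that(1)] nb[OF that(2)] hi])
    have vsupp: "v x = 0" "v2 a b x = 0" if "norm x > \<rho>" for x a b
      unfolding v_def v2_def supp[OF that] by auto
    note L2 = integral_hessian_eq_laplacian[OF d1 d2 cont cont2 vsupp ab]
    \<comment> \<open>The number 10 is 1 for the Laplacian of the potential plus 3 terms with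
      derivatives of the cutoff in each of 3 directions.\<close>
    have S: "norm (\<Sum>e\<in>Basis. v2 e e x) \<le> 10 * Z * A * K" if x: "norm x \<le> \<rho>" for x
    proof -
      have AK: "0 \<le> A * K" using A K by simp
      have "(\<Sum>e\<in>Basis. v2 e e x) = bump c x * (\<Sum>e\<in>Basis. pot2 \<kappa> \<delta> e e h x)
          + (\<Sum>e\<in>Basis. 2 * (bump1 c e x * pot1 \<kappa> \<delta> e h x) + bump2 c e e x * pot \<kappa> \<delta> h x)"
        unfolding v2_def sum_distrib_left sum.distrib[symmetric] by (intro sum.cong refl) simp
      also have "norm \<dots> \<le> Z * (A * K) + (\<Sum>e\<in>(Basis::(real^3) set). 3 * (Z * (A * K)))"
      proof (rule norm_triangle_mono)
        show "norm (bump c x * (\<Sum>e\<in>Basis. pot2 \<kappa> \<delta> e e h x)) \<le> Z * (A * K)"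
          unfolding norm_mult by (intro mult_mono Z lap x) simp
        show "norm (\<Sum>e\<in>Basis. 2 * (bump1 c e x * pot1 \<kappa> \<delta> e h x) + bump2 c e e x * pot \<kappa> \<delta> h x) \<le> (\<Sum>e\<in>(Basis::(real^3) set). 3 * (Z * (A * K)))"
        proof (rule sum_norm_le)
          fix e :: "real^3" assume e: "e \<in> Basis"
          have "norm (2 * (bump1 c e x * pot1 \<kappa> \<delta> e h x)) \<le> 2 * (Z * (A * K))"
            unfolding norm_mult by (intro mult_mono Z u1 x e) (use Z in auto)
          moreover have "norm (bump2 c e e x * pot \<kappa> \<delta> h x) \<le> Z * (A * K)"
            unfolding norm_mult by (intro mult_mono Z u0 x e) simp
          ultimately show "norm (2 * (bump1 c e x * pot1 \<kappa> \<delta> e h x) + bump2 c e e x * pot \<kappa> \<delta> h x) \<le> 3 * (Z * (A * K))"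
            using norm_triangle_ineq[of "2 * (bump1 c e x * pot1 \<kappa> \<delta> e h x)" "bump2 c e e x * pot \<kappa> \<delta> h x"] by linarith
        qed
      qed
      finally show ?thesis by (simp add: mult_ac)
    qed
    have "(LINT x|lborel. (norm (v2 a b x))\<^sup>2) \<le> (LINT x|lborel. (norm (\<Sum>e\<in>Basis. v2 e e x))\<^sup>2)" by (rule L2(2))
    also have "\<dots> \<le> (LINT x|lborel. (10 * Z * A * K)\<^sup>2 * indicator (cball (0::real^3) \<rho>) x)"
    proof (rule integral_mono')
      show "integrable lborel (\<lambda>x. (10 * Z * A * K)\<^sup>2 * indicator (cball (0::real^3) \<rho>) x :: real)"
        by (intro integrable_mult_right integrable_indicator_cball)
      show "(norm (\<Sum>e\<in>Basis. v2 e e x))\<^sup>2 \<le> (10 * Z * A * K)\<^sup>2 * indicator (cball (0::real^3) \<rho>) x" for x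
        using S[of x] vsupp(2)[of x] by (cases "norm x \<le> \<rho>") (auto intro!: power_mono)
    qed simp
    also have "\<dots> = (10 * Z * A)\<^sup>2 * W * K\<^sup>2" by (simp add: W_def power_mult_distrib)
    finally have L2v: "(LINT x|lborel. (norm (v2 a b x))\<^sup>2) \<le> (10 * Z * A)\<^sup>2 * W * K\<^sup>2" .
    have pw: "indicator (cball 0 R) x * norm (pot2 \<kappa> \<delta> a b h x)
        \<le> (1 / c0) * (((1 + 3 * Z * A) * K) * indicator (cball 0 \<rho>) x + (norm (v2 a b x))\<^sup>2)" for x
    proof (cases "norm x \<le> R")
      case True
      then have x: "norm x \<le> \<rho>" using R by (simp add: \<rho>_def)
      have "bump c x * pot2 \<kappa> \<delta> a b h x = v2 a b x - (bump1 c b x * pot1 \<kappa> \<delta> a h x + bump1 c a x * pot1 \<kappa> \<delta> b h x + bump2 c a b x * pot \<kappa> \<delta> h x)"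
        by (simp add: v2_def)
      also have "norm \<dots> \<le> norm (v2 a b x) + (Z * (A * K) + Z * (A * K) + Z * (A * K))"
      proof (intro order_trans[OF norm_triangle_ineq4] add_left_mono norm_triangle_mono)
        show "norm (bump1 c b x * pot1 \<kappa> \<delta> a h x) \<le> Z * (A * K)"
          "norm (bump1 c a x * pot1 \<kappa> \<delta> b h x) \<le> Z * (A * K)"
          unfolding norm_mult by (intro mult_mono Z u1 x ab; simp)+
        show "norm (bump2 c a b x * pot \<kappa> \<delta> h x) \<le> Z * (A * K)"
          unfolding norm_mult by (intro mult_mono Z u0 x ab) simp
      qed
      finally have "c0 * norm (pot2 \<kappa> \<delta> a b h x) \<le> norm (v2 a b x) + 3 * Z * A * K"
        using mult_right_mono[OF zeta_lb[OF True] norm_ge_zero[of "pot2 \<kappa> \<delta> a b h x"]] unfolding norm_mult by linarith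
      \<comment> \<open>The passage from L^2 to L^1: t \<le> 1 + t^2 on a ball of finite
        measure.\<close>
      moreover have "norm (v2 a b x) \<le> 1 + (norm (v2 a b x))\<^sup>2"
        using zero_le_power2[of "1 - norm (v2 a b x)"] norm_ge_zero[of "v2 a b x"] unfolding power2_diff by (simp del: norm_ge_zero) 
      ultimately have "c0 * norm (pot2 \<kappa> \<delta> a b h x) \<le> (1 + 3 * Z * A) * K + (norm (v2 a b x))\<^sup>2"
        using K by (simp add: algebra_simps)
      then show ?thesis using True x c0 by (simp add: field_simps)
    next
      case False
      then show ?thesis using c0 Z A K by (simp add: indicator_def)
    qed
    have i: "integrable lborel (\<lambda>x. (1 / c0) * (((1 + 3 * Z * A) * K) * indicator (cball 0 \<rho>) x + (norm (v2 a b x))\<^sup>2))"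
      by (intro integrable_mult_right Bochner_Integration.integrable_add integrable_indicator_cball L2(1))
    have "(\<integral>\<^sup>+x. indicator (cball 0 R) x * ennreal (norm (pot2 \<kappa> \<delta> a b h x)) \<partial>lborel)
       \<le> (\<integral>\<^sup>+x. ennreal ((1 / c0) * (((1 + 3 * Z * A) * K) * indicator (cball 0 \<rho>) x + (norm (v2 a b x))\<^sup>2)) \<partial>lborel)"
    proof (rule nn_integral_mono)
      fix x
      have "indicator (cball 0 R) x * ennreal (norm (pot2 \<kappa> \<delta> a b h x)) = ennreal (indicator (cball 0 R) x * norm (pot2 \<kappa> \<delta> a b h x))"
        by (simp add: indicator_def)
      then show "indicator (cball 0 R) x * ennreal (norm (pot2 \<kappa> \<delta> a b h x))
          \<le> ennreal ((1 / c0) * (((1 + 3 * Z * A) * K) * indicator (cball 0 \<rho>) x + (norm (v2 a b x))\<^sup>2))"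
        using ennreal_leI[OF pw[of x]] by (simp only:)
    qed
    also have "\<dots> = ennreal (LINT x|lborel. (1 / c0) * (((1 + 3 * Z * A) * K) * indicator (cball 0 \<rho>) x + (norm (v2 a b x))\<^sup>2))"
      by (rule nn_integral_eq_integral[OF i]) (use c0 Z A K in \<open>auto simp: indicator_def\<close>)
    also have "(LINT x|lborel. (1 / c0) * (((1 + 3 * Z * A) * K) * indicator (cball 0 \<rho>) x + (norm (v2 a b x))\<^sup>2))
       = (1 / c0) * (((1 + 3 * Z * A) * K) * W + (LINT x|lborel. (norm (v2 a b x))\<^sup>2))"
      using integrable_indicator_cball[of "0::real^3" \<rho>] L2(1) by (simp add: W_def)
    also have "\<dots> \<le> (1 / c0) * (((1 + 3 * Z * A) * K\<^sup>2) * W + (10 * Z * A)\<^sup>2 * W * K\<^sup>2)"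
    proof (intro mult_left_mono add_mono L2v mult_right_mono)
      show "K \<le> K\<^sup>2" using K by (simp add: power2_eq_square mult_le_cancel_left1)
    qed (use c0 Z A W in auto)
    also have "\<dots> = C * (1 + \<bar>\<kappa>\<bar>) ^ 8"
      by (simp add: C_def K_def power_mult[symmetric] field_simps)
    finally show "(\<integral>\<^sup>+x. indicator (cball 0 R) x * ennreal (norm (pot2 \<kappa> \<delta> a b h x)) \<partial>lborel) \<le> ennreal (C * (1 + \<bar>\<kappa>\<bar>) ^ 8)"
      by (simp add: ennreal_leI)
  qed
qed

section \<open>The strongly singular Green operator\<close>

lemma borel_measurable_radial0 [measurable]:
  assumes [measurable]: "f \<in> borel_measurable M" "g \<in> borel_measurable M"
  shows "(\<lambda>x. radial0 (f x) (g x)) \<in> borel_measurable M"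
  unfolding radial0_def by measurable

lemma norm_radial0_le: "norm (radial0 \<kappa> t) \<le> 1 / \<bar>t\<bar>"
proof -
  have "norm (exp (\<i> * of_real \<kappa> * of_real t)) = 1"
    using norm_exp_i_times[of "\<kappa> * t"] by (simp add: mult.assoc)
  then have "norm (radial0 \<kappa> t) = 1 / (4 * pi * \<bar>t\<bar>)"
    by (simp add: radial0_def norm_divide norm_mult)
  also have "\<dots> \<le> 1 / \<bar>t\<bar>"
  proof (cases "t = 0")
    case False
    then show ?thesis using pi_gt3 by (intro divide_left_mono) auto
  qed simp
  finally show ?thesis .
qed

lemma inverse_le_one_plus_inverse_square: "1 / \<bar>r\<bar> \<le> 1 + 1 / r\<^sup>2" for r :: real
proof -
  have "2 * (1 / \<bar>r\<bar>) \<le> 1 + (1 / \<bar>r\<bar>)\<^sup>2" using zero_le_power2[of "1 - 1 / \<bar>r\<bar>"] unfolding power2_diff by simp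
  moreover have "0 \<le> 1 / \<bar>r\<bar>" by simp
  ultimately have "1 / \<bar>r\<bar> \<le> 1 + (1 / \<bar>r\<bar>)\<^sup>2" by linarith
  then show ?thesis by (simp add: power_divide)
qed

text \<open>The part of the Green function lost by regularising. It is integrable and lives in the
  ball of radius \<delta>, so its convolution with a smooth density is differentiated by
  differentiating the density.\<close>

definition Gdiff :: "real \<Rightarrow> real \<Rightarrow> real^3 \<Rightarrow> complex" where
  "Gdiff \<kappa> \<delta> w = radial0 \<kappa> (norm w) - Greg \<kappa> \<delta> w"

lemma Gdiff_outside: "0 < \<delta> \<Longrightarrow> \<delta> \<le> norm w \<Longrightarrow> Gdiff \<kappa> \<delta> w = 0"
  by (simp add: Gdiff_def Greg_eq)

lemma Gdiff_bound:
  assumes "0 < \<delta>" "\<delta> \<le> 1" "w \<noteq> 0"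
  shows "norm (Gdiff \<kappa> \<delta> w) \<le> 13 * (1 + \<bar>\<kappa>\<bar>)\<^sup>2 * (indicator (cball 0 1) w * (1 + 1 / (norm w)\<^sup>2))"
proof (cases "norm w \<le> 1")
  case True
  obtain e :: "real^3" where e: "norm e = 1" using norm_Basis nonempty_Basis by blast
  have K: "1 \<le> (1 + \<bar>\<kappa>\<bar>)\<^sup>2" by (simp add: one_le_power)
  have "norm (Gdiff \<kappa> \<delta> w) \<le> norm (radial0 \<kappa> (norm w)) + norm (Greg \<kappa> \<delta> w)"
    unfolding Gdiff_def by (rule norm_triangle_ineq4)
  also have "\<dots> \<le> 1 * (1 + 1 / (norm w)\<^sup>2) + 12 * (1 + \<bar>\<kappa>\<bar>)\<^sup>2 * (1 + 1 / (norm w)\<^sup>2)"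
    using norm_radial0_le[of \<kappa> "norm w"] inverse_le_one_plus_inverse_square[of "norm w"]
      Greg_singular_bound(2)[OF assms e, of \<kappa>] by (intro add_mono) auto
  also have "\<dots> \<le> (1 + \<bar>\<kappa>\<bar>)\<^sup>2 * (1 + 1 / (norm w)\<^sup>2) + 12 * (1 + \<bar>\<kappa>\<bar>)\<^sup>2 * (1 + 1 / (norm w)\<^sup>2)"
    using K by (intro add_right_mono mult_right_mono) auto
  finally show ?thesis using True by simp
next
  case False
  then show ?thesis using assms Gdiff_outside[of \<delta> w \<kappa>] by simp
qed

lemma Gdiff_measurable:
  assumes "0 < \<delta>" and [measurable]: "f \<in> borel_measurable M" "g \<in> borel_measurable M"
  shows "(\<lambda>x. Gdiff (f x) \<delta> (g x)) \<in> borel_measurable M"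
  unfolding Gdiff_def using Greg_measurable(1)[OF assms] by measurable

lemma integrable_Gdiff:
  assumes "0 < \<delta>" "\<delta> \<le> 1"
  shows "integrable lborel (Gdiff \<kappa> \<delta>)"
proof (rule Bochner_Integration.integrable_bound[OF integrable_mult_right[OF integrable_sing]])
  show "Gdiff \<kappa> \<delta> \<in> borel_measurable lborel"
    using Gdiff_measurable[OF assms(1), of "\<lambda>_. \<kappa>" lborel "\<lambda>w. w"] by simp
  show "AE w in lborel. norm (Gdiff \<kappa> \<delta> w) \<le> norm (13 * (1 + \<bar>\<kappa>\<bar>)\<^sup>2 * (indicator (cball 0 1) w * (1 + 1 / (norm w)\<^sup>2)) :: real)"
    using AE_lborel_singleton[of 0]
  proof eventually_elim
    case (elim w)
    show ?case using order_trans[OF Gdiff_bound[OF assms elim, of \<kappa>] abs_ge_self] by (simp only: real_norm_def)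
  qed
qed

definition radii :: "nat \<Rightarrow> real" where "radii n = 1 / real (Suc n)"

lemma radii: "0 < radii n" "radii n \<le> 1" "radii \<longlonglongrightarrow> 0"
  unfolding radii_def using LIMSEQ_Suc[OF lim_1_over_n] by auto

text \<open>At each w other than 0 the difference vanishes as soon as the radius is below |w|, and
  \<open>Gdiff_bound\<close> is a majorant independent of the radius.\<close>

lemma Gdiff_mass_tendsto: "(\<lambda>n. LINT w|lborel. norm (Gdiff \<kappa> (radii n) w)) \<longlonglongrightarrow> 0"
proof -
  have "(\<lambda>n. LINT w|lborel. norm (Gdiff \<kappa> (radii n) w)) \<longlonglongrightarrow> (LINT w|(lborel :: (real^3) measure). (0::real))"
  proof (rule integral_dominated_convergence[OF _ _ integrable_mult_right[where c="13 * (1 + \<bar>\<kappa>\<bar>)\<^sup>2", OF integrable_sing[of 1]]])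
    show "(\<lambda>w. norm (Gdiff \<kappa> (radii n) w)) \<in> borel_measurable lborel" for n
      using borel_measurable_integrable[OF integrable_norm[OF integrable_Gdiff[OF radii(1,2)]]] .
    show "AE w in lborel. (\<lambda>n. norm (Gdiff \<kappa> (radii n) w)) \<longlonglongrightarrow> 0"
      using AE_lborel_singleton[of "0::real^3"]
    proof eventually_elim
      case (elim w)
      have "eventually (\<lambda>n. radii n < norm w) sequentially"
        using order_tendstoD(2)[OF radii(3), of "norm w"] elim by simp
      then have "eventually (\<lambda>n. norm (Gdiff \<kappa> (radii n) w) = 0) sequentially"
        by eventually_elim (simp add: Gdiff_outside radii)
      then show ?case by (rule tendsto_eventually)
    qed
    show "AE w in lborel. norm (norm (Gdiff \<kappa> (radii n) w)) \<le> 13 * (1 + \<bar>\<kappa>\<bar>)\<^sup>2 * (indicator (cball 0 1) w * (1 + 1 / (norm w)\<^sup>2))" for n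
      using AE_lborel_singleton[of 0]
    proof eventually_elim
      case (elim w)
      then show ?case using Gdiff_bound[OF radii(1,2) elim, of \<kappa>] by simp
    qed
  qed simp
  then show ?thesis by simp
qed

text \<open>Derivatives and bound are arguments rather than existentially quantified: for plane
  waves the growth of the bound in the wave vector matters, since it has to be integrated against a
  Fourier transform.\<close>

definition C2_bounded ::
  "(real^3 \<Rightarrow> complex) \<Rightarrow> (real^3 \<Rightarrow> real^3 \<Rightarrow> complex) \<Rightarrow> (real^3 \<Rightarrow> real^3 \<Rightarrow> real^3 \<Rightarrow> complex) \<Rightarrow> real \<Rightarrow> bool" where
  "C2_bounded g g1 g2 B \<longleftrightarrow>
    (\<forall>a\<in>Basis. \<forall>x. has_dir_deriv a g (g1 a x) x) \<and>
    (\<forall>a\<in>Basis. \<forall>b\<in>Basis. \<forall>x. has_dir_deriv b (g1 a) (g2 a b x) x) \<and>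
    (\<forall>x. norm (g x) \<le> B) \<and> (\<forall>a\<in>Basis. \<forall>x. norm (g1 a x) \<le> B) \<and> (\<forall>a\<in>Basis. \<forall>b\<in>Basis. \<forall>x. norm (g2 a b x) \<le> B) \<and>
    continuous_on UNIV g \<and> (\<forall>a\<in>Basis. continuous_on UNIV (g1 a)) \<and> (\<forall>a\<in>Basis. \<forall>b\<in>Basis. continuous_on UNIV (g2 a b))"

lemma C2_boundedD:
  assumes "C2_bounded g g1 g2 B"
  shows "a \<in> Basis \<Longrightarrow> has_dir_deriv a g (g1 a x) x" "a \<in> Basis \<Longrightarrow> b \<in> Basis \<Longrightarrow> has_dir_deriv b (g1 a) (g2 a b x) x"
    "norm (g x) \<le> B" "a \<in> Basis \<Longrightarrow> norm (g1 a x) \<le> B" "a \<in> Basis \<Longrightarrow> b \<in> Basis \<Longrightarrow> norm (g2 a b x) \<le> B"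
    "continuous_on UNIV g" "a \<in> Basis \<Longrightarrow> continuous_on UNIV (g1 a)" "a \<in> Basis \<Longrightarrow> b \<in> Basis \<Longrightarrow> continuous_on UNIV (g2 a b)"
    "0 \<le> B" "g \<in> borel_measurable borel" "a \<in> Basis \<Longrightarrow> g1 a \<in> borel_measurable borel" "a \<in> Basis \<Longrightarrow> b \<in> Basis \<Longrightarrow> g2 a b \<in> borel_measurable borel"
  using assms order_trans[OF norm_ge_zero, of "g x" B] unfolding C2_bounded_def
  by (auto intro!: borel_measurable_continuous_onI)

lemma C2_bounded_planewave:
  "C2_bounded (planewave \<xi>) (\<lambda>a x. \<i> * of_real (\<xi> \<bullet> a) * planewave \<xi> x)
     (\<lambda>a b x. - of_real ((\<xi> \<bullet> a) * (\<xi> \<bullet> b)) * planewave \<xi> x) (1 + (norm \<xi>)\<^sup>2)"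
proof -
  have a: "\<bar>\<xi> \<bullet> a\<bar> \<le> norm \<xi>" if "a \<in> Basis" for a using Basis_le_norm[OF that] .
  have b: "\<bar>\<xi> \<bullet> a\<bar> * \<bar>\<xi> \<bullet> b\<bar> \<le> (norm \<xi>)\<^sup>2" if "a \<in> Basis" "b \<in> Basis" for a b
    unfolding power2_eq_square by (intro mult_mono a that) auto
  have c: "norm \<xi> \<le> 1 + (norm \<xi>)\<^sup>2"
    using zero_le_power2[of "1 - norm \<xi>"] norm_ge_zero[of \<xi>] unfolding power2_diff power_one by linarith
  have "continuous_on UNIV (planewave \<xi>)"
    unfolding planewave_def[abs_def] by (intro continuous_intros)
  moreover have "has_dir_deriv b (\<lambda>x. \<i> * of_real (\<xi> \<bullet> a) * planewave \<xi> x) (- of_real ((\<xi> \<bullet> a) * (\<xi> \<bullet> b)) * planewave \<xi> x) x" for a b x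
    using has_dir_deriv_cmult[where c="\<i> * of_real (\<xi> \<bullet> a)", OF has_dir_deriv_planewave[of b \<xi> x]]
    by (simp add: algebra_simps)
  ultimately show ?thesis
    unfolding C2_bounded_def
    by (auto simp: norm_mult abs_mult has_dir_deriv_planewave intro: order_trans[OF a c] add_increasing b intro!: continuous_intros)
qed

lemma C2_bounded_mult:
  assumes f: "C2_bounded f f1 f2 A" and g: "C2_bounded g g1 g2 B"
  shows "C2_bounded (\<lambda>x. f x * g x) (\<lambda>a x. f x * g1 a x + f1 a x * g x)
    (\<lambda>a b x. (f x * g2 a b x + f1 b x * g1 a x) + (f1 a x * g1 b x + f2 a b x * g x)) (4 * A * B)"
proof -
  note F = C2_boundedD[OF f] and G = C2_boundedD[OF g]
  have AB: "0 \<le> A * B" using F G by simp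
  have m: "norm (x * y) \<le> A * B" if "norm x \<le> A" "norm y \<le> B" for x y :: complex
    using that F(9) unfolding norm_mult by (intro mult_mono) auto
  have t: "norm (x + y) \<le> X + Y" if "norm x \<le> X" "norm y \<le> Y" for x y :: complex and X Y
    using that by (rule norm_triangle_mono)
  show ?thesis
    unfolding C2_bounded_def
  proof (intro conjI ballI allI)
    fix a b x :: "real^3" assume a: "a \<in> Basis" and b: "b \<in> Basis"
    show "norm ((f x * g2 a b x + f1 b x * g1 a x) + (f1 a x * g1 b x + f2 a b x * g x)) \<le> 4 * A * B"
      by (rule order_trans[OF t[OF t[OF m m] t[OF m m]]]) (use F G a b in auto)
  next
    fix a x :: "real^3" assume a: "a \<in> Basis"
    show "norm (f x * g1 a x + f1 a x * g x) \<le> 4 * A * B"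
      by (rule order_trans[OF t[OF m m]]) (use F G a AB in auto)
  next
    fix x show "norm (f x * g x) \<le> 4 * A * B"
      by (rule order_trans[OF m]) (use F G AB in auto)
  qed (auto intro!: has_dir_deriv_mult has_dir_deriv_add continuous_intros F G)
qed

lemma C2_bounded_test_function:
  assumes f: "test_function f"
  obtains B where "C2_bounded f (\<lambda>a. dir_deriv a f) (\<lambda>a b. dir_deriv b (dir_deriv a f)) B"
proof -
  have f1: "test_function (dir_deriv a f)" if "a \<in> Basis" for a by (rule test_function_dir_deriv[OF f that])
  have f2: "test_function (dir_deriv b (dir_deriv a f))" if "a \<in> Basis" "b \<in> Basis" for a b
    by (rule test_function_dir_deriv[OF f1[OF that(1)] that(2)])
  obtain B0 where B0: "\<And>x. norm (f x) \<le> B0" "0 \<le> B0" using test_function_bounds[OF f] by metis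
  have "\<exists>B. \<forall>x. norm (dir_deriv a f x) \<le> B" if "a \<in> Basis" for a
    using test_function_bounds[OF f1[OF that]] by metis
  then obtain B1 where B1: "\<And>a x. a \<in> Basis \<Longrightarrow> norm (dir_deriv a f x) \<le> B1 a" by metis
  have "\<exists>B. \<forall>x. norm (dir_deriv b (dir_deriv a f) x) \<le> B" if "a \<in> Basis" "b \<in> Basis" for a b
    using test_function_bounds[OF f2[OF that]] by metis
  then obtain B2 where B2: "\<And>a b x. a \<in> Basis \<Longrightarrow> b \<in> Basis \<Longrightarrow> norm (dir_deriv b (dir_deriv a f) x) \<le> B2 a b" by metis
  have B1n: "0 \<le> B1 a" if "a \<in> Basis" for a using order_trans[OF norm_ge_zero B1[OF that]] .
  have B2n: "0 \<le> B2 a b" if "a \<in> Basis" "b \<in> Basis" for a b using order_trans[OF norm_ge_zero B2[OF that]] .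
  define B where "B = B0 + (\<Sum>a\<in>Basis. B1 a) + (\<Sum>a\<in>Basis. \<Sum>b\<in>Basis. B2 a b)"
  have sn: "0 \<le> (\<Sum>a\<in>Basis. B1 a)" "0 \<le> (\<Sum>a\<in>(Basis::(real^3) set). \<Sum>b\<in>Basis. B2 a b)"
    by (intro sum_nonneg B1n B2n; assumption)+
  have n0: "norm (f x) \<le> B" for x using B0(1)[of x] sn unfolding B_def by linarith
  have n1: "norm (dir_deriv a f x) \<le> B" if a: "a \<in> Basis" for a x
  proof -
    have "B1 a \<le> (\<Sum>a\<in>Basis. B1 a)" using a B1n by (intro member_le_sum) auto
    then show ?thesis using B1[OF a, of x] sn B0(2) unfolding B_def by linarith
  qed
  have n2: "norm (dir_deriv b (dir_deriv a f) x) \<le> B" if a: "a \<in> Basis" and b: "b \<in> Basis" for a b x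
  proof -
    have "B2 a b \<le> (\<Sum>b\<in>Basis. B2 a b)" using a b B2n by (intro member_le_sum) auto
    also have "\<dots> \<le> (\<Sum>a\<in>Basis. \<Sum>b\<in>Basis. B2 a b)"
      using a B2n by (intro member_le_sum[where f="\<lambda>a. \<Sum>b\<in>Basis. B2 a b"] sum_nonneg) auto
    finally show ?thesis using B2[OF a b, of x] sn B0(2) unfolding B_def by linarith
  qed
  have "C2_bounded f (\<lambda>a. dir_deriv a f) (\<lambda>a b. dir_deriv b (dir_deriv a f)) B"
    unfolding C2_bounded_def
    by (auto intro!: n0 n1 n2 test_function_has_dir_deriv test_function_continuous f f1 f2)
  then show thesis by (rule that)
qed

lemma
  assumes A: "integrable lborel A" and g: "C2_bounded g g1 g2 B" and ab: "a \<in> Basis" "b \<in> Basis"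
  shows C2_convolution_integrable: "integrable lborel (\<lambda>w. A w * g (x - w))" "integrable lborel (\<lambda>w. A w * g1 a (x - w))"
      "integrable lborel (\<lambda>w. A w * g2 a b (x - w))"
    and has_dir_deriv_convolution: "has_dir_deriv a (\<lambda>x. LINT w|lborel. A w * g (x - w)) (LINT w|lborel. A w * g1 a (x - w)) x"
      "has_dir_deriv b (\<lambda>x. LINT w|lborel. A w * g1 a (x - w)) (LINT w|lborel. A w * g2 a b (x - w)) x"
proof -
  note G = C2_boundedD[OF g]
  have i: "integrable lborel (\<lambda>w. B * norm (A w))" using A by auto
  have [measurable]: "A \<in> borel_measurable borel" using A by auto
  have bd: "norm (A w * y) \<le> B * norm (A w)" if "norm y \<le> B" for w y
    using that unfolding norm_mult by (subst mult.commute) (rule mult_right_mono, auto)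
  have I: "integrable lborel (\<lambda>w. A w * k (x - w))"
    if [measurable]: "k \<in> borel_measurable borel" and k: "\<And>x. norm (k x) \<le> B" for k x
    by (rule Bochner_Integration.integrable_bound[OF i])
      (use bd[OF k] in \<open>auto intro!: AE_I2 order_trans[OF _ abs_ge_self]\<close>)
  show "integrable lborel (\<lambda>w. A w * g (x - w))" "integrable lborel (\<lambda>w. A w * g1 a (x - w))"
      "integrable lborel (\<lambda>w. A w * g2 a b (x - w))"
    by (intro I G ab)+
  show "has_dir_deriv a (\<lambda>x. LINT w|lborel. A w * g (x - w)) (LINT w|lborel. A w * g1 a (x - w)) x"
    by (rule has_dir_deriv_integral(2)[OF I[OF G(10,3)] has_dir_deriv_cmult[OF has_dir_deriv_translate[OF G(1)[OF ab(1)]]] bd[OF G(4)[OF ab(1)]] i])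
  show "has_dir_deriv b (\<lambda>x. LINT w|lborel. A w * g1 a (x - w)) (LINT w|lborel. A w * g2 a b (x - w)) x"
    by (rule has_dir_deriv_integral(2)[OF I[OF G(11,4)] has_dir_deriv_cmult[OF has_dir_deriv_translate[OF G(2)[OF ab]]] bd[OF G(5)[OF ab]] i])
      (use ab in auto)
qed

lemma integral_mult_linear:
  fixes A f g :: "'a \<Rightarrow> complex"
  assumes "integrable M (\<lambda>w. A w * f w)" "integrable M (\<lambda>w. A w * g w)"
  shows "integrable M (\<lambda>w. A w * (c * f w + g w))"
    and "(LINT w|M. A w * (c * f w + g w)) = c * (LINT w|M. A w * f w) + (LINT w|M. A w * g w)"
proof -
  have eq: "A w * (c * f w + g w) = c * (A w * f w) + A w * g w" for w by (simp add: algebra_simps)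
  show "integrable M (\<lambda>w. A w * (c * f w + g w))"
    unfolding eq by (intro Bochner_Integration.integrable_add integrable_mult_right assms)
  show "(LINT w|M. A w * (c * f w + g w)) = c * (LINT w|M. A w * f w) + (LINT w|M. A w * g w)"
    unfolding eq
    by (subst Bochner_Integration.integral_add[OF integrable_mult_right[OF assms(1)] assms(2)]) simp
qed

definition npot :: "real \<Rightarrow> (real^3 \<Rightarrow> complex) \<Rightarrow> real^3 \<Rightarrow> complex" where
  "npot \<kappa> h x = (LINT z|lborel. radial0 \<kappa> (norm (x - z)) * h z)"

text \<open>\<open>Tgreen \<kappa> a b h\<close> is the \<open>b\<close>-component of \<open>(\<kappa>\<^sup>2 + grad div)\<close> applied to the potential of
  the density \<open>h\<close> in direction \<open>a\<close>.\<close>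

definition Tgreen :: "real \<Rightarrow> real^3 \<Rightarrow> real^3 \<Rightarrow> (real^3 \<Rightarrow> complex) \<Rightarrow> real^3 \<Rightarrow> complex" where
  "Tgreen \<kappa> a b h y = of_real (\<kappa>\<^sup>2 * (a \<bullet> b)) * npot \<kappa> h y + dir_deriv b (dir_deriv a (npot \<kappa> h)) y"

definition Treg :: "real \<Rightarrow> real \<Rightarrow> real^3 \<Rightarrow> real^3 \<Rightarrow> (real^3 \<Rightarrow> complex) \<Rightarrow> real^3 \<Rightarrow> complex" where
  "Treg \<kappa> \<delta> a b h y = of_real (\<kappa>\<^sup>2 * (a \<bullet> b)) * pot \<kappa> \<delta> h y + pot2 \<kappa> \<delta> a b h y"

lemma dir_deriv_twice_open:
  assumes S: "open S" "y \<in> S"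
    and eq: "\<And>x. x \<in> S \<Longrightarrow> f x = F x"
    and F1: "\<And>x. has_dir_deriv a F (F1 x) x" and F2: "has_dir_deriv b F1 F2 y"
  shows "x \<in> S \<Longrightarrow> has_dir_deriv a f (dir_deriv a f x) x" "has_dir_deriv b (dir_deriv a f) F2 y"
proof -
  have 1: "has_dir_deriv a f (F1 x) x" if "x \<in> S" for x
    by (rule has_dir_deriv_cong_open[OF F1 S(1) that]) (simp add: eq)
  show "x \<in> S \<Longrightarrow> has_dir_deriv a f (dir_deriv a f x) x"
    using 1[of x] has_dir_deriv_imp_dir_deriv[OF 1, of x] by simp
  show "has_dir_deriv b (dir_deriv a f) F2 y"
    by (rule has_dir_deriv_cong_open[OF F2 S]) (simp add: has_dir_deriv_imp_dir_deriv[OF 1])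
qed

text \<open>Near y the potential of \<open>indicator \<Omega> z * g z\<close> is that of the
  regularised kernel plus a convolution of \<open>Gdiff\<close> with \<open>g\<close> itself: the
  latter sees only points close to y, all inside \<Omega>, so the jump of the indicator is
  invisible. Derivatives fall on the kernel in the first term and on \<open>g\<close> in the
  second.\<close>

lemma
  assumes g: "C2_bounded g g1 g2 B" and \<Omega>: "open \<Omega>" "bounded \<Omega>"
    and \<delta>: "0 < \<delta>" "\<delta> \<le> 1" "cball y (2 * \<delta>) \<subseteq> \<Omega>" and ab: "a \<in> Basis" "b \<in> Basis"
  shows npot_interior_deriv: "has_dir_deriv a (npot \<kappa> (\<lambda>z. indicator \<Omega> z * g z)) (dir_deriv a (npot \<kappa> (\<lambda>z. indicator \<Omega> z * g z)) y) y"
      "has_dir_deriv b (dir_deriv a (npot \<kappa> (\<lambda>z. indicator \<Omega> z * g z))) (dir_deriv b (dir_deriv a (npot \<kappa> (\<lambda>z. indicator \<Omega> z * g z))) y) y"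
    and Tgreen_interior: "Tgreen \<kappa> a b (\<lambda>z. indicator \<Omega> z * g z) y = Treg \<kappa> \<delta> a b (\<lambda>z. indicator \<Omega> z * g z) y
      + (LINT w|lborel. Gdiff \<kappa> \<delta> w * (of_real (\<kappa>\<^sup>2 * (a \<bullet> b)) * g (y - w) + g2 a b (y - w)))"
proof -
  note G = C2_boundedD[OF g]
  let ?h = "\<lambda>z. indicator \<Omega> z * g z"
  obtain R where "\<forall>x\<in>\<Omega>. norm x \<le> R" using \<Omega>(2) unfolding bounded_iff by blast
  then have R: "\<Omega> \<subseteq> cball 0 R" by auto
  have [measurable]: "\<Omega> \<in> sets borel" "g \<in> borel_measurable borel" using borel_open[OF \<Omega>(1)] G(10) by auto
  have h: "integrable lborel ?h"
    by (rule integrable_bounded_support[where B=B and R=R])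
      (use G(3,9) R in \<open>auto simp: norm_mult indicator_def\<close>)
  note n = norm_Basis[OF ab(1)] norm_Basis[OF ab(2)]
  note A = integrable_Gdiff[OF \<delta>(1,2), of \<kappa>]
  note conv = C2_convolution_integrable[OF A g ab] and conv' = has_dir_deriv_convolution[OF A g ab]
  let ?F = "\<lambda>x. pot \<kappa> \<delta> ?h x + (LINT w|lborel. Gdiff \<kappa> \<delta> w * g (x - w))"
  let ?F1 = "\<lambda>x. pot1 \<kappa> \<delta> a ?h x + (LINT w|lborel. Gdiff \<kappa> \<delta> w * g1 a (x - w))"
  let ?F2 = "pot2 \<kappa> \<delta> a b ?h y + (LINT w|lborel. Gdiff \<kappa> \<delta> w * g2 a b (y - w))"
  have eq: "npot \<kappa> ?h x = ?F x" if x: "x \<in> ball y \<delta>" for x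
  proof -
    \<comment> \<open>The ball of radius 2 \<delta> leaves room for x to move in a ball of radius
      \<delta> around y, as differentiation at y demands.\<close>
    have e: "Gdiff \<kappa> \<delta> (x - z) * ?h z = Gdiff \<kappa> \<delta> (x - z) * g (x - (x - z))" for z
    proof (cases "z \<in> \<Omega>")
      case False
      then have "\<not> dist y z \<le> 2 * \<delta>" using \<delta>(3) by auto
      then have "dist x z \<ge> \<delta>" using x dist_triangle[of y z x] by simp
      then show ?thesis using Gdiff_outside[OF \<delta>(1)] by (simp add: dist_norm)
    qed simp
    have i1: "integrable lborel (\<lambda>z. Gdiff \<kappa> \<delta> (x - z) * ?h z)"
      unfolding e using lborel_integrable_reflect[of "\<lambda>w. Gdiff \<kappa> \<delta> w * g (x - w)" x] conv(1)[of x] by simp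
    have "npot \<kappa> ?h x = (LINT z|lborel. Greg \<kappa> \<delta> (x - z) * ?h z + Gdiff \<kappa> \<delta> (x - z) * ?h z)"
      unfolding npot_def Gdiff_def by (intro Bochner_Integration.integral_cong refl) (simp add: algebra_simps)
    also have "\<dots> = pot \<kappa> \<delta> ?h x + (LINT z|lborel. Gdiff \<kappa> \<delta> (x - z) * ?h z)"
      unfolding pot_def by (rule Bochner_Integration.integral_add[OF pot_integrable(1)[OF \<delta>(1) n h] i1])
    also have "(LINT z|lborel. Gdiff \<kappa> \<delta> (x - z) * ?h z) = (LINT w|lborel. Gdiff \<kappa> \<delta> w * g (x - w))"
      unfolding e by (rule lborel_integral_reflect[of "\<lambda>w. Gdiff \<kappa> \<delta> w * g (x - w)" x])
    finally show ?thesis .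
  qed
  have F1: "has_dir_deriv a ?F (?F1 x) x" for x
    by (intro has_dir_deriv_add has_dir_deriv_pot[OF \<delta>(1) n h] conv')
  have F2: "has_dir_deriv b ?F1 ?F2 y"
    by (intro has_dir_deriv_add has_dir_deriv_pot1[OF \<delta>(1) n h] conv')
  have y: "y \<in> ball y \<delta>" using \<delta> by simp
  note D = dir_deriv_twice_open[OF open_ball y eq F1 F2]
  show "has_dir_deriv a (npot \<kappa> ?h) (dir_deriv a (npot \<kappa> ?h) y) y" by (rule D(1)[OF _ y])
  have d2: "dir_deriv b (dir_deriv a (npot \<kappa> ?h)) y = ?F2"
    by (rule has_dir_deriv_imp_dir_deriv[OF D(2)])
  show "has_dir_deriv b (dir_deriv a (npot \<kappa> ?h)) (dir_deriv b (dir_deriv a (npot \<kappa> ?h)) y) y"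
    unfolding d2 by (rule D(2))
  show "Tgreen \<kappa> a b ?h y = Treg \<kappa> \<delta> a b ?h y
      + (LINT w|lborel. Gdiff \<kappa> \<delta> w * (of_real (\<kappa>\<^sup>2 * (a \<bullet> b)) * g (y - w) + g2 a b (y - w)))"
    unfolding Tgreen_def Treg_def d2 eq[OF y] integral_mult_linear(2)[OF conv(1,3)] by (simp add: algebra_simps)
qed

text \<open>The density is smooth on the whole space, so both derivatives fall on it. Truncating the
  kernel at 3 R makes it integrable and does not change the potential at points of norm below 2 R,
  since the density vanishes beyond R.\<close>

lemma Tgreen_compact:
  assumes g: "C2_bounded g g1 g2 B" and supp: "\<And>x. norm x > R \<Longrightarrow> g x = 0"
    and y: "norm y < 2 * R" and ab: "a \<in> Basis" "b \<in> Basis"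
  shows "Tgreen \<kappa> a b g y = (LINT w|lborel. (indicator (cball 0 (3 * R)) w * radial0 \<kappa> (norm w)) * (of_real (\<kappa>\<^sup>2 * (a \<bullet> b)) * g (y - w) + g2 a b (y - w)))"
    and "integrable lborel (\<lambda>w. (indicator (cball 0 (3 * R)) w * radial0 \<kappa> (norm w)) * (of_real (\<kappa>\<^sup>2 * (a \<bullet> b)) * g (y - w) + g2 a b (y - w)))"
proof -
  define A where "A w = indicator (cball (0::real^3) (3 * R)) w * radial0 \<kappa> (norm w)" for w
  have A: "integrable lborel A"
  proof (rule Bochner_Integration.integrable_bound[OF integrable_sing[of "3 * R"]])
    show "A \<in> borel_measurable lborel" unfolding A_def[abs_def] by (intro borel_measurable_times borel_measurable_indicator) auto
    show "AE w in lborel. norm (A w) \<le> norm (indicator (cball (0::real^3) (3 * R)) w * (1 + 1 / (norm w)\<^sup>2) :: real)"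
    proof (rule AE_I2)
      fix w :: "real^3"
      have "norm (radial0 \<kappa> (norm w)) \<le> 1 + 1 / (norm w)\<^sup>2"
        using norm_radial0_le[of \<kappa> "norm w"] inverse_le_one_plus_inverse_square[of "norm w"] by linarith
      then show "norm (A w) \<le> norm (indicator (cball (0::real^3) (3 * R)) w * (1 + 1 / (norm w)\<^sup>2) :: real)"
        by (simp add: A_def norm_mult indicator_def)
    qed
  qed
  note conv = C2_convolution_integrable[OF A g ab] and conv' = has_dir_deriv_convolution[OF A g ab]
  have eq: "npot \<kappa> g x = (LINT w|lborel. A w * g (x - w))" if x: "x \<in> ball 0 (2 * R)" for x
  proof -
    have "A (x - z) * g z = radial0 \<kappa> (norm (x - z)) * g z" for z
    proof (cases "norm z > R")
      case False
      then have "norm (x - z) \<le> 3 * R" using x norm_triangle_ineq4[of x z] by simp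
      then show ?thesis by (simp add: A_def)
    qed (simp add: supp)
    then have "npot \<kappa> g x = (LINT z|lborel. A (x - z) * g (x - (x - z)))"
      by (simp only: npot_def diff_diff_eq2 add_diff_cancel_left')
    then show ?thesis by (simp only: lborel_integral_reflect[of "\<lambda>w. A w * g (x - w)" x])
  qed
  have yb: "y \<in> ball 0 (2 * R)" using y by simp
  have d2: "dir_deriv b (dir_deriv a (npot \<kappa> g)) y = (LINT w|lborel. A w * g2 a b (y - w))"
    by (rule has_dir_deriv_imp_dir_deriv[OF dir_deriv_twice_open(2)[OF open_ball yb eq conv']])
  show "Tgreen \<kappa> a b g y = (LINT w|lborel. (indicator (cball 0 (3 * R)) w * radial0 \<kappa> (norm w)) * (of_real (\<kappa>\<^sup>2 * (a \<bullet> b)) * g (y - w) + g2 a b (y - w)))"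
    unfolding A_def[symmetric] Tgreen_def d2 eq[OF yb] integral_mult_linear(2)[OF conv(1,3)] ..
  show "integrable lborel (\<lambda>w. (indicator (cball 0 (3 * R)) w * radial0 \<kappa> (norm w)) * (of_real (\<kappa>\<^sup>2 * (a \<bullet> b)) * g (y - w) + g2 a b (y - w)))"
    unfolding A_def[symmetric] by (rule integral_mult_linear(1)[OF conv(1,3)])
qed

text \<open>The dependence on the density and on the radius separate: for plane waves
  \<open>B\<close> is quadratic in the wave vector, while the mass of \<open>Gdiff\<close> tends to
  zero with the radius.\<close>

lemma Tgreen_Treg_diff:
  assumes g: "C2_bounded g g1 g2 B" and \<Omega>: "open \<Omega>" "bounded \<Omega>"
    and \<delta>: "0 < \<delta>" "\<delta> \<le> 1" "cball y (2 * \<delta>) \<subseteq> \<Omega>" and ab: "a \<in> Basis" "b \<in> Basis"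
  shows "norm (Tgreen \<kappa> a b (\<lambda>z. indicator \<Omega> z * g z) y - Treg \<kappa> \<delta> a b (\<lambda>z. indicator \<Omega> z * g z) y)
    \<le> (\<kappa>\<^sup>2 + 1) * B * (LINT w|lborel. norm (Gdiff \<kappa> \<delta> w))"
proof -
  note G = C2_boundedD[OF g]
  note A = integrable_Gdiff[OF \<delta>(1,2), of \<kappa>]
  have ab1: "\<bar>a \<bullet> b\<bar> \<le> 1" using Cauchy_Schwarz_ineq2[of a b] norm_Basis[OF ab(1)] norm_Basis[OF ab(2)] by simp
  have "norm (of_real (\<kappa>\<^sup>2 * (a \<bullet> b)) * g x) \<le> \<kappa>\<^sup>2 * 1 * B" for x
    unfolding norm_mult norm_of_real abs_mult by (intro mult_mono G ab1) auto
  then have bd: "norm (of_real (\<kappa>\<^sup>2 * (a \<bullet> b)) * g x + g2 a b x) \<le> (\<kappa>\<^sup>2 + 1) * B" for x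
    using norm_triangle_mono[OF _ G(5)[OF ab, of x], of "of_real (\<kappa>\<^sup>2 * (a \<bullet> b)) * g x" "\<kappa>\<^sup>2 * B"]
    by (simp add: distrib_right)
  have "norm (LINT w|lborel. Gdiff \<kappa> \<delta> w * (of_real (\<kappa>\<^sup>2 * (a \<bullet> b)) * g (y - w) + g2 a b (y - w)))
     \<le> (LINT w|lborel. (\<kappa>\<^sup>2 + 1) * B * norm (Gdiff \<kappa> \<delta> w))"
  proof (rule order_trans[OF integral_norm_bound integral_mono])
    show "integrable lborel (\<lambda>w. norm (Gdiff \<kappa> \<delta> w * (of_real (\<kappa>\<^sup>2 * (a \<bullet> b)) * g (y - w) + g2 a b (y - w))))"
      by (intro integrable_norm integral_mult_linear C2_convolution_integrable(1,3)[OF A g ab])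
    show "norm (Gdiff \<kappa> \<delta> w * (of_real (\<kappa>\<^sup>2 * (a \<bullet> b)) * g (y - w) + g2 a b (y - w))) \<le> (\<kappa>\<^sup>2 + 1) * B * norm (Gdiff \<kappa> \<delta> w)" for w
      unfolding norm_mult[of "Gdiff _ _ _"] by (subst mult.commute) (intro mult_right_mono bd norm_ge_zero)
  qed (use A in auto)
  then show ?thesis unfolding Tgreen_interior[OF assms] by simp
qed

lemma interior_radius:
  assumes "open \<Omega>" "y \<in> \<Omega>"
  obtains e where "0 < e" "e \<le> 1" "\<And>\<delta>. 0 < \<delta> \<Longrightarrow> \<delta> \<le> e \<Longrightarrow> cball y (2 * \<delta>) \<subseteq> \<Omega>"
proof -
  obtain d where d: "0 < d" "cball y d \<subseteq> \<Omega>" using assms open_contains_cball by blast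
  show thesis
  proof
    show "0 < min 1 (d / 2)" "min 1 (d / 2) \<le> 1" using d by auto
    show "cball y (2 * \<delta>) \<subseteq> \<Omega>" if "\<delta> \<le> min 1 (d / 2)" for \<delta>
      using that by (intro order_trans[OF subset_cball d(2)]) auto
  qed
qed

lemma Treg_tendsto:
  assumes g: "C2_bounded g g1 g2 B" and \<Omega>: "open \<Omega>" "bounded \<Omega>"
    and y: "y \<in> \<Omega>" and ab: "a \<in> Basis" "b \<in> Basis"
  shows "(\<lambda>n. Treg \<kappa> (radii n) a b (\<lambda>z. indicator \<Omega> z * g z) y) \<longlonglongrightarrow> Tgreen \<kappa> a b (\<lambda>z. indicator \<Omega> z * g z) y"
proof -
  let ?h = "\<lambda>z. indicator \<Omega> z * g z"
  obtain e where e: "0 < e" "e \<le> 1" "\<And>\<delta>. 0 < \<delta> \<Longrightarrow> \<delta> \<le> e \<Longrightarrow> cball y (2 * \<delta>) \<subseteq> \<Omega>"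
    using interior_radius[OF \<Omega>(1) y] by blast
  have "eventually (\<lambda>n. radii n < e) sequentially" using order_tendstoD(2)[OF radii(3) e(1)] .
  then have "eventually (\<lambda>n. norm (Treg \<kappa> (radii n) a b ?h y - Tgreen \<kappa> a b ?h y)
      \<le> (\<kappa>\<^sup>2 + 1) * B * (LINT w|lborel. norm (Gdiff \<kappa> (radii n) w))) sequentially"
  proof eventually_elim
    case (elim n)
    then have "cball y (2 * radii n) \<subseteq> \<Omega>" by (intro e(3) radii) simp
    from Tgreen_Treg_diff[OF g \<Omega> radii(1,2) this ab] show ?case by (simp only: norm_minus_commute)
  qed
  moreover have "(\<lambda>n. (\<kappa>\<^sup>2 + 1) * B * (LINT w|lborel. norm (Gdiff \<kappa> (radii n) w))) \<longlonglongrightarrow> 0"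
    using tendsto_mult[OF tendsto_const Gdiff_mass_tendsto[of \<kappa>], of "(\<kappa>\<^sup>2 + 1) * B"] by simp
  ultimately have "(\<lambda>n. Treg \<kappa> (radii n) a b ?h y - Tgreen \<kappa> a b ?h y) \<longlonglongrightarrow> 0"
    by (rule Lim_null_comparison)
  then show ?thesis by (simp add: LIM_zero_iff)
qed

definition Kreg :: "real \<Rightarrow> real \<Rightarrow> real^3 \<Rightarrow> real^3 \<Rightarrow> real^3 \<Rightarrow> complex" where
  "Kreg \<kappa> \<delta> a b w = of_real (\<kappa>\<^sup>2 * (a \<bullet> b)) * Greg \<kappa> \<delta> w + Greg2 \<kappa> \<delta> a b w"

lemma Kreg_measurable:
  assumes "\<delta> > 0" and [measurable]: "f \<in> borel_measurable M" "g \<in> borel_measurable M"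
  shows "(\<lambda>x. Kreg (f x) \<delta> a b (g x)) \<in> borel_measurable M"
  unfolding Kreg_def using Greg_measurable(1)[OF assms] Greg_measurable(3)[OF assms, of a b] by measurable

lemma norm_Kreg:
  assumes \<delta>: "\<delta> > 0" and ab: "a \<in> Basis" "b \<in> Basis"
  shows "norm (Kreg \<kappa> \<delta> a b w) \<le> (\<kappa>\<^sup>2 + 1) * Cbound \<kappa> \<delta>"
proof -
  note n = norm_Basis[OF ab(1)] norm_Basis[OF ab(2)]
  have ab1: "\<bar>a \<bullet> b\<bar> \<le> 1" using Cauchy_Schwarz_ineq2[of a b] n by simp
  have "norm (of_real (\<kappa>\<^sup>2 * (a \<bullet> b)) * Greg \<kappa> \<delta> w) \<le> \<kappa>\<^sup>2 * 1 * Cbound \<kappa> \<delta>"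
    unfolding norm_mult norm_of_real abs_mult by (intro mult_mono Greg_Cbound(1)[OF \<delta> n] ab1) auto
  then have "norm (Kreg \<kappa> \<delta> a b w) \<le> \<kappa>\<^sup>2 * 1 * Cbound \<kappa> \<delta> + Cbound \<kappa> \<delta>"
    unfolding Kreg_def by (rule norm_triangle_mono) (rule Greg_Cbound(3)[OF \<delta> n])
  then show ?thesis by (simp add: distrib_right)
qed

lemma Treg_eq_integral:
  assumes \<delta>: "\<delta> > 0" and ab: "a \<in> Basis" "b \<in> Basis" and h: "integrable lborel h"
  shows "Treg \<kappa> \<delta> a b h y = (LINT z|lborel. Kreg \<kappa> \<delta> a b (y - z) * h z)"
    and "integrable lborel (\<lambda>z. Kreg \<kappa> \<delta> a b (y - z) * h z)"
proof -
  note i = pot_integrable[OF \<delta> norm_Basis[OF ab(1)] norm_Basis[OF ab(2)] h, of \<kappa> y]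
  have e: "Kreg \<kappa> \<delta> a b (y - z) * h z = of_real (\<kappa>\<^sup>2 * (a \<bullet> b)) * (Greg \<kappa> \<delta> (y - z) * h z) + Greg2 \<kappa> \<delta> a b (y - z) * h z" for z
    by (simp add: Kreg_def algebra_simps)
  show "integrable lborel (\<lambda>z. Kreg \<kappa> \<delta> a b (y - z) * h z)"
    unfolding e by (intro Bochner_Integration.integrable_add integrable_mult_right i)
  show "Treg \<kappa> \<delta> a b h y = (LINT z|lborel. Kreg \<kappa> \<delta> a b (y - z) * h z)"
    unfolding e Treg_def pot_def pot2_def
    by (subst Bochner_Integration.integral_add[OF integrable_mult_right[OF i(1)] i(3)]) simp
qed

text \<open>Values outside \<Omega> are set to zero because at boundary points the second
  derivatives in \<open>Tgreen\<close> may fail to exist, and \<open>dir_deriv\<close> is then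
  arbitrary.\<close>

definition TP :: "(real^3) set \<Rightarrow> real \<Rightarrow> real^3 \<Rightarrow> real^3 \<Rightarrow> real^3 \<Rightarrow> real^3 \<Rightarrow> complex" where
  "TP \<Omega> \<kappa> a b \<xi> y = indicator \<Omega> y * Tgreen \<kappa> a b (\<lambda>z. indicator \<Omega> z * planewave \<xi> z) y"

section \<open>Measurability and an L^1 bound uniform in the wave vector\<close>

lemma integrable_indicator_planewave:
  assumes "open \<Omega>" "bounded \<Omega>"
  shows "integrable lborel (\<lambda>z. indicator \<Omega> z * planewave \<xi> z)"
proof -
  obtain R where R: "\<forall>x\<in>\<Omega>. norm x \<le> R" using assms(2) unfolding bounded_iff by blast
  have [measurable]: "\<Omega> \<in> sets borel" using assms by simp
  show ?thesis
    by (rule integrable_bounded_support[where B=1 and R=R]) (use R in \<open>auto simp: norm_mult indicator_def\<close>)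
qed

lemma Treg_measurable:
  assumes \<delta>: "\<delta> > 0" and ab: "a \<in> Basis" "b \<in> Basis" and \<Omega>: "open \<Omega>" "bounded \<Omega>"
    and [measurable]: "k \<in> borel_measurable M" "\<xi> \<in> borel_measurable M" "y \<in> borel_measurable M"
  shows "(\<lambda>x. Treg (k x) \<delta> a b (\<lambda>z. indicator \<Omega> z * planewave (\<xi> x) z) (y x)) \<in> borel_measurable M"
proof -
  have [measurable]: "\<Omega> \<in> sets borel" using \<Omega> by simp
  have [measurable]: "(\<lambda>p. Kreg (k (fst p)) \<delta> a b (y (fst p) - snd p)) \<in> borel_measurable (M \<Otimes>\<^sub>M lborel)"
    by (intro Kreg_measurable[OF \<delta>]) measurable
  have "(\<lambda>p. Kreg (k (fst p)) \<delta> a b (y (fst p) - snd p) * (indicator \<Omega> (snd p) * planewave (\<xi> (fst p)) (snd p))) \<in> borel_measurable (M \<Otimes>\<^sub>M lborel)"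
    by measurable
  then have "(\<lambda>(x, z). Kreg (k x) \<delta> a b (y x - z) * (indicator \<Omega> z * planewave (\<xi> x) z)) \<in> borel_measurable (M \<Otimes>\<^sub>M lborel)"
    by (simp add: case_prod_beta)
  from lborel.borel_measurable_lebesgue_integral[OF this] show ?thesis
    unfolding Treg_eq_integral(1)[OF \<delta> ab integrable_indicator_planewave[OF \<Omega>]] .
qed

text \<open>Being defined by derivatives, \<open>Tgreen\<close> is not obviously measurable. It is a
  pointwise limit of regularised integrals, which are jointly measurable in all parameters.\<close>

lemma TP_measurable:
  assumes ab: "a \<in> Basis" "b \<in> Basis" and \<Omega>: "open \<Omega>" "bounded \<Omega>"
    and [measurable]: "k \<in> borel_measurable M" "\<xi> \<in> borel_measurable M" "y \<in> borel_measurable M"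
  shows "(\<lambda>x. TP \<Omega> (k x) a b (\<xi> x) (y x)) \<in> borel_measurable M"
proof (rule borel_measurable_LIMSEQ_metric)
  have [measurable]: "\<Omega> \<in> sets borel" using \<Omega> by simp
  note [measurable] = Treg_measurable[OF radii(1) ab \<Omega>, of k M \<xi> y]
  show "(\<lambda>x. indicator \<Omega> (y x) * Treg (k x) (radii n) a b (\<lambda>z. indicator \<Omega> z * planewave (\<xi> x) z) (y x)) \<in> borel_measurable M" for n
    by measurable
  show "(\<lambda>n. indicator \<Omega> (y x) * Treg (k x) (radii n) a b (\<lambda>z. indicator \<Omega> z * planewave (\<xi> x) z) (y x)) \<longlonglongrightarrow> TP \<Omega> (k x) a b (\<xi> x) (y x)" for x
    using Treg_tendsto[OF C2_bounded_planewave \<Omega> _ ab, of "y x" "k x" "\<xi> x"]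
    unfolding TP_def by (cases "y x \<in> \<Omega>") simp_all
qed

text \<open>Fatou's lemma along the radii: \<open>pot2_L1_bound\<close> holds for every radius with
  the same constant, and \<kappa>^2 times the potential is bounded pointwise. The constant is
  independent of the wave vector because only the modulus of the density and its support
  enter.\<close>

lemma TP_L1_bound:
  assumes \<Omega>: "open \<Omega>" "bounded \<Omega>"
  obtains C where "0 \<le> C"
    "\<And>\<kappa> a b \<xi>. a \<in> Basis \<Longrightarrow> b \<in> Basis \<Longrightarrow> integrable lborel (TP \<Omega> \<kappa> a b \<xi>)"
    "\<And>\<kappa> a b \<xi>. a \<in> Basis \<Longrightarrow> b \<in> Basis \<Longrightarrow> (LINT y|lborel. norm (TP \<Omega> \<kappa> a b \<xi> y)) \<le> C * (1 + \<bar>\<kappa>\<bar>) ^ 8"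
proof -
  obtain R' where R': "\<forall>x\<in>\<Omega>. norm x \<le> R'" using \<Omega>(2) unfolding bounded_iff by blast
  define R where "R = max R' 1"
  have R: "0 < R" "\<And>x. x \<in> \<Omega> \<Longrightarrow> norm x \<le> R" using R' by (auto simp: R_def intro: max.coboundedI1)
  have \<Omega>m[measurable]: "\<Omega> \<in> sets borel" using \<Omega> by simp
  obtain C0 where C0: "0 \<le> C0" "\<And>\<kappa> \<delta> h a b. \<lbrakk>0 < \<delta>; \<delta> \<le> 1; h \<in> borel_measurable borel; \<And>z. norm (h z) \<le> 1;
      \<And>z. norm z > R \<Longrightarrow> h z = 0; a \<in> Basis; b \<in> Basis\<rbrakk> \<Longrightarrow>
      (\<integral>\<^sup>+x. indicator (cball 0 R) x * ennreal (norm (pot2 \<kappa> \<delta> a b h x)) \<partial>lborel) \<le> ennreal (C0 * (1 + \<bar>\<kappa>\<bar>) ^ 8)"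
  proof (rule pot2_L1_bound[OF R(1)], goal_cases)
    case (1 C)
    show ?case by (rule that[OF 1(2,3)])
  qed
  define V where "V = measure lborel (cball (0::real^3) R)"
  define J where "J = sing_mass (3 * R)"
  have VJ: "0 \<le> V" "0 \<le> J" unfolding V_def J_def by (simp_all add: sing_mass_nonneg)
  \<comment> \<open>\<open>12 * J * V\<close> is for the potential, bounded on the ball of radius R,
    and \<open>C0\<close> for its second derivatives.\<close>
  define C where "C = 12 * J * V + C0"
  have C: "0 \<le> C" using VJ C0 by (simp add: C_def)
  have nn: "(\<integral>\<^sup>+y. ennreal (norm (TP \<Omega> \<kappa> a b \<xi> y)) \<partial>lborel) \<le> ennreal (C * (1 + \<bar>\<kappa>\<bar>) ^ 8)"
    if ab: "a \<in> Basis" "b \<in> Basis" for \<kappa> a b \<xi>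
  proof -
    let ?h = "\<lambda>z. indicator \<Omega> z * planewave \<xi> z"
    define K where "K = (1 + \<bar>\<kappa>\<bar>) ^ 8"
    have hm: "?h \<in> borel_measurable borel" by measurable
    have h1: "norm (?h z) \<le> 1" for z by (simp add: norm_mult indicator_def)
    have h2: "?h z = 0" if "norm z > R" for z using R(2)[of z] that by (auto simp: indicator_def)
    note n = norm_Basis[OF ab(1)] norm_Basis[OF ab(2)]
    have ab1: "\<bar>a \<bullet> b\<bar> \<le> 1" using Cauchy_Schwarz_ineq2[of a b] n by simp
    have pot: "norm (of_real (\<kappa>\<^sup>2 * (a \<bullet> b)) * pot \<kappa> \<delta> ?h y) \<le> 12 * J * K" if \<delta>: "0 < \<delta>" "\<delta> \<le> 1" and y: "norm y \<le> R" for \<delta> y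
    proof -
      have "norm (pot \<kappa> \<delta> ?h y) \<le> (12 * (1 + \<bar>\<kappa>\<bar>)\<^sup>2) * J + 0 * measure lborel (cball (0::real^3) \<delta>)"
        unfolding pot_def J_def
        by (rule convolution_singular_bound[OF _ _ _ h1 h2])
          (use Greg_singular_bound(2)[OF \<delta> _ n(1)] y R(1) in auto)
      then have "norm (of_real (\<kappa>\<^sup>2 * (a \<bullet> b)) * pot \<kappa> \<delta> ?h y) \<le> (\<kappa>\<^sup>2 * 1) * ((12 * (1 + \<bar>\<kappa>\<bar>)\<^sup>2) * J)"
        unfolding norm_mult norm_of_real abs_mult by (intro mult_mono ab1) auto
      also have "\<dots> = (12 * J) * (\<kappa>\<^sup>2 * (1 + \<bar>\<kappa>\<bar>)\<^sup>2)" by simp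
      also have "\<kappa>\<^sup>2 * (1 + \<bar>\<kappa>\<bar>)\<^sup>2 \<le> (1 + \<bar>\<kappa>\<bar>)\<^sup>2 * (1 + \<bar>\<kappa>\<bar>)\<^sup>2"
        using power_mono[of "\<bar>\<kappa>\<bar>" "1 + \<bar>\<kappa>\<bar>" 2] by (intro mult_right_mono) auto
      also have "\<dots> \<le> K" unfolding K_def power_add[symmetric] by (intro power_increasing) auto
      finally show ?thesis using VJ by (simp add: mult_left_mono)
    qed
    have reg: "(\<integral>\<^sup>+y. ennreal (norm (indicator \<Omega> y * Treg \<kappa> (radii i) a b ?h y)) \<partial>lborel) \<le> ennreal (C * K)" for i
    proof -
      have "(\<integral>\<^sup>+y. ennreal (norm (indicator \<Omega> y * Treg \<kappa> (radii i) a b ?h y)) \<partial>lborel)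
        \<le> (\<integral>\<^sup>+y. (ennreal (12 * J * K) * indicator (cball 0 R) y + indicator (cball 0 R) y * ennreal (norm (pot2 \<kappa> (radii i) a b ?h y))) \<partial>lborel)"
      proof (rule nn_integral_mono)
        fix y
        show "ennreal (norm (indicator \<Omega> y * Treg \<kappa> (radii i) a b ?h y))
          \<le> ennreal (12 * J * K) * indicator (cball 0 R) y + indicator (cball 0 R) y * ennreal (norm (pot2 \<kappa> (radii i) a b ?h y))"
        proof (cases "y \<in> \<Omega>")
          case True
          have "norm (Treg \<kappa> (radii i) a b ?h y) \<le> 12 * J * K + norm (pot2 \<kappa> (radii i) a b ?h y)"
            unfolding Treg_def by (rule norm_triangle_mono[OF pot[OF radii(1,2) R(2)[OF True]] order_refl])
          then have "ennreal (norm (Treg \<kappa> (radii i) a b ?h y)) \<le> ennreal (12 * J * K) + ennreal (norm (pot2 \<kappa> (radii i) a b ?h y))"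
            using VJ by (subst ennreal_plus[symmetric]) (auto simp: K_def simp del: ennreal_plus intro!: ennreal_leI)
          then show ?thesis using True R(2)[OF True] by (simp add: indicator_def)
        qed simp
      qed
      also have "\<dots> = ennreal (12 * J * K) * emeasure lborel (cball (0::real^3) R)
          + (\<integral>\<^sup>+y. indicator (cball 0 R) y * ennreal (norm (pot2 \<kappa> (radii i) a b ?h y)) \<partial>lborel)"
      proof -
        have [measurable]: "cball (0::real^3) R \<in> sets borel" by simp
        have [measurable]: "pot2 \<kappa> (radii i) a b ?h \<in> borel_measurable borel"
          by (rule borel_measurable_continuous_onI[OF continuous_pot2[OF radii(1) n integrable_indicator_planewave[OF \<Omega>]]])
        show ?thesis
          by (subst nn_integral_add, measurable) (simp add: nn_integral_cmult_indicator)
      qed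
      also have "\<dots> \<le> ennreal (12 * J * K) * ennreal V + ennreal (C0 * K)"
      proof -
        have "emeasure lborel (cball (0::real^3) R) \<noteq> \<infinity>"
          using emeasure_lborel_cball_finite[of "0::real^3" R] by (rule less_imp_neq)
        then have "emeasure lborel (cball (0::real^3) R) = ennreal V"
          unfolding V_def by (intro emeasure_eq_ennreal_measure) simp
        then show ?thesis
          unfolding K_def by (simp only:) (intro add_left_mono C0(2)[OF radii(1,2) hm h1 h2 ab])
      qed
      also have "\<dots> = ennreal (C * K)"
        using VJ C0(1) by (simp add: C_def K_def ennreal_mult[symmetric] ennreal_plus[symmetric] algebra_simps del: ennreal_plus)
      finally show ?thesis .
    qed
    \<comment> \<open>Pointwise convergence allows the limit integrand to be written as a liminf,
      the form in which Fatou's lemma applies.\<close>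
    have lim: "ennreal (norm (TP \<Omega> \<kappa> a b \<xi> y)) = liminf (\<lambda>i. ennreal (norm (indicator \<Omega> y * Treg \<kappa> (radii i) a b ?h y)))" for y
    proof -
      have "(\<lambda>i. indicator \<Omega> y * Treg \<kappa> (radii i) a b ?h y) \<longlonglongrightarrow> TP \<Omega> \<kappa> a b \<xi> y"
        using Treg_tendsto[OF C2_bounded_planewave \<Omega> _ ab, of y \<kappa> \<xi>] unfolding TP_def by (cases "y \<in> \<Omega>") simp_all
      then have "(\<lambda>i. ennreal (norm (indicator \<Omega> y * Treg \<kappa> (radii i) a b ?h y))) \<longlonglongrightarrow> ennreal (norm (TP \<Omega> \<kappa> a b \<xi> y))"
        by (intro tendsto_ennrealI tendsto_norm)
      then show ?thesis by (rule lim_imp_Liminf[OF sequentially_bot, symmetric])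
    qed
    have "(\<integral>\<^sup>+y. ennreal (norm (TP \<Omega> \<kappa> a b \<xi> y)) \<partial>lborel) \<le> liminf (\<lambda>i. \<integral>\<^sup>+y. ennreal (norm (indicator \<Omega> y * Treg \<kappa> (radii i) a b ?h y)) \<partial>lborel)"
      unfolding lim
    proof (rule nn_integral_liminf)
      fix i
      have [measurable]: "(\<lambda>y. Treg \<kappa> (radii i) a b ?h y) \<in> borel_measurable lborel"
        using Treg_measurable[OF radii(1) ab \<Omega>, of "\<lambda>_. \<kappa>" lborel "\<lambda>_. \<xi>" "\<lambda>y. y"] by simp
      show "(\<lambda>y. ennreal (norm (indicator \<Omega> y * Treg \<kappa> (radii i) a b ?h y))) \<in> borel_measurable lborel"
        by measurable
    qed
    also have "\<dots> \<le> ennreal (C * K)"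
      using reg by (intro Liminf_le) (auto intro!: always_eventually)
    finally show ?thesis by (simp add: K_def)
  qed
  have meas: "TP \<Omega> \<kappa> a b \<xi> \<in> borel_measurable lborel" if "a \<in> Basis" "b \<in> Basis" for \<kappa> a b \<xi>
    using TP_measurable[OF that \<Omega>, of "\<lambda>_. \<kappa>" lborel "\<lambda>_. \<xi>" "\<lambda>y. y"] by simp
  have int: "integrable lborel (TP \<Omega> \<kappa> a b \<xi>)" if "a \<in> Basis" "b \<in> Basis" for \<kappa> a b \<xi>
    using nn[OF that, of \<kappa> \<xi>] meas[OF that] by (auto simp: integrable_iff_bounded intro: le_less_trans)
  have "(LINT y|lborel. norm (TP \<Omega> \<kappa> a b \<xi> y)) \<le> C * (1 + \<bar>\<kappa>\<bar>) ^ 8" if ab: "a \<in> Basis" "b \<in> Basis" for \<kappa> a b \<xi>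
  proof -
    have "ennreal (LINT y|lborel. norm (TP \<Omega> \<kappa> a b \<xi> y)) \<le> ennreal (C * (1 + \<bar>\<kappa>\<bar>) ^ 8)"
      using nn[OF ab, of \<kappa> \<xi>] nn_integral_eq_integral[OF integrable_norm[OF int[OF ab, of \<kappa> \<xi>]]] by simp
    then show ?thesis using C by (subst (asm) ennreal_le_iff) auto
  qed
  with C int show thesis by (rule that)
qed

text \<open>For a fixed radius the kernel is bounded, and Fubini and Fourier inversion give the
  formula. The limit of small radii is taken under the k-integral: at the interior point y the
  regularised values grow at most quadratically in the wave vector, uniformly in the radius, and the
  transform of a test function absorbs this growth.\<close>

lemma Tgreen_fourier_synthesis:
  assumes \<phi>: "test_function \<phi>" "tsupp \<phi> \<subseteq> \<Omega>" and \<Omega>: "open \<Omega>" "bounded \<Omega>"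
    and ab: "a \<in> Basis" "b \<in> Basis" and y: "y \<in> \<Omega>"
  shows "(LINT k|lborel. fourier \<phi> k * TP \<Omega> \<kappa> a b (k + \<zeta>) y)
    = of_real ((2 * pi) ^ 3) * Tgreen \<kappa> a b (\<lambda>z. \<phi> z * planewave \<zeta> z) y"
proof -
  note [measurable] = test_function_measurable[OF \<phi>(1)]
  have \<Omega>m[measurable]: "\<Omega> \<in> sets borel" using \<Omega> by simp
  let ?h = "\<lambda>\<xi> z. indicator \<Omega> z * planewave \<xi> z"
  obtain e where e: "0 < e" "e \<le> 1" "\<And>\<delta>. 0 < \<delta> \<Longrightarrow> \<delta> \<le> e \<Longrightarrow> cball y (2 * \<delta>) \<subseteq> \<Omega>"
    using interior_radius[OF \<Omega>(1) y] by blast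
  obtain N where N: "\<And>n. n \<ge> N \<Longrightarrow> radii n < e"
    using order_tendstoD(2)[OF radii(3) e(1)] unfolding eventually_sequentially by blast
  \<comment> \<open>The first radii are skipped, so that every remaining ball lies in \<Omega> and
    \<open>Tgreen_Treg_diff\<close> applies for all n.\<close>
  define \<delta> where "\<delta> n = radii (n + N)" for n
  have \<delta>: "0 < \<delta> n" "\<delta> n \<le> 1" "cball y (2 * \<delta> n) \<subseteq> \<Omega>" for n
    unfolding \<delta>_def using N[of "n + N"] by (intro radii e(3) less_imp_le; simp)+
  have lim: "(\<lambda>n. Treg \<kappa> (\<delta> n) a b (\<lambda>z. indicator \<Omega> z * g z) y) \<longlonglongrightarrow> Tgreen \<kappa> a b (\<lambda>z. indicator \<Omega> z * g z) y"
    if "C2_bounded g g1 g2 B" for g g1 g2 B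
    unfolding \<delta>_def by (rule LIMSEQ_ignore_initial_segment[OF Treg_tendsto[OF that \<Omega> y ab]])
  define m where "m \<delta> = (LINT w|lborel. norm (Gdiff \<kappa> \<delta> w))" for \<delta>
  have "(\<lambda>n. m (\<delta> n)) \<longlonglongrightarrow> 0"
    unfolding \<delta>_def m_def by (rule LIMSEQ_ignore_initial_segment[OF Gdiff_mass_tendsto])
  then have "Bseq (\<lambda>n. m (\<delta> n))" by (rule convergent_imp_Bseq[OF convergentI])
  then obtain M where "\<forall>n. norm (m (\<delta> n)) \<le> M" unfolding Bseq_def by auto
  then have M: "norm (m (\<delta> n)) \<le> M" for n by simp
  have m0: "0 \<le> m \<delta>" for \<delta> unfolding m_def by simp
  define L where "L = (LINT z|lborel. (\<kappa>\<^sup>2 + 1) * Cbound \<kappa> e * indicator \<Omega> z)"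
  define D where "D = \<bar>L\<bar> + (\<kappa>\<^sup>2 + 1) * (m e + M)"
  have \<Omega>i: "integrable lborel (\<lambda>z. c * indicator \<Omega> z :: real)" for c
    using emeasure_bounded_finite[OF \<Omega>(2)] by (intro integrable_mult_right integrable_real_indicator) auto
  \<comment> \<open>\<open>Cbound\<close> would blow up along the radii. Each regularised value is
    instead compared, through the singular value, with the one at the fixed radius
    \<open>e\<close>.\<close>
  have bd: "norm (Treg \<kappa> (\<delta> n) a b (?h \<xi>) y) \<le> D * (1 + (norm \<xi>)\<^sup>2)" for n \<xi>
  proof -
    have "norm (Treg \<kappa> e a b (?h \<xi>) y) \<le> L"
      unfolding Treg_eq_integral(1)[OF e(1) ab integrable_indicator_planewave[OF \<Omega>]] L_def
    proof (rule order_trans[OF integral_norm_bound integral_mono])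
      show "integrable lborel (\<lambda>z. norm (Kreg \<kappa> e a b (y - z) * ?h \<xi> z))"
        by (intro integrable_norm Treg_eq_integral(2)[OF e(1) ab integrable_indicator_planewave[OF \<Omega>]])
      show "norm (Kreg \<kappa> e a b (y - z) * ?h \<xi> z) \<le> (\<kappa>\<^sup>2 + 1) * Cbound \<kappa> e * indicator \<Omega> z" for z
        using norm_Kreg[OF e(1) ab, of \<kappa> "y - z"] by (simp add: norm_mult indicator_def)
    qed (rule \<Omega>i)
    then have a: "norm (Treg \<kappa> e a b (?h \<xi>) y) \<le> \<bar>L\<bar> * (1 + (norm \<xi>)\<^sup>2)"
      using mult_left_mono[of 1 "1 + (norm \<xi>)\<^sup>2" "\<bar>L\<bar>"] by simp
    have b: "norm (Tgreen \<kappa> a b (?h \<xi>) y - Treg \<kappa> e a b (?h \<xi>) y) \<le> (\<kappa>\<^sup>2 + 1) * m e * (1 + (norm \<xi>)\<^sup>2)"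
      using Tgreen_Treg_diff[OF C2_bounded_planewave[of \<xi>] \<Omega> e(1,2) e(3)[OF e(1) order_refl] ab, of \<kappa>] by (simp add: m_def mult_ac)
    have c: "norm (Tgreen \<kappa> a b (?h \<xi>) y - Treg \<kappa> (\<delta> n) a b (?h \<xi>) y) \<le> (\<kappa>\<^sup>2 + 1) * m (\<delta> n) * (1 + (norm \<xi>)\<^sup>2)"
      using Tgreen_Treg_diff[OF C2_bounded_planewave[of \<xi>] \<Omega> \<delta> ab, of \<kappa>] by (simp add: m_def mult_ac)
    also have "\<dots> \<le> (\<kappa>\<^sup>2 + 1) * M * (1 + (norm \<xi>)\<^sup>2)"
      using M[of n] by (intro mult_right_mono mult_left_mono) auto
    finally have c: "norm (Tgreen \<kappa> a b (?h \<xi>) y - Treg \<kappa> (\<delta> n) a b (?h \<xi>) y) \<le> (\<kappa>\<^sup>2 + 1) * M * (1 + (norm \<xi>)\<^sup>2)" .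
    have "norm (Treg \<kappa> (\<delta> n) a b (?h \<xi>) y) \<le> norm (Treg \<kappa> e a b (?h \<xi>) y) + norm (Tgreen \<kappa> a b (?h \<xi>) y - Treg \<kappa> e a b (?h \<xi>) y)
        + norm (Tgreen \<kappa> a b (?h \<xi>) y - Treg \<kappa> (\<delta> n) a b (?h \<xi>) y)"
      using norm_triangle_ineq4[of "Treg \<kappa> e a b (?h \<xi>) y + (Tgreen \<kappa> a b (?h \<xi>) y - Treg \<kappa> e a b (?h \<xi>) y)" "Tgreen \<kappa> a b (?h \<xi>) y - Treg \<kappa> (\<delta> n) a b (?h \<xi>) y"]
        norm_triangle_ineq[of "Treg \<kappa> e a b (?h \<xi>) y" "Tgreen \<kappa> a b (?h \<xi>) y - Treg \<kappa> e a b (?h \<xi>) y"] by simp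
    also have "\<dots> \<le> \<bar>L\<bar> * (1 + (norm \<xi>)\<^sup>2) + (\<kappa>\<^sup>2 + 1) * m e * (1 + (norm \<xi>)\<^sup>2) + (\<kappa>\<^sup>2 + 1) * M * (1 + (norm \<xi>)\<^sup>2)"
      by (intro add_mono a b c)
    also have "\<dots> = D * (1 + (norm \<xi>)\<^sup>2)" by (simp add: D_def algebra_simps)
    finally show ?thesis .
  qed
  have D: "0 \<le> D" using bd[of 0 0] order_trans[OF norm_ge_zero] by fastforce
  \<comment> \<open>Trades the weight at the shifted wave vector for the weight at k, at the price
    of a constant depending on \<zeta>.\<close>
  have shift: "1 + (norm (k + \<zeta>))\<^sup>2 \<le> 2 * (1 + (norm \<zeta>)\<^sup>2) * (1 + (norm k)\<^sup>2)" for k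
  proof -
    have "(norm (k + \<zeta>))\<^sup>2 \<le> (norm k + norm \<zeta>)\<^sup>2" by (intro power_mono norm_triangle_ineq) simp
    also have "\<dots> \<le> 2 * (norm k)\<^sup>2 + 2 * (norm \<zeta>)\<^sup>2"
      using zero_le_power2[of "norm k - norm \<zeta>"] by (simp add: power2_sum power2_diff)
    finally have "1 + (norm (k + \<zeta>))\<^sup>2 \<le> 1 + 2 * (norm k)\<^sup>2 + 2 * (norm \<zeta>)\<^sup>2" by simp
    also have "\<dots> \<le> 2 * (1 + (norm \<zeta>)\<^sup>2) * (1 + (norm k)\<^sup>2)" by (simp add: algebra_simps)
    finally show ?thesis .
  qed
  note FI = test_function_fourier_integrable[OF \<phi>(1)]
  have meas: "(\<lambda>k. Treg \<kappa> (\<delta> n) a b (?h (k + \<zeta>)) y) \<in> borel_measurable lborel" for n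
    using Treg_measurable[OF \<delta>(1) ab \<Omega>, of "\<lambda>_. \<kappa>" lborel "\<lambda>k. k + \<zeta>" "\<lambda>_. y"] by simp
  have 1: "(\<lambda>n. LINT k|lborel. fourier \<phi> k * Treg \<kappa> (\<delta> n) a b (?h (k + \<zeta>)) y) \<longlonglongrightarrow> (LINT k|lborel. fourier \<phi> k * TP \<Omega> \<kappa> a b (k + \<zeta>) y)"
  proof (rule integral_dominated_convergence[OF _ _ integrable_mult_right[where c="D * (2 * (1 + (norm \<zeta>)\<^sup>2))", OF FI(1)]])
    show "(\<lambda>k. fourier \<phi> k * TP \<Omega> \<kappa> a b (k + \<zeta>) y) \<in> borel_measurable lborel"
      using TP_measurable[OF ab \<Omega>, of "\<lambda>_. \<kappa>" lborel "\<lambda>k. k + \<zeta>" "\<lambda>_. y"] by (intro borel_measurable_times) auto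
    show "(\<lambda>k. fourier \<phi> k * Treg \<kappa> (\<delta> n) a b (?h (k + \<zeta>)) y) \<in> borel_measurable lborel" for n
      using meas[of n] by (intro borel_measurable_times) auto
    show "AE k in lborel. (\<lambda>n. fourier \<phi> k * Treg \<kappa> (\<delta> n) a b (?h (k + \<zeta>)) y) \<longlonglongrightarrow> fourier \<phi> k * TP \<Omega> \<kappa> a b (k + \<zeta>) y"
      using lim[OF C2_bounded_planewave] y by (intro AE_I2 tendsto_mult tendsto_const) (simp add: TP_def)
    show "AE k in lborel. norm (fourier \<phi> k * Treg \<kappa> (\<delta> n) a b (?h (k + \<zeta>)) y) \<le> D * (2 * (1 + (norm \<zeta>)\<^sup>2)) * ((1 + (norm k)\<^sup>2) * norm (fourier \<phi> k))" for n
    proof (rule AE_I2)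
      fix k
      have "norm (Treg \<kappa> (\<delta> n) a b (?h (k + \<zeta>)) y) \<le> D * (2 * (1 + (norm \<zeta>)\<^sup>2) * (1 + (norm k)\<^sup>2))"
        by (rule order_trans[OF bd]) (intro mult_left_mono shift D)
      then have "norm (fourier \<phi> k) * norm (Treg \<kappa> (\<delta> n) a b (?h (k + \<zeta>)) y) \<le> norm (fourier \<phi> k) * (D * (2 * (1 + (norm \<zeta>)\<^sup>2) * (1 + (norm k)\<^sup>2)))"
        by (rule mult_left_mono) simp
      then show "norm (fourier \<phi> k * Treg \<kappa> (\<delta> n) a b (?h (k + \<zeta>)) y) \<le> D * (2 * (1 + (norm \<zeta>)\<^sup>2)) * ((1 + (norm k)\<^sup>2) * norm (fourier \<phi> k))"
        unfolding norm_mult by (simp only: mult_ac)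
    qed
  qed
  obtain B\<phi> where B\<phi>: "C2_bounded \<phi> (\<lambda>a. dir_deriv a \<phi>) (\<lambda>a b. dir_deriv b (dir_deriv a \<phi>)) B\<phi>"
    using C2_bounded_test_function[OF \<phi>(1)] by blast
  note g = C2_bounded_mult[OF B\<phi> C2_bounded_planewave[of \<zeta>]]
  have ind: "indicator \<Omega> z * (\<phi> z * planewave \<zeta> z) = \<phi> z * planewave \<zeta> z" for z
    using \<phi>(2) tsupp_vanish[of z \<phi>] by (cases "z \<in> \<Omega>") auto
  have 2: "(LINT k|lborel. fourier \<phi> k * Treg \<kappa> (\<delta> n) a b (?h (k + \<zeta>)) y)
      = of_real ((2 * pi) ^ 3) * Treg \<kappa> (\<delta> n) a b (\<lambda>z. \<phi> z * planewave \<zeta> z) y" for n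
  proof -
    have Km: "(\<lambda>p. Kreg \<kappa> (\<delta> n) a b (y - snd p)) \<in> borel_measurable (lborel \<Otimes>\<^sub>M lborel)"
      by (intro Kreg_measurable[OF \<delta>(1)]) measurable
    have "(LINT k|lborel. fourier \<phi> k * Treg \<kappa> (\<delta> n) a b (?h (k + \<zeta>)) y)
      = (LINT k|lborel. LINT z|lborel. fourier \<phi> k * (Kreg \<kappa> (\<delta> n) a b (y - z) * ?h (k + \<zeta>) z))"
      unfolding Treg_eq_integral(1)[OF \<delta>(1) ab integrable_indicator_planewave[OF \<Omega>]] integral_mult_right_zero ..
    also have "\<dots> = (LINT z|lborel. LINT k|lborel. fourier \<phi> k * (Kreg \<kappa> (\<delta> n) a b (y - z) * ?h (k + \<zeta>) z))"
    proof (rule Fubini_product_bound[where a="fourier \<phi>" and b="\<lambda>z. of_real ((\<kappa>\<^sup>2 + 1) * Cbound \<kappa> (\<delta> n) * indicator \<Omega> z)"])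
      have "(\<lambda>p. fourier \<phi> (fst p) * (Kreg \<kappa> (\<delta> n) a b (y - snd p) * (indicator \<Omega> (snd p) * planewave (fst p + \<zeta>) (snd p)))) \<in> borel_measurable (lborel \<Otimes>\<^sub>M lborel)"
        using Km by measurable
      then show "(\<lambda>(k, z). fourier \<phi> k * (Kreg \<kappa> (\<delta> n) a b (y - z) * ?h (k + \<zeta>) z)) \<in> borel_measurable (lborel \<Otimes>\<^sub>M lborel)"
        by (simp add: case_prod_beta)
      show "norm (fourier \<phi> k * (Kreg \<kappa> (\<delta> n) a b (y - z) * ?h (k + \<zeta>) z)) \<le> norm (fourier \<phi> k) * norm (complex_of_real ((\<kappa>\<^sup>2 + 1) * Cbound \<kappa> (\<delta> n) * indicator \<Omega> z))" for k z
        unfolding norm_mult[of "fourier \<phi> k"] norm_of_real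
        using order_trans[OF norm_Kreg[OF \<delta>(1) ab, of \<kappa> n "y - z"] abs_ge_self]
        by (intro mult_left_mono) (auto simp: norm_mult indicator_def)
      show "integrable lborel (\<lambda>z. complex_of_real ((\<kappa>\<^sup>2 + 1) * Cbound \<kappa> (\<delta> n) * indicator \<Omega> z))"
        by (rule integrable_of_real[OF \<Omega>i])
    qed (rule FI(2))
    also have "(\<lambda>z. LINT k|lborel. fourier \<phi> k * (Kreg \<kappa> (\<delta> n) a b (y - z) * ?h (k + \<zeta>) z))
      = (\<lambda>z. of_real ((2 * pi) ^ 3) * (Kreg \<kappa> (\<delta> n) a b (y - z) * (\<phi> z * planewave \<zeta> z)))"
    proof
      fix z
      have "fourier \<phi> k * (Kreg \<kappa> (\<delta> n) a b (y - z) * ?h (k + \<zeta>) z) = (Kreg \<kappa> (\<delta> n) a b (y - z) * ?h \<zeta> z) * (fourier \<phi> k * planewave k z)" for k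
        unfolding planewave_mult[symmetric] by (simp only: mult_ac)
      moreover have "(LINT k|lborel. fourier \<phi> k * planewave k z) = of_real ((2 * pi) ^ 3) * \<phi> z"
        using test_function_fourier_inversion[OF \<phi>(1), of z] by simp
      ultimately have "(LINT k|lborel. fourier \<phi> k * (Kreg \<kappa> (\<delta> n) a b (y - z) * ?h (k + \<zeta>) z))
        = (Kreg \<kappa> (\<delta> n) a b (y - z) * ?h \<zeta> z) * (of_real ((2 * pi) ^ 3) * \<phi> z)"
        by (simp only: integral_mult_right_zero)
      also have "\<dots> = of_real ((2 * pi) ^ 3) * (Kreg \<kappa> (\<delta> n) a b (y - z) * (indicator \<Omega> z * (\<phi> z * planewave \<zeta> z)))"
        by (simp only: mult_ac)
      finally show "(LINT k|lborel. fourier \<phi> k * (Kreg \<kappa> (\<delta> n) a b (y - z) * ?h (k + \<zeta>) z))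
        = of_real ((2 * pi) ^ 3) * (Kreg \<kappa> (\<delta> n) a b (y - z) * (\<phi> z * planewave \<zeta> z))"
        unfolding ind .
    qed
    also have "(LINT z|lborel. of_real ((2 * pi) ^ 3) * (Kreg \<kappa> (\<delta> n) a b (y - z) * (\<phi> z * planewave \<zeta> z)))
      = of_real ((2 * pi) ^ 3) * Treg \<kappa> (\<delta> n) a b (\<lambda>z. \<phi> z * planewave \<zeta> z) y"
      unfolding Treg_eq_integral(1)[OF \<delta>(1) ab integrable_mult_planewave[OF test_function_integrable[OF \<phi>(1)]]] by simp
    finally show ?thesis .
  qed
  have "(\<lambda>n. LINT k|lborel. fourier \<phi> k * Treg \<kappa> (\<delta> n) a b (?h (k + \<zeta>)) y) \<longlonglongrightarrow> of_real ((2 * pi) ^ 3) * Tgreen \<kappa> a b (\<lambda>z. \<phi> z * planewave \<zeta> z) y"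
    unfolding 2 using tendsto_mult[OF tendsto_const lim[OF g]] unfolding ind .
  then show ?thesis using 1 LIMSEQ_unique by blast
qed

section \<open>Amplitudes depending on the frequency\<close>

text \<open>Families of functions of the frequency variable \<open>\<kappa>\<close> that are \<open>C\<^sup>2\<close> with polynomial growth,
  uniformly with respect to a parameter weighted by \<open>\<beta>\<close>.\<close>

definition amp_witness ::
  "'w measure \<Rightarrow> ('w \<Rightarrow> real) \<Rightarrow> nat \<Rightarrow> real \<Rightarrow> (real \<Rightarrow> 'w \<Rightarrow> complex) \<Rightarrow> (real \<Rightarrow> 'w \<Rightarrow> complex) \<Rightarrow> (real \<Rightarrow> 'w \<Rightarrow> complex) \<Rightarrow> bool" where
  "amp_witness M \<beta> n C K K1 K2 \<longleftrightarrow> 0 \<le> C \<and>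
    (\<forall>w\<in>space M. 0 \<le> \<beta> w \<and> (\<forall>\<kappa>.
      ((\<lambda>\<kappa>. K \<kappa> w) has_vector_derivative K1 \<kappa> w) (at \<kappa>) \<and>
      ((\<lambda>\<kappa>. K1 \<kappa> w) has_vector_derivative K2 \<kappa> w) (at \<kappa>) \<and> isCont (\<lambda>\<kappa>. K2 \<kappa> w) \<kappa> \<and>
      norm (K \<kappa> w) \<le> C * (1 + \<bar>\<kappa>\<bar>) ^ n * \<beta> w \<and> norm (K1 \<kappa> w) \<le> C * (1 + \<bar>\<kappa>\<bar>) ^ n * \<beta> w \<and>
      norm (K2 \<kappa> w) \<le> C * (1 + \<bar>\<kappa>\<bar>) ^ n * \<beta> w)) \<and>
    (\<forall>\<kappa>. K \<kappa> \<in> borel_measurable M \<and> K1 \<kappa> \<in> borel_measurable M \<and> K2 \<kappa> \<in> borel_measurable M)"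

definition amp_family :: "'w measure \<Rightarrow> ('w \<Rightarrow> real) \<Rightarrow> nat \<Rightarrow> (real \<Rightarrow> 'w \<Rightarrow> complex) \<Rightarrow> bool" where
  "amp_family M \<beta> n K \<longleftrightarrow> (\<exists>C K1 K2. amp_witness M \<beta> n C K K1 K2)"

lemma amp_witnessD:
  assumes "amp_witness M \<beta> n C K K1 K2"
  shows "0 \<le> C" "w \<in> space M \<Longrightarrow> 0 \<le> \<beta> w"
    "w \<in> space M \<Longrightarrow> ((\<lambda>\<kappa>. K \<kappa> w) has_vector_derivative K1 \<kappa> w) (at \<kappa>)"
    "w \<in> space M \<Longrightarrow> ((\<lambda>\<kappa>. K1 \<kappa> w) has_vector_derivative K2 \<kappa> w) (at \<kappa>)"
    "w \<in> space M \<Longrightarrow> isCont (\<lambda>\<kappa>. K2 \<kappa> w) \<kappa>"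
    "w \<in> space M \<Longrightarrow> norm (K \<kappa> w) \<le> C * (1 + \<bar>\<kappa>\<bar>) ^ n * \<beta> w"
    "w \<in> space M \<Longrightarrow> norm (K1 \<kappa> w) \<le> C * (1 + \<bar>\<kappa>\<bar>) ^ n * \<beta> w"
    "w \<in> space M \<Longrightarrow> norm (K2 \<kappa> w) \<le> C * (1 + \<bar>\<kappa>\<bar>) ^ n * \<beta> w"
    "K \<kappa> \<in> borel_measurable M" "K1 \<kappa> \<in> borel_measurable M" "K2 \<kappa> \<in> borel_measurable M"
  using assms unfolding amp_witness_def by auto

lemma amp_family_const:
  assumes "c \<in> borel_measurable M" "\<And>w. w \<in> space M \<Longrightarrow> norm (c w) \<le> \<beta> w"
  shows "amp_family M \<beta> 0 (\<lambda>\<kappa>. c)"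
proof -
  have "0 \<le> \<beta> w" if "w \<in> space M" for w using order_trans[OF norm_ge_zero assms(2)[OF that]] .
  then have "amp_witness M \<beta> 0 1 (\<lambda>\<kappa>. c) (\<lambda>\<kappa> w. 0) (\<lambda>\<kappa> w. 0)"
    unfolding amp_witness_def using assms by auto
  then show ?thesis unfolding amp_family_def by blast
qed

lemma amp_family_param: "amp_family M (\<lambda>_. 1) 1 (\<lambda>\<kappa> w. of_real \<kappa>)"
proof -
  have "((\<lambda>\<kappa>. complex_of_real \<kappa>) has_vector_derivative 1) (at \<kappa>)" for \<kappa>
    using has_vector_derivative_of_real[of "\<lambda>x. x" 1 "at \<kappa>"] by simp
  then have "amp_witness M (\<lambda>_. 1) 1 1 (\<lambda>\<kappa> w. of_real \<kappa>) (\<lambda>\<kappa> w. 1) (\<lambda>\<kappa> w. 0)"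
    unfolding amp_witness_def by auto
  then show ?thesis unfolding amp_family_def by blast
qed

text \<open>Each derivative in \<kappa> brings down a factor \<open>s w\<close>, so a bound on
  \<open>s\<close> is what keeps the weight constant.\<close>

lemma amp_family_exp:
  assumes s[measurable]: "s \<in> borel_measurable M" and S: "\<And>w. w \<in> space M \<Longrightarrow> \<bar>s w\<bar> \<le> S"
  shows "amp_family M (\<lambda>_. 1) 0 (\<lambda>\<kappa> w. exp (\<i> * of_real (\<kappa> * s w)))"
proof -
  let ?e = "\<lambda>\<kappa> w. exp (\<i> * of_real (\<kappa> * s w))"
  have d: "((\<lambda>\<kappa>. ?e \<kappa> w) has_vector_derivative \<i> * of_real (s w) * ?e \<kappa> w) (at \<kappa>)" for w \<kappa>
    using exp_scaleR_has_vector_derivative_right[of "\<i> * of_real (s w)" \<kappa> UNIV]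
    by (simp add: scaleR_conv_of_real mult_ac)
  have d2: "((\<lambda>\<kappa>. \<i> * of_real (s w) * ?e \<kappa> w) has_vector_derivative (\<i> * of_real (s w)) * (\<i> * of_real (s w) * ?e \<kappa> w)) (at \<kappa>)" for w \<kappa>
    by (intro has_vector_derivative_mult_right d)
  define C where "C = 1 + \<bar>S\<bar> + \<bar>S\<bar> * \<bar>S\<bar>"
  have S1: "\<bar>s w\<bar> \<le> \<bar>S\<bar>" if "w \<in> space M" for w
    using S[OF that] by linarith
  have S': "\<bar>s w\<bar> \<le> \<bar>S\<bar>" "\<bar>s w\<bar> * \<bar>s w\<bar> \<le> \<bar>S\<bar> * \<bar>S\<bar>" if "w \<in> space M" for w
    using S1[OF that] by (auto simp only: intro!: mult_mono abs_ge_zero)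
  have C: "1 \<le> C" "\<bar>s w\<bar> \<le> C" "\<bar>s w\<bar> * \<bar>s w\<bar> \<le> C" if "w \<in> space M" for w
    using S'[OF that] unfolding C_def by (auto simp: add_increasing2)
  have C0: "0 \<le> C" unfolding C_def by simp
  have "amp_witness M (\<lambda>_. 1) 0 C ?e (\<lambda>\<kappa> w. \<i> * of_real (s w) * ?e \<kappa> w) (\<lambda>\<kappa> w. (\<i> * of_real (s w)) * (\<i> * of_real (s w) * ?e \<kappa> w))"
    unfolding amp_witness_def
  proof (intro conjI ballI allI d d2 C0)
    fix \<kappa> w assume w: "w \<in> space M"
    show "norm (?e \<kappa> w) \<le> C * (1 + \<bar>\<kappa>\<bar>) ^ 0 * 1"
      "norm (\<i> * of_real (s w) * ?e \<kappa> w) \<le> C * (1 + \<bar>\<kappa>\<bar>) ^ 0 * 1"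
      "norm ((\<i> * of_real (s w)) * (\<i> * of_real (s w) * ?e \<kappa> w)) \<le> C * (1 + \<bar>\<kappa>\<bar>) ^ 0 * 1"
      using C[OF w] by (simp_all add: norm_mult)
    show "isCont (\<lambda>\<kappa>. (\<i> * of_real (s w)) * (\<i> * of_real (s w) * ?e \<kappa> w)) \<kappa>"
      by (intro continuous_intros)
  qed (simp, measurable)
  then show ?thesis unfolding amp_family_def by blast
qed

lemma amp_family_mult:
  assumes "amp_family M \<beta> m K" "amp_family M \<gamma> n L"
  shows "amp_family M (\<lambda>w. \<beta> w * \<gamma> w) (m + n) (\<lambda>\<kappa> w. K \<kappa> w * L \<kappa> w)"
proof -
  obtain A K1 K2 where K: "amp_witness M \<beta> m A K K1 K2" using assms(1) unfolding amp_family_def by blast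
  obtain B L1 L2 where L: "amp_witness M \<gamma> n B L L1 L2" using assms(2) unfolding amp_family_def by blast
  note K = amp_witnessD[OF K] and L = amp_witnessD[OF L]
  let ?D1 = "\<lambda>\<kappa> w. K \<kappa> w * L1 \<kappa> w + K1 \<kappa> w * L \<kappa> w"
  let ?D2 = "\<lambda>\<kappa> w. (K \<kappa> w * L2 \<kappa> w + K1 \<kappa> w * L1 \<kappa> w) + (K1 \<kappa> w * L1 \<kappa> w + K2 \<kappa> w * L \<kappa> w)"
  have AB: "0 \<le> A * B" using K(1) L(1) by simp
  have "amp_witness M (\<lambda>w. \<beta> w * \<gamma> w) (m + n) (4 * (A * B)) (\<lambda>\<kappa> w. K \<kappa> w * L \<kappa> w) ?D1 ?D2"
    unfolding amp_witness_def
  proof (intro conjI ballI allI)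
    fix w \<kappa> assume w: "w \<in> space M"
    have iso: "isCont (\<lambda>\<kappa>. K \<kappa> w) \<kappa>" "isCont (\<lambda>\<kappa>. K1 \<kappa> w) \<kappa>" "isCont (\<lambda>\<kappa>. L \<kappa> w) \<kappa>" "isCont (\<lambda>\<kappa>. L1 \<kappa> w) \<kappa>"
      using has_vector_derivative_continuous[OF K(3)[OF w]] has_vector_derivative_continuous[OF K(4)[OF w]]
        has_vector_derivative_continuous[OF L(3)[OF w]] has_vector_derivative_continuous[OF L(4)[OF w]] by auto
    show bg: "0 \<le> \<beta> w * \<gamma> w" using K(2)[OF w] L(2)[OF w] by simp
    show "((\<lambda>\<kappa>. K \<kappa> w * L \<kappa> w) has_vector_derivative ?D1 \<kappa> w) (at \<kappa>)"
      by (intro has_vector_derivative_mult K L w)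
    show "((\<lambda>\<kappa>. ?D1 \<kappa> w) has_vector_derivative ?D2 \<kappa> w) (at \<kappa>)"
      by (intro has_vector_derivative_add has_vector_derivative_mult K L w)
    show "isCont (\<lambda>\<kappa>. ?D2 \<kappa> w) \<kappa>"
      by (intro continuous_intros iso K(5) L(5) w)
    define X where "X = A * B * (1 + \<bar>\<kappa>\<bar>) ^ (m + n) * (\<beta> w * \<gamma> w)"
    have X: "0 \<le> X" unfolding X_def using AB bg by simp
    have p: "norm (x * y) \<le> X" if "norm x \<le> A * (1 + \<bar>\<kappa>\<bar>) ^ m * \<beta> w" "norm y \<le> B * (1 + \<bar>\<kappa>\<bar>) ^ n * \<gamma> w" for x y :: complex
    proof -
      have "norm (x * y) \<le> (A * (1 + \<bar>\<kappa>\<bar>) ^ m * \<beta> w) * (B * (1 + \<bar>\<kappa>\<bar>) ^ n * \<gamma> w)"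
        unfolding norm_mult using that order_trans[OF norm_ge_zero that(1)] by (intro mult_mono) auto
      also have "\<dots> = X" by (simp add: X_def power_add mult_ac)
      finally show ?thesis .
    qed
    have e: "4 * (A * B) * (1 + \<bar>\<kappa>\<bar>) ^ (m + n) * (\<beta> w * \<gamma> w) = 4 * X" by (simp add: X_def mult_ac)
    have q: "norm (K \<kappa> w * L \<kappa> w) \<le> X" "norm (K \<kappa> w * L1 \<kappa> w) \<le> X" "norm (K1 \<kappa> w * L \<kappa> w) \<le> X"
      "norm (K \<kappa> w * L2 \<kappa> w) \<le> X" "norm (K1 \<kappa> w * L1 \<kappa> w) \<le> X" "norm (K2 \<kappa> w * L \<kappa> w) \<le> X"
      by (intro p K L w)+
    show "norm (K \<kappa> w * L \<kappa> w) \<le> 4 * (A * B) * (1 + \<bar>\<kappa>\<bar>) ^ (m + n) * (\<beta> w * \<gamma> w)"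
      unfolding e using q X by linarith
    show "norm (?D1 \<kappa> w) \<le> 4 * (A * B) * (1 + \<bar>\<kappa>\<bar>) ^ (m + n) * (\<beta> w * \<gamma> w)"
      unfolding e using norm_triangle_mono[OF q(2,3)] X by linarith
    show "norm (?D2 \<kappa> w) \<le> 4 * (A * B) * (1 + \<bar>\<kappa>\<bar>) ^ (m + n) * (\<beta> w * \<gamma> w)"
      unfolding e using norm_triangle_mono[OF norm_triangle_mono[OF q(4,5)] norm_triangle_mono[OF q(5,6)]] X by linarith
  next
    fix \<kappa>
    note [measurable] = K(9)[of \<kappa>] K(10)[of \<kappa>] K(11)[of \<kappa>] L(9)[of \<kappa>] L(10)[of \<kappa>] L(11)[of \<kappa>]
    show "(\<lambda>w. K \<kappa> w * L \<kappa> w) \<in> borel_measurable M" "?D1 \<kappa> \<in> borel_measurable M" "?D2 \<kappa> \<in> borel_measurable M"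
      by measurable
  qed (use AB in simp)
  then show ?thesis unfolding amp_family_def by blast
qed

lemma amp_family_add:
  assumes "amp_family M \<beta> m K" "amp_family M \<gamma> n L"
  shows "amp_family M (\<lambda>w. \<beta> w + \<gamma> w) (m + n) (\<lambda>\<kappa> w. K \<kappa> w + L \<kappa> w)"
proof -
  obtain A K1 K2 where K: "amp_witness M \<beta> m A K K1 K2" using assms(1) unfolding amp_family_def by blast
  obtain B L1 L2 where L: "amp_witness M \<gamma> n B L L1 L2" using assms(2) unfolding amp_family_def by blast
  note K = amp_witnessD[OF K] and L = amp_witnessD[OF L]
  have "amp_witness M (\<lambda>w. \<beta> w + \<gamma> w) (m + n) (A + B) (\<lambda>\<kappa> w. K \<kappa> w + L \<kappa> w) (\<lambda>\<kappa> w. K1 \<kappa> w + L1 \<kappa> w) (\<lambda>\<kappa> w. K2 \<kappa> w + L2 \<kappa> w)"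
    unfolding amp_witness_def
  proof (intro conjI ballI allI)
    fix w \<kappa> assume w: "w \<in> space M"
    show "((\<lambda>\<kappa>. K \<kappa> w + L \<kappa> w) has_vector_derivative K1 \<kappa> w + L1 \<kappa> w) (at \<kappa>)"
      "((\<lambda>\<kappa>. K1 \<kappa> w + L1 \<kappa> w) has_vector_derivative K2 \<kappa> w + L2 \<kappa> w) (at \<kappa>)"
      "isCont (\<lambda>\<kappa>. K2 \<kappa> w + L2 \<kappa> w) \<kappa>"
      by (intro has_vector_derivative_add continuous_intros K L w)+
    show "0 \<le> \<beta> w + \<gamma> w" using K(2)[OF w] L(2)[OF w] by simp
    have p: "norm (x + y) \<le> (A + B) * (1 + \<bar>\<kappa>\<bar>) ^ (m + n) * (\<beta> w + \<gamma> w)"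
      if "norm x \<le> A * (1 + \<bar>\<kappa>\<bar>) ^ m * \<beta> w" "norm y \<le> B * (1 + \<bar>\<kappa>\<bar>) ^ n * \<gamma> w" for x y :: complex
    proof -
      let ?P = "(1 + \<bar>\<kappa>\<bar>) ^ (m + n)"
      have "A * (1 + \<bar>\<kappa>\<bar>) ^ m * \<beta> w \<le> A * ?P * (\<beta> w + \<gamma> w)"
        using K(1) K(2)[OF w] L(2)[OF w] by (intro mult_mono mult_left_mono power_increasing) auto
      moreover have "B * (1 + \<bar>\<kappa>\<bar>) ^ n * \<gamma> w \<le> B * ?P * (\<beta> w + \<gamma> w)"
        using K(2)[OF w] L(1) L(2)[OF w] by (intro mult_mono mult_left_mono power_increasing) auto
      ultimately show ?thesis
        using norm_triangle_mono[OF that] by (simp add: distrib_right)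
    qed
    show "norm (K \<kappa> w + L \<kappa> w) \<le> (A + B) * (1 + \<bar>\<kappa>\<bar>) ^ (m + n) * (\<beta> w + \<gamma> w)"
      "norm (K1 \<kappa> w + L1 \<kappa> w) \<le> (A + B) * (1 + \<bar>\<kappa>\<bar>) ^ (m + n) * (\<beta> w + \<gamma> w)"
      "norm (K2 \<kappa> w + L2 \<kappa> w) \<le> (A + B) * (1 + \<bar>\<kappa>\<bar>) ^ (m + n) * (\<beta> w + \<gamma> w)"
      by (intro p K L w)+
  next
    fix \<kappa>
    note [measurable] = K(9)[of \<kappa>] K(10)[of \<kappa>] K(11)[of \<kappa>] L(9)[of \<kappa>] L(10)[of \<kappa>] L(11)[of \<kappa>]
    show "(\<lambda>w. K \<kappa> w + L \<kappa> w) \<in> borel_measurable M" "(\<lambda>w. K1 \<kappa> w + L1 \<kappa> w) \<in> borel_measurable M" "(\<lambda>w. K2 \<kappa> w + L2 \<kappa> w) \<in> borel_measurable M"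
      by measurable
  qed (use K(1) L(1) in simp)
  then show ?thesis unfolding amp_family_def by blast
qed

text \<open>Single functions of \<kappa> are families over a one-point space, so that the closure
  rules for families also serve for them.\<close>

definition amplitude :: "(real \<Rightarrow> complex) \<Rightarrow> bool" where
  "amplitude a \<longleftrightarrow> (\<exists>n. amp_family (count_space (UNIV :: unit set)) (\<lambda>_. 1) n (\<lambda>\<kappa> _. a \<kappa>))"

lemma amp_family_scale:
  assumes "amp_family M \<beta> n K" "\<And>w. w \<in> space M \<Longrightarrow> \<beta> w \<le> c * \<gamma> w" "0 \<le> c" "\<And>w. w \<in> space M \<Longrightarrow> 0 \<le> \<gamma> w"
  shows "amp_family M \<gamma> n K"
proof -
  obtain A K1 K2 where W: "amp_witness M \<beta> n A K K1 K2" using assms(1) unfolding amp_family_def by blast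
  note K = amp_witnessD[OF W]
  have p: "x \<le> A * c * (1 + \<bar>\<kappa>\<bar>) ^ n * \<gamma> w" if "x \<le> A * (1 + \<bar>\<kappa>\<bar>) ^ n * \<beta> w" "w \<in> space M" for x \<kappa> w
  proof -
    have "A * (1 + \<bar>\<kappa>\<bar>) ^ n * \<beta> w \<le> A * (1 + \<bar>\<kappa>\<bar>) ^ n * (c * \<gamma> w)"
      using K(1) assms(2)[OF that(2)] by (intro mult_left_mono) auto
    then show ?thesis using that(1) by (simp add: mult_ac)
  qed
  have "amp_witness M \<gamma> n (A * c) K K1 K2"
    unfolding amp_witness_def using K assms(3,4) by (auto intro!: p)
  then show ?thesis unfolding amp_family_def by blast
qed

lemma amplitude_const: "amplitude (\<lambda>_. c)"
  unfolding amplitude_def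
  by (rule exI, rule amp_family_scale[where c="norm c", OF amp_family_const[where \<beta>="\<lambda>_. norm c"]]) auto

lemma amplitude_param: "amplitude of_real"
  unfolding amplitude_def by (rule exI, rule amp_family_param)

lemma amplitude_add: "amplitude a \<Longrightarrow> amplitude b \<Longrightarrow> amplitude (\<lambda>\<kappa>. a \<kappa> + b \<kappa>)"
  unfolding amplitude_def
  by (elim exE, rule exI, rule amp_family_scale[where c=2, OF amp_family_add]) auto

lemma amplitude_mult: "amplitude a \<Longrightarrow> amplitude b \<Longrightarrow> amplitude (\<lambda>\<kappa>. a \<kappa> * b \<kappa>)"
  unfolding amplitude_def
  by (elim exE, rule exI, rule amp_family_scale[where c=1, OF amp_family_mult]) auto

lemma amplitude_sum: "(\<And>i. i \<in> I \<Longrightarrow> amplitude (a i)) \<Longrightarrow> amplitude (\<lambda>\<kappa>. \<Sum>i\<in>I. a i \<kappa>)"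
  by (induction I rule: infinite_finite_induct) (auto intro: amplitude_const amplitude_add)

lemma amplitude_exp: "amplitude (\<lambda>\<kappa>. exp (\<i> * of_real (\<kappa> * s)))"
  unfolding amplitude_def by (rule exI, rule amp_family_exp[where S="\<bar>s\<bar>"]) auto

text \<open>A variant of \<open>has_dir_deriv_integral\<close> with a majorant valid only within
  distance 1 of x: a bound of polynomial growth in \<kappa> yields no majorant for all \<kappa> at
  once.\<close>

lemma has_vector_derivative_integral_local:
  fixes F :: "real \<Rightarrow> 'w \<Rightarrow> 'b::{banach, second_countable_topology}"
  assumes int: "\<And>x. integrable M (F x)" and meas: "F' x \<in> borel_measurable M"
    and der: "\<And>w t. w \<in> space M \<Longrightarrow> ((\<lambda>t. F t w) has_vector_derivative F' t w) (at t)"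
    and bd: "\<And>w t. w \<in> space M \<Longrightarrow> \<bar>t - x\<bar> \<le> 1 \<Longrightarrow> norm (F' t w) \<le> \<beta> w"
    and \<beta>: "integrable M \<beta>"
  shows "((\<lambda>t. LINT w|M. F t w) has_vector_derivative (LINT w|M. F' x w)) (at x)"
proof -
  define Q where "Q h w = (1 / h) *\<^sub>R (F (x + h) w - F x w)" for h :: real and w
  have der': "((\<lambda>t. F (x + t) w) has_vector_derivative F' (x + t) w) (at t)" if "w \<in> space M" for w t
  proof -
    have "((\<lambda>t. x + t) has_vector_derivative 1) (at t)" by (auto intro!: derivative_eq_intros)
    from vector_diff_chain_at[OF this der[OF that]] show ?thesis by (simp add: o_def)
  qed
  have Q_lim: "((\<lambda>h. Q h w) \<longlongrightarrow> F' x w) (at 0)" if "w \<in> space M" for w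
    using der'[OF that, of 0] unfolding has_vector_derivative_0_iff_quotient Q_def by simp
  have Q_bd: "norm (Q h w) \<le> \<beta> w" if w: "w \<in> space M" and h: "\<bar>h\<bar> \<le> 1" for h w
  proof -
    have "norm (F (x + h) w - F (x + 0) w - h *\<^sub>R 0) \<le> \<bar>h\<bar> * \<beta> w"
      by (rule increment_bound[OF der'[OF w]]) (use bd[OF w] h in auto)
    moreover have "0 \<le> \<beta> w" using order_trans[OF norm_ge_zero bd[OF w, of x]] by simp
    ultimately show ?thesis unfolding Q_def by (simp add: divide_le_eq mult.commute)
  qed
  have Q_int: "integrable M (Q h)" for h
    unfolding Q_def by (intro integrable_scaleR_right Bochner_Integration.integrable_diff int)
  have "((\<lambda>h. LINT w|M. Q h w) \<longlongrightarrow> (LINT w|M. F' x w)) (at 0)"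
    unfolding tendsto_at_iff_sequentially comp_def
  proof (intro allI impI)
    fix X :: "nat \<Rightarrow> real" assume X: "\<forall>i. X i \<in> UNIV - {0}" "X \<longlonglongrightarrow> 0"
    \<comment> \<open>Steps of size 1 or more may leave the range of the majorant and are dropped
      from the sequence.\<close>
    obtain N where N: "\<And>n. n \<ge> N \<Longrightarrow> \<bar>X n\<bar> < 1"
      using LIMSEQ_D[OF X(2), of 1] by auto
    have X0: "filterlim (\<lambda>n. X (n + N)) (at 0) sequentially"
      unfolding filterlim_at using LIMSEQ_ignore_initial_segment[OF X(2)] X(1) by auto
    have "(\<lambda>n. LINT w|M. Q (X (n + N)) w) \<longlonglongrightarrow> (LINT w|M. F' x w)"
    proof (rule integral_dominated_convergence[OF meas borel_measurable_integrable[OF Q_int] \<beta>])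
      show "AE w in M. (\<lambda>n. Q (X (n + N)) w) \<longlonglongrightarrow> F' x w"
        by (intro AE_I2 filterlim_compose[OF Q_lim X0])
      show "AE w in M. norm (Q (X (n + N)) w) \<le> \<beta> w" for n
        using N[of "n + N"] by (intro AE_I2 Q_bd) auto
    qed
    then show "(\<lambda>n. LINT w|M. Q (X n) w) \<longlonglongrightarrow> (LINT w|M. F' x w)"
      by (rule LIMSEQ_offset)
  qed
  also have "(\<lambda>h. LINT w|M. Q h w) = (\<lambda>h. (1 / h) *\<^sub>R ((LINT w|M. F (x + h) w) - (LINT w|M. F (x + 0) w)))"
    unfolding Q_def
    by (intro ext, subst integral_scaleR_right, subst Bochner_Integration.integral_diff[OF int int]) simp
  finally have "((\<lambda>h. LINT w|M. F (x + h) w) has_vector_derivative (LINT w|M. F' x w)) (at (x - x))"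
    unfolding diff_self has_vector_derivative_0_iff_quotient .
  moreover have "((\<lambda>s. s - x) has_vector_derivative 1) (at x)" by (auto intro!: derivative_eq_intros)
  ultimately have "((\<lambda>h. LINT w|M. F (x + h) w) \<circ> (\<lambda>s. s - x) has_vector_derivative 1 *\<^sub>R (LINT w|M. F' x w)) (at x)"
    by (intro vector_diff_chain_at)
  then show ?thesis by (simp add: o_def)
qed

text \<open>Within distance 1 of \<kappa> the growth factor is at most a power of
  \<open>2 + \<bar>\<kappa>\<bar>\<close>, which provides the local majorant for both
  differentiations and for continuity of the second derivative.\<close>

lemma amplitude_integral:
  assumes K: "amp_family M \<beta> n K" and \<beta>: "integrable M \<beta>"
  shows "amp_family (count_space (UNIV :: unit set)) (\<lambda>_. 1) n (\<lambda>\<kappa> _. LINT w|M. K \<kappa> w)"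
proof -
  obtain A K1 K2 where W: "amp_witness M \<beta> n A K K1 K2" using K unfolding amp_family_def by blast
  note K = amp_witnessD[OF W]
  have i: "integrable M (\<lambda>w. c * \<beta> w)" for c using \<beta> by simp
  have I: "integrable M f" if "f \<in> borel_measurable M" "\<And>w. w \<in> space M \<Longrightarrow> norm (f w) \<le> c * \<beta> w" for f :: "_ \<Rightarrow> complex" and c
    by (rule Bochner_Integration.integrable_bound[OF i that(1)])
      (rule AE_I2, simp only: real_norm_def, rule order_trans[OF that(2) abs_ge_self])
  have int: "integrable M (K \<kappa>)" "integrable M (K1 \<kappa>)" "integrable M (K2 \<kappa>)" for \<kappa>
    by (rule I[OF K(9) K(6)] I[OF K(10) K(7)] I[OF K(11) K(8)]; assumption)+
  have loc: "A * (1 + \<bar>t\<bar>) ^ n * \<beta> w \<le> A * (2 + \<bar>\<kappa>\<bar>) ^ n * \<beta> w" if "\<bar>t - \<kappa>\<bar> \<le> 1" "w \<in> space M" for t \<kappa> w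
    using that K(1,2) by (intro mult_right_mono mult_left_mono power_mono) auto
  have d1: "((\<lambda>\<kappa>. LINT w|M. K \<kappa> w) has_vector_derivative (LINT w|M. K1 \<kappa> w)) (at \<kappa>)" for \<kappa>
    by (rule has_vector_derivative_integral_local[OF int(1) K(10) K(3) order_trans[OF K(7) loc] i])
  have d2: "((\<lambda>\<kappa>. LINT w|M. K1 \<kappa> w) has_vector_derivative (LINT w|M. K2 \<kappa> w)) (at \<kappa>)" for \<kappa>
    by (rule has_vector_derivative_integral_local[OF int(2) K(11) K(4) order_trans[OF K(8) loc] i])
  have c: "isCont (\<lambda>\<kappa>. LINT w|M. K2 \<kappa> w) \<kappa>" for \<kappa>
    unfolding continuous_at_sequentially comp_def
  proof (intro allI impI)
    fix X assume X: "X \<longlonglongrightarrow> \<kappa>"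
    obtain N where N: "\<And>n. n \<ge> N \<Longrightarrow> \<bar>X n - \<kappa>\<bar> < 1"
      using LIMSEQ_D[OF X, of 1] by auto
    have "(\<lambda>n. LINT w|M. K2 (X (n + N)) w) \<longlonglongrightarrow> (LINT w|M. K2 \<kappa> w)"
    proof (rule integral_dominated_convergence[OF K(11) K(11) i])
      show "AE w in M. (\<lambda>n. K2 (X (n + N)) w) \<longlonglongrightarrow> K2 \<kappa> w"
        by (intro AE_I2 isCont_tendsto_compose[OF K(5)] LIMSEQ_ignore_initial_segment[OF X])
      show "AE w in M. norm (K2 (X (j + N)) w) \<le> (A * (2 + \<bar>\<kappa>\<bar>) ^ n) * \<beta> w" for j
        using N[of "j + N"] by (intro AE_I2 order_trans[OF K(8) loc]) auto
    qed
    then show "(\<lambda>n. LINT w|M. K2 (X n) w) \<longlonglongrightarrow> (LINT w|M. K2 \<kappa> w)"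
      by (rule LIMSEQ_offset)
  qed
  define B where "B = A * (LINT w|M. \<beta> w)"
  have \<beta>0: "0 \<le> (LINT w|M. \<beta> w)" by (rule integral_nonneg_AE) (use K(2) in \<open>auto intro!: AE_I2\<close>)
  have bd: "norm (LINT w|M. f w) \<le> B * (1 + \<bar>\<kappa>\<bar>) ^ n * 1"
    if "integrable M f" "\<And>w. w \<in> space M \<Longrightarrow> norm (f w) \<le> A * (1 + \<bar>\<kappa>\<bar>) ^ n * \<beta> w" for f :: "_ \<Rightarrow> complex" and \<kappa>
  proof -
    have "norm (LINT w|M. f w) \<le> (LINT w|M. A * (1 + \<bar>\<kappa>\<bar>) ^ n * \<beta> w)"
      by (rule order_trans[OF integral_norm_bound integral_mono]) (use that i in auto)
    then show ?thesis by (simp add: B_def mult_ac)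
  qed
  have "amp_witness (count_space (UNIV :: unit set)) (\<lambda>_. 1) n B (\<lambda>\<kappa> _. LINT w|M. K \<kappa> w) (\<lambda>\<kappa> _. LINT w|M. K1 \<kappa> w) (\<lambda>\<kappa> _. LINT w|M. K2 \<kappa> w)"
    unfolding amp_witness_def
    by (intro conjI ballI allI d1 d2 c bd int K(6-8))
      (use \<beta>0 K(1) in \<open>auto simp: B_def\<close>)
  then show ?thesis unfolding amp_family_def by blast
qed

section \<open>Half-line Fourier transforms\<close>

lemma tendsto_inverse_one_plus_square: "((\<lambda>x::real. c * (1 / (1 + x\<^sup>2))) \<longlongrightarrow> 0) at_top"
proof -
  have "filterlim (\<lambda>x::real. 1 + x\<^sup>2) at_top at_top"
    by (intro filterlim_tendsto_add_at_top[OF tendsto_const] filterlim_pow_at_top filterlim_ident) simp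
  then have "((\<lambda>x::real. 1 / (1 + x\<^sup>2)) \<longlongrightarrow> 0) at_top"
    by (intro tendsto_divide_0[OF tendsto_const] filterlim_at_top_imp_at_infinity)
  from tendsto_mult[OF tendsto_const this, of c] show ?thesis by simp
qed

text \<open>Two integrations by parts on the half line give decay of order l^-2, as the boundary
  terms at 0 are multiples of \<open>q 0\<close> and \<open>q1 0\<close>. Thus the transform is
  integrable even though the second derivative of \<open>Q\<close> may jump at 0, and inversion
  applies to the continuous function \<open>Q\<close>.\<close>

lemma half_line_transform:
  fixes q q1 q2 :: "real \<Rightarrow> complex"
  assumes q: "\<And>x. (q has_vector_derivative q1 x) (at x)" "\<And>x. (q1 has_vector_derivative q2 x) (at x)" "\<And>x. isCont q2 x"
    and bd: "\<And>x. norm (q x) \<le> C * (1 / (1 + x\<^sup>2))" "\<And>x. norm (q1 x) \<le> C * (1 / (1 + x\<^sup>2))" "\<And>x. norm (q2 x) \<le> C * (1 / (1 + x\<^sup>2))"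
    and q0: "q 0 = 0" "q1 0 = 0"
  defines "Q \<equiv> \<lambda>x. if 0 < x then q x else 0"
  shows "integrable lborel Q"
    and "integrable lborel (\<lambda>l. LINT x|lborel. Q x * exp (\<i> * of_real (x * l)))"
    and "(LINT l|lborel. (LINT x|lborel. Q x * exp (\<i> * of_real (x * l))) * exp (- \<i> * of_real (\<omega> * l))) = 2 * of_real pi * Q \<omega>"
proof -
  have C: "0 \<le> C" using order_trans[OF norm_ge_zero bd(1)[of 0]] by simp
  have qc: "isCont q x" "isCont q1 x" for x
    using has_vector_derivative_continuous[OF q(1)] has_vector_derivative_continuous[OF q(2)] by auto
  have Q_alt: "Q = (\<lambda>x. q (max 0 x))" using q0 by (auto simp: Q_def max_def fun_eq_iff)
  have cont_q: "continuous_on UNIV q" using qc by (simp add: continuous_on_eq_continuous_at)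
  have cont_Q: "continuous_on UNIV Q"
    unfolding Q_alt by (intro continuous_on_compose2[OF cont_q] continuous_intros) auto
  have [measurable]: "Q \<in> borel_measurable borel" by (rule borel_measurable_continuous_onI[OF cont_Q])
  have i: "integrable lborel (\<lambda>x::real. c * (1 / (1 + x\<^sup>2)))" for c
    by (rule integrable_mult_right[OF integrable_inverse_1_plus_square_UNIV])
  have Q_bd: "norm (Q x) \<le> C * (1 / (1 + x\<^sup>2))" for x using bd(1)[of x] C by (simp add: Q_def)
  have int_bd: "integrable lborel f" if "f \<in> borel_measurable borel" "\<And>x. norm (f x) \<le> c * (1 / (1 + x\<^sup>2))" for f :: "real \<Rightarrow> complex" and c
    by (rule Bochner_Integration.integrable_bound[OF i])
      (use that(1) in simp, rule AE_I2, simp only: real_norm_def, rule order_trans[OF that(2) abs_ge_self])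
  show Q_int: "integrable lborel Q" by (rule int_bd[OF _ Q_bd]) measurable
  define B where "B l = (LINT x|lborel. Q x * exp (\<i> * of_real (x * l)))" for l
  define I where "I = (LINT x|lborel. C * (1 / (1 + x\<^sup>2)))"
  have norm_int: "norm (LINT x|lborel. f x) \<le> I" if "f \<in> borel_measurable borel" "\<And>x. norm (f x) \<le> C * (1 / (1 + x\<^sup>2))" for f :: "real \<Rightarrow> complex"
    unfolding I_def by (rule order_trans[OF integral_norm_bound integral_mono]) (use int_bd[OF that] i that(2) in auto)
  have B1: "norm (B l) \<le> I" for l
    unfolding B_def by (rule norm_int) (use Q_bd in \<open>auto simp: norm_mult\<close>)
  have B2: "l\<^sup>2 * norm (B l) \<le> I" for l
  proof -
    \<comment> \<open>Both integrations by parts at once: \<open>f\<close> is the derivative of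
      \<open>F\<close>, and since \<open>F\<close> tends to zero at both ends, the integral of
      \<open>f\<close> over the half line is zero.\<close>
    define F where "F x = (q1 x - \<i> * of_real l * q x) * exp (\<i> * of_real (x * l))" for x
    define f where "f x = (q2 x + of_real (l\<^sup>2) * q x) * exp (\<i> * of_real (x * l))" for x
    have e: "((\<lambda>x. exp (\<i> * of_real (x * l))) has_vector_derivative \<i> * of_real l * exp (\<i> * of_real (x * l))) (at x)" for x
      using exp_scaleR_has_vector_derivative_right[of "\<i> * of_real l" x UNIV]
      by (simp add: scaleR_conv_of_real mult_ac)
    have dF: "(F has_vector_derivative f x) (at x)" for x
    proof -
      have "(F has_vector_derivative (q1 x - \<i> * of_real l * q x) * (\<i> * of_real l * exp (\<i> * of_real (x * l)))
          + (q2 x - \<i> * of_real l * q1 x) * exp (\<i> * of_real (x * l))) (at x)"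
        unfolding F_def[abs_def]
        by (intro has_vector_derivative_mult has_vector_derivative_diff has_vector_derivative_mult_right q e)
      moreover have "(q1 x - \<i> * of_real l * q x) * (\<i> * of_real l * E) + (q2 x - \<i> * of_real l * q1 x) * E
          = (q2 x + of_real (l\<^sup>2) * q x) * E" for E
        by (simp add: algebra_simps power2_eq_square)
      ultimately show ?thesis by (simp add: f_def)
    qed
    have cf: "isCont f x" for x
      unfolding f_def[abs_def] by (intro continuous_intros q qc)
    have [measurable]: "f \<in> borel_measurable borel" "q2 \<in> borel_measurable borel" "q \<in> borel_measurable borel"
      using cf q(3) qc by (auto intro!: borel_measurable_continuous_onI simp: continuous_on_eq_continuous_at)
    have fb: "norm (f x) \<le> (C + l\<^sup>2 * C) * (1 / (1 + x\<^sup>2))" for x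
    proof -
      have "norm (f x) \<le> norm (q2 x) + l\<^sup>2 * norm (q x)"
        unfolding f_def norm_mult using norm_triangle_ineq[of "q2 x" "of_real (l\<^sup>2) * q x"] by (simp add: norm_mult norm_power)
      also have "\<dots> \<le> C * (1 / (1 + x\<^sup>2)) + l\<^sup>2 * (C * (1 / (1 + x\<^sup>2)))"
        by (intro add_mono mult_left_mono bd) simp
      finally show ?thesis by (simp only: distrib_right mult.assoc)
    qed
    have f_int: "integrable lborel f" by (rule int_bd[OF _ fb]) measurable
    have F_bd: "norm (F x) \<le> (C + \<bar>l\<bar> * C) * (1 / (1 + x\<^sup>2))" for x
    proof -
      have "norm (F x) \<le> norm (q1 x) + \<bar>l\<bar> * norm (q x)"
        unfolding F_def norm_mult using norm_triangle_ineq4[of "q1 x" "\<i> * of_real l * q x"] by (simp add: norm_mult)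
      also have "\<dots> \<le> C * (1 / (1 + x\<^sup>2)) + \<bar>l\<bar> * (C * (1 / (1 + x\<^sup>2)))"
        by (intro add_mono mult_left_mono bd) simp
      finally show ?thesis by (simp only: distrib_right mult.assoc)
    qed
    have F_top: "(F \<longlongrightarrow> 0) at_top"
      by (rule Lim_null_comparison[OF _ tendsto_inverse_one_plus_square[of "C + \<bar>l\<bar> * C"]])
        (rule always_eventually, rule allI, rule F_bd)
    have "isCont F 0" using has_vector_derivative_continuous[OF dF] by simp
    then have F_0: "(F \<longlongrightarrow> 0) (at_right 0)"
      using q0 by (auto simp: isCont_def F_def intro: filterlim_mono[OF _ order_refl at_le])
    have "(LBINT x=0..\<infinity>. f x) = 0 - 0"
    proof (rule interval_integral_FTC_integrable[where F=F])
      show "set_integrable lborel (einterval 0 \<infinity>) f"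
        using integrable_mult_indicator[OF _ f_int, of "einterval 0 \<infinity>"] by (simp add: set_integrable_def)
      show "((F \<circ> real_of_ereal) \<longlongrightarrow> 0) (at_right 0)"
        using F_0 unfolding zero_ereal_def by (simp add: ereal_tendsto_simps)
      show "((F \<circ> real_of_ereal) \<longlongrightarrow> 0) (at_left \<infinity>)"
        using F_top by (simp add: ereal_tendsto_simps)
    qed (use dF cf in auto)
    then have "(LINT x|lborel. indicator {0<..} x *\<^sub>R f x) = 0"
      by (simp add: interval_lebesgue_integral_0_infty set_lebesgue_integral_def)
    moreover have "indicator {0<..} x *\<^sub>R f x = indicator {0<..} x *\<^sub>R (q2 x * exp (\<i> * of_real (x * l))) + of_real (l\<^sup>2) * (Q x * exp (\<i> * of_real (x * l)))" for x
      by (simp add: f_def Q_def indicator_def algebra_simps)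
    moreover have g_int: "integrable lborel (\<lambda>x. indicator {0<..} x *\<^sub>R (q2 x * exp (\<i> * of_real (x * l))))"
      by (rule int_bd[where c=C]) (use bd(3) C in \<open>auto simp: norm_mult indicator_def\<close>)
    moreover have "integrable lborel (\<lambda>x. of_real (l\<^sup>2) * (Q x * exp (\<i> * of_real (x * l))))"
      by (intro integrable_mult_right int_bd[where c=C]) (use Q_bd in \<open>auto simp: norm_mult\<close>)
    ultimately have "(LINT x|lborel. indicator {0<..} x *\<^sub>R (q2 x * exp (\<i> * of_real (x * l)))) + of_real (l\<^sup>2) * B l = 0"
      by (simp add: B_def)
    then have "of_real (l\<^sup>2) * B l = - (LINT x|lborel. indicator {0<..} x *\<^sub>R (q2 x * exp (\<i> * of_real (x * l))))"
      by (simp add: add_eq_0_iff)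
    then have "l\<^sup>2 * norm (B l) = norm (LINT x|lborel. indicator {0<..} x *\<^sub>R (q2 x * exp (\<i> * of_real (x * l))))"
      by (metis abs_power2 norm_minus_cancel norm_mult norm_of_real)
    also have "\<dots> \<le> I"
      by (rule norm_int) (use bd(3) C in \<open>auto simp: norm_mult indicator_def\<close>)
    finally show ?thesis .
  qed
  have B_bd: "norm (B l) \<le> (2 * I) * (1 / (1 + l\<^sup>2))" for l
  proof -
    have "0 < 1 + l\<^sup>2" by (simp add: add_pos_nonneg)
    moreover have "(1 + l\<^sup>2) * norm (B l) \<le> 2 * I" using B1[of l] B2[of l] by (simp add: distrib_right)
    ultimately show ?thesis by (simp add: field_simps)
  qed
  have B_meas: "B \<in> borel_measurable borel" unfolding B_def[abs_def] by measurable
  show B_int: "integrable lborel (\<lambda>l. LINT x|lborel. Q x * exp (\<i> * of_real (x * l)))"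
    unfolding B_def[symmetric] using int_bd[OF B_meas B_bd] .
  \<comment> \<open>The transform has the sign of the time convention; reflecting its argument
    brings it into the form of \<open>fourier_inversion\<close>.\<close>
  have Bf: "B (0 - k) = (LINT x|lborel. Q x * exp (- \<i> * of_real (k \<bullet> x)))" for k
    by (simp add: B_def mult.commute)
  have "(LINT k|lborel. B (0 - k) * exp (\<i> * of_real (k \<bullet> \<omega>))) = of_real ((2 * pi) ^ DIM(real)) * Q \<omega>"
  proof (rule fourier_inversion[OF cont_Q _ Q_int Bf])
    show "norm (Q x) \<le> C" for x
    proof -
      have "C * (1 / (1 + x\<^sup>2)) \<le> C * 1" by (intro mult_left_mono C) (simp add: divide_le_eq add_pos_nonneg)
      then show ?thesis using Q_bd[of x] by simp
    qed
    show "integrable lborel (\<lambda>k. B (0 - k))"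
      by (subst lborel_integrable_reflect) (use B_int in \<open>simp add: B_def[abs_def]\<close>)
  qed
  moreover have "(LINT l|lborel. B l * exp (- \<i> * of_real (\<omega> * l))) = (LINT k|lborel. B (0 - k) * exp (\<i> * of_real (k \<bullet> \<omega>)))"
    using lborel_integral_reflect[of "\<lambda>l. B l * exp (- \<i> * of_real (\<omega> * l))" 0] by (simp add: mult.commute)
  ultimately show "(LINT l|lborel. (LINT x|lborel. Q x * exp (\<i> * of_real (x * l))) * exp (- \<i> * of_real (\<omega> * l))) = 2 * of_real pi * Q \<omega>"
    unfolding B_def[symmetric] by simp
qed

text \<open>The phase is linear in t and unbounded; setting it to zero off a ball containing the
  support of \<open>h\<close> changes no integral and makes it bounded. The factor \<sigma> covers
  both \<omega> and -\<omega>.\<close>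

lemma amp_family_fourier:
  fixes h :: "real \<Rightarrow> complex"
  assumes h: "test_function h"
  shows "amp_family (count_space (UNIV :: unit set)) (\<lambda>_. 1) 0 (\<lambda>\<kappa> _. LINT t|lborel. h t * exp (\<i> * of_real (\<kappa> * (\<sigma> * t))))"
proof -
  note [measurable] = test_function_measurable[OF h]
  obtain R where R: "\<And>x. norm x > R \<Longrightarrow> h x = 0" using test_function_bounds[OF h] by metis
  define s where "s t = \<sigma> * (t * indicator {-R..R} t)" for t
  have eq: "h t * exp (\<i> * of_real (\<kappa> * (\<sigma> * t))) = h t * exp (\<i> * of_real (\<kappa> * s t))" for \<kappa> t
    using R[of t] by (cases "\<bar>t\<bar> \<le> R") (auto simp: s_def abs_le_iff)
  have "amp_family lborel (\<lambda>t. norm (h t) * 1) (0 + 0) (\<lambda>\<kappa> t. h t * exp (\<i> * of_real (\<kappa> * s t)))"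
  proof (intro amp_family_mult amp_family_const amp_family_exp)
    show "\<bar>s t\<bar> \<le> \<bar>\<sigma>\<bar> * \<bar>R\<bar>" for t
      unfolding s_def abs_mult by (intro mult_left_mono) (auto simp: indicator_def)
  qed (auto simp: s_def[abs_def])
  then have "amp_family lborel (\<lambda>t. norm (h t)) 0 (\<lambda>\<kappa> t. h t * exp (\<i> * of_real (\<kappa> * s t)))" by simp
  from amplitude_integral[OF this integrable_norm[OF test_function_integrable[OF h]]]
  show ?thesis unfolding eq .
qed

text \<open>Taken complex-valued, to multiply spectra directly; the power is chosen above the
  polynomial growth that it has to compensate.\<close>

definition damping :: "nat \<Rightarrow> real \<Rightarrow> complex" where
  "damping n x = 1 / (1 + (complex_of_real x)\<^sup>2) ^ n"

lemma has_vector_derivative_damping: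
  shows "(damping N has_vector_derivative - (2 * of_nat N) * (of_real x * damping (Suc N) x)) (at x)"
    and "((\<lambda>x. - (2 * of_nat N) * (of_real x * damping (Suc N) x)) has_vector_derivative
      - (2 * of_nat N) * (damping (Suc N) x - 2 * of_nat (Suc N) * (of_real x * (of_real x * damping (Suc (Suc N)) x)))) (at x)"
    and "norm (damping N x) = 1 / (1 + x\<^sup>2) ^ N"
proof -
  have nz: "1 + (complex_of_real x)\<^sup>2 \<noteq> 0" for x
  proof -
    have "1 + (complex_of_real x)\<^sup>2 = of_real (1 + x\<^sup>2)" by simp
    moreover have "1 + x\<^sup>2 \<noteq> 0" using zero_le_power2[of x] by linarith
    ultimately show ?thesis by (simp only: of_real_eq_0_iff not_False_eq_True)
  qed
  have d: "(damping n has_vector_derivative - (2 * of_nat n) * (of_real x * damping (Suc n) x)) (at x)" for n x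
  proof -
    have "((\<lambda>z. exp (0 * z) / z ^ n) has_field_derivative exp (0 * (1 + (of_real x)\<^sup>2)) * (0 / (1 + (complex_of_real x)\<^sup>2) ^ n - of_nat n / (1 + (of_real x)\<^sup>2) ^ Suc n)) (at (1 + (complex_of_real x)\<^sup>2))"
      by (rule has_field_derivative_exp_div_power[OF nz])
    moreover have "((\<lambda>z. 1 + z\<^sup>2) has_field_derivative 2 * of_real x) (at (complex_of_real x))"
      by (auto intro!: derivative_eq_intros)
    ultimately have "((\<lambda>z. exp (0 * (1 + z\<^sup>2)) / (1 + z\<^sup>2) ^ n) has_field_derivative
        exp (0 * (1 + (of_real x)\<^sup>2)) * (0 / (1 + (complex_of_real x)\<^sup>2) ^ n - of_nat n / (1 + (of_real x)\<^sup>2) ^ Suc n) * (2 * of_real x)) (at (complex_of_real x))"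
      by (rule DERIV_chain2)
    from has_vector_derivative_real_field[OF this] show ?thesis
      by (simp add: damping_def[abs_def] mult_ac)
  qed
  show "(damping N has_vector_derivative - (2 * of_nat N) * (of_real x * damping (Suc N) x)) (at x)" by (rule d)
  have "((\<lambda>x. complex_of_real x) has_vector_derivative 1) (at x)"
    using has_vector_derivative_of_real[of "\<lambda>x. x" 1 "at x"] by simp
  from has_vector_derivative_mult_right[OF has_vector_derivative_mult[OF this d], of "- (2 * of_nat N)" "Suc N"]
  show "((\<lambda>x. - (2 * of_nat N) * (of_real x * damping (Suc N) x)) has_vector_derivative
      - (2 * of_nat N) * (damping (Suc N) x - 2 * of_nat (Suc N) * (of_real x * (of_real x * damping (Suc (Suc N)) x)))) (at x)"
    by (simp add: algebra_simps)
  have "norm (1 + (complex_of_real x)\<^sup>2) = 1 + x\<^sup>2"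
  proof -
    have "1 + (complex_of_real x)\<^sup>2 = of_real (1 + x\<^sup>2)" by simp
    then show ?thesis by (simp only: norm_of_real) simp
  qed
  then show "norm (damping N x) = 1 / (1 + x\<^sup>2) ^ N" by (simp add: damping_def[abs_def] norm_divide norm_power)
qed

text \<open>Applying 1 - d^2/dt^2 N times to \<open>f\<close> gives a test function \<open>h\<close>
  whose transform is \<open>(1 + x\<^sup>2) ^ N\<close> times that of \<open>f\<close>. The spectrum
  is therefore \<open>damping N\<close> times a function \<open>p\<close> of polynomial growth, and
  differentiating either factor twice preserves the order of its bound.\<close>

lemma spectrum_damped:
  assumes f: "test_function f" and s: "amplitude s"
  obtains q1 q2 C where
    "\<And>x. ((\<lambda>x. of_real (x\<^sup>2) * (time_fourier f x * time_fourier f (- x) * s x)) has_vector_derivative q1 x) (at x)"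
    "\<And>x. (q1 has_vector_derivative q2 x) (at x)" "\<And>x. isCont q2 x"
    "\<And>x. norm (of_real (x\<^sup>2) * (time_fourier f x * time_fourier f (- x) * s x)) \<le> C * (1 / (1 + x\<^sup>2))"
    "\<And>x. norm (q1 x) \<le> C * (1 / (1 + x\<^sup>2))" "\<And>x. norm (q2 x) \<le> C * (1 / (1 + x\<^sup>2))"
proof -
  let ?u = "count_space (UNIV :: unit set)"
  let ?F = "\<lambda>t. complex_of_real (f t)"
  have F: "test_function ?F" by (rule test_function_of_real[OF f])
  obtain m where m: "amp_family ?u (\<lambda>_. 1) m (\<lambda>\<kappa> _. s \<kappa>)" using s unfolding amplitude_def by blast
  \<comment> \<open>Two powers for the factor x^2 and \<open>m\<close> for \<open>s\<close>; the two
    Fourier transforms are bounded and add none.\<close>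
  define n where "n = 2 + m"
  \<comment> \<open>One power more than the growth consumes: the surplus is the decay
    \<open>1 / (1 + x\<^sup>2)\<close>.\<close>
  define N where "N = n + 1"
  obtain h where h: "test_function h" "\<And>k. fourier h k = of_real (\<Prod>b\<leftarrow>replicate N 1. 1 + (k \<bullet> b)\<^sup>2) * fourier ?F k"
  proof -
    have "set (replicate N (1::real)) \<subseteq> Basis" by (auto simp: Basis_real_def)
    from test_function_fourier_list[OF F this] show thesis using that by blast
  qed
  \<comment> \<open>The time transform has the opposite sign in the exponent, so the spatial
    identity is used at -x; the multiplier is even.\<close>
  have h': "(LINT t|lborel. h t * exp (\<i> * of_real (x * (1 * t)))) = of_real ((1 + x\<^sup>2) ^ N) * time_fourier f x" for x
    using h(2)[of "- x"] by (simp add: fourier_def planewave_def time_fourier_def prod_list_replicate)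
  have r_nz: "damping N x * of_real ((1 + x\<^sup>2) ^ N) = 1" for x
  proof -
    have "1 + x\<^sup>2 \<noteq> 0" using zero_le_power2[of x] by linarith
    then have "complex_of_real (1 + x\<^sup>2) ^ N \<noteq> 0" by (simp only: power_eq_0_iff of_real_eq_0_iff) simp
    then show ?thesis by (simp add: damping_def)
  qed
  define p where "p x = of_real (x\<^sup>2) * ((LINT t|lborel. h t * exp (\<i> * of_real (x * (1 * t)))) * time_fourier f (- x) * s x)" for x
  have p_eq: "of_real (x\<^sup>2) * (time_fourier f x * time_fourier f (- x) * s x) = damping N x * p x" for x
  proof -
    have "damping N x * p x = (damping N x * of_real ((1 + x\<^sup>2) ^ N)) * (of_real (x\<^sup>2) * (time_fourier f x * time_fourier f (- x) * s x))"
      unfolding p_def h' by (simp only: mult_ac)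
    then show ?thesis by (simp only: r_nz mult_1)
  qed
  have "amp_family ?u (\<lambda>_. 1) n (\<lambda>\<kappa> _. p \<kappa>)"
  proof -
    have "amp_family ?u (\<lambda>_. (1 * 1) * ((1 * 1) * 1)) ((1 + 1) + ((0 + 0) + m))
      (\<lambda>\<kappa> _. (of_real \<kappa> * of_real \<kappa>) * ((LINT t|lborel. h t * exp (\<i> * of_real (\<kappa> * (1 * t)))) * (LINT t|lborel. ?F t * exp (\<i> * of_real (\<kappa> * (- 1 * t)))) * s \<kappa>))"
      by (intro amp_family_mult amp_family_param amp_family_fourier h(1) F m)
    then show ?thesis
      by (simp add: p_def[abs_def] n_def power2_eq_square time_fourier_def)
  qed
  then obtain A p1 p2 where wit: "amp_witness ?u (\<lambda>_. 1) n A (\<lambda>\<kappa> _. p \<kappa>) p1 p2" unfolding amp_family_def by blast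
  note W = amp_witnessD(1)[OF wit] amp_witnessD(3-8)[OF wit, of "()", simplified]
  define P1 where "P1 x = p1 x ()" for x
  define P2 where "P2 x = p2 x ()" for x
  note W = W[folded P1_def P2_def]
  define R1 where "R1 x = - (2 * of_nat N) * (of_real x * damping (Suc N) x)" for x
  define R2 where "R2 x = - (2 * of_nat N) * (damping (Suc N) x - 2 * of_nat (Suc N) * (of_real x * (of_real x * damping (Suc (Suc N)) x)))" for x
  have rn: "norm (damping k x) = 1 / (1 + x\<^sup>2) ^ k" for k x
    by (rule has_vector_derivative_damping(3))
  \<comment> \<open>Large enough for 1 and for the coefficients \<open>2 * N\<close> and
    \<open>2 * N * (1 + 2 * (N + 1))\<close> arising from the two derivatives of the damping
    factor.\<close>
  define E where "E = 4 * (real N + 1) * (real N + 1)"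
  have x1: "1 \<le> 1 + x\<^sup>2" "\<bar>x\<bar> \<le> 1 + x\<^sup>2" for x :: real
  proof -
    show "1 \<le> 1 + x\<^sup>2" by simp
    have "2 * \<bar>x\<bar> \<le> 1 + x\<^sup>2" using zero_le_power2[of "1 - \<bar>x\<bar>"] unfolding power2_diff by simp
    then show "\<bar>x\<bar> \<le> 1 + x\<^sup>2" by linarith
  qed
  have r_le: "\<bar>x\<bar> * norm (damping (Suc k) x) \<le> norm (damping k x)" "norm (damping (Suc k) x) \<le> norm (damping k x)" for k x
  proof -
    have pos: "0 < (1 + x\<^sup>2)" using x1(1)[of x] by linarith
    have "\<bar>x\<bar> * norm (damping (Suc k) x) \<le> (1 + x\<^sup>2) * norm (damping (Suc k) x)" by (intro mult_right_mono x1) simp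
    also have "\<dots> = norm (damping k x)" using pos by (simp add: rn)
    finally show "\<bar>x\<bar> * norm (damping (Suc k) x) \<le> norm (damping k x)" .
    have "1 * norm (damping (Suc k) x) \<le> (1 + x\<^sup>2) * norm (damping (Suc k) x)" by (intro mult_right_mono x1) simp
    also have "\<dots> = norm (damping k x)" using pos by (simp add: rn)
    finally show "norm (damping (Suc k) x) \<le> norm (damping k x)" by simp
  qed
  have R_bd: "norm (damping N x) \<le> E * norm (damping N x)" "norm (R1 x) \<le> E * norm (damping N x)" "norm (R2 x) \<le> E * norm (damping N x)" for x
  proof -
    have N0: "0 \<le> real N" by simp
    have E: "1 \<le> E" "2 * real N \<le> E" "2 * real N * (1 + 2 * (real N + 1)) \<le> E"
      unfolding E_def using N0 by (auto simp: algebra_simps intro: add_increasing)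
    show "norm (damping N x) \<le> E * norm (damping N x)" using mult_right_mono[OF E(1) norm_ge_zero[of "damping N x"]] by simp
    have "norm (R1 x) = 2 * real N * (\<bar>x\<bar> * norm (damping (Suc N) x))" by (simp add: R1_def norm_mult)
    also have "\<dots> \<le> 2 * real N * norm (damping N x)" by (intro mult_left_mono r_le) simp
    also have "\<dots> \<le> E * norm (damping N x)" by (intro mult_right_mono E) simp
    finally show "norm (R1 x) \<le> E * norm (damping N x)" .
    have "norm (R2 x) \<le> 2 * real N * (norm (damping (Suc N) x) + 2 * (real N + 1) * (\<bar>x\<bar> * (\<bar>x\<bar> * norm (damping (Suc (Suc N)) x))))"
    proof -
      have "norm (R2 x) = 2 * real N * norm (damping (Suc N) x - 2 * of_nat (Suc N) * (of_real x * (of_real x * damping (Suc (Suc N)) x)))"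
        unfolding R2_def norm_mult[of "- (2 * of_nat N)"] by simp
      also have "\<dots> \<le> 2 * real N * (norm (damping (Suc N) x) + norm (2 * of_nat (Suc N) * (of_real x * (of_real x * damping (Suc (Suc N)) x))))"
        by (intro mult_left_mono norm_triangle_ineq4) simp
      also have "norm (2 * of_nat (Suc N) * (of_real x * (of_real x * damping (Suc (Suc N)) x))) = 2 * (real N + 1) * (\<bar>x\<bar> * (\<bar>x\<bar> * norm (damping (Suc (Suc N)) x)))"
        unfolding norm_mult norm_of_nat norm_of_real by simp
      finally show ?thesis .
    qed
    also have "\<dots> \<le> 2 * real N * (norm (damping N x) + 2 * (real N + 1) * norm (damping N x))"
      by (intro mult_left_mono add_mono r_le order_trans[OF mult_left_mono[OF r_le(1)] r_le(1)]) auto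
    also have "\<dots> = 2 * real N * (1 + 2 * (real N + 1)) * norm (damping N x)" by (simp add: algebra_simps)
    also have "\<dots> \<le> E * norm (damping N x)" by (intro mult_right_mono E) simp
    finally show "norm (R2 x) \<le> E * norm (damping N x)" .
  qed
  have damp: "norm (a * b) \<le> (E * A * 2 ^ n) * (1 / (1 + x\<^sup>2))"
    if a: "norm a \<le> E * norm (damping N x)" and b: "norm b \<le> A * (1 + \<bar>x\<bar>) ^ n" for a b :: complex and x
  proof -
    have pos: "0 < (1 + x\<^sup>2)" using x1(1)[of x] by linarith
    have E0: "0 \<le> E" by (simp add: E_def)
    have "(1 + \<bar>x\<bar>) ^ n \<le> (2 * (1 + x\<^sup>2)) ^ n" 
    proof (intro power_mono)
      have "1 + \<bar>x\<bar> \<le> (1 + x\<^sup>2) + (1 + x\<^sup>2)" by (intro add_mono x1)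
      then show "1 + \<bar>x\<bar> \<le> 2 * (1 + x\<^sup>2)" by simp
    qed simp
    then have "norm b \<le> A * (2 * (1 + x\<^sup>2)) ^ n" using b mult_left_mono[OF _ W(1), of "(1 + \<bar>x\<bar>) ^ n" "(2 * (1 + x\<^sup>2)) ^ n"] by linarith
    then have "norm (a * b) \<le> (E * norm (damping N x)) * (A * (2 * (1 + x\<^sup>2)) ^ n)"
      unfolding norm_mult using a E0 by (intro mult_mono) auto
    also have "\<dots> = (E * A * 2 ^ n) * (1 / (1 + x\<^sup>2))"
    proof -
      have "(E * (1 / y ^ N)) * (A * (2 * y) ^ n) = (E * A * 2 ^ n) * (1 / y)" if "0 < y" for y :: real
        using that by (simp add: N_def power_mult_distrib)
      from this[OF pos] show ?thesis by (simp only: rn)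
    qed
    finally show ?thesis .
  qed
  have rcS: "isCont (damping k) x" for k x
    using has_vector_derivative_continuous[OF has_vector_derivative_damping(1)[of k x]] by simp
  have rc: "isCont (damping N) x" "isCont R1 x" for x
    unfolding R1_def[abs_def] by (intro continuous_intros rcS)+
  have R2c: "isCont R2 x" for x unfolding R2_def[abs_def] by (intro continuous_intros rcS)
  have pc: "isCont p x" "isCont P1 x" for x
    using has_vector_derivative_continuous[OF W(2)] has_vector_derivative_continuous[OF W(3)] by auto
  have R': "(damping N has_vector_derivative R1 x) (at x)" "(R1 has_vector_derivative R2 x) (at x)" for x
    unfolding R1_def[abs_def] R2_def by (rule has_vector_derivative_damping)+
  have res: "((\<lambda>x. damping N x * p x) has_vector_derivative damping N x * P1 x + R1 x * p x) (at x)"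
    "((\<lambda>x. damping N x * P1 x + R1 x * p x) has_vector_derivative (damping N x * P2 x + R1 x * P1 x) + (R1 x * P1 x + R2 x * p x)) (at x)"
    "isCont (\<lambda>x. (damping N x * P2 x + R1 x * P1 x) + (R1 x * P1 x + R2 x * p x)) x"
    "norm (damping N x * p x) \<le> 4 * (E * A * 2 ^ n) * (1 / (1 + x\<^sup>2))"
    "norm (damping N x * P1 x + R1 x * p x) \<le> 4 * (E * A * 2 ^ n) * (1 / (1 + x\<^sup>2))"
    "norm ((damping N x * P2 x + R1 x * P1 x) + (R1 x * P1 x + R2 x * p x)) \<le> 4 * (E * A * 2 ^ n) * (1 / (1 + x\<^sup>2))" for x
  proof -
    show "((\<lambda>x. damping N x * p x) has_vector_derivative damping N x * P1 x + R1 x * p x) (at x)"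
      by (intro has_vector_derivative_mult R' W)
    show "((\<lambda>x. damping N x * P1 x + R1 x * p x) has_vector_derivative (damping N x * P2 x + R1 x * P1 x) + (R1 x * P1 x + R2 x * p x)) (at x)"
      by (intro has_vector_derivative_mult has_vector_derivative_add R' W)
    show "isCont (\<lambda>x. (damping N x * P2 x + R1 x * P1 x) + (R1 x * P1 x + R2 x * p x)) x"
      by (intro continuous_intros rc R2c pc W)
    define X where "X = (E * A * 2 ^ n) * (1 / (1 + x\<^sup>2))"
    have e: "4 * (E * A * 2 ^ n) * (1 / (1 + x\<^sup>2)) = 4 * X" by (simp add: X_def)
    have X: "0 \<le> X" unfolding X_def E_def using W(1) x1(1)[of x] by simp
    note b = damp[OF R_bd(1) W(5), of x, folded X_def] damp[OF R_bd(1) W(6), of x, folded X_def] damp[OF R_bd(1) W(7), of x, folded X_def]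
      damp[OF R_bd(2) W(5), of x, folded X_def] damp[OF R_bd(2) W(6), of x, folded X_def] damp[OF R_bd(3) W(5), of x, folded X_def]
    show "norm (damping N x * p x) \<le> 4 * (E * A * 2 ^ n) * (1 / (1 + x\<^sup>2))" unfolding e using b X by linarith
    show "norm (damping N x * P1 x + R1 x * p x) \<le> 4 * (E * A * 2 ^ n) * (1 / (1 + x\<^sup>2))"
      unfolding e using norm_triangle_mono[OF b(2) b(4)] X by linarith
    show "norm ((damping N x * P2 x + R1 x * P1 x) + (R1 x * P1 x + R2 x * p x)) \<le> 4 * (E * A * 2 ^ n) * (1 / (1 + x\<^sup>2))"
      unfolding e using norm_triangle_mono[OF norm_triangle_mono[OF b(3) b(5)] norm_triangle_mono[OF b(5) b(6)]] X by linarith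
  qed
  show thesis by (rule that[unfolded p_eq, OF res])
qed

section \<open>Families built from plane waves and the Green function\<close>

definition amp_bounded :: "'w measure \<Rightarrow> (real \<Rightarrow> 'w \<Rightarrow> complex) \<Rightarrow> bool" where
  "amp_bounded M K \<longleftrightarrow> (\<exists>n. amp_family M (\<lambda>_. 1) n K)"

lemma amp_bounded_const:
  assumes "c \<in> borel_measurable M" "\<And>w. w \<in> space M \<Longrightarrow> norm (c w) \<le> B"
  shows "amp_bounded M (\<lambda>\<kappa>. c)"
  unfolding amp_bounded_def
  by (rule exI, rule amp_family_scale[where c="\<bar>B\<bar>", OF amp_family_const[where \<beta>="\<lambda>_. \<bar>B\<bar>"]])
    (use assms in \<open>auto intro: order_trans[OF _ abs_ge_self]\<close>)

lemma amp_bounded_param: "amp_bounded M (\<lambda>\<kappa> w. of_real \<kappa>)"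
  unfolding amp_bounded_def by (rule exI, rule amp_family_param)

lemma amp_bounded_exp:
  "s \<in> borel_measurable M \<Longrightarrow> (\<And>w. w \<in> space M \<Longrightarrow> \<bar>s w\<bar> \<le> S) \<Longrightarrow> amp_bounded M (\<lambda>\<kappa> w. exp (\<i> * of_real (\<kappa> * s w)))"
  unfolding amp_bounded_def by (rule exI, rule amp_family_exp)

lemma amp_bounded_add: "amp_bounded M K \<Longrightarrow> amp_bounded M L \<Longrightarrow> amp_bounded M (\<lambda>\<kappa> w. K \<kappa> w + L \<kappa> w)"
  unfolding amp_bounded_def
  by (elim exE, rule exI, rule amp_family_scale[where c=2, OF amp_family_add]) auto

lemma amp_bounded_mult: "amp_bounded M K \<Longrightarrow> amp_bounded M L \<Longrightarrow> amp_bounded M (\<lambda>\<kappa> w. K \<kappa> w * L \<kappa> w)"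
  unfolding amp_bounded_def
  by (elim exE, rule exI, rule amp_family_scale[where c=1, OF amp_family_mult]) auto

lemma amp_bounded_planewave:
  assumes "x \<in> borel_measurable M" "\<And>w. w \<in> space M \<Longrightarrow> norm (x w) \<le> R"
  shows "amp_bounded M (\<lambda>\<kappa> w. planewave (\<kappa> *\<^sub>R v) (x w :: 'a::euclidean_space))"
proof -
  have "amp_bounded M (\<lambda>\<kappa> w. exp (\<i> * of_real (\<kappa> * (v \<bullet> x w))))"
  proof (rule amp_bounded_exp)
    show "\<bar>v \<bullet> x w\<bar> \<le> norm v * R" if "w \<in> space M" for w
      using Cauchy_Schwarz_ineq2[of v "x w"] mult_left_mono[OF assms(2)[OF that] norm_ge_zero[of v]] by linarith
    show "(\<lambda>w. v \<bullet> x w) \<in> borel_measurable M" using assms(1) by measurable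
  qed
  then show ?thesis by (simp add: planewave_def)
qed

text \<open>The form in which singular kernels enter: a factor \<open>c\<close> free of \<kappa>,
  whose modulus is controlled by the weight, times a family bounded uniformly in w.\<close>

lemma amp_family_weighted:
  assumes "c \<in> borel_measurable M" "\<And>w. w \<in> space M \<Longrightarrow> norm (c w) \<le> \<beta> w" "amp_bounded M K"
  shows "\<exists>n. amp_family M \<beta> n (\<lambda>\<kappa> w. c w * K \<kappa> w)"
proof -
  obtain n where "amp_family M (\<lambda>_. 1) n K" using assms(3) unfolding amp_bounded_def by blast
  from amp_family_mult[OF amp_family_const[OF assms(1,2)] this] show ?thesis by auto
qed

text \<open>Phases are linear in the space variables. Clipping these to a ball keeps the families
  bounded everywhere; outside the ball the accompanying weight is zero, so no integral
  changes.\<close>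

definition clip :: "real \<Rightarrow> 'a::real_normed_vector \<Rightarrow> 'a" where
  "clip R x = (if norm x \<le> R then x else 0)"

lemma norm_clip: "norm (clip R x) \<le> \<bar>R\<bar>"
  by (auto simp: clip_def)

lemma clip_eq: "norm x \<le> R \<Longrightarrow> clip R x = x"
  by (simp add: clip_def)

lemma clip_measurable [measurable]:
  fixes f :: "'w \<Rightarrow> 'a::euclidean_space"
  assumes [measurable]: "f \<in> borel_measurable M"
  shows "(\<lambda>w. clip R (f w)) \<in> borel_measurable M"
  unfolding clip_def by measurable

lemma amplitude_planewave_integral:
  fixes c :: "'a::euclidean_space \<Rightarrow> complex"
  assumes c: "integrable lborel c" and supp: "\<And>y. norm y > R \<Longrightarrow> c y = 0"
  shows "amplitude (\<lambda>\<kappa>. LINT y|lborel. c y * planewave (\<kappa> *\<^sub>R v) y)"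
proof -
  have eq: "c y * planewave (\<kappa> *\<^sub>R v) y = c y * planewave (\<kappa> *\<^sub>R v) (clip R y)" for \<kappa> y
    using supp[of y] by (cases "norm y \<le> R") (auto simp: clip_eq)
  have "\<exists>n. amp_family lborel (\<lambda>y. norm (c y)) n (\<lambda>\<kappa> y. c y * planewave (\<kappa> *\<^sub>R v) (clip R y))"
    by (rule amp_family_weighted) (use c in \<open>auto intro!: amp_bounded_planewave[where R="\<bar>R\<bar>"] norm_clip\<close>)
  then show ?thesis
    unfolding eq amplitude_def using amplitude_integral[OF _ integrable_norm[OF c]] by blast
qed

text \<open>The lower bound on \<open>t\<close> tames the negative powers; in the application it is
  the radius of the regularisation.\<close>

lemma amp_bounded_radial0:
  assumes [measurable]: "t \<in> borel_measurable M" and t: "\<And>w. w \<in> space M \<Longrightarrow> \<delta> \<le> t w \<and> t w \<le> T" and \<delta>: "0 < \<delta>"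
  shows "amp_bounded M (\<lambda>\<kappa> w. radial0 \<kappa> (t w))" "amp_bounded M (\<lambda>\<kappa> w. radial1 \<kappa> (t w))" "amp_bounded M (\<lambda>\<kappa> w. radial2 \<kappa> (t w))"
proof -
  have c: "amp_bounded M (\<lambda>\<kappa> w. z / of_real (t w) ^ n)" for z :: complex and n
  proof (rule amp_bounded_const)
    fix w assume w: "w \<in> space M"
    have "\<delta> ^ n \<le> (t w) ^ n" using t[OF w] \<delta> by (intro power_mono) auto
    then show "norm (z / complex_of_real (t w) ^ n) \<le> norm z / \<delta> ^ n"
      using t[OF w] \<delta> by (simp add: norm_divide norm_power) (intro divide_left_mono mult_pos_pos zero_less_power, auto)
  qed measurable
  have e: "amp_bounded M (\<lambda>\<kappa> w. exp (\<i> * of_real (\<kappa> * t w)))"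
    by (rule amp_bounded_exp[where S=T]) (use t \<delta> in \<open>force intro: order_trans\<close>)+
  have k: "amp_bounded M (\<lambda>\<kappa> w. of_real \<kappa> * (z / of_real (t w) ^ n))" for z :: complex and n
    by (intro amp_bounded_mult amp_bounded_param c)
  have kk: "amp_bounded M (\<lambda>\<kappa> w. of_real \<kappa> * (of_real \<kappa> * (z / of_real (t w) ^ n)))" for z :: complex and n
    by (intro amp_bounded_mult amp_bounded_param c)
  have "amp_bounded M (\<lambda>\<kappa> w. exp (\<i> * of_real (\<kappa> * t w)) * ((1 / (4 * of_real pi)) / of_real (t w) ^ 1))"
    by (intro amp_bounded_mult e c)
  then show "amp_bounded M (\<lambda>\<kappa> w. radial0 \<kappa> (t w))"
    by (simp add: radial0_def mult.assoc)
  have "amp_bounded M (\<lambda>\<kappa> w. exp (\<i> * of_real (\<kappa> * t w)) * (of_real \<kappa> * ((\<i> / (8 * of_real pi)) / of_real (t w) ^ 2) + (- 1 / (8 * of_real pi)) / of_real (t w) ^ 3))"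
    by (intro amp_bounded_mult amp_bounded_add e k c)
  moreover have "(\<lambda>\<kappa> w. exp (\<i> * of_real (\<kappa> * t w)) * (of_real \<kappa> * ((\<i> / (8 * of_real pi)) / of_real (t w) ^ 2) + (- 1 / (8 * of_real pi)) / of_real (t w) ^ 3))
     = (\<lambda>\<kappa> w. radial1 \<kappa> (t w))"
    by (intro ext) (simp add: radial1_def mult.assoc)
  ultimately show "amp_bounded M (\<lambda>\<kappa> w. radial1 \<kappa> (t w))" by simp
  have "amp_bounded M (\<lambda>\<kappa> w. exp (\<i> * of_real (\<kappa> * t w)) * ((of_real \<kappa> * (of_real \<kappa> * ((- 1 / (16 * of_real pi)) / of_real (t w) ^ 3))
      + of_real \<kappa> * ((- 3 * \<i> / (16 * of_real pi)) / of_real (t w) ^ 4)) + (3 / (16 * of_real pi)) / of_real (t w) ^ 5))"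
    by (intro amp_bounded_mult amp_bounded_add e k kk c)
  moreover have "(\<lambda>\<kappa> w. exp (\<i> * of_real (\<kappa> * t w)) * ((of_real \<kappa> * (of_real \<kappa> * ((- 1 / (16 * of_real pi)) / of_real (t w) ^ 3))
      + of_real \<kappa> * ((- 3 * \<i> / (16 * of_real pi)) / of_real (t w) ^ 4)) + (3 / (16 * of_real pi)) / of_real (t w) ^ 5))
     = (\<lambda>\<kappa> w. radial2 \<kappa> (t w))"
    by (intro ext) (simp add: radial2_def mult.assoc power2_eq_square)
  ultimately show "amp_bounded M (\<lambda>\<kappa> w. radial2 \<kappa> (t w))" by simp
qed

lemma amp_bounded_Greg:
  assumes \<delta>: "0 < \<delta>" and x[measurable]: "x \<in> borel_measurable M" and R: "\<And>w. w \<in> space M \<Longrightarrow> norm (x w) \<le> R"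
  shows "amp_bounded M (\<lambda>\<kappa> w. Greg \<kappa> \<delta> (x w))" "amp_bounded M (\<lambda>\<kappa> w. Kreg \<kappa> \<delta> a b (x w))"
proof -
  define t where "t w = max (norm (x w)) \<delta>" for w
  have [measurable]: "t \<in> borel_measurable M" unfolding t_def[abs_def] by measurable
  define T where "T = max \<bar>R\<bar> \<delta>"
  have t: "\<delta> \<le> t w \<and> t w \<le> T" if "w \<in> space M" for w
    using R[OF that] unfolding t_def T_def by auto
  note r = amp_bounded_radial0[OF \<open>t \<in> borel_measurable M\<close> t \<delta>]
  define s where "s w = (norm (x w))\<^sup>2 - (t w)\<^sup>2" for w
  have s_bd: "\<bar>s w\<bar> \<le> T\<^sup>2" if "w \<in> space M" for w
  proof -
    have "0 \<le> t w" using t[OF that] \<delta> by linarith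
    then have "(t w)\<^sup>2 \<le> T\<^sup>2" using t[OF that] by (intro power_mono) auto
    moreover have "(norm (x w))\<^sup>2 \<le> (t w)\<^sup>2" unfolding t_def by (intro power_mono) auto
    moreover have "0 \<le> (norm (x w))\<^sup>2" by simp
    ultimately show ?thesis unfolding s_def by linarith
  qed
  have s: "amp_bounded M (\<lambda>\<kappa> w. complex_of_real (s w))"
    by (rule amp_bounded_const[where B="T\<^sup>2"]) (use s_bd in \<open>auto simp: s_def simp flip: of_real_power of_real_diff\<close>)
  have s2: "amp_bounded M (\<lambda>\<kappa> w. complex_of_real ((s w)\<^sup>2 / 2))"
  proof (rule amp_bounded_const[where B="(T\<^sup>2)\<^sup>2"])
    fix w assume "w \<in> space M"
    from power_mono[OF s_bd[OF this] abs_ge_zero, of 2] have "(s w)\<^sup>2 \<le> (T\<^sup>2)\<^sup>2" by simp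
    moreover have "0 \<le> (s w)\<^sup>2" by simp
    ultimately show "norm (complex_of_real ((s w)\<^sup>2 / 2)) \<le> (T\<^sup>2)\<^sup>2"
      unfolding norm_of_real by linarith
  qed (simp add: s_def)
  have reg: "reg0 \<kappa> \<delta> ((norm (x w))\<^sup>2) = radial0 \<kappa> (t w) + radial1 \<kappa> (t w) * of_real (s w) + radial2 \<kappa> (t w) * of_real ((s w)\<^sup>2 / 2)"
    "reg1 \<kappa> \<delta> ((norm (x w))\<^sup>2) = radial1 \<kappa> (t w) + radial2 \<kappa> (t w) * of_real (s w)"
    "reg2 \<kappa> \<delta> ((norm (x w))\<^sup>2) = radial2 \<kappa> (t w)" for \<kappa> w
    unfolding s_def by (rule reg_norm[OF less_imp_le[OF \<delta>] t_def])+
  show G: "amp_bounded M (\<lambda>\<kappa> w. Greg \<kappa> \<delta> (x w))"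
    unfolding Greg_def reg by (intro amp_bounded_add amp_bounded_mult r s s2)
  have c1: "amp_bounded M (\<lambda>\<kappa> w. complex_of_real (2 * (a \<bullet> b)))"
    by (rule amp_bounded_const) auto
  have c0: "amp_bounded M (\<lambda>\<kappa> w. complex_of_real (a \<bullet> b))"
    by (rule amp_bounded_const) auto
  have c2: "amp_bounded M (\<lambda>\<kappa> w. complex_of_real (4 * (x w \<bullet> a) * (x w \<bullet> b)))"
  proof (rule amp_bounded_const[where B="4 * (\<bar>R\<bar> * norm a) * (\<bar>R\<bar> * norm b)"])
    fix w assume w: "w \<in> space M"
    have "\<bar>x w \<bullet> c\<bar> \<le> \<bar>R\<bar> * norm c" for c
      using Cauchy_Schwarz_ineq2[of "x w" c] mult_right_mono[of "norm (x w)" "\<bar>R\<bar>" "norm c"] R[OF w] by force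
    then show "norm (complex_of_real (4 * (x w \<bullet> a) * (x w \<bullet> b))) \<le> 4 * (\<bar>R\<bar> * norm a) * (\<bar>R\<bar> * norm b)"
      unfolding norm_of_real abs_mult by (intro mult_mono) auto
  qed measurable
  show "amp_bounded M (\<lambda>\<kappa> w. Kreg \<kappa> \<delta> a b (x w))"
    using amp_bounded_add[OF amp_bounded_mult[OF amp_bounded_mult[OF amp_bounded_mult[OF amp_bounded_param amp_bounded_param] c0] G[unfolded Greg_def reg]]
        amp_bounded_add[OF amp_bounded_mult[OF c1 amp_bounded_add[OF r(2) amp_bounded_mult[OF r(3) s]]] amp_bounded_mult[OF c2 r(3)]]]
    by (rule back_subst[where P="amp_bounded M"])
      (assumption, assumption, assumption, intro ext, simp only: Kreg_def Greg2_def Greg_def reg, simp add: power2_eq_square algebra_simps)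
qed

lemma amplitude_double_integral:
  fixes K :: "real \<Rightarrow> 'a::euclidean_space \<times> 'b::euclidean_space \<Rightarrow> complex"
  assumes K: "amp_family (lborel \<Otimes>\<^sub>M lborel) \<beta> n K" and \<beta>: "integrable (lborel \<Otimes>\<^sub>M lborel) \<beta>"
  shows "amplitude (\<lambda>\<kappa>. LINT y|lborel. LINT w|lborel. K \<kappa> (y, w))"
    and "integrable lborel (\<lambda>y. LINT w|lborel. K \<kappa> (y, w))"
proof -
  obtain A K1 K2 where W: "amp_witness (lborel \<Otimes>\<^sub>M lborel) \<beta> n A K K1 K2" using K unfolding amp_family_def by blast
  have i: "integrable (lborel \<Otimes>\<^sub>M lborel) (K \<kappa>)" for \<kappa>
  proof (rule Bochner_Integration.integrable_bound[OF integrable_mult_right[OF \<beta>] amp_witnessD(9)[OF W]])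
    show "AE p in lborel \<Otimes>\<^sub>M lborel. norm (K \<kappa> p) \<le> norm (A * (1 + \<bar>\<kappa>\<bar>) ^ n * \<beta> p)"
      by (rule AE_I2, simp only: real_norm_def, rule order_trans[OF amp_witnessD(6)[OF W] abs_ge_self])
  qed
  have "(LINT y|lborel. LINT w|lborel. K \<kappa> (y, w)) = (LINT p|(lborel \<Otimes>\<^sub>M lborel). K \<kappa> p)" for \<kappa>
    using lborel_pair.integral_fst'[OF i] .
  then show "amplitude (\<lambda>\<kappa>. LINT y|lborel. LINT w|lborel. K \<kappa> (y, w))"
    using amplitude_integral[OF K \<beta>] unfolding amplitude_def by auto
  show "integrable lborel (\<lambda>y. LINT w|lborel. K \<kappa> (y, w))"
    using lborel_pair.integrable_fst'[OF i] .
qed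

lemma lborel_integrable_product:
  fixes a :: "'a::euclidean_space \<Rightarrow> real" and b :: "'b::euclidean_space \<Rightarrow> real"
  assumes "integrable lborel a" "integrable lborel b"
  shows "integrable (lborel \<Otimes>\<^sub>M lborel) (\<lambda>p. a (fst p) * b (snd p))"
proof -
  have [measurable]: "a \<in> borel_measurable borel" "b \<in> borel_measurable borel" using assms by auto
  have "integrable (lborel \<Otimes>\<^sub>M lborel) (\<lambda>(x, y). a x * b y)"
    by (rule integrable_product_bound[OF _ _ assms]) (measurable, simp add: abs_mult)
  then show ?thesis by (simp add: split_beta')
qed

text \<open>For a smooth density supported in \<open>\<Omega>\<close> the derivatives can be moved onto the density.\<close>

lemma amplitude_Tgreen_smooth:
  assumes \<phi>: "test_function \<phi>" and \<phi>R: "\<And>x. norm x > R \<Longrightarrow> \<phi> x = 0" and R: "0 < R"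
    and h[measurable]: "h \<in> borel_measurable borel" and hB: "\<And>y. norm (h y) \<le> B" and hR: "\<And>y. norm y > R \<Longrightarrow> h y = (0::complex)"
    and ab: "a \<in> Basis" "b \<in> Basis"
  shows "amplitude (\<lambda>\<kappa>. LINT y|lborel. h y * planewave (\<kappa> *\<^sub>R v) y * Tgreen \<kappa> a b (\<lambda>z. \<phi> z * planewave (\<kappa> *\<^sub>R u) z) y)"
    and "integrable lborel (\<lambda>y. h y * planewave (\<kappa> *\<^sub>R v) y * Tgreen \<kappa> a b (\<lambda>z. \<phi> z * planewave (\<kappa> *\<^sub>R u) z) y)"
proof -
  obtain B\<phi> where B\<phi>: "C2_bounded \<phi> (\<lambda>a. dir_deriv a \<phi>) (\<lambda>a b. dir_deriv b (dir_deriv a \<phi>)) B\<phi>"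
    using C2_bounded_test_function[OF \<phi>] by blast
  note D = C2_boundedD[OF B\<phi>]
  note [measurable] = D(10) D(11)[OF ab(1)] D(11)[OF ab(2)] D(12)[OF ab]
  \<comment> \<open>\<open>A\<close> collects the weight and the singular factor 1 / (4 pi |w|),
    both free of \<kappa>; everything depending on \<kappa> goes into \<open>L\<close>, with bounds
    that are uniform in y and w.\<close>
  define A where "A p = h (fst p) * (indicator (cball 0 (3 * R)) (snd p) * (1 / (4 * of_real pi * of_real (norm (snd p)))))" for p :: "(real^3) \<times> (real^3)"
  define y' where "y' p = clip R (fst p)" for p :: "(real^3) \<times> (real^3)"
  define w' where "w' p = clip (3 * R) (snd p)" for p :: "(real^3) \<times> (real^3)"
  \<comment> \<open>The product rule for the second derivative of \<phi> times a plane wave, sorted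
    by powers of \<kappa>. The part with \<kappa>^2 merges with the Helmholtz term into the
    coefficient \<open>a \<bullet> b - (u \<bullet> a) * (u \<bullet> b)\<close>.\<close>
  define L where "L \<kappa> p = planewave (\<kappa> *\<^sub>R v) (y' p) * (exp (\<i> * of_real (\<kappa> * norm (w' p))) * (planewave (\<kappa> *\<^sub>R u) (y' p - w' p) *
     (of_real \<kappa> * (of_real \<kappa> * (of_real (a \<bullet> b - (u \<bullet> a) * (u \<bullet> b)) * \<phi> (y' p - w' p)))
      + (of_real \<kappa> * (\<i> * of_real (u \<bullet> a) * dir_deriv b \<phi> (y' p - w' p) + \<i> * of_real (u \<bullet> b) * dir_deriv a \<phi> (y' p - w' p))
      + dir_deriv b (dir_deriv a \<phi>) (y' p - w' p)))))" for \<kappa> :: real and p :: "(real^3) \<times> (real^3)"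
  have mm[measurable]: "y' \<in> borel_measurable (lborel \<Otimes>\<^sub>M lborel)" "w' \<in> borel_measurable (lborel \<Otimes>\<^sub>M lborel)"
    unfolding y'_def[abs_def] w'_def[abs_def] by measurable
  have yb: "norm (y' p) \<le> \<bar>R\<bar>" and wb: "norm (w' p) \<le> \<bar>3 * R\<bar>" for p
    unfolding y'_def w'_def by (rule norm_clip)+
  have ywb: "norm (y' p - w' p) \<le> \<bar>R\<bar> + \<bar>3 * R\<bar>" for p
    using norm_triangle_ineq4[of "y' p" "w' p"] yb[of p] wb[of p] by linarith
  have f: "amp_bounded (lborel \<Otimes>\<^sub>M lborel) (\<lambda>\<kappa> p. g (y' p - w' p))"
    if [measurable]: "g \<in> borel_measurable borel" and "\<And>x. norm (g x) \<le> B\<phi>" for g :: "real^3 \<Rightarrow> complex"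
    by (rule amp_bounded_const) (use that(2) in \<open>auto\<close>)
  have const: "amp_bounded (lborel \<Otimes>\<^sub>M lborel) (\<lambda>\<kappa> (p :: (real^3) \<times> (real^3)). c)" for c
    by (rule amp_bounded_const) auto
  have "amp_bounded (lborel \<Otimes>\<^sub>M lborel) L"
    unfolding L_def[abs_def]
    by (intro amp_bounded_mult amp_bounded_add amp_bounded_param const f D ab
        amp_bounded_planewave[OF _ yb] amp_bounded_planewave[OF _ ywb] amp_bounded_exp[where S="\<bar>3 * R\<bar>"]) (use wb in auto)
  define \<beta> where "\<beta> p = (\<bar>B\<bar> * indicator (cball 0 R) (fst p)) * (indicator (cball 0 (3 * R)) (snd p) * (1 + 1 / (norm (snd p))\<^sup>2))" for p :: "(real^3) \<times> (real^3)"
  have \<beta>: "integrable (lborel \<Otimes>\<^sub>M lborel) \<beta>"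
    unfolding \<beta>_def[abs_def] by (intro lborel_integrable_product integrable_mult_right integrable_indicator_cball integrable_sing)
  have A_bd: "norm (A p) \<le> \<beta> p" for p
  proof -
    have "norm (h (fst p)) \<le> \<bar>B\<bar> * indicator (cball 0 R) (fst p)"
      using hB[of "fst p"] hR[of "fst p"] by (cases "norm (fst p) \<le> R") auto
    moreover have "norm (indicator (cball 0 (3 * R)) (snd p) * (1 / (4 * of_real pi * of_real (norm (snd p)))) :: complex)
        \<le> indicator (cball 0 (3 * R)) (snd p) * (1 + 1 / (norm (snd p))\<^sup>2)"
      using order_trans[OF norm_radial0_le[of 0 "norm (snd p)"] inverse_le_one_plus_inverse_square[of "norm (snd p)"]]
      by (simp add: radial0_def indicator_def)
    ultimately show ?thesis unfolding A_def \<beta>_def norm_mult[of "h _"] by (intro mult_mono) auto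
  qed
  have Am: "A \<in> borel_measurable (lborel \<Otimes>\<^sub>M lborel)"
  proof -
    have [measurable]: "cball (0::real^3) (3 * R) \<in> sets borel" by simp
    show ?thesis unfolding A_def[abs_def] by measurable
  qed
  obtain n where n: "amp_family (lborel \<Otimes>\<^sub>M lborel) \<beta> n (\<lambda>\<kappa> p. A p * L \<kappa> p)"
    using amp_family_weighted[OF Am A_bd \<open>amp_bounded (lborel \<Otimes>\<^sub>M lborel) L\<close>] by blast
  have eq: "(LINT w|lborel. A (y, w) * L \<kappa> (y, w)) = h y * planewave (\<kappa> *\<^sub>R v) y * Tgreen \<kappa> a b (\<lambda>z. \<phi> z * planewave (\<kappa> *\<^sub>R u) z) y" for \<kappa> y
  proof (cases "norm y \<le> R")
    case False
    then show ?thesis using hR[of y] by (simp add: A_def)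
  next
    case True
    have supp: "\<phi> x * planewave (\<kappa> *\<^sub>R u) x = 0" if "norm x > R" for x using \<phi>R[OF that] by simp
    have y2: "norm y < 2 * R" using True R by linarith
    note T = Tgreen_compact(1)[OF C2_bounded_mult[OF B\<phi> C2_bounded_planewave[of "\<kappa> *\<^sub>R u"]] supp y2 ab, where \<kappa>=\<kappa>]
    have "A (y, w) * L \<kappa> (y, w) = h y * planewave (\<kappa> *\<^sub>R v) y * ((indicator (cball 0 (3 * R)) w * radial0 \<kappa> (norm w)) *
       (of_real (\<kappa>\<^sup>2 * (a \<bullet> b)) * (\<phi> (y - w) * planewave (\<kappa> *\<^sub>R u) (y - w)) +
        ((\<phi> (y - w) * (- of_real (((\<kappa> *\<^sub>R u) \<bullet> a) * ((\<kappa> *\<^sub>R u) \<bullet> b)) * planewave (\<kappa> *\<^sub>R u) (y - w))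
          + dir_deriv b \<phi> (y - w) * (\<i> * of_real ((\<kappa> *\<^sub>R u) \<bullet> a) * planewave (\<kappa> *\<^sub>R u) (y - w)))
         + (dir_deriv a \<phi> (y - w) * (\<i> * of_real ((\<kappa> *\<^sub>R u) \<bullet> b) * planewave (\<kappa> *\<^sub>R u) (y - w))
          + dir_deriv b (dir_deriv a \<phi>) (y - w) * planewave (\<kappa> *\<^sub>R u) (y - w)))))" for w
    proof (cases "norm w \<le> 3 * R")
      case False
      then show ?thesis by (simp add: A_def)
    next
      case w: True
      have c: "y' (y, w) = y" "w' (y, w) = w" using True w by (simp_all add: y'_def w'_def clip_eq)
      have "A (y, w) = h y * (1 / (4 * of_real pi * of_real (norm w)))" using w by (simp add: A_def)
      then show ?thesis
        using w unfolding L_def c radial0_def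
        by (simp add: power2_eq_square mult.assoc) (simp add: algebra_simps)
    qed
    then show ?thesis by (subst T) (assumption, simp only: integral_mult_right_zero)
  qed
  show "amplitude (\<lambda>\<kappa>. LINT y|lborel. h y * planewave (\<kappa> *\<^sub>R v) y * Tgreen \<kappa> a b (\<lambda>z. \<phi> z * planewave (\<kappa> *\<^sub>R u) z) y)"
    using amplitude_double_integral(1)[OF n \<beta>] unfolding eq .
  show "integrable lborel (\<lambda>y. h y * planewave (\<kappa> *\<^sub>R v) y * Tgreen \<kappa> a b (\<lambda>z. \<phi> z * planewave (\<kappa> *\<^sub>R u) z) y)"
    using amplitude_double_integral(2)[OF n \<beta>, of \<kappa>] unfolding eq .
qed

text \<open>On the compact support of the weight one regularisation radius works for all points, and the
  formula for the strongly singular integral becomes explicit in \<open>\<kappa>\<close>.\<close>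

lemma amplitude_Tgreen_rough:
  assumes \<phi>: "test_function \<phi>" "tsupp \<phi> \<subseteq> \<Omega>" and \<Omega>: "open \<Omega>" "bounded \<Omega>"
    and ab: "a \<in> Basis" "b \<in> Basis"
  shows "amplitude (\<lambda>\<kappa>. LINT y|lborel. \<phi> y * planewave (\<kappa> *\<^sub>R v) y * Tgreen \<kappa> a b (\<lambda>z. indicator \<Omega> z * planewave (\<kappa> *\<^sub>R u) z) y)"
proof -
  let ?M = "lborel \<Otimes>\<^sub>M (lborel :: (real^3) measure) :: ((real^3) \<times> (real^3)) measure"
  have \<Omega>m[measurable]: "\<Omega> \<in> sets borel" using \<Omega> by simp
  obtain R' where R': "\<forall>x\<in>\<Omega>. norm x \<le> R'" using \<Omega>(2) unfolding bounded_iff by blast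
  define R where "R = max R' 1"
  have R: "1 \<le> R" "\<And>x. x \<in> \<Omega> \<Longrightarrow> norm x \<le> R" using R' by (auto simp: R_def intro: max.coboundedI1)
  obtain B where B: "\<And>x. norm (\<phi> x) \<le> B" "0 \<le> B" using test_function_bounds[OF \<phi>(1)] by metis
  note [measurable] = test_function_measurable[OF \<phi>(1)]
  have \<phi>\<Omega>: "\<phi> y = 0" if "y \<notin> \<Omega>" for y using \<phi>(2) tsupp_vanish[of y \<phi>] that by auto
  have "compact (tsupp \<phi>)" using \<phi>(1) by (simp add: test_function_def)
  \<comment> \<open>The compact support of \<phi> has positive distance from the complement of
    \<Omega>; this is the source of one radius for all y.\<close>
  then obtain e where e: "0 < e" "(\<Union>x\<in>tsupp \<phi>. cball x e) \<subseteq> \<Omega>"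
    using compact_subset_open_imp_cball_epsilon_subset[OF _ \<Omega>(1) \<phi>(2)] by metis
  define \<delta> where "\<delta> = min 1 (e / 2)"
  have \<delta>: "0 < \<delta>" "\<delta> \<le> 1" using e by (auto simp: \<delta>_def)
  have \<delta>\<Omega>: "cball y (2 * \<delta>) \<subseteq> \<Omega>" if "\<phi> y \<noteq> 0" for y
  proof -
    have "y \<in> tsupp \<phi>" using tsupp_vanish that by blast
    then have "cball y e \<subseteq> \<Omega>" using e(2) by auto
    moreover have "cball y (2 * \<delta>) \<subseteq> cball y e" by (intro subset_cball) (simp add: \<delta>_def)
    ultimately show ?thesis by blast
  qed
  define y' where "y' p = clip R (fst p)" for p :: "(real^3) \<times> (real^3)"
  define w' where "w' p = clip R (snd p)" for p :: "(real^3) \<times> (real^3)"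
  have mm[measurable]: "y' \<in> borel_measurable ?M" "w' \<in> borel_measurable ?M"
    unfolding y'_def[abs_def] w'_def[abs_def] by measurable
  have yb: "norm (y' p) \<le> \<bar>R\<bar>" and wb: "norm (w' p) \<le> \<bar>R\<bar>" for p
    unfolding y'_def w'_def by (rule norm_clip)+
  have ywb: "norm (y' p - w' p) \<le> \<bar>R\<bar> + \<bar>R\<bar>" for p
    using norm_triangle_ineq4[of "y' p" "w' p"] yb[of p] wb[of p] by linarith
  have const: "amp_bounded ?M (\<lambda>\<kappa> p. c)" for c by (rule amp_bounded_const) auto
  define L1 where "L1 \<kappa> p = planewave (\<kappa> *\<^sub>R v) (y' p) * (Kreg \<kappa> \<delta> a b (y' p - w' p) * planewave (\<kappa> *\<^sub>R u) (w' p))" for \<kappa> :: real and p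
  \<comment> \<open>The Helmholtz term and the second derivative act on the plane wave as the scalar
    \<kappa>^2 times \<open>a \<bullet> b - (u \<bullet> a) * (u \<bullet> b)\<close>; both halves
    of \<open>Gdiff\<close> multiply this same factor.\<close>
  define Q where "Q \<kappa> p = planewave (\<kappa> *\<^sub>R v) (y' p) * (of_real \<kappa> * (of_real \<kappa> * (of_real (a \<bullet> b - (u \<bullet> a) * (u \<bullet> b)) * planewave (\<kappa> *\<^sub>R u) (y' p - w' p))))" for \<kappa> :: real and p
  have L1: "amp_bounded ?M L1"
    unfolding L1_def[abs_def]
    by (intro amp_bounded_mult amp_bounded_planewave[OF _ yb] amp_bounded_planewave[OF _ wb] amp_bounded_Greg(2)[OF \<delta>(1) _ ywb]) measurable
  have Q: "amp_bounded ?M Q"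
    unfolding Q_def[abs_def]
    by (intro amp_bounded_mult amp_bounded_param const amp_bounded_planewave[OF _ yb] amp_bounded_planewave[OF _ ywb]) measurable
  \<comment> \<open>\<open>A1\<close> belongs to the regularised kernel on \<Omega>;
    \<open>A2\<close> and \<open>A3\<close> belong to the singular and the regularised half of
    \<open>Gdiff\<close>, the minus sign between them being part of \<open>A3\<close>.\<close>
  define A1 where "A1 p = \<phi> (fst p) * indicator \<Omega> (snd p)" for p :: "(real^3) \<times> (real^3)"
  define A2 where "A2 p = \<phi> (fst p) * (indicator (cball 0 \<delta>) (snd p) * (1 / (4 * of_real pi * of_real (norm (snd p)))))" for p :: "(real^3) \<times> (real^3)"
  define A3 where "A3 p = - (\<phi> (fst p) * indicator (cball 0 \<delta>) (snd p))" for p :: "(real^3) \<times> (real^3)"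
  have Am: "A1 \<in> borel_measurable ?M" "A2 \<in> borel_measurable ?M" "A3 \<in> borel_measurable ?M"
  proof -
    have [measurable]: "cball (0::real^3) \<delta> \<in> sets borel" by simp
    show "A1 \<in> borel_measurable ?M" "A2 \<in> borel_measurable ?M" "A3 \<in> borel_measurable ?M"
      unfolding A1_def[abs_def] A2_def[abs_def] A3_def[abs_def] by measurable
  qed
  define \<beta> where "\<beta> p = (B * indicator (cball 0 R) (fst p)) * (indicator (cball 0 R) (snd p) * (1 + 1 / (norm (snd p))\<^sup>2))" for p :: "(real^3) \<times> (real^3)"
  have \<beta>: "integrable ?M \<beta>"
    unfolding \<beta>_def[abs_def] by (intro lborel_integrable_product integrable_mult_right integrable_indicator_cball integrable_sing)
  have \<phi>b: "norm (\<phi> y) \<le> B * indicator (cball 0 R) y" for y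
    using B(1)[of y] \<phi>\<Omega>[of y] R(2)[of y] by (cases "y \<in> \<Omega>") (auto simp: B)
  have bd: "norm (\<phi> (fst p) * z) \<le> \<beta> p" if "norm z \<le> indicator (cball 0 R) (snd p) * (1 + 1 / (norm (snd p))\<^sup>2)" for p and z :: complex
    unfolding \<beta>_def norm_mult using that \<phi>b B(2) by (intro mult_mono) auto
  have A1b: "norm (A1 p) \<le> \<beta> p" for p
    unfolding A1_def by (rule bd) (use R(2)[of "snd p"] in \<open>auto simp: indicator_def\<close>)
  have A2b: "norm (A2 p) \<le> \<beta> p" for p
    unfolding A2_def
  proof (rule bd)
    show "norm (indicator (cball 0 \<delta>) (snd p) * (1 / (4 * of_real pi * of_real (norm (snd p)))) :: complex)
        \<le> indicator (cball 0 R) (snd p) * (1 + 1 / (norm (snd p))\<^sup>2)"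
      using order_trans[OF norm_radial0_le[of 0 "norm (snd p)"] inverse_le_one_plus_inverse_square[of "norm (snd p)"]] R(1) \<delta>
      by (simp add: radial0_def indicator_def)
  qed
  have A3b: "norm (A3 p) \<le> \<beta> p" for p
    unfolding A3_def norm_minus_cancel by (rule bd) (use R(1) \<delta> in \<open>auto simp: indicator_def\<close>)
  have ew: "amp_bounded ?M (\<lambda>\<kappa> p. exp (\<i> * of_real (\<kappa> * norm (w' p))))"
    by (rule amp_bounded_exp[where S="\<bar>R\<bar>"]) (use wb in auto)
  have Gw: "amp_bounded ?M (\<lambda>\<kappa> p. Greg \<kappa> \<delta> (w' p))"
    by (rule amp_bounded_Greg(1)[OF \<delta>(1) _ wb]) measurable
  obtain n1 where n1: "amp_family ?M \<beta> n1 (\<lambda>\<kappa> p. A1 p * L1 \<kappa> p)"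
    using amp_family_weighted[OF Am(1) A1b L1] by blast
  obtain n2 where n2: "amp_family ?M \<beta> n2 (\<lambda>\<kappa> p. A2 p * (exp (\<i> * of_real (\<kappa> * norm (w' p))) * Q \<kappa> p))"
    using amp_family_weighted[OF Am(2) A2b amp_bounded_mult[OF ew Q]] by blast
  obtain n3 where n3: "amp_family ?M \<beta> n3 (\<lambda>\<kappa> p. A3 p * (Greg \<kappa> \<delta> (w' p) * Q \<kappa> p))"
    using amp_family_weighted[OF Am(3) A3b amp_bounded_mult[OF Gw Q]] by blast
  note n23 = amp_family_add[OF n2 n3] and \<beta>2 = Bochner_Integration.integrable_add[OF \<beta> \<beta>]
  define g2 where "g2 \<kappa> x = - of_real (((\<kappa> *\<^sub>R u) \<bullet> a) * ((\<kappa> *\<^sub>R u) \<bullet> b)) * planewave (\<kappa> *\<^sub>R u) x" for \<kappa> x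
  have eq1: "(LINT w|lborel. A1 (y, w) * L1 \<kappa> (y, w)) = \<phi> y * planewave (\<kappa> *\<^sub>R v) y * Treg \<kappa> \<delta> a b (\<lambda>z. indicator \<Omega> z * planewave (\<kappa> *\<^sub>R u) z) y" for \<kappa> y
  proof (cases "y \<in> \<Omega>")
    case False
    then show ?thesis by (simp add: A1_def \<phi>\<Omega>)
  next
    case True
    have "A1 (y, w) * L1 \<kappa> (y, w) = \<phi> y * planewave (\<kappa> *\<^sub>R v) y * (Kreg \<kappa> \<delta> a b (y - w) * (indicator \<Omega> w * planewave (\<kappa> *\<^sub>R u) w))" for w
      using R(2)[OF True] R(2)[of w] by (cases "w \<in> \<Omega>") (simp_all add: A1_def L1_def y'_def w'_def clip_eq)
    then show ?thesis
      unfolding Treg_eq_integral(1)[OF \<delta>(1) ab integrable_indicator_planewave[OF \<Omega>]] by simp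
  qed
  have eq2: "(LINT w|lborel. A2 (y, w) * (exp (\<i> * of_real (\<kappa> * norm (w' (y, w)))) * Q \<kappa> (y, w)) + A3 (y, w) * (Greg \<kappa> \<delta> (w' (y, w)) * Q \<kappa> (y, w)))
     = \<phi> y * planewave (\<kappa> *\<^sub>R v) y * (LINT w|lborel. Gdiff \<kappa> \<delta> w * (of_real (\<kappa>\<^sup>2 * (a \<bullet> b)) * planewave (\<kappa> *\<^sub>R u) (y - w) + g2 \<kappa> (y - w)))" for \<kappa> y
  proof (cases "y \<in> \<Omega>")
    case False
    then show ?thesis by (simp add: A2_def A3_def \<phi>\<Omega>)
  next
    case True
    have "A2 (y, w) * (exp (\<i> * of_real (\<kappa> * norm (w' (y, w)))) * Q \<kappa> (y, w)) + A3 (y, w) * (Greg \<kappa> \<delta> (w' (y, w)) * Q \<kappa> (y, w))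
      = \<phi> y * planewave (\<kappa> *\<^sub>R v) y * (Gdiff \<kappa> \<delta> w * (of_real (\<kappa>\<^sup>2 * (a \<bullet> b)) * planewave (\<kappa> *\<^sub>R u) (y - w) + g2 \<kappa> (y - w)))" for w
    proof (cases "norm w \<le> \<delta>")
      case False
      then show ?thesis using Gdiff_outside[OF \<delta>(1), of w \<kappa>] by (simp add: A2_def A3_def)
    next
      case w: True
      have c: "y' (y, w) = y" "w' (y, w) = w" using R(2)[OF True] w \<delta> R(1) by (simp_all add: y'_def w'_def clip_eq)
      define X :: complex where "X = 1 / (4 * of_real pi * of_real (norm w))"
      have A: "A2 (y, w) = \<phi> y * X" "A3 (y, w) = - \<phi> y" using w by (simp_all add: A2_def A3_def X_def)
      have r: "radial0 \<kappa> (norm w) = exp (\<i> * of_real (\<kappa> * norm w)) * X" by (simp add: radial0_def X_def mult.assoc)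
      show ?thesis
        unfolding Q_def c Gdiff_def g2_def A r
        by (simp add: power2_eq_square algebra_simps)
    qed
    then show ?thesis by simp
  qed
  have T: "\<phi> y * planewave (\<kappa> *\<^sub>R v) y * Tgreen \<kappa> a b (\<lambda>z. indicator \<Omega> z * planewave (\<kappa> *\<^sub>R u) z) y
    = \<phi> y * planewave (\<kappa> *\<^sub>R v) y * Treg \<kappa> \<delta> a b (\<lambda>z. indicator \<Omega> z * planewave (\<kappa> *\<^sub>R u) z) y
     + \<phi> y * planewave (\<kappa> *\<^sub>R v) y * (LINT w|lborel. Gdiff \<kappa> \<delta> w * (of_real (\<kappa>\<^sup>2 * (a \<bullet> b)) * planewave (\<kappa> *\<^sub>R u) (y - w) + g2 \<kappa> (y - w)))" for \<kappa> y
  proof (cases "\<phi> y = 0")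
    case False
    show ?thesis
      unfolding Tgreen_interior[OF C2_bounded_planewave[of "\<kappa> *\<^sub>R u"] \<Omega> \<delta> \<delta>\<Omega>[OF False] ab] g2_def by (simp add: distrib_left)
  qed simp
  have "(LINT y|lborel. \<phi> y * planewave (\<kappa> *\<^sub>R v) y * Tgreen \<kappa> a b (\<lambda>z. indicator \<Omega> z * planewave (\<kappa> *\<^sub>R u) z) y)
    = (LINT y|lborel. LINT w|lborel. A1 (y, w) * L1 \<kappa> (y, w))
     + (LINT y|lborel. LINT w|lborel. A2 (y, w) * (exp (\<i> * of_real (\<kappa> * norm (w' (y, w)))) * Q \<kappa> (y, w)) + A3 (y, w) * (Greg \<kappa> \<delta> (w' (y, w)) * Q \<kappa> (y, w)))" for \<kappa>
    unfolding T eq1[symmetric] eq2[symmetric]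
    by (rule Bochner_Integration.integral_add[OF amplitude_double_integral(2)[OF n1 \<beta>] amplitude_double_integral(2)[OF n23 \<beta>2]])
  then show ?thesis
    using amplitude_add[OF amplitude_double_integral(1)[OF n1 \<beta>] amplitude_double_integral(1)[OF n23 \<beta>2]] by simp
qed

section \<open>The kernels in Fourier space\<close>

lemma
  fixes F :: "'w \<Rightarrow> 'a::euclidean_space ^ 'n"
  assumes F: "\<And>i. integrable M (\<lambda>x. F x $ i)"
  shows integrable_vec: "integrable M F" and integral_vec_nth: "(LINT x|M. F x) $ i = (LINT x|M. F x $ i)"
proof -
  have lin: "bounded_linear (axis i :: 'a \<Rightarrow> 'a ^ 'n)" for i
    unfolding linear_conv_bounded_linear[symmetric] by (rule linearI) (auto simp: axis_def vec_eq_iff)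
  have eq: "F x = (\<Sum>i\<in>UNIV. axis i (F x $ i))" for x
    by (simp add: vec_eq_iff axis_def sum.delta')
  have "integrable M (\<lambda>x. \<Sum>i\<in>UNIV. axis i (F x $ i))"
    by (intro Bochner_Integration.integrable_sum integrable_bounded_linear[OF lin] F)
  then show "integrable M F" unfolding eq[symmetric] .
  from integral_bounded_linear[OF bounded_linear_vec_nth[of i] this] show "(LINT x|M. F x) $ i = (LINT x|M. F x $ i)" by simp
qed

lemma axis_1_in_Basis: "axis i (1::real) \<in> Basis"
  by (auto simp: Basis_vec_def)

lemma C2_bounded_const: "C2_bounded (\<lambda>x. c) (\<lambda>a x. 0) (\<lambda>a b x. 0) (norm c)"
  unfolding C2_bounded_def by (auto intro: has_dir_deriv_const)

lemma C2_bounded_add: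
  assumes f: "C2_bounded f f1 f2 A" and g: "C2_bounded g g1 g2 B"
  shows "C2_bounded (\<lambda>x. f x + g x) (\<lambda>a x. f1 a x + g1 a x) (\<lambda>a b x. f2 a b x + g2 a b x) (A + B)"
  using C2_boundedD[OF f] C2_boundedD[OF g] unfolding C2_bounded_def
  by (auto intro!: has_dir_deriv_add norm_triangle_mono continuous_intros)

section \<open>Linearity of the Green operator on densities cut off to \<Omega>\<close>

definition C2_function :: "(real^3 \<Rightarrow> complex) \<Rightarrow> bool" where
  "C2_function g \<longleftrightarrow> (\<exists>g1 g2 B. C2_bounded g g1 g2 B)"

lemma C2_function_planewave: "C2_function (planewave \<xi>)"
  unfolding C2_function_def using C2_bounded_planewave by blast

lemma C2_function_test_function: "test_function f \<Longrightarrow> C2_function f"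
  unfolding C2_function_def using C2_bounded_test_function by metis

lemma C2_function_const: "C2_function (\<lambda>x. c)"
  unfolding C2_function_def using C2_bounded_const by blast

lemma C2_function_add: "C2_function f \<Longrightarrow> C2_function g \<Longrightarrow> C2_function (\<lambda>x. f x + g x)"
  unfolding C2_function_def using C2_bounded_add by blast

lemma C2_function_mult: "C2_function f \<Longrightarrow> C2_function g \<Longrightarrow> C2_function (\<lambda>x. f x * g x)"
  unfolding C2_function_def using C2_bounded_mult by blast

lemma C2_function_sum: "(\<And>i. i \<in> I \<Longrightarrow> C2_function (f i)) \<Longrightarrow> C2_function (\<lambda>x. \<Sum>i\<in>I. f i x)"
  by (induction I rule: infinite_finite_induct) (auto intro: C2_function_const C2_function_add)

lemma C2_function_cutoff:
  assumes g: "C2_function g" and \<Omega>: "open \<Omega>" "bounded \<Omega>"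
  obtains B R where "0 \<le> B" "\<And>z. norm (indicator \<Omega> z * g z) \<le> B" "\<And>z. norm z > R \<Longrightarrow> indicator \<Omega> z * g z = 0"
    "(\<lambda>z. indicator \<Omega> z * g z) \<in> borel_measurable borel"
proof -
  obtain g1 g2 B where "C2_bounded g g1 g2 B" using g unfolding C2_function_def by blast
  note G = C2_boundedD[OF this]
  obtain R where R: "\<forall>x\<in>\<Omega>. norm x \<le> R" using \<Omega>(2) unfolding bounded_iff by blast
  have [measurable]: "\<Omega> \<in> sets borel" "g \<in> borel_measurable borel" using borel_open[OF \<Omega>(1)] G(10) by auto
  show thesis
    by (rule that[of B R]) (use G(3,9) R in \<open>auto simp: norm_mult indicator_def\<close>)
qed

lemma integrable_cutoff:
  assumes "C2_function g" "open \<Omega>" "bounded \<Omega>"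
  shows "integrable lborel (\<lambda>z. indicator \<Omega> z * g z)"
  by (rule C2_function_cutoff[OF assms]) (rule integrable_bounded_support)

lemma integrable_npot:
  assumes g: "C2_function g" and \<Omega>: "open \<Omega>" "bounded \<Omega>"
  shows "integrable lborel (\<lambda>z. radial0 \<kappa> (norm (x - z)) * (indicator \<Omega> z * g z))"
proof -
  obtain B R where B: "0 \<le> B" "\<And>z. norm (indicator \<Omega> z * g z) \<le> B" "\<And>z. norm z > R \<Longrightarrow> indicator \<Omega> z * g z = 0"
    and [measurable]: "(\<lambda>z. indicator \<Omega> z * g z) \<in> borel_measurable borel"
    using C2_function_cutoff[OF assms] by metis
  define s where "s w = indicator (cball 0 (norm x + R)) w * (1 + 1 / (norm w)\<^sup>2)" for w :: "real^3"
  have "integrable lborel (\<lambda>z. s (x - z) * B)"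
    using integrable_sing[of "norm x + R"] lborel_integrable_reflect[of s x] unfolding s_def[abs_def] by simp
  then show ?thesis
  proof (rule Bochner_Integration.integrable_bound)
    show "(\<lambda>z. radial0 \<kappa> (norm (x - z)) * (indicator \<Omega> z * g z)) \<in> borel_measurable lborel" by measurable
    show "AE z in lborel. norm (radial0 \<kappa> (norm (x - z)) * (indicator \<Omega> z * g z)) \<le> norm (s (x - z) * B)"
    proof (rule AE_I2)
      fix z
      show "norm (radial0 \<kappa> (norm (x - z)) * (indicator \<Omega> z * g z)) \<le> norm (s (x - z) * B)"
      proof (cases "norm z > R")
        case True
        show ?thesis by (subst B(3)[OF True]) simp
      next
        case False
        then have "s (x - z) = 1 + 1 / (norm (x - z))\<^sup>2"
          using norm_triangle_ineq4[of x z] by (simp add: s_def)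
        then have "norm (radial0 \<kappa> (norm (x - z))) \<le> s (x - z)"
          using order_trans[OF norm_radial0_le[of \<kappa> "norm (x - z)"] inverse_le_one_plus_inverse_square[of "norm (x - z)"]] by simp
        then have "norm (radial0 \<kappa> (norm (x - z))) * norm (indicator \<Omega> z * g z) \<le> s (x - z) * B"
          using B(2)[of z] by (intro mult_mono) (auto simp: s_def)
        also have "\<dots> \<le> norm (s (x - z) * B)" by simp
        finally show ?thesis by (simp only: norm_mult)
      qed
    qed
  qed
qed

lemma Treg_cutoff_tendsto:
  assumes "C2_function g" "open \<Omega>" "bounded \<Omega>" "y \<in> \<Omega>" "a \<in> Basis" "b \<in> Basis"
  shows "(\<lambda>n. Treg \<kappa> (radii n) a b (\<lambda>z. indicator \<Omega> z * g z) y) \<longlonglongrightarrow> Tgreen \<kappa> a b (\<lambda>z. indicator \<Omega> z * g z) y"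
  using assms Treg_tendsto unfolding C2_function_def by blast

text \<open>\<open>Treg\<close> is an absolutely convergent integral and hence additive;
  \<open>Tgreen\<close> inherits this as its pointwise limit.\<close>

lemma Tgreen_cutoff_add:
  assumes g: "C2_function g" and h: "C2_function h" and \<Omega>: "open \<Omega>" "bounded \<Omega>" and y: "y \<in> \<Omega>" and ab: "a \<in> Basis" "b \<in> Basis"
  shows "Tgreen \<kappa> a b (\<lambda>z. indicator \<Omega> z * (g z + h z)) y
    = Tgreen \<kappa> a b (\<lambda>z. indicator \<Omega> z * g z) y + Tgreen \<kappa> a b (\<lambda>z. indicator \<Omega> z * h z) y"
proof (rule LIMSEQ_unique[OF Treg_cutoff_tendsto[OF C2_function_add[OF g h] \<Omega> y ab]])
  have "Treg \<kappa> (radii n) a b (\<lambda>z. indicator \<Omega> z * (g z + h z)) y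
    = Treg \<kappa> (radii n) a b (\<lambda>z. indicator \<Omega> z * g z) y + Treg \<kappa> (radii n) a b (\<lambda>z. indicator \<Omega> z * h z) y" for n
    unfolding Treg_eq_integral(1)[OF radii(1) ab integrable_cutoff[OF C2_function_add[OF g h] \<Omega>]]
      Treg_eq_integral(1)[OF radii(1) ab integrable_cutoff[OF g \<Omega>]] Treg_eq_integral(1)[OF radii(1) ab integrable_cutoff[OF h \<Omega>]]
    unfolding distrib_left
    by (rule Bochner_Integration.integral_add) (intro Treg_eq_integral(2) radii ab integrable_cutoff g h \<Omega>)+
  then show "(\<lambda>n. Treg \<kappa> (radii n) a b (\<lambda>z. indicator \<Omega> z * (g z + h z)) y)
    \<longlonglongrightarrow> Tgreen \<kappa> a b (\<lambda>z. indicator \<Omega> z * g z) y + Tgreen \<kappa> a b (\<lambda>z. indicator \<Omega> z * h z) y"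
    using tendsto_add[OF Treg_cutoff_tendsto[OF g \<Omega> y ab, of \<kappa>] Treg_cutoff_tendsto[OF h \<Omega> y ab, of \<kappa>]] by simp
qed

lemma Tgreen_cutoff_cmult:
  assumes g: "C2_function g" and \<Omega>: "open \<Omega>" "bounded \<Omega>" and y: "y \<in> \<Omega>" and ab: "a \<in> Basis" "b \<in> Basis"
  shows "Tgreen \<kappa> a b (\<lambda>z. indicator \<Omega> z * (c * g z)) y = c * Tgreen \<kappa> a b (\<lambda>z. indicator \<Omega> z * g z) y"
proof (rule LIMSEQ_unique[OF Treg_cutoff_tendsto[OF C2_function_mult[OF C2_function_const g] \<Omega> y ab]])
  have "Treg \<kappa> (radii n) a b (\<lambda>z. indicator \<Omega> z * (c * g z)) y = c * Treg \<kappa> (radii n) a b (\<lambda>z. indicator \<Omega> z * g z) y" for n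
    unfolding Treg_eq_integral(1)[OF radii(1) ab integrable_cutoff[OF C2_function_mult[OF C2_function_const g] \<Omega>]]
      Treg_eq_integral(1)[OF radii(1) ab integrable_cutoff[OF g \<Omega>]]
    by (subst integral_mult_right_zero[symmetric]) (simp add: ac_simps)
  then show "(\<lambda>n. Treg \<kappa> (radii n) a b (\<lambda>z. indicator \<Omega> z * (c * g z)) y) \<longlonglongrightarrow> c * Tgreen \<kappa> a b (\<lambda>z. indicator \<Omega> z * g z) y"
    using tendsto_mult_left[OF Treg_cutoff_tendsto[OF g \<Omega> y ab, of \<kappa>], of c] by simp
qed

lemma Tgreen_cutoff_sum:
  assumes I: "finite I" and g: "\<And>i. i \<in> I \<Longrightarrow> C2_function (g i)"
    and \<Omega>: "open \<Omega>" "bounded \<Omega>" and y: "y \<in> \<Omega>" and ab: "a \<in> Basis" "b \<in> Basis"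
  shows "Tgreen \<kappa> a b (\<lambda>z. indicator \<Omega> z * (\<Sum>i\<in>I. c i * g i z)) y = (\<Sum>i\<in>I. c i * Tgreen \<kappa> a b (\<lambda>z. indicator \<Omega> z * g i z) y)"
  using I g
proof (induction I)
  case empty
  show ?case using Tgreen_cutoff_cmult[OF C2_function_const \<Omega> y ab, of \<kappa> 0 0] by simp
next
  case (insert i I)
  have "C2_function (\<lambda>z. \<Sum>i\<in>I. c i * g i z)" "C2_function (\<lambda>z. c i * g i z)"
    using insert.prems by (auto intro!: C2_function_sum C2_function_mult C2_function_const)
  from Tgreen_cutoff_add[OF this(2,1) \<Omega> y ab, of \<kappa>] Tgreen_cutoff_cmult[OF insert.prems[of i] \<Omega> y ab, of \<kappa> "c i"] insert
  show ?case by simp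
qed

lemma scaleR_vec_nth: "(r *\<^sub>R (x :: complex ^ 'n)) $ i = of_real r * x $ i"
  unfolding vector_scaleR_component by (rule scaleR_conv_of_real)

lemma green_eq_radial0: "green c \<omega> x = radial0 (\<omega> / c) (norm x)"
  by (simp add: green_def radial0_def mult.assoc)

text \<open>The bridge from \<open>green_op\<close> to scalar terms. The divergence differentiates
  along \<open>axis j 1\<close> first and the gradient along \<open>axis i 1\<close> second, which
  is the order in \<open>Tgreen\<close>, so no symmetry of second derivatives is invoked.\<close>

lemma green_op_nth:
  assumes g: "\<And>j. C2_function (g j)" and \<Omega>: "open \<Omega>" "bounded \<Omega>" and y: "y \<in> \<Omega>"
    and F: "\<And>z j. F z $ j = indicator \<Omega> z * g j z"
  shows "green_op c \<omega> F y $ i = (\<Sum>j\<in>UNIV. Tgreen (\<omega> / c) (axis j 1) (axis i 1) (\<lambda>z. indicator \<Omega> z * g j z) y)"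
proof -
  let ?N = "\<lambda>j. npot (\<omega> / c) (\<lambda>z. indicator \<Omega> z * g j z)"
  define u where "u = (\<lambda>x. LINT y|lborel. green c \<omega> (x - y) *s F y)"
  have u: "u x $ j = ?N j x" for x j
    unfolding u_def npot_def green_eq_radial0
    by (subst integral_vec_nth) (simp_all add: F integrable_npot[OF g \<Omega>])
  have div: "divergence u = (\<lambda>x. \<Sum>j\<in>UNIV. dir_deriv (axis j 1) (?N j) x)"
    by (rule ext) (simp add: divergence_def u)
  obtain e where e: "0 < e" "e \<le> 1" "\<And>\<delta>. 0 < \<delta> \<Longrightarrow> \<delta> \<le> e \<Longrightarrow> cball y (2 * \<delta>) \<subseteq> \<Omega>"
    using interior_radius[OF \<Omega>(1) y] by metis
  \<comment> \<open>The divergence is a sum and can be differentiated term by term only once every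
    term is known to have a derivative at y.\<close>
  have d: "has_dir_deriv (axis i 1) (dir_deriv (axis j 1) (?N j)) (dir_deriv (axis i 1) (dir_deriv (axis j 1) (?N j)) y) y" for j
  proof -
    obtain g1 g2 B where "C2_bounded (g j) g1 g2 B" using g[of j] unfolding C2_function_def by blast
    from npot_interior_deriv(2)[OF this \<Omega> e(1,2) e(3)[OF e(1) order_refl] axis_1_in_Basis axis_1_in_Basis] show ?thesis .
  qed
  have "gradient (divergence u) y $ i = (\<Sum>j\<in>UNIV. dir_deriv (axis i 1) (dir_deriv (axis j 1) (?N j)) y)"
    unfolding gradient_def div by (simp add: has_dir_deriv_imp_dir_deriv[OF has_dir_deriv_sum[OF d]])
  moreover have "((\<omega>\<^sup>2 / c\<^sup>2) *\<^sub>R u y) $ i = (\<Sum>j\<in>UNIV. of_real ((\<omega> / c)\<^sup>2 * (axis j 1 \<bullet> axis i (1::real))) * ?N j y)"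
    by (simp only: scaleR_vec_nth u)
      (simp add: inner_axis_axis power_divide if_distrib[of "\<lambda>x. _ * x"] if_distrib[of "\<lambda>x. x * _"] if_distrib[of of_real] cong: if_cong)
  ultimately show ?thesis
    unfolding green_op_def Let_def u_def[symmetric] Tgreen_def by (simp add: sum.distrib)
qed

text \<open>In the inner integral y is fixed, so its part of the phase is a constant
  \<open>A y\<close> and the density is a plane wave in z. For the kernel in z the vector k shifts
  the wave vector, for the kernel in y it goes into \<open>A\<close>. The factors
  \<open>\<omega>\<^sup>2 / c\<^sup>2\<close> and \<open>c\<^sup>2 / \<omega>\<^sup>2\<close>
  cancel.\<close>

lemma kern_nth:
  assumes \<Omega>: "open \<Omega>" "bounded \<Omega>" and c: "0 < c" "0 < \<omega>"
    and ph: "\<And>y z. exp (- \<i> * of_real (\<omega> / c * (z $ 3 + \<theta> \<bullet> y))) * exp (\<i> * of_real (k \<bullet> \<alpha> y z)) = A y * planewave \<xi> z"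
  shows "kern c \<Omega> \<alpha> \<omega> \<theta> k $ i $ j
    = of_real (1 / (2 * pi) ^ 3) * (LINT y|lborel. A y * TP \<Omega> (\<omega> / c) (axis j 1) (axis i 1) \<xi> y)"
proof -
  let ?F = "\<lambda>y z. (indicator \<Omega> z * exp (- \<i> * of_real (\<omega> / c * (z $ 3 + \<theta> \<bullet> y))) * exp (\<i> * of_real (k \<bullet> \<alpha> y z))) *s axis j (1::complex)"
  have G: "green_op c \<omega> (?F y) y $ i = A y * Tgreen (\<omega> / c) (axis j 1) (axis i 1) (\<lambda>z. indicator \<Omega> z * planewave \<xi> z) y" if y: "y \<in> \<Omega>" for y
  proof -
    have "green_op c \<omega> (?F y) y $ i
      = (\<Sum>l\<in>UNIV. Tgreen (\<omega> / c) (axis l 1) (axis i 1) (\<lambda>z. indicator \<Omega> z * ((if l = j then A y else 0) * planewave \<xi> z)) y)"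
      by (rule green_op_nth[OF C2_function_mult[OF C2_function_const C2_function_planewave] \<Omega> y])
        (simp add: axis_def mult.assoc flip: ph)
    also have "\<dots> = (\<Sum>l\<in>UNIV. (if l = j then A y else 0) * Tgreen (\<omega> / c) (axis l 1) (axis i 1) (\<lambda>z. indicator \<Omega> z * planewave \<xi> z) y)"
      by (simp only: Tgreen_cutoff_cmult[OF C2_function_planewave \<Omega> y axis_1_in_Basis axis_1_in_Basis])
    finally show ?thesis by (simp add: if_distrib[of "\<lambda>x. x * _"] cong: if_cong)
  qed
  have "(LINT y:\<Omega>|lborel. green_tensor_int c \<omega> (?F y) y $ i)
    = (LINT y|lborel. of_real (c\<^sup>2 / \<omega>\<^sup>2) * (A y * TP \<Omega> (\<omega> / c) (axis j 1) (axis i 1) \<xi> y))"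
    unfolding set_lebesgue_integral_def
  proof (rule Bochner_Integration.integral_cong[OF refl])
    fix y
    show "indicator \<Omega> y *\<^sub>R (green_tensor_int c \<omega> (?F y) y $ i) = of_real (c\<^sup>2 / \<omega>\<^sup>2) * (A y * TP \<Omega> (\<omega> / c) (axis j 1) (axis i 1) \<xi> y)"
    proof (cases "y \<in> \<Omega>")
      case True
      then show ?thesis
        unfolding green_tensor_int_def scaleR_vec_nth G[OF True] by (simp add: TP_def)
    qed (simp add: TP_def)
  qed
  moreover have "of_real (\<omega>\<^sup>2 / (c\<^sup>2 * (2 * pi) ^ 3)) * of_real (c\<^sup>2 / \<omega>\<^sup>2) = complex_of_real (1 / (2 * pi) ^ 3)"
    using c unfolding of_real_mult[symmetric] by (simp add: field_simps)
  ultimately show ?thesis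
    unfolding kern_def vec_lambda_beta integral_mult_right_zero by (simp only: mult.assoc[symmetric])
qed

lemma exp_eq_planewave:
  "exp (- \<i> * of_real (\<kappa> * (z $ 3 + \<theta> \<bullet> y))) = planewave (\<kappa> *\<^sub>R (- \<theta>)) y * planewave (\<kappa> *\<^sub>R (- e3)) z"
  by (simp add: planewave_def e3_def inner_axis' exp_add[symmetric] algebra_simps)

lemma kern_z_nth:
  assumes \<Omega>: "open \<Omega>" "bounded \<Omega>" and c: "0 < c" "0 < \<omega>"
  shows "kern_z c \<Omega> \<omega> \<theta> k $ i $ j = of_real (1 / (2 * pi) ^ 3) *
    (LINT y|lborel. planewave ((\<omega> / c) *\<^sub>R (- \<theta>)) y * TP \<Omega> (\<omega> / c) (axis j 1) (axis i 1) (k + (\<omega> / c) *\<^sub>R (- e3)) y)"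
  unfolding kern_z_def
  by (rule kern_nth[OF assms], unfold exp_eq_planewave planewave_mult[symmetric]) (simp add: planewave_def mult.commute)

lemma kern_y_nth:
  assumes \<Omega>: "open \<Omega>" "bounded \<Omega>" and c: "0 < c" "0 < \<omega>"
  shows "kern_y c \<Omega> \<omega> \<theta> k $ i $ j = of_real (1 / (2 * pi) ^ 3) *
    (LINT y|lborel. (planewave k y * planewave ((\<omega> / c) *\<^sub>R (- \<theta>)) y) * TP \<Omega> (\<omega> / c) (axis j 1) (axis i 1) ((\<omega> / c) *\<^sub>R (- e3)) y)"
  unfolding kern_y_def
  by (rule kern_nth[OF assms], unfold exp_eq_planewave) (simp add: planewave_def)

text \<open>The L^1 bound for \<open>TP\<close> is independent of the wave vector, so the y-integral
  of the modulus is at most a constant times \<open>norm (\<Phi> k)\<close>. This justifies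
  exchanging the integrals over k and y in both operators.\<close>

lemma integrable_TP_product:
  fixes \<Phi> :: "real^3 \<Rightarrow> complex"
  assumes \<Omega>: "open \<Omega>" "bounded \<Omega>" and \<Phi>: "integrable lborel \<Phi>"
    and A[measurable]: "case_prod A \<in> borel_measurable (lborel \<Otimes>\<^sub>M lborel)" and A1: "\<And>k y. norm (A k y) \<le> 1"
    and \<xi>[measurable]: "\<xi> \<in> borel_measurable borel" and ab: "a \<in> Basis" "b \<in> Basis"
  shows "integrable (lborel \<Otimes>\<^sub>M lborel) (\<lambda>(k, y). \<Phi> k * (A k y * TP \<Omega> \<kappa> a b (\<xi> k) y))"
proof -
  obtain C where C: "0 \<le> C" "\<And>\<kappa> a b \<xi>. a \<in> Basis \<Longrightarrow> b \<in> Basis \<Longrightarrow> integrable lborel (TP \<Omega> \<kappa> a b \<xi>)"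
    "\<And>\<kappa> a b \<xi>. a \<in> Basis \<Longrightarrow> b \<in> Basis \<Longrightarrow> (LINT y|lborel. norm (TP \<Omega> \<kappa> a b \<xi> y)) \<le> C * (1 + \<bar>\<kappa>\<bar>) ^ 8"
  proof (rule TP_L1_bound[OF \<Omega>], goal_cases)
    case (1 C)
    show ?case by (rule 1(1)[OF 1(2-4)])
  qed
  have [measurable]: "\<Phi> \<in> borel_measurable borel" using \<Phi> by auto
  have TPm[measurable]: "(\<lambda>p. TP \<Omega> \<kappa> a b (\<xi> (fst p)) (snd p)) \<in> borel_measurable (lborel \<Otimes>\<^sub>M lborel)"
    by (intro TP_measurable ab \<Omega>) measurable
  have Am: "(\<lambda>p. A (fst p) (snd p)) \<in> borel_measurable (lborel \<Otimes>\<^sub>M lborel)"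
    using A by (simp add: split_beta')
  let ?f = "\<lambda>p. \<Phi> (fst p) * (A (fst p) (snd p) * TP \<Omega> \<kappa> a b (\<xi> (fst p)) (snd p))"
  have fm: "?f \<in> borel_measurable (lborel \<Otimes>\<^sub>M lborel)"
    by (intro borel_measurable_times TPm Am) measurable
  have Ay: "A k \<in> borel_measurable lborel" for k
    using measurable_Pair2[OF A, of k] by simp
  have bd: "norm (?f (k, y)) \<le> norm (\<Phi> k) * norm (TP \<Omega> \<kappa> a b (\<xi> k) y)" for k y
    using mult_right_mono[OF A1[of k y], of "norm (TP \<Omega> \<kappa> a b (\<xi> k) y)"] by (simp add: norm_mult mult_left_mono)
  have inner: "integrable lborel (\<lambda>y. ?f (k, y))" for k
  proof (rule Bochner_Integration.integrable_bound[OF integrable_mult_right[OF integrable_norm[OF C(2)[OF ab, of \<kappa> "\<xi> k"]]]])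
    show "(\<lambda>y. ?f (k, y)) \<in> borel_measurable lborel" using measurable_compose[OF measurable_Pair1' fm] by simp
    show "AE y in lborel. norm (?f (k, y)) \<le> norm (norm (\<Phi> k) * norm (TP \<Omega> \<kappa> a b (\<xi> k) y))"
      using bd by (auto simp: abs_mult)
  qed
  have "integrable (lborel \<Otimes>\<^sub>M lborel) ?f"
  proof (rule lborel_pair.Fubini_integrable[OF fm])
    show "integrable lborel (\<lambda>k. LINT y|lborel. norm (?f (k, y)))"
    proof (rule Bochner_Integration.integrable_bound[OF integrable_mult_left[OF integrable_norm[OF \<Phi>]]])
      show "(\<lambda>k. LINT y|lborel. norm (?f (k, y))) \<in> borel_measurable lborel"
        by (rule lborel.borel_measurable_lebesgue_integral) (use fm in \<open>simp add: split_beta'\<close>)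
      show "AE k in lborel. norm (LINT y|lborel. norm (?f (k, y))) \<le> norm (norm (\<Phi> k) * (C * (1 + \<bar>\<kappa>\<bar>) ^ 8))"
      proof (rule AE_I2)
        fix k
        have "(LINT y|lborel. norm (?f (k, y))) \<le> (LINT y|lborel. norm (\<Phi> k) * norm (TP \<Omega> \<kappa> a b (\<xi> k) y))"
          by (intro integral_mono integrable_norm inner integrable_mult_right C ab bd)
        also have "\<dots> \<le> norm (\<Phi> k) * (C * (1 + \<bar>\<kappa>\<bar>) ^ 8)"
          using C(3)[OF ab, of \<kappa> "\<xi> k"] by (simp add: mult_left_mono)
        finally show "norm (LINT y|lborel. norm (?f (k, y))) \<le> norm (norm (\<Phi> k) * (C * (1 + \<bar>\<kappa>\<bar>) ^ 8))"
          by (simp add: abs_mult C(1))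
      qed
    qed
    show "AE k in lborel. integrable lborel (\<lambda>y. ?f (k, y))" using inner by simp
  qed
  then show ?thesis by (simp add: split_beta')
qed

text \<open>In this operator k shifts the wave vector of the density; after the exchange the
  k-integral rebuilds the density \<open>P j m\<close> inside the Green operator, by
  \<open>Tgreen_fourier_synthesis\<close>.\<close>

lemma K_op_nth:
  assumes \<Omega>: "open \<Omega>" "bounded \<Omega>" and c: "0 < c" "0 < \<omega>"
    and P: "\<And>j m. test_function (P j m)" "\<And>j m. tsupp (P j m) \<subseteq> \<Omega>"
    and F: "\<And>k j m. F k $ j $ m = fourier (P j m) k"
  shows "K_op c \<Omega> F \<omega> \<theta> $ i $ m = (\<Sum>j\<in>UNIV. LINT y|lborel. indicator \<Omega> y * planewave ((\<omega> / c) *\<^sub>R (- \<theta>)) y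
    * Tgreen (\<omega> / c) (axis j 1) (axis i 1) (\<lambda>z. P j m z * planewave ((\<omega> / c) *\<^sub>R (- e3)) z) y)"
proof -
  have one: "of_real (1 / (2 * pi) ^ 3) * of_real ((2 * pi) ^ 3) = (1::complex)" by (simp flip: of_real_mult)
  define \<kappa> where "\<kappa> = \<omega> / c"
  define f where "f i j m k y = fourier (P j m) k * (planewave (\<kappa> *\<^sub>R (- \<theta>)) y * TP \<Omega> \<kappa> (axis j 1) (axis i 1) (k + \<kappa> *\<^sub>R (- e3)) y)" for i j m k y
  have f: "integrable (lborel \<Otimes>\<^sub>M lborel) (\<lambda>(k, y). f i j m k y)" for i j m
    unfolding f_def
    by (rule integrable_TP_product[OF \<Omega> test_function_fourier_integrable(2)[OF P(1)] _ _ _ axis_1_in_Basis axis_1_in_Basis])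
      (auto simp: norm_planewave intro!: borel_measurable_planewave)
  have K: "kern_z c \<Omega> \<omega> \<theta> k $ i $ j * F k $ j $ m = of_real (1 / (2 * pi) ^ 3) * (LINT y|lborel. f i j m k y)" for i j m k
    unfolding kern_z_nth[OF \<Omega> c] F f_def \<kappa>_def by simp
  have int: "integrable lborel (\<lambda>k. kern_z c \<Omega> \<omega> \<theta> k $ i $ j * F k $ j $ m)" for i j m
    unfolding K using lborel_pair.integrable_fst[OF f] by (intro integrable_mult_right)
  have ent: "(kern_z c \<Omega> \<omega> \<theta> k ** F k) $ i $ m = (\<Sum>j\<in>UNIV. kern_z c \<Omega> \<omega> \<theta> k $ i $ j * F k $ j $ m)" for i m k
    by (simp add: matrix_matrix_mult_def)
  have i1: "integrable lborel (\<lambda>k. (kern_z c \<Omega> \<omega> \<theta> k ** F k) $ i $ m)" for i m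
    unfolding ent by (intro Bochner_Integration.integrable_sum int)
  have "K_op c \<Omega> F \<omega> \<theta> $ i $ m = (LINT k|lborel. (kern_z c \<Omega> \<omega> \<theta> k ** F k) $ i $ m)"
    unfolding K_op_def by (subst integral_vec_nth, intro integrable_vec i1, subst integral_vec_nth, rule i1, rule refl)
  also have "\<dots> = (\<Sum>j\<in>UNIV. LINT k|lborel. kern_z c \<Omega> \<omega> \<theta> k $ i $ j * F k $ j $ m)"
    unfolding ent by (rule Bochner_Integration.integral_sum) (rule int)
  also have "\<dots> = (\<Sum>j\<in>UNIV. LINT y|lborel. indicator \<Omega> y * planewave (\<kappa> *\<^sub>R (- \<theta>)) y
    * Tgreen \<kappa> (axis j 1) (axis i 1) (\<lambda>z. P j m z * planewave (\<kappa> *\<^sub>R (- e3)) z) y)"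
  proof (rule sum.cong[OF refl])
    fix j
    have "(LINT k|lborel. kern_z c \<Omega> \<omega> \<theta> k $ i $ j * F k $ j $ m) = of_real (1 / (2 * pi) ^ 3) * (LINT k|lborel. LINT y|lborel. f i j m k y)"
      unfolding K by simp
    also have "(LINT k|lborel. LINT y|lborel. f i j m k y) = (LINT y|lborel. LINT k|lborel. f i j m k y)"
      by (rule lborel_pair.Fubini_integral[symmetric]) (rule f)
    also have "\<dots> = (LINT y|lborel. of_real ((2 * pi) ^ 3) * (indicator \<Omega> y * planewave (\<kappa> *\<^sub>R (- \<theta>)) y
      * Tgreen \<kappa> (axis j 1) (axis i 1) (\<lambda>z. P j m z * planewave (\<kappa> *\<^sub>R (- e3)) z) y))"
    proof (rule Bochner_Integration.integral_cong[OF refl])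
      fix y
      show "(LINT k|lborel. f i j m k y) = of_real ((2 * pi) ^ 3) * (indicator \<Omega> y * planewave (\<kappa> *\<^sub>R (- \<theta>)) y
        * Tgreen \<kappa> (axis j 1) (axis i 1) (\<lambda>z. P j m z * planewave (\<kappa> *\<^sub>R (- e3)) z) y)"
      proof (cases "y \<in> \<Omega>")
        case True
        have "(LINT k|lborel. f i j m k y) = planewave (\<kappa> *\<^sub>R (- \<theta>)) y * (LINT k|lborel. fourier (P j m) k * TP \<Omega> \<kappa> (axis j 1) (axis i 1) (k + \<kappa> *\<^sub>R (- e3)) y)"
          unfolding f_def integral_mult_right_zero[symmetric] by (simp add: ac_simps)
        then show ?thesis
          unfolding Tgreen_fourier_synthesis[OF P \<Omega> axis_1_in_Basis axis_1_in_Basis True] using True by simp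
      qed (simp add: f_def TP_def)
    qed
    finally show "(LINT k|lborel. kern_z c \<Omega> \<omega> \<theta> k $ i $ j * F k $ j $ m) = (LINT y|lborel. indicator \<Omega> y * planewave (\<kappa> *\<^sub>R (- \<theta>)) y
      * Tgreen \<kappa> (axis j 1) (axis i 1) (\<lambda>z. P j m z * planewave (\<kappa> *\<^sub>R (- e3)) z) y)"
      by (simp only: integral_mult_right_zero) (simp only: mult.assoc[symmetric] one mult_1_left)
  qed
  finally show ?thesis unfolding \<kappa>_def .
qed

text \<open>Here k occurs only in the phase in y, outside the Green operator, so plain Fourier
  inversion at y turns the k-integral into the weight \<open>P i j\<close>.\<close>

lemma K_dagger_nth:
  assumes \<Omega>: "open \<Omega>" "bounded \<Omega>" and c: "0 < c" "0 < \<omega>"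
    and P: "\<And>j m. test_function (P j m)" "\<And>j m. tsupp (P j m) \<subseteq> \<Omega>"
    and F: "\<And>k j m. F k $ j $ m = fourier (P j m) k"
  shows "K_dagger c \<Omega> F \<omega> \<theta> $ i $ m = (\<Sum>j\<in>UNIV. LINT y|lborel. P i j y * planewave ((\<omega> / c) *\<^sub>R (- \<theta>)) y
    * Tgreen (\<omega> / c) (axis m 1) (axis j 1) (\<lambda>z. indicator \<Omega> z * planewave ((\<omega> / c) *\<^sub>R (- e3)) z) y)"
proof -
  have one: "of_real (1 / (2 * pi) ^ 3) * of_real ((2 * pi) ^ 3) = (1::complex)" by (simp flip: of_real_mult)
  define \<kappa> where "\<kappa> = \<omega> / c"
  define f where "f i j m k y = fourier (P i j) k * ((planewave k y * planewave (\<kappa> *\<^sub>R (- \<theta>)) y) * TP \<Omega> \<kappa> (axis m 1) (axis j 1) (\<kappa> *\<^sub>R (- e3)) y)" for i j m k y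
  have f: "integrable (lborel \<Otimes>\<^sub>M lborel) (\<lambda>(k, y). f i j m k y)" for i j m
    unfolding f_def
    by (rule integrable_TP_product[OF \<Omega> test_function_fourier_integrable(2)[OF P(1)] _ _ _ axis_1_in_Basis axis_1_in_Basis])
      (auto simp: norm_planewave norm_mult split_beta' intro!: borel_measurable_planewave borel_measurable_times)
  have K: "F k $ i $ j * kern_y c \<Omega> \<omega> \<theta> k $ j $ m = of_real (1 / (2 * pi) ^ 3) * (LINT y|lborel. f i j m k y)" for i j m k
    unfolding kern_y_nth[OF \<Omega> c] F f_def \<kappa>_def by simp
  have int: "integrable lborel (\<lambda>k. F k $ i $ j * kern_y c \<Omega> \<omega> \<theta> k $ j $ m)" for i j m
    unfolding K using lborel_pair.integrable_fst[OF f] by (intro integrable_mult_right)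
  have ent: "(F k ** kern_y c \<Omega> \<omega> \<theta> k) $ i $ m = (\<Sum>j\<in>UNIV. F k $ i $ j * kern_y c \<Omega> \<omega> \<theta> k $ j $ m)" for i m k
    by (simp add: matrix_matrix_mult_def)
  have i1: "integrable lborel (\<lambda>k. (F k ** kern_y c \<Omega> \<omega> \<theta> k) $ i $ m)" for i m
    unfolding ent by (intro Bochner_Integration.integrable_sum int)
  have "K_dagger c \<Omega> F \<omega> \<theta> $ i $ m = (LINT k|lborel. (F k ** kern_y c \<Omega> \<omega> \<theta> k) $ i $ m)"
    unfolding K_dagger_def by (subst integral_vec_nth, intro integrable_vec i1, subst integral_vec_nth, rule i1, rule refl)
  also have "\<dots> = (\<Sum>j\<in>UNIV. LINT k|lborel. F k $ i $ j * kern_y c \<Omega> \<omega> \<theta> k $ j $ m)"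
    unfolding ent by (rule Bochner_Integration.integral_sum) (rule int)
  also have "\<dots> = (\<Sum>j\<in>UNIV. LINT y|lborel. P i j y * planewave (\<kappa> *\<^sub>R (- \<theta>)) y
    * Tgreen \<kappa> (axis m 1) (axis j 1) (\<lambda>z. indicator \<Omega> z * planewave (\<kappa> *\<^sub>R (- e3)) z) y)"
  proof (rule sum.cong[OF refl])
    fix j
    have "(LINT k|lborel. F k $ i $ j * kern_y c \<Omega> \<omega> \<theta> k $ j $ m) = of_real (1 / (2 * pi) ^ 3) * (LINT k|lborel. LINT y|lborel. f i j m k y)"
      unfolding K by simp
    also have "(LINT k|lborel. LINT y|lborel. f i j m k y) = (LINT y|lborel. LINT k|lborel. f i j m k y)"
      by (rule lborel_pair.Fubini_integral[symmetric]) (rule f)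
    also have "\<dots> = (LINT y|lborel. of_real ((2 * pi) ^ 3) * (P i j y * planewave (\<kappa> *\<^sub>R (- \<theta>)) y
      * Tgreen \<kappa> (axis m 1) (axis j 1) (\<lambda>z. indicator \<Omega> z * planewave (\<kappa> *\<^sub>R (- e3)) z) y))"
    proof (rule Bochner_Integration.integral_cong[OF refl])
      fix y
      have "(LINT k|lborel. f i j m k y) = (LINT k|lborel. fourier (P i j) k * planewave k y)
         * (planewave (\<kappa> *\<^sub>R (- \<theta>)) y * TP \<Omega> \<kappa> (axis m 1) (axis j 1) (\<kappa> *\<^sub>R (- e3)) y)"
        unfolding f_def integral_mult_left_zero[symmetric] by (simp add: ac_simps)
      also have "(LINT k|lborel. fourier (P i j) k * planewave k y) = of_real ((2 * pi) ^ 3) * P i j y"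
        using test_function_fourier_inversion[OF P(1)[of i j], of y] by simp
      finally show "(LINT k|lborel. f i j m k y) = of_real ((2 * pi) ^ 3) * (P i j y * planewave (\<kappa> *\<^sub>R (- \<theta>)) y
        * Tgreen \<kappa> (axis m 1) (axis j 1) (\<lambda>z. indicator \<Omega> z * planewave (\<kappa> *\<^sub>R (- e3)) z) y)"
        using P(2)[of i j] tsupp_vanish[of y "P i j"] by (cases "y \<in> \<Omega>") (auto simp: TP_def)
    qed
    finally show "(LINT k|lborel. F k $ i $ j * kern_y c \<Omega> \<omega> \<theta> k $ j $ m) = (LINT y|lborel. P i j y * planewave (\<kappa> *\<^sub>R (- \<theta>)) y
      * Tgreen \<kappa> (axis m 1) (axis j 1) (\<lambda>z. indicator \<Omega> z * planewave (\<kappa> *\<^sub>R (- e3)) z) y)"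
      by (simp only: integral_mult_right_zero) (simp only: mult.assoc[symmetric] one mult_1_left)
  qed
  finally show ?thesis unfolding \<kappa>_def .
qed

section \<open>Recovering a spectrum from its half-line transform\<close>

lemma amplitude_has_derivative:
  assumes "amplitude a"
  obtains a1 where "\<And>x. (a has_vector_derivative a1 x) (at x)"
proof -
  obtain n C K1 K2 where W: "amp_witness (count_space (UNIV :: unit set)) (\<lambda>_. 1) n C (\<lambda>\<kappa> _. a \<kappa>) K1 K2"
    using assms unfolding amplitude_def amp_family_def by blast
  show thesis by (rule that[of "\<lambda>x. K1 x ()"]) (use amp_witnessD(3)[OF W, of "()"] in simp)
qed

lemma amplitude_measurable:
  assumes "amplitude a"
  shows "a \<in> borel_measurable borel"
proof -
  obtain a1 where "\<And>x. (a has_vector_derivative a1 x) (at x)"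
    using amplitude_has_derivative[OF assms] by metis
  then have "continuous_on UNIV a"
    by (intro continuous_at_imp_continuous_on ballI) (rule has_vector_derivative_continuous)
  then show ?thesis by (rule borel_measurable_continuous_onI)
qed

text \<open>The Born terms are amplitudes in the wave number \<omega> / c, whereas the data
  integrate over \<omega>.\<close>

lemma amplitude_rescale:
  assumes "amplitude a"
  shows "amplitude (\<lambda>x. a (x / c))"
proof -
  obtain n C K1 K2 where W: "amp_witness (count_space (UNIV :: unit set)) (\<lambda>_. 1) n C (\<lambda>\<kappa> _. a \<kappa>) K1 K2"
    using assms unfolding amplitude_def amp_family_def by blast
  note D = amp_witnessD(1)[OF W] amp_witnessD(3-8)[OF W, of "()", simplified]
  define r where "r = 1 / c"
  have lin: "((\<lambda>x. x / c) has_vector_derivative r) (at x)" for x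
    unfolding r_def has_real_derivative_iff_has_vector_derivative[symmetric] by (rule DERIV_cdivide[OF DERIV_ident])
  have chain: "((\<lambda>x. g (x / c)) has_vector_derivative of_real r * g') (at x)" if "(g has_vector_derivative g') (at (x / c))" for g g' x
    using vector_diff_chain_at[OF lin that] by (simp add: o_def scaleR_conv_of_real)
  define S where "S = 1 + \<bar>r\<bar>"
  have S: "1 \<le> S" by (simp add: S_def)
  have pow: "(1 + \<bar>x / c\<bar>) ^ n \<le> S ^ n * (1 + \<bar>x\<bar>) ^ n" for x
  proof -
    have "1 + \<bar>x / c\<bar> \<le> S * (1 + \<bar>x\<bar>)"
    proof -
      have "\<bar>x / c\<bar> = \<bar>r\<bar> * \<bar>x\<bar>" by (simp add: r_def abs_divide)
      then show ?thesis by (simp add: S_def algebra_simps)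
    qed
    from power_mono[OF this, of n] show ?thesis by (simp add: power_mult_distrib)
  qed
  have bd: "norm (z * w) \<le> C * S ^ n * S\<^sup>2 * (1 + \<bar>x\<bar>) ^ n" if z: "norm z \<le> S\<^sup>2" and w: "norm w \<le> C * (1 + \<bar>x / c\<bar>) ^ n" for z w :: complex and x
  proof -
    have "norm (z * w) \<le> S\<^sup>2 * (C * (S ^ n * (1 + \<bar>x\<bar>) ^ n))"
      unfolding norm_mult by (intro mult_mono z order_trans[OF w] mult_left_mono pow D(1)) auto
    then show ?thesis by (simp add: ac_simps)
  qed
  have S2: "1 \<le> S\<^sup>2" "\<bar>r\<bar> \<le> S\<^sup>2" "r\<^sup>2 \<le> S\<^sup>2"
  proof -
    show "1 \<le> S\<^sup>2" using S by (simp add: one_le_power)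
    show "r\<^sup>2 \<le> S\<^sup>2" unfolding abs_le_square_iff[symmetric] by (simp add: S_def)
    have "S \<le> S\<^sup>2" using S by (simp add: power2_eq_square)
    then show "\<bar>r\<bar> \<le> S\<^sup>2" by (simp add: S_def)
  qed
  have "amp_witness (count_space (UNIV :: unit set)) (\<lambda>_. 1) n (C * S ^ n * S\<^sup>2) (\<lambda>x _. a (x / c))
    (\<lambda>x w. of_real r * K1 (x / c) w) (\<lambda>x w. of_real r * (of_real r * K2 (x / c) w))"
    unfolding amp_witness_def
  proof (intro conjI ballI allI)
    fix w :: unit and x :: real
    have w: "w = ()" by simp
    show "((\<lambda>x. a (x / c)) has_vector_derivative of_real r * K1 (x / c) w) (at x)"
      unfolding w by (rule chain) (rule D)
    have "((\<lambda>x. K1 (x / c) ()) has_vector_derivative of_real r * K2 (x / c) ()) (at x)"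
      by (rule chain) (rule D)
    then show "((\<lambda>x. of_real r * K1 (x / c) w) has_vector_derivative of_real r * (of_real r * K2 (x / c) w)) (at x)"
      unfolding w by (rule has_vector_derivative_mult_right)
    have "isCont (\<lambda>x. K2 (x / c) ()) x"
      using has_vector_derivative_continuous[OF lin] D(4) by (rule isCont_o2)
    then show "isCont (\<lambda>x. of_real r * (of_real r * K2 (x / c) w)) x"
      unfolding w by (intro continuous_intros)
    show "norm (a (x / c)) \<le> C * S ^ n * S\<^sup>2 * (1 + \<bar>x\<bar>) ^ n * 1"
      using bd[of 1 "a (x / c)" x] S2 D(5)[of "x / c"] by simp
    show "norm (of_real r * K1 (x / c) w) \<le> C * S ^ n * S\<^sup>2 * (1 + \<bar>x\<bar>) ^ n * 1"
      using bd[of "of_real r" "K1 (x / c) ()" x] S2 D(6)[of "x / c"] by simp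
    show "norm (of_real r * (of_real r * K2 (x / c) w)) \<le> C * S ^ n * S\<^sup>2 * (1 + \<bar>x\<bar>) ^ n * 1"
      using bd[of "of_real r * of_real r" "K2 (x / c) ()" x] S2 D(7)[of "x / c"]
      by (simp add: power2_eq_square norm_mult mult.assoc)
    show "0 \<le> C * S ^ n * S\<^sup>2" using D(1) S by simp
  qed auto
  then show ?thesis unfolding amplitude_def amp_family_def by blast
qed

lemma amplitude_spectrum:
  assumes f: "test_function f"
  shows "amplitude (\<lambda>x. time_fourier f x * time_fourier f (- x))"
proof -
  note F = test_function_of_real[OF f]
  have "amplitude (\<lambda>x. time_fourier f x)" "amplitude (\<lambda>x. time_fourier f (- x))"
    unfolding amplitude_def using amp_family_fourier[OF F, of 1] amp_family_fourier[OF F, of "-1"]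
    by (auto simp: time_fourier_def)
  then show ?thesis by (rule amplitude_mult)
qed

text \<open>Supplies the condition \<open>q1 0 = 0\<close> of the half-line transform; the square is
  the factor \<omega>^2 of the far field.\<close>

lemma square_mult_amplitude_derivative_0:
  assumes "amplitude a"
  shows "((\<lambda>x. of_real (x\<^sup>2) * a x) has_vector_derivative 0) (at 0)"
proof -
  obtain a1 where a1: "\<And>x. (a has_vector_derivative a1 x) (at x)"
    using amplitude_has_derivative[OF assms] by metis
  have "((\<lambda>x. complex_of_real (x\<^sup>2)) has_vector_derivative of_real 0) (at 0)"
    by (rule has_vector_derivative_of_real) (auto intro!: derivative_eq_intros simp: has_real_derivative_iff_has_vector_derivative[symmetric])
  from has_vector_derivative_mult[OF this a1] show ?thesis by simp
qed

lemma lborel_integral_rescale: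
  fixes f :: "real \<Rightarrow> complex"
  assumes "integrable lborel f" "0 < c"
  shows "(LINT l|lborel. f (2 * l / c)) = of_real (c / 2) * (LINT x|lborel. f x)"
  using lborel_integral_affine[OF _ assms(1), of "2 / c" 0] assms(2) by (simp add: scaleR_conv_of_real)

text \<open>The real part is half the sum of the transform and its conjugate. Inverting the
  conjugate at \<omega> yields the conjugate of the extension by zero at -\<omega>, which is 0. In
  the constant, pi is half of 2 pi, and c / 2 comes from the variable 2 l / c.\<close>

lemma half_line_real_part:
  fixes q q1 q2 :: "real \<Rightarrow> complex"
  assumes q: "\<And>x. (q has_vector_derivative q1 x) (at x)" "\<And>x. (q1 has_vector_derivative q2 x) (at x)" "\<And>x. isCont q2 x"
    and bd: "\<And>x. norm (q x) \<le> C * (1 / (1 + x\<^sup>2))" "\<And>x. norm (q1 x) \<le> C * (1 / (1 + x\<^sup>2))" "\<And>x. norm (q2 x) \<le> C * (1 / (1 + x\<^sup>2))"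
    and q0: "q 0 = 0" "q1 0 = 0" and c: "0 < c" and \<omega>: "0 < \<omega>"
  shows "(LINT l|lborel. of_real (Re (LINT x|lborel. (if 0 < x then q x else 0) * exp (\<i> * of_real (x * (2 * l / c)))))
      * exp (- \<i> * of_real (\<omega> * (2 * l / c)))) = of_real (pi * c / 2) * q \<omega>"
proof -
  let ?Q = "\<lambda>x. if 0 < x then q x else 0"
  define B where "B l = (LINT x|lborel. ?Q x * exp (\<i> * of_real (x * l)))" for l
  note T = half_line_transform[OF q bd q0]
  have B: "integrable lborel B" and inv: "(LINT l|lborel. B l * exp (- \<i> * of_real (\<omega> * l))) = 2 * of_real pi * ?Q \<omega>" for \<omega>
    using T(2,3) unfolding B_def[abs_def] by auto
  define e where "e \<omega> l = exp (- \<i> * complex_of_real (\<omega> * l))" for \<omega> l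
  have e_eq: "e \<omega> l = planewave (- \<omega>) l" for \<omega> l
    by (simp add: e_def planewave_def)
  have iB: "integrable lborel (\<lambda>l. B l * e \<omega> l)" for \<omega>
    unfolding e_eq by (rule integrable_mult_planewave[OF B])
  have cB: "cnj (B l * e (- \<omega>) l) = cnj (B l) * e \<omega> l" for \<omega> l
    by (simp add: e_def exp_cnj)
  have icB: "integrable lborel (\<lambda>l. cnj (B l) * e \<omega> l)" for \<omega>
    unfolding cB[symmetric] by (rule integrable_cnj[OF iB])
  have split: "complex_of_real (Re (B l)) * e \<omega> l = 1 / 2 * (B l * e \<omega> l) + 1 / 2 * (cnj (B l) * e \<omega> l)" for l
  proof -
    have "complex_of_real (Re (B l)) = 1 / 2 * B l + 1 / 2 * cnj (B l)"
      using complex_add_cnj[of "B l"] by (simp add: field_simps)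
    then show ?thesis by (simp only: distrib_right mult.assoc)
  qed
  have "(LINT l|lborel. cnj (B l) * e \<omega> l) = cnj (LINT l|lborel. B l * e (- \<omega>) l)"
    unfolding cB[symmetric] by (rule Bochner_Integration.integral_cnj)
  also have "\<dots> = 0" using inv[of "- \<omega>"] \<omega> unfolding e_def by simp
  finally have 0: "(LINT l|lborel. cnj (B l) * e \<omega> l) = 0" .
  have "(LINT l|lborel. of_real (Re (B l)) * e \<omega> l) = 1 / 2 * (LINT l|lborel. B l * e \<omega> l) + 1 / 2 * (LINT l|lborel. cnj (B l) * e \<omega> l)"
    unfolding split
    by (subst Bochner_Integration.integral_add) (intro integrable_mult_right iB icB, intro integrable_mult_right iB icB, simp)
  then have main: "(LINT l|lborel. of_real (Re (B l)) * e \<omega> l) = of_real pi * q \<omega>"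
    unfolding 0 using inv[of \<omega>] \<omega> unfolding e_def by simp
  have "integrable lborel (\<lambda>l. of_real (Re (B l)) * e \<omega> l)"
    unfolding split by (intro Bochner_Integration.integrable_add integrable_mult_right iB icB)
  from lborel_integral_rescale[OF this c] have "(LINT l|lborel. of_real (Re (B (2 * l / c))) * e \<omega> (2 * l / c)) = of_real (pi * c / 2) * q \<omega>"
    unfolding main by simp
  then show ?thesis unfolding B_def e_def .
qed

lemma first_order_coefficient:
  fixes a b m :: complex
  assumes "(\<lambda>\<epsilon>. of_real \<epsilon> * a + of_real (\<epsilon>\<^sup>2) * b - of_real \<epsilon> * m) \<in> o[at_right 0](\<lambda>\<epsilon>. complex_of_real \<epsilon>)"
  shows "m = a"
proof -
  have "((\<lambda>\<epsilon>. (of_real \<epsilon> * a + of_real (\<epsilon>\<^sup>2) * b - of_real \<epsilon> * m) / complex_of_real \<epsilon>) \<longlongrightarrow> 0) (at_right 0)"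
    using smalloD_tendsto[OF assms] .
  moreover have "((\<lambda>\<epsilon>. (of_real \<epsilon> * a + of_real (\<epsilon>\<^sup>2) * b - of_real \<epsilon> * m) / complex_of_real \<epsilon>) \<longlongrightarrow> a + of_real 0 * b - m) (at_right 0)"
  proof (rule Lim_transform_eventually)
    show "((\<lambda>\<epsilon>. a + of_real \<epsilon> * b - m) \<longlongrightarrow> a + of_real 0 * b - m) (at_right 0)"
      by (intro tendsto_intros)
    show "\<forall>\<^sub>F \<epsilon> in at_right 0. a + of_real \<epsilon> * b - m = (of_real \<epsilon> * a + of_real (\<epsilon>\<^sup>2) * b - of_real \<epsilon> * m) / complex_of_real \<epsilon>"
      using eventually_at_right_less[of 0] by eventually_elim (simp add: field_simps power2_eq_square)
  qed
  ultimately have "0 = a + of_real 0 * b - m" by (rule tendsto_unique[OF trivial_limit_at_right_real])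
  then show ?thesis by simp
qed

text \<open>The degree 8 is that of \<open>TP_L1_bound\<close>; fixing it once spares the
  bookkeeping of degrees in sums.\<close>

definition poly_bounded :: "(real \<Rightarrow> complex) \<Rightarrow> bool" where
  "poly_bounded a \<longleftrightarrow> a \<in> borel_measurable borel \<and> (\<exists>C\<ge>0. \<forall>\<kappa>. norm (a \<kappa>) \<le> C * (1 + \<bar>\<kappa>\<bar>) ^ 8)"

lemma poly_bounded_add:
  assumes "poly_bounded a" "poly_bounded b"
  shows "poly_bounded (\<lambda>\<kappa>. a \<kappa> + b \<kappa>)"
proof -
  obtain C D where CD: "0 \<le> C" "\<And>\<kappa>. norm (a \<kappa>) \<le> C * (1 + \<bar>\<kappa>\<bar>) ^ 8" "0 \<le> D" "\<And>\<kappa>. norm (b \<kappa>) \<le> D * (1 + \<bar>\<kappa>\<bar>) ^ 8"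
    using assms unfolding poly_bounded_def by blast
  have "norm (a \<kappa> + b \<kappa>) \<le> (C + D) * (1 + \<bar>\<kappa>\<bar>) ^ 8" for \<kappa>
    using norm_triangle_mono[OF CD(2)[of \<kappa>] CD(4)[of \<kappa>]] by (simp add: distrib_right)
  moreover have "(\<lambda>\<kappa>. a \<kappa> + b \<kappa>) \<in> borel_measurable borel"
    using assms unfolding poly_bounded_def by (intro borel_measurable_add) auto
  ultimately show ?thesis
    using CD(1,3) unfolding poly_bounded_def by (intro conjI exI[of _ "C + D"]) auto
qed

lemma poly_bounded_cmult:
  assumes "poly_bounded a"
  shows "poly_bounded (\<lambda>\<kappa>. c * a \<kappa>)"
proof -
  obtain C where C: "0 \<le> C" "\<And>\<kappa>. norm (a \<kappa>) \<le> C * (1 + \<bar>\<kappa>\<bar>) ^ 8"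
    using assms unfolding poly_bounded_def by blast
  have "norm (c * a \<kappa>) \<le> (norm c * C) * (1 + \<bar>\<kappa>\<bar>) ^ 8" for \<kappa>
    using mult_left_mono[OF C(2)[of \<kappa>] norm_ge_zero[of c]] by (simp add: norm_mult mult.assoc)
  moreover have "(\<lambda>\<kappa>. c * a \<kappa>) \<in> borel_measurable borel"
    using assms unfolding poly_bounded_def by (intro borel_measurable_times) auto
  ultimately show ?thesis
    using C(1) unfolding poly_bounded_def by (intro conjI exI[of _ "norm c * C"]) auto
qed

lemma poly_bounded_sum: "(\<And>i. i \<in> I \<Longrightarrow> poly_bounded (a i)) \<Longrightarrow> poly_bounded (\<lambda>\<kappa>. \<Sum>i\<in>I. a i \<kappa>)"
proof (induction I rule: infinite_finite_induct)
  case (insert i I)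
  then show ?case by (simp add: poly_bounded_add)
qed (auto simp: poly_bounded_def)

text \<open>No derivative of \<open>a\<close> is known, so \<open>a\<close> is compared with
  \<open>p\<close>, the fourth power of \<open>1 + (x / c)\<^sup>2\<close>. This is an amplitude
  that dominates degree 8, and \<open>spectrum_damped\<close> for \<open>p\<close> provides the
  integrable majorant.\<close>

lemma integrable_spectrum_poly_bounded:
  assumes f: "test_function f" and a: "poly_bounded a" and s: "\<And>x. norm (s x) \<le> S" "s \<in> borel_measurable borel"
  shows "integrable lborel (\<lambda>x. of_real (x\<^sup>2) * (time_fourier f x * time_fourier f (- x) * (s x * a (x / c))))"
proof -
  obtain C where C: "0 \<le> C" "\<And>\<kappa>. norm (a \<kappa>) \<le> C * (1 + \<bar>\<kappa>\<bar>) ^ 8" and [measurable]: "a \<in> borel_measurable borel"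
    using a unfolding poly_bounded_def by blast
  define p where "p x = ((1 + of_real (x / c) * of_real (x / c)) * (1 + of_real (x / c) * of_real (x / c)))
     * ((1 + of_real (x / c) * of_real (x / c)) * (1 + of_real (x / c) * complex_of_real (x / c)))" for x
  have "amplitude p"
    unfolding p_def[abs_def] by (intro amplitude_mult amplitude_add amplitude_const amplitude_rescale[OF amplitude_param])
  then obtain D where D: "\<And>x. norm (of_real (x\<^sup>2) * (time_fourier f x * time_fourier f (- x) * p x)) \<le> D * (1 / (1 + x\<^sup>2))"
  proof (rule spectrum_damped[OF f], goal_cases)
    case (1 q1 q2 D)
    show ?case by (rule that[OF 1(5)])
  qed
  have p: "norm (a (x / c)) \<le> 16 * C * norm (p x)" for x
  proof -
    define k where "k = \<bar>x / c\<bar>"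
    \<comment> \<open>The fourth power of this inequality produces the factor 16.\<close>
    have "(1 + k)\<^sup>2 \<le> 2 * (1 + k\<^sup>2)" using zero_le_power2[of "1 - k"] by (simp add: power2_eq_square algebra_simps)
    from power_mono[OF this, of 4] have "(1 + k) ^ 8 \<le> 16 * (1 + k\<^sup>2) ^ 4"
      unfolding power_mult_distrib power_mult[symmetric] by simp
    moreover have "p x = of_real ((1 + k\<^sup>2) ^ 4)" unfolding p_def k_def by (simp add: power2_eq_square power4_eq_xxxx)
    then have "norm (p x) = (1 + k\<^sup>2) ^ 4" by (simp only: norm_of_real) simp
    ultimately have "C * (1 + k) ^ 8 \<le> C * (16 * norm (p x))" using C(1) by (intro mult_left_mono) auto
    then show ?thesis using C(2)[of "x / c"] unfolding k_def by (simp add: mult.assoc)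
  qed
  have [measurable]: "time_fourier f \<in> borel_measurable borel" "s \<in> borel_measurable borel"
  proof -
    note F = test_function_of_real[OF f]
    have "amplitude (\<lambda>x. time_fourier f x)"
      unfolding amplitude_def using amp_family_fourier[OF F, of 1] by (auto simp: time_fourier_def)
    then show "time_fourier f \<in> borel_measurable borel" by (rule amplitude_measurable)
  qed (rule s)
  show ?thesis
  proof (rule Bochner_Integration.integrable_bound)
    show "integrable lborel (\<lambda>x::real. (\<bar>S\<bar> * (16 * C) * D) * (1 / (1 + x\<^sup>2)))"
      by (intro integrable_mult_right integrable_inverse_1_plus_square_UNIV)
    show "AE x in lborel. norm (of_real (x\<^sup>2) * (time_fourier f x * time_fourier f (- x) * (s x * a (x / c))))
      \<le> norm ((\<bar>S\<bar> * (16 * C) * D) * (1 / (1 + x\<^sup>2)))"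
    proof (rule AE_I2)
      fix x
      let ?b = "of_real (x\<^sup>2) * (time_fourier f x * time_fourier f (- x))"
      have "norm (of_real (x\<^sup>2) * (time_fourier f x * time_fourier f (- x) * (s x * a (x / c)))) = norm (s x) * (norm (a (x / c)) * norm ?b)"
        by (simp add: norm_mult)
      also have "\<dots> \<le> \<bar>S\<bar> * ((16 * C * norm (p x)) * norm ?b)"
        using s(1)[of x] p[of x] C(1) by (intro mult_mono) auto
      also have "\<dots> = \<bar>S\<bar> * (16 * C) * norm (of_real (x\<^sup>2) * (time_fourier f x * time_fourier f (- x) * p x))"
        by (simp add: norm_mult)
      also have "\<dots> \<le> \<bar>S\<bar> * (16 * C) * (D * (1 / (1 + x\<^sup>2)))"
        using C(1) by (intro mult_left_mono D) auto
      also have "\<dots> \<le> norm ((\<bar>S\<bar> * (16 * C) * D) * (1 / (1 + x\<^sup>2)))"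
        by (simp only: real_norm_def mult.assoc[symmetric]) (rule abs_ge_self)
      finally show "norm (of_real (x\<^sup>2) * (time_fourier f x * time_fourier f (- x) * (s x * a (x / c))))
        \<le> norm ((\<bar>S\<bar> * (16 * C) * D) * (1 / (1 + x\<^sup>2)))" .
    qed
  qed measurable
qed

section \<open>Expansion of the data\<close>

text \<open>For a unit vector \<theta> this is minus the matrix of the orthogonal projection onto
  the plane perpendicular to \<theta>.\<close>

definition proj :: "real^3 \<Rightarrow> 3 \<Rightarrow> 3 \<Rightarrow> complex" where
  "proj \<theta> j i = ccross (cvec \<theta>) (ccross (cvec \<theta>) (axis i 1)) $ j"

lemma ccross_ccross_nth: "ccross (cvec \<theta>) (ccross (cvec \<theta>) w) $ j = (\<Sum>i\<in>UNIV. proj \<theta> j i * w $ i)"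
proof -
  have "j = 1 \<or> j = 2 \<or> j = 3" by (rule exhaust_3)
  then show ?thesis
    by (elim disjE) (simp_all add: proj_def ccross_def sum_3 vector_3 axis_def algebra_simps)
qed

lemma exp_eq_planewave_theta: "exp (- \<i> * of_real (\<kappa> * (\<theta> \<bullet> y))) = planewave (\<kappa> *\<^sub>R (- \<theta>)) y"
  by (simp add: planewave_def)

lemma exp_eq_planewave_e3: "exp (- \<i> * of_real (\<kappa> * y $ 3)) = planewave (\<kappa> *\<^sub>R (- e3)) y"
  by (simp add: planewave_def e3_def inner_axis')

lemma far_field_nth:
  assumes \<theta>: "norm \<theta> = 1" and \<rho>: "0 < \<rho>"
    and F: "\<And>i. integrable lborel (\<lambda>y. planewave ((\<omega> / c) *\<^sub>R (- \<theta>)) y * F y $ i)"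
  shows "far_field c \<omega> F (\<rho> *\<^sub>R \<theta>) $ j = - (of_real (\<omega>\<^sup>2) * exp (\<i> * of_real (\<omega> / c * \<rho>)) / of_real (4 * pi * \<rho> * c\<^sup>2))
    * (\<Sum>i\<in>UNIV. proj \<theta> j i * (LINT y|lborel. planewave ((\<omega> / c) *\<^sub>R (- \<theta>)) y * F y $ i))"
proof -
  have n: "norm (\<rho> *\<^sub>R \<theta>) = \<rho>" and s: "sgn (\<rho> *\<^sub>R \<theta>) = \<theta>"
    using \<theta> \<rho> by (simp_all add: sgn_div_norm)
  have nth: "(planewave ((\<omega> / c) *\<^sub>R (- \<theta>)) y *s ccross (cvec \<theta>) (ccross (cvec \<theta>) (F y))) $ j
    = (\<Sum>i\<in>UNIV. proj \<theta> j i * (planewave ((\<omega> / c) *\<^sub>R (- \<theta>)) y * F y $ i))" for y j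
    unfolding vector_smult_component ccross_ccross_nth sum_distrib_left by (simp only: ac_simps)
  have "(LINT y|lborel. planewave ((\<omega> / c) *\<^sub>R (- \<theta>)) y *s ccross (cvec \<theta>) (ccross (cvec \<theta>) (F y))) $ j
    = (LINT y|lborel. (\<Sum>i\<in>UNIV. proj \<theta> j i * (planewave ((\<omega> / c) *\<^sub>R (- \<theta>)) y * F y $ i)))"
    by (subst integral_vec_nth) (simp_all only: nth Bochner_Integration.integrable_sum integrable_mult_right F)
  also have "\<dots> = (\<Sum>i\<in>UNIV. proj \<theta> j i * (LINT y|lborel. planewave ((\<omega> / c) *\<^sub>R (- \<theta>)) y * F y $ i))"
    by (subst Bochner_Integration.integral_sum) (simp_all only: integrable_mult_right F integral_mult_right_zero)
  finally show ?thesis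
    unfolding far_field_def Let_def n s exp_eq_planewave_theta vector_smult_component by simp
qed

text \<open>The single scattering term: the Fourier transform of \<open>h\<close> at
  \<open>\<kappa> *\<^sub>R (\<theta> + e3)\<close>, where the phases of the incident and of the
  outgoing wave add up.\<close>

definition phase_integral :: "real^3 \<Rightarrow> (real^3 \<Rightarrow> complex) \<Rightarrow> real \<Rightarrow> complex" where
  "phase_integral \<theta> h \<kappa> = (LINT y|lborel. h y * planewave (\<kappa> *\<^sub>R (- \<theta> - e3)) y)"

text \<open>The double scattering term, bilinear in the weight \<open>h\<close> and the density
  \<open>g\<close>: the response in direction l to a density in direction j, with the incident phase
  on \<open>g\<close> and the outgoing phase on \<open>h\<close>. Which of the two is smooth decides
  how it is treated.\<close>

definition green_form :: "real^3 \<Rightarrow> (real^3 \<Rightarrow> complex) \<Rightarrow> (real^3 \<Rightarrow> complex) \<Rightarrow> 3 \<Rightarrow> 3 \<Rightarrow> real \<Rightarrow> complex" where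
  "green_form \<theta> h g j l \<kappa> = (LINT y|lborel. h y * planewave (\<kappa> *\<^sub>R (- \<theta>)) y
     * Tgreen \<kappa> (axis j 1) (axis l 1) (\<lambda>z. g z * planewave (\<kappa> *\<^sub>R (- e3)) z) y)"

text \<open>Coefficients of \<open>\<epsilon>\<close> in the second order Born approximation for the susceptibility
  \<open>C + \<epsilon> P\<close> on \<open>\<Omega>\<close>, without the far field prefactor; \<open>a = C p\<close>.\<close>

definition born0 :: "(real^3) set \<Rightarrow> complex^3^3 \<Rightarrow> complex^3 \<Rightarrow> real^3 \<Rightarrow> 3 \<Rightarrow> real \<Rightarrow> complex" where
  "born0 \<Omega> C a \<theta> i \<kappa> = a $ i * phase_integral \<theta> (indicator \<Omega>) \<kappa>
    + (\<Sum>l\<in>UNIV. \<Sum>j\<in>UNIV. (C $ i $ l * a $ j) * green_form \<theta> (indicator \<Omega>) (indicator \<Omega>) j l \<kappa>)"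

definition born1 :: "(real^3) set \<Rightarrow> complex^3^3 \<Rightarrow> complex^3 \<Rightarrow> (3 \<Rightarrow> 3 \<Rightarrow> real^3 \<Rightarrow> complex) \<Rightarrow> complex^3 \<Rightarrow> real^3 \<Rightarrow> 3 \<Rightarrow> real \<Rightarrow> complex" where
  "born1 \<Omega> C a P p \<theta> i \<kappa> = (\<Sum>m\<in>UNIV. p $ m * phase_integral \<theta> (P i m) \<kappa>)
    + (\<Sum>l\<in>UNIV. \<Sum>j\<in>UNIV. a $ j * green_form \<theta> (P i l) (indicator \<Omega>) j l \<kappa>
        + C $ i $ l * (\<Sum>m\<in>UNIV. p $ m * green_form \<theta> (indicator \<Omega>) (P j m) j l \<kappa>))"

definition born2 :: "(3 \<Rightarrow> 3 \<Rightarrow> real^3 \<Rightarrow> complex) \<Rightarrow> complex^3 \<Rightarrow> real^3 \<Rightarrow> 3 \<Rightarrow> real \<Rightarrow> complex" where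
  "born2 P p \<theta> i \<kappa> = (\<Sum>l\<in>UNIV. \<Sum>j\<in>UNIV. \<Sum>m\<in>UNIV. p $ m * green_form \<theta> (P i l) (P j m) j l \<kappa>)"

lemma green_form_TP:
  assumes "\<And>y. y \<notin> \<Omega> \<Longrightarrow> h y = 0"
  shows "h y * planewave (\<kappa> *\<^sub>R (- \<theta>)) y * Tgreen \<kappa> a b (\<lambda>z. indicator \<Omega> z * planewave (\<kappa> *\<^sub>R (- e3)) z) y
    = h y * planewave (\<kappa> *\<^sub>R (- \<theta>)) y * TP \<Omega> \<kappa> a b (\<kappa> *\<^sub>R (- e3)) y"
  using assms by (cases "y \<in> \<Omega>") (auto simp: TP_def)

lemma green_form_indicator_integrable:
  assumes \<Omega>: "open \<Omega>" "bounded \<Omega>" and h[measurable]: "h \<in> borel_measurable borel" and B: "\<And>y. norm (h y) \<le> B" and h0: "\<And>y. y \<notin> \<Omega> \<Longrightarrow> h y = 0"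
  shows "integrable lborel (\<lambda>y. h y * planewave (\<kappa> *\<^sub>R (- \<theta>)) y * Tgreen \<kappa> (axis j 1) (axis l 1) (\<lambda>z. indicator \<Omega> z * planewave (\<kappa> *\<^sub>R (- e3)) z) y)"
proof -
  let ?T = "TP \<Omega> \<kappa> (axis j 1) (axis l 1) (\<kappa> *\<^sub>R (- e3))"
  have T: "integrable lborel ?T"
    by (rule TP_L1_bound[OF \<Omega>]) (simp add: axis_1_in_Basis)
  then have [measurable]: "?T \<in> borel_measurable borel" by auto
  have "integrable lborel (\<lambda>y. h y * planewave (\<kappa> *\<^sub>R (- \<theta>)) y * ?T y)"
  proof (rule Bochner_Integration.integrable_bound[OF integrable_mult_right[of "B", OF integrable_norm[OF T]]])
    show "AE y in lborel. norm (h y * planewave (\<kappa> *\<^sub>R (- \<theta>)) y * ?T y) \<le> norm (B * norm (?T y))"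
    proof (rule AE_I2)
      fix y
      have "norm (h y * planewave (\<kappa> *\<^sub>R (- \<theta>)) y * ?T y) \<le> B * norm (?T y)"
        using mult_right_mono[OF B[of y], of "norm (?T y)"] by (simp add: norm_mult norm_planewave)
      then show "norm (h y * planewave (\<kappa> *\<^sub>R (- \<theta>)) y * ?T y) \<le> norm (B * norm (?T y))" by simp
    qed
  qed measurable
  moreover have "h y * planewave (\<kappa> *\<^sub>R (- \<theta>)) y * Tgreen \<kappa> (axis j 1) (axis l 1) (\<lambda>z. indicator \<Omega> z * planewave (\<kappa> *\<^sub>R (- e3)) z) y
    = h y * planewave (\<kappa> *\<^sub>R (- \<theta>)) y * ?T y" for y
    by (rule green_form_TP) (rule h0)
  ultimately show ?thesis by (simp only:)
qed

text \<open>With \<open>indicator \<Omega>\<close> both as weight and as density, the Green forms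
  are estimated by \<open>TP_L1_bound\<close>; their measurability in \<kappa> comes from the joint
  measurability of \<open>TP\<close>.\<close>

lemma poly_bounded_born0:
  assumes \<Omega>: "open \<Omega>" "bounded \<Omega>"
  shows "poly_bounded (born0 \<Omega> C a \<theta> i)"
proof -
  have \<Omega>m[measurable]: "\<Omega> \<in> sets borel" using \<Omega> by simp
  have i\<Omega>: "integrable lborel (indicator \<Omega> :: real^3 \<Rightarrow> real)"
    using emeasure_bounded_finite[OF \<Omega>(2)] by (intro integrable_real_indicator) auto
  have p: "poly_bounded (phase_integral \<theta> (indicator \<Omega>))"
    unfolding poly_bounded_def
  proof (intro conjI exI allI)
    have "(\<lambda>\<kappa>. LINT y|lborel. indicator \<Omega> y * planewave (\<kappa> *\<^sub>R (- \<theta> - e3)) y) \<in> borel_measurable borel"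
      by (rule lborel.borel_measurable_lebesgue_integral) (simp add: split_beta', measurable)
    then show "phase_integral \<theta> (indicator \<Omega>) \<in> borel_measurable borel" unfolding phase_integral_def[abs_def] .
    show "0 \<le> measure lborel \<Omega>" by simp
    fix \<kappa> :: real
    have "norm (phase_integral \<theta> (indicator \<Omega>) \<kappa>) \<le> (LINT y|lborel. norm (indicator \<Omega> y * planewave (\<kappa> *\<^sub>R (- \<theta> - e3)) y))"
      unfolding phase_integral_def by (rule integral_norm_bound)
    also have "\<dots> = (LINT y|lborel. indicator \<Omega> y)"
      by (rule Bochner_Integration.integral_cong) (auto simp: norm_mult norm_planewave indicator_def)
    also have "\<dots> = measure lborel \<Omega> * 1" using \<Omega>m by simp
    also have "\<dots> \<le> measure lborel \<Omega> * (1 + \<bar>\<kappa>\<bar>) ^ 8"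
      by (intro mult_left_mono one_le_power) auto
    finally show "norm (phase_integral \<theta> (indicator \<Omega>) \<kappa>) \<le> measure lborel \<Omega> * (1 + \<bar>\<kappa>\<bar>) ^ 8" .
  qed
  have g: "poly_bounded (green_form \<theta> (indicator \<Omega>) (indicator \<Omega>) j l)" for j l
  proof -
    let ?T = "\<lambda>\<kappa>. TP \<Omega> \<kappa> (axis j 1) (axis l 1) (\<kappa> *\<^sub>R (- e3))"
    obtain D where D: "0 \<le> D" "\<And>\<kappa>. integrable lborel (?T \<kappa>)" "\<And>\<kappa>. (LINT y|lborel. norm (?T \<kappa> y)) \<le> D * (1 + \<bar>\<kappa>\<bar>) ^ 8"
    proof (rule TP_L1_bound[OF \<Omega>], goal_cases)
      case (1 D)
      show ?case by (rule 1(1)[OF 1(2) 1(3)[OF axis_1_in_Basis axis_1_in_Basis] 1(4)[OF axis_1_in_Basis axis_1_in_Basis]])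
    qed
    have eq: "green_form \<theta> (indicator \<Omega>) (indicator \<Omega>) j l \<kappa> = (LINT y|lborel. planewave (\<kappa> *\<^sub>R (- \<theta>)) y * ?T \<kappa> y)" for \<kappa>
      unfolding green_form_def by (rule Bochner_Integration.integral_cong) (auto simp: TP_def indicator_def)
    have m: "(\<lambda>p. TP \<Omega> (fst p) (axis j 1) (axis l 1) (fst p *\<^sub>R (- e3)) (snd p)) \<in> borel_measurable (borel \<Otimes>\<^sub>M lborel)"
      by (intro TP_measurable axis_1_in_Basis \<Omega>) measurable
    show ?thesis
      unfolding poly_bounded_def
    proof (intro conjI exI allI)
      have "(\<lambda>p. planewave (fst p *\<^sub>R (- \<theta>)) (snd p) * TP \<Omega> (fst p) (axis j 1) (axis l 1) (fst p *\<^sub>R (- e3)) (snd p)) \<in> borel_measurable (borel \<Otimes>\<^sub>M lborel)"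
        by (intro borel_measurable_times m) measurable
      then have "(\<lambda>\<kappa>. LINT y|lborel. planewave (\<kappa> *\<^sub>R (- \<theta>)) y * ?T \<kappa> y) \<in> borel_measurable borel"
        by (intro lborel.borel_measurable_lebesgue_integral) (simp add: split_beta')
      then show "green_form \<theta> (indicator \<Omega>) (indicator \<Omega>) j l \<in> borel_measurable borel" unfolding eq[symmetric] .
      show "0 \<le> D" by (rule D)
      fix \<kappa>
      have "norm (green_form \<theta> (indicator \<Omega>) (indicator \<Omega>) j l \<kappa>) \<le> (LINT y|lborel. norm (planewave (\<kappa> *\<^sub>R (- \<theta>)) y * ?T \<kappa> y))"
        unfolding eq by (rule integral_norm_bound)
      also have "\<dots> \<le> D * (1 + \<bar>\<kappa>\<bar>) ^ 8" using D(3)[of \<kappa>] by (simp add: norm_mult norm_planewave)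
      finally show "norm (green_form \<theta> (indicator \<Omega>) (indicator \<Omega>) j l \<kappa>) \<le> D * (1 + \<bar>\<kappa>\<bar>) ^ 8" .
    qed
  qed
  show ?thesis
    unfolding born0_def[abs_def] by (intro poly_bounded_add poly_bounded_cmult poly_bounded_sum p g)
qed

lemma amplitude_cmult: "amplitude a \<Longrightarrow> amplitude (\<lambda>\<kappa>. c * a \<kappa>)"
  by (intro amplitude_mult amplitude_const)

text \<open>Each term falls under one of three cases: a phase integral of a test function, a Green
  form with smooth density and bounded weight, or one with density \<open>indicator \<Omega>\<close>
  and a test function as weight.\<close>

lemma
  assumes \<Omega>: "open \<Omega>" "bounded \<Omega>" and P: "\<And>j m. test_function (P j m)" "\<And>j m. tsupp (P j m) \<subseteq> \<Omega>"
  shows amplitude_born1: "amplitude (born1 \<Omega> C a P p \<theta> i)" and amplitude_born2: "amplitude (born2 P p \<theta> i)"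
    and green_form_integrable:
      "\<And>j l m. integrable lborel (\<lambda>y. indicator \<Omega> y * planewave (\<kappa> *\<^sub>R (- \<theta>)) y * Tgreen \<kappa> (axis j 1) (axis l 1) (\<lambda>z. P j m z * planewave (\<kappa> *\<^sub>R (- e3)) z) y)"
      "\<And>i j l m. integrable lborel (\<lambda>y. P i l y * planewave (\<kappa> *\<^sub>R (- \<theta>)) y * Tgreen \<kappa> (axis j 1) (axis l 1) (\<lambda>z. P j m z * planewave (\<kappa> *\<^sub>R (- e3)) z) y)"
proof -
  have \<Omega>m[measurable]: "\<Omega> \<in> sets borel" using \<Omega> by simp
  obtain R' where R': "\<forall>x\<in>\<Omega>. norm x \<le> R'" using \<Omega>(2) unfolding bounded_iff by blast
  define R where "R = max R' 1"
  have R: "0 < R" "\<And>x. x \<in> \<Omega> \<Longrightarrow> norm x \<le> R" using R' by (auto simp: R_def intro: max.coboundedI1)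
  have P0: "P j m y = 0" if "y \<notin> \<Omega>" for j m y using P(2)[of j m] tsupp_vanish[of y "P j m"] that by auto
  have PR: "P j m x = 0" if "norm x > R" for j m x using P0 R(2)[of x] that by force
  have \<Omega>R: "indicator \<Omega> x = (0::complex)" if "norm x > R" for x using R(2)[of x] that by (auto simp: indicator_def)
  have \<Omega>B: "norm (indicator \<Omega> x :: complex) \<le> 1" for x by (simp add: indicator_def)
  have I\<Omega>: "(indicator \<Omega> :: real^3 \<Rightarrow> complex) \<in> borel_measurable borel" by simp
  have Pm: "P j m \<in> borel_measurable borel" for j m by (rule test_function_measurable[OF P(1)])
  note S1 = amplitude_Tgreen_smooth[OF P(1) PR R(1) I\<Omega> \<Omega>B \<Omega>R axis_1_in_Basis axis_1_in_Basis]
  have S2: "amplitude (green_form \<theta> (P i l) (P j m) j l)"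
    "integrable lborel (\<lambda>y. P i l y * planewave (\<kappa> *\<^sub>R (- \<theta>)) y * Tgreen \<kappa> (axis j 1) (axis l 1) (\<lambda>z. P j m z * planewave (\<kappa> *\<^sub>R (- e3)) z) y)" for i l j m \<kappa>
  proof -
    obtain B where B: "\<And>x. norm (P i l x) \<le> B" using test_function_bounds[OF P(1)[of i l]] by metis
    note S = amplitude_Tgreen_smooth[OF P(1) PR R(1) Pm B PR axis_1_in_Basis axis_1_in_Basis]
    show "amplitude (green_form \<theta> (P i l) (P j m) j l)" unfolding green_form_def[abs_def] by (rule S(1))
    show "integrable lborel (\<lambda>y. P i l y * planewave (\<kappa> *\<^sub>R (- \<theta>)) y * Tgreen \<kappa> (axis j 1) (axis l 1) (\<lambda>z. P j m z * planewave (\<kappa> *\<^sub>R (- e3)) z) y)"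
      by (rule S(2))
  qed
  show "integrable lborel (\<lambda>y. indicator \<Omega> y * planewave (\<kappa> *\<^sub>R (- \<theta>)) y * Tgreen \<kappa> (axis j 1) (axis l 1) (\<lambda>z. P j m z * planewave (\<kappa> *\<^sub>R (- e3)) z) y)" for j l m
    by (rule S1(2))
  show "integrable lborel (\<lambda>y. P i l y * planewave (\<kappa> *\<^sub>R (- \<theta>)) y * Tgreen \<kappa> (axis j 1) (axis l 1) (\<lambda>z. P j m z * planewave (\<kappa> *\<^sub>R (- e3)) z) y)" for i j l m
    by (rule S2(2))
  have 1: "amplitude (green_form \<theta> (indicator \<Omega>) (P j m) j l)" for j l m
    unfolding green_form_def[abs_def] by (rule S1(1))
  have 2: "amplitude (green_form \<theta> (P i l) (indicator \<Omega>) j l)" for i j l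
    unfolding green_form_def[abs_def] by (rule amplitude_Tgreen_rough[OF P \<Omega> axis_1_in_Basis axis_1_in_Basis])
  have 3: "amplitude (phase_integral \<theta> (P i m))" for i m
    unfolding phase_integral_def[abs_def] by (rule amplitude_planewave_integral[OF test_function_integrable[OF P(1)] PR])
  show "amplitude (born1 \<Omega> C a P p \<theta> i)"
    unfolding born1_def[abs_def] by (intro amplitude_add amplitude_sum amplitude_cmult 1 2 3)
  show "amplitude (born2 P p \<theta> i)"
    unfolding born2_def[abs_def] by (intro amplitude_sum amplitude_cmult S2)
qed

lemma scaleR_mat_nth: "(r *\<^sub>R (A :: complex ^ 'n ^ 'm)) $ i $ j = of_real r * A $ i $ j"
  unfolding vector_scaleR_component by (rule scaleR_conv_of_real)

lemma test_function_0: "test_function (\<lambda>x::'a::euclidean_space. 0::'b::real_normed_vector)"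
proof -
  have Z: "dir_deriv b (\<lambda>x. 0) = (\<lambda>x. 0 :: 'b)" for b :: 'a
    by (rule ext) (rule has_dir_deriv_imp_dir_deriv[OF has_dir_deriv_const])
  have "foldr dir_deriv bs (\<lambda>x. 0) = (\<lambda>x. 0 :: 'b)" for bs :: "'a list"
    by (induction bs) (simp_all add: Z)
  then show ?thesis by (simp add: test_function_def tsupp_def smooth_def)
qed

lemma induced_field_nth:
  fixes \<psi> :: "real^3 \<Rightarrow> complex^3^3"
  assumes \<psi>0: "\<And>y i m. y \<notin> \<Omega> \<Longrightarrow> \<psi> y $ i $ m = 0"
  shows "(chi_hat \<Omega> \<chi>0 \<psi> \<epsilon> y *v E_inc c q f \<omega> y) $ i
    = indicator \<Omega> y * ((time_fourier f \<omega> * (chi0_mat \<chi>0 *v pol q) $ i) * planewave ((\<omega> / c) *\<^sub>R (- e3)) y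
      + (\<Sum>m\<in>UNIV. (time_fourier f \<omega> * (of_real \<epsilon> * pol q $ m)) * (\<psi> y $ i $ m * planewave ((\<omega> / c) *\<^sub>R (- e3)) y)))"
proof (cases "y \<in> \<Omega>")
  case True
  have "(chi_hat \<Omega> \<chi>0 \<psi> \<epsilon> y *v E_inc c q f \<omega> y) $ i
    = (\<Sum>m\<in>UNIV. (chi0_mat \<chi>0 $ i $ m + of_real \<epsilon> * \<psi> y $ i $ m) * (time_fourier f \<omega> * planewave ((\<omega> / c) *\<^sub>R (- e3)) y * pol q $ m))"
    unfolding matrix_vector_mult_def chi_hat_def E_inc_def exp_eq_planewave_e3 vec_lambda_beta
    using True by (simp add: scaleR_mat_nth[simplified])
  then show ?thesis
    using True by (simp add: matrix_vector_mult_def sum_3 algebra_simps)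
qed (simp add: chi_hat_def matrix_vector_mult_def)

lemma green_op_induced_field:
  fixes \<psi> :: "real^3 \<Rightarrow> complex^3^3"
  assumes \<Omega>: "open \<Omega>" "bounded \<Omega>" and y: "y \<in> \<Omega>"
    and \<psi>0: "\<And>y i m. y \<notin> \<Omega> \<Longrightarrow> \<psi> y $ i $ m = 0" and \<psi>: "\<And>i m. test_function (\<lambda>y. \<psi> y $ i $ m)"
  shows "green_op c \<omega> (\<lambda>z. chi_hat \<Omega> \<chi>0 \<psi> \<epsilon> z *v E_inc c q f \<omega> z) y $ l
    = time_fourier f \<omega> * (\<Sum>j\<in>UNIV. (chi0_mat \<chi>0 *v pol q) $ j * Tgreen (\<omega> / c) (axis j 1) (axis l 1) (\<lambda>z. indicator \<Omega> z * planewave ((\<omega> / c) *\<^sub>R (- e3)) z) y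
      + of_real \<epsilon> * (\<Sum>m\<in>UNIV. pol q $ m * Tgreen (\<omega> / c) (axis j 1) (axis l 1) (\<lambda>z. \<psi> z $ j $ m * planewave ((\<omega> / c) *\<^sub>R (- e3)) z) y))"
proof -
  let ?F = "time_fourier f \<omega>" and ?p = "planewave ((\<omega> / c) *\<^sub>R (- e3))" and ?a = "chi0_mat \<chi>0 *v pol q"
  let ?T = "\<lambda>j. Tgreen (\<omega> / c) (axis j 1) (axis l 1)"
  have c0: "C2_function (\<lambda>z. (?F * ?a $ j) * ?p z)" for j
    by (intro C2_function_mult C2_function_const C2_function_planewave)
  have c1: "C2_function (\<lambda>z. \<psi> z $ j $ m * ?p z)" for j m
    by (intro C2_function_mult C2_function_planewave C2_function_test_function \<psi>)
  have c2: "C2_function (\<lambda>z. \<Sum>m\<in>UNIV. (?F * (of_real \<epsilon> * pol q $ m)) * (\<psi> z $ j $ m * ?p z))" for j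
    by (intro C2_function_sum C2_function_mult[OF C2_function_const] c1)
  have cut: "indicator \<Omega> z * (\<psi> z $ j $ m * ?p z) = \<psi> z $ j $ m * ?p z" for z j m
    using \<psi>0[of z] by (cases "z \<in> \<Omega>") auto
  have "green_op c \<omega> (\<lambda>z. chi_hat \<Omega> \<chi>0 \<psi> \<epsilon> z *v E_inc c q f \<omega> z) y $ l
    = (\<Sum>j\<in>UNIV. ?T j (\<lambda>z. indicator \<Omega> z * ((?F * ?a $ j) * ?p z + (\<Sum>m\<in>UNIV. (?F * (of_real \<epsilon> * pol q $ m)) * (\<psi> z $ j $ m * ?p z)))) y)"
    by (rule green_op_nth[OF C2_function_add[OF c0 c2] \<Omega> y]) (rule induced_field_nth[OF \<psi>0])
  also have "\<dots> = (\<Sum>j\<in>UNIV. (?F * ?a $ j) * ?T j (\<lambda>z. indicator \<Omega> z * ?p z) y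
      + (\<Sum>m\<in>UNIV. (?F * (of_real \<epsilon> * pol q $ m)) * ?T j (\<lambda>z. \<psi> z $ j $ m * ?p z) y))"
    unfolding Tgreen_cutoff_add[OF c0 c2 \<Omega> y axis_1_in_Basis axis_1_in_Basis]
      Tgreen_cutoff_cmult[OF C2_function_planewave \<Omega> y axis_1_in_Basis axis_1_in_Basis]
      Tgreen_cutoff_sum[OF finite c1 \<Omega> y axis_1_in_Basis axis_1_in_Basis] cut ..
  also have "\<dots> = ?F * (\<Sum>j\<in>UNIV. ?a $ j * ?T j (\<lambda>z. indicator \<Omega> z * ?p z) y
      + of_real \<epsilon> * (\<Sum>m\<in>UNIV. pol q $ m * ?T j (\<lambda>z. \<psi> z $ j $ m * ?p z) y))"
    by (simp only: sum_distrib_left distrib_left mult.assoc)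
  finally show ?thesis .
qed

lemma planewave_theta_e3: "planewave (\<kappa> *\<^sub>R (- \<theta>)) y * planewave (\<kappa> *\<^sub>R (- e3)) y = planewave (\<kappa> *\<^sub>R (- \<theta> - e3)) y"
  unfolding planewave_mult by (simp add: scaleR_diff_right)

text \<open>The second order Born approximation is quadratic in the susceptibility, so the scattered
  field is exactly a polynomial of degree 2 in \<epsilon> and no remainder has to be
  estimated.\<close>

lemma scattered_field_nth:
  fixes \<psi> :: "real^3 \<Rightarrow> complex^3^3" and \<Omega> :: "(real^3) set" and q \<theta> :: "real^3" and \<chi>0 \<omega> c :: real
  defines "C \<equiv> chi0_mat \<chi>0" and "p \<equiv> pol q" and "P \<equiv> (\<lambda>i m y. \<psi> y $ i $ m)" and "\<kappa> \<equiv> \<omega> / c"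
  assumes \<Omega>: "open \<Omega>" "bounded \<Omega>"
    and \<psi>: "\<And>i m. test_function (\<lambda>y. \<psi> y $ i $ m)" "\<And>i m. tsupp (\<lambda>y. \<psi> y $ i $ m) \<subseteq> \<Omega>"
    and \<theta>: "norm \<theta> = 1" and \<rho>: "0 < \<rho>"
  shows "E2 c \<Omega> \<chi>0 \<psi> q f \<epsilon> \<omega> (\<rho> *\<^sub>R \<theta>) $ j - E_inc c q f \<omega> (\<rho> *\<^sub>R \<theta>) $ j
    = - (of_real (\<omega>\<^sup>2) * exp (\<i> * of_real (\<omega> / c * \<rho>)) / of_real (4 * pi * \<rho> * c\<^sup>2)) *
      (\<Sum>i\<in>UNIV. proj \<theta> j i * (time_fourier f \<omega> *
        (born0 \<Omega> C (C *v p) \<theta> i \<kappa> + of_real \<epsilon> * born1 \<Omega> C (C *v p) P p \<theta> i \<kappa> + of_real (\<epsilon>\<^sup>2) * born2 P p \<theta> i \<kappa>)))"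
proof -
  let ?F = "time_fourier f \<omega>" and ?a = "C *v p"
  let ?pt = "planewave (\<kappa> *\<^sub>R (- \<theta>))" and ?pe = "planewave (\<kappa> *\<^sub>R (- e3))"
  define T0 where "T0 j l = Tgreen \<kappa> (axis j 1) (axis l 1) (\<lambda>z. indicator \<Omega> z * ?pe z)" for j l :: 3
  define T1 where "T1 j m l = Tgreen \<kappa> (axis j 1) (axis l 1) (\<lambda>z. P j m z * ?pe z)" for j m l :: 3
  define X where "X = chi_hat \<Omega> \<chi>0 \<psi> \<epsilon>"
  define E where "E = E_inc c q f \<omega>"
  have \<Omega>m[measurable]: "\<Omega> \<in> sets borel" using \<Omega> by simp
  have P: "test_function (P i m)" "tsupp (P i m) \<subseteq> \<Omega>" for i m unfolding P_def by (rule \<psi>)+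
  have P0: "P i m y = 0" if "y \<notin> \<Omega>" for y i m
    using P(2)[of i m] tsupp_vanish[of y "P i m"] that by auto
  have \<psi>0: "\<psi> y $ i $ m = 0" if "y \<notin> \<Omega>" for y i m using P0[OF that] unfolding P_def .
  have XE: "(X y *v E y) $ i = indicator \<Omega> y * ((?F * ?a $ i) * ?pe y + (\<Sum>m\<in>UNIV. (?F * (of_real \<epsilon> * p $ m)) * (P i m y * ?pe y)))" for y i
    unfolding X_def E_def C_def p_def P_def \<kappa>_def by (rule induced_field_nth[OF \<psi>0])
  \<comment> \<open>Lets the cutoff in the susceptibility be inserted or dropped wherever an entry
    of \<psi> is a factor.\<close>
  have Pcut: "indicator \<Omega> y * P i m y = P i m y" for y i m using P0[of y] by (cases "y \<in> \<Omega>") auto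
  have hb1: "has_bochner_integral lborel (\<lambda>y. ?pt y * (X y *v E y) $ i)
    (?F * (?a $ i * phase_integral \<theta> (indicator \<Omega>) \<kappa> + of_real \<epsilon> * (\<Sum>m\<in>UNIV. p $ m * phase_integral \<theta> (P i m) \<kappa>)))" for i
  proof -
    have i0: "has_bochner_integral lborel (\<lambda>y. indicator \<Omega> y * planewave (\<kappa> *\<^sub>R (- \<theta> - e3)) y) (phase_integral \<theta> (indicator \<Omega>) \<kappa>)"
      unfolding phase_integral_def by (rule has_bochner_integral_integrable[OF integrable_indicator_planewave[OF \<Omega>]])
    have i1: "has_bochner_integral lborel (\<lambda>y. P i m y * planewave (\<kappa> *\<^sub>R (- \<theta> - e3)) y) (phase_integral \<theta> (P i m) \<kappa>)" for m
      unfolding phase_integral_def by (rule has_bochner_integral_integrable[OF integrable_mult_planewave[OF test_function_integrable[OF P(1)]]])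
    have "has_bochner_integral lborel (\<lambda>y. ?F * (?a $ i * (indicator \<Omega> y * planewave (\<kappa> *\<^sub>R (- \<theta> - e3)) y)
        + of_real \<epsilon> * (\<Sum>m\<in>UNIV. p $ m * (P i m y * planewave (\<kappa> *\<^sub>R (- \<theta> - e3)) y))))
      (?F * (?a $ i * phase_integral \<theta> (indicator \<Omega>) \<kappa> + of_real \<epsilon> * (\<Sum>m\<in>UNIV. p $ m * phase_integral \<theta> (P i m) \<kappa>)))"
      by (intro has_bochner_integral_mult_right has_bochner_integral_add has_bochner_integral_sum i0 i1)
    moreover have "?F * (?a $ i * (indicator \<Omega> y * planewave (\<kappa> *\<^sub>R (- \<theta> - e3)) y)
        + of_real \<epsilon> * (\<Sum>m\<in>UNIV. p $ m * (P i m y * planewave (\<kappa> *\<^sub>R (- \<theta> - e3)) y)))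
      = ?pt y * (X y *v E y) $ i" for y
      unfolding XE planewave_theta_e3[symmetric]
      by (subst Pcut[symmetric]) (simp only: sum_distrib_left distrib_left ac_simps)
    ultimately show ?thesis by (simp only:)
  qed
  have XG: "?pt y * (X y *v green_op c \<omega> (\<lambda>z. X z *v E z) y) $ i
    = ?F * ((\<Sum>l\<in>UNIV. \<Sum>j\<in>UNIV. (C $ i $ l * ?a $ j) * (indicator \<Omega> y * ?pt y * T0 j l y))
      + of_real \<epsilon> * (\<Sum>l\<in>UNIV. \<Sum>j\<in>UNIV. ?a $ j * (P i l y * ?pt y * T0 j l y)
          + C $ i $ l * (\<Sum>m\<in>UNIV. p $ m * (indicator \<Omega> y * ?pt y * T1 j m l y)))
      + of_real (\<epsilon>\<^sup>2) * (\<Sum>l\<in>UNIV. \<Sum>j\<in>UNIV. \<Sum>m\<in>UNIV. p $ m * (P i l y * ?pt y * T1 j m l y)))" for y i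
  proof (cases "y \<in> \<Omega>")
    case False
    then show ?thesis by (simp add: X_def chi_hat_def P0 matrix_vector_mult_def)
  next
    case True
    have G: "green_op c \<omega> (\<lambda>z. X z *v E z) y $ l = ?F * (\<Sum>j\<in>UNIV. ?a $ j * T0 j l y + of_real \<epsilon> * (\<Sum>m\<in>UNIV. p $ m * T1 j m l y))" for l
      unfolding X_def E_def T0_def T1_def P_def C_def p_def \<kappa>_def by (rule green_op_induced_field[OF \<Omega> True \<psi>0 \<psi>(1)])
    have X: "X y $ i $ l = C $ i $ l + of_real \<epsilon> * P i l y" for l
      using True by (simp add: X_def chi_hat_def C_def P_def scaleR_mat_nth[simplified])
    \<comment> \<open>Hiding the sums over m in \<open>S\<close> turns the expansion in powers of
      \<epsilon> into plain ring arithmetic.\<close>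
    define S where "S j l = (\<Sum>m\<in>UNIV. p $ m * T1 j m l y)" for j l
    have S1: "(\<Sum>m\<in>UNIV. p $ m * (z * T1 j m l y)) = z * S j l" for z j l
      unfolding S_def sum_distrib_left by (simp only: ac_simps)
    have "?pt y * (X y *v green_op c \<omega> (\<lambda>z. X z *v E z) y) $ i
      = (\<Sum>l\<in>UNIV. \<Sum>j\<in>UNIV. ?pt y * ((C $ i $ l + of_real \<epsilon> * P i l y) * (?F * (?a $ j * T0 j l y + of_real \<epsilon> * S j l))))"
      unfolding matrix_vector_mult_def[of "X y"] vec_lambda_beta X G S_def[symmetric] sum_distrib_left ..
    also have "\<dots> = (\<Sum>l\<in>UNIV. \<Sum>j\<in>UNIV. ?F * ((C $ i $ l * ?a $ j) * (?pt y * T0 j l y)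
        + of_real \<epsilon> * (?a $ j * (P i l y * ?pt y * T0 j l y) + C $ i $ l * (?pt y * S j l))
        + of_real (\<epsilon>\<^sup>2) * (P i l y * ?pt y * S j l)))"
      by (intro sum.cong refl) (simp add: power2_eq_square algebra_simps)
    finally show ?thesis
      by (simp only: indicator_simps(1)[OF True] mult_1_left S1) (simp only: sum_distrib_left distrib_left sum.distrib)
  qed
  have hb2: "has_bochner_integral lborel (\<lambda>y. ?pt y * (X y *v green_op c \<omega> (\<lambda>z. X z *v E z) y) $ i)
    (?F * ((\<Sum>l\<in>UNIV. \<Sum>j\<in>UNIV. (C $ i $ l * ?a $ j) * green_form \<theta> (indicator \<Omega>) (indicator \<Omega>) j l \<kappa>)
      + of_real \<epsilon> * (\<Sum>l\<in>UNIV. \<Sum>j\<in>UNIV. ?a $ j * green_form \<theta> (P i l) (indicator \<Omega>) j l \<kappa>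
          + C $ i $ l * (\<Sum>m\<in>UNIV. p $ m * green_form \<theta> (indicator \<Omega>) (P j m) j l \<kappa>))
      + of_real (\<epsilon>\<^sup>2) * born2 P p \<theta> i \<kappa>))" for i
  proof -
    have 0: "has_bochner_integral lborel (\<lambda>y. indicator \<Omega> y * ?pt y * T0 j l y) (green_form \<theta> (indicator \<Omega>) (indicator \<Omega>) j l \<kappa>)" for j l
      unfolding green_form_def T0_def
      by (rule has_bochner_integral_integrable[OF green_form_indicator_integrable[OF \<Omega>, of _ 1]]) (auto simp: indicator_def)
    have 1: "has_bochner_integral lborel (\<lambda>y. P i l y * ?pt y * T0 j l y) (green_form \<theta> (P i l) (indicator \<Omega>) j l \<kappa>)" for j l
    proof -
      obtain B where B: "\<And>x. norm (P i l x) \<le> B" using test_function_bounds[OF P(1)[of i l]] by metis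
      show ?thesis
        unfolding green_form_def T0_def
        by (rule has_bochner_integral_integrable[OF green_form_indicator_integrable[OF \<Omega> test_function_measurable[OF P(1)] B P0]])
    qed
    have 2: "has_bochner_integral lborel (\<lambda>y. indicator \<Omega> y * ?pt y * T1 j m l y) (green_form \<theta> (indicator \<Omega>) (P j m) j l \<kappa>)" for j m l
      unfolding green_form_def T1_def by (rule has_bochner_integral_integrable[OF green_form_integrable(1)[OF \<Omega> P]])
    have 3: "has_bochner_integral lborel (\<lambda>y. P i l y * ?pt y * T1 j m l y) (green_form \<theta> (P i l) (P j m) j l \<kappa>)" for j m l
      unfolding green_form_def T1_def by (rule has_bochner_integral_integrable[OF green_form_integrable(2)[OF \<Omega> P]])
    show ?thesis
      unfolding XG born2_def
      by (intro has_bochner_integral_mult_right has_bochner_integral_add has_bochner_integral_sum 0 1 2 3)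
  qed
  have "far_field c \<omega> (\<lambda>y. X y *v E y) (\<rho> *\<^sub>R \<theta>) $ j + far_field c \<omega> (\<lambda>y. X y *v green_op c \<omega> (\<lambda>z. X z *v E z) y) (\<rho> *\<^sub>R \<theta>) $ j
    = - (of_real (\<omega>\<^sup>2) * exp (\<i> * of_real (\<omega> / c * \<rho>)) / of_real (4 * pi * \<rho> * c\<^sup>2)) *
      (\<Sum>i\<in>UNIV. proj \<theta> j i * (LINT y|lborel. ?pt y * (X y *v E y) $ i) + proj \<theta> j i * (LINT y|lborel. ?pt y * (X y *v green_op c \<omega> (\<lambda>z. X z *v E z) y) $ i))"
    unfolding \<kappa>_def sum.distrib distrib_left
    by (subst (1 2) far_field_nth[OF \<theta> \<rho>]) (use hb1 hb2 in \<open>auto simp: has_bochner_integral_iff \<kappa>_def\<close>)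
  also have "\<dots> = - (of_real (\<omega>\<^sup>2) * exp (\<i> * of_real (\<omega> / c * \<rho>)) / of_real (4 * pi * \<rho> * c\<^sup>2)) *
      (\<Sum>i\<in>UNIV. proj \<theta> j i * (?F * (born0 \<Omega> C ?a \<theta> i \<kappa> + of_real \<epsilon> * born1 \<Omega> C ?a P p \<theta> i \<kappa> + of_real (\<epsilon>\<^sup>2) * born2 P p \<theta> i \<kappa>)))"
    unfolding has_bochner_integral_integral_eq[OF hb1] has_bochner_integral_integral_eq[OF hb2] born0_def born1_def
    by (simp only: distrib_left ac_simps)
  finally show ?thesis
    unfolding E2_def Let_def X_def E_def by simp
qed

section \<open>Identification of the first order data\<close>

lemma integrable_half_line_mult_exp:
  fixes q :: "real \<Rightarrow> complex"
  assumes "integrable lborel q"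
  shows "integrable lborel (\<lambda>x. (if 0 < x then q x else 0) * exp (\<i> * of_real (x * l)))"
proof -
  have "integrable lborel (\<lambda>x. indicator {0<..} x *\<^sub>R q x)"
    using assms by (intro integrable_mult_indicator) auto
  from integrable_mult_planewave[OF this, of l] show ?thesis
    by (rule Bochner_Integration.integrable_cong[THEN iffD1, rotated -1]) (auto simp: planewave_def indicator_def mult.commute)
qed

lemma first_order_data_unique:
  fixes \<psi> :: "real^3 \<Rightarrow> complex^3^3" and \<Omega> :: "(real^3) set" and q \<theta> :: "real^3" and \<chi>0 \<rho> c :: real and j :: 3 and f :: "real \<Rightarrow> real"
  defines "S \<equiv> \<lambda>x. - (exp (\<i> * of_real (x * ((\<rho> - \<rho> * \<theta> $ 3) / c))) * (1 / of_real (4 * pi * \<rho> * c\<^sup>2)))"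
    and "B1 \<equiv> \<lambda>x. \<Sum>i\<in>UNIV. proj \<theta> j i * born1 \<Omega> (chi0_mat \<chi>0) (chi0_mat \<chi>0 *v pol q) (\<lambda>i m y. \<psi> y $ i $ m) (pol q) \<theta> i x"
  defines "Q \<equiv> \<lambda>x. of_real (x\<^sup>2) * (time_fourier f x * time_fourier f (- x) * (S x * B1 (x / c)))"
  assumes M: "first_order_data c \<Omega> \<chi>0 \<psi> q f d M" and j: "j \<in> {1, 2}" and det: "\<rho> *\<^sub>R \<theta> \<in> detector d"
    and \<Omega>: "open \<Omega>" "bounded \<Omega>" and f: "test_function f"
    and \<psi>: "\<And>i m. test_function (\<lambda>y. \<psi> y $ i $ m)" "\<And>i m. tsupp (\<lambda>y. \<psi> y $ i $ m) \<subseteq> \<Omega>"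
    and \<theta>: "norm \<theta> = 1" and \<rho>: "0 < \<rho>"
  shows "M j l (\<rho> *\<^sub>R \<theta>) = eta q $ j / of_real pi * of_real (Re (LINT x|lborel. (if 0 < x then Q x else 0) * exp (\<i> * of_real (x * (2 * l / c)))))"
    and "amplitude (\<lambda>x. S x * B1 (x / c))"
proof -
  let ?C = "chi0_mat \<chi>0" and ?p = "pol q" and ?P = "\<lambda>i m y. \<psi> y $ i $ m"
  define B0 where "B0 x = (\<Sum>i\<in>UNIV. proj \<theta> j i * born0 \<Omega> ?C (?C *v ?p) \<theta> i x)" for x
  define B2 where "B2 x = (\<Sum>i\<in>UNIV. proj \<theta> j i * born2 ?P ?p \<theta> i x)" for x
  define Q0 where "Q0 x = of_real (x\<^sup>2) * (time_fourier f x * time_fourier f (- x) * (S x * B0 (x / c)))" for x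
  define Q2 where "Q2 x = of_real (x\<^sup>2) * (time_fourier f x * time_fourier f (- x) * (S x * B2 (x / c)))" for x
  have S: "amplitude S"
  proof -
    have "amplitude (\<lambda>x. - 1 * (exp (\<i> * of_real (x * ((\<rho> - \<rho> * \<theta> $ 3) / c))) * (1 / of_real (4 * pi * \<rho> * c\<^sup>2))))"
      by (intro amplitude_mult amplitude_exp amplitude_const)
    then show ?thesis by (simp add: S_def)
  qed
  have S_bd: "norm (S x) \<le> norm (1 / complex_of_real (4 * pi * \<rho> * c\<^sup>2))" for x
    unfolding S_def norm_minus_cancel norm_mult norm_exp_i_times by simp
  have B1: "amplitude B1" unfolding B1_def
    by (intro amplitude_sum amplitude_cmult amplitude_born1[OF \<Omega> \<psi>])
  have B2: "amplitude B2" unfolding B2_def[abs_def]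
    by (intro amplitude_sum amplitude_cmult amplitude_born2[OF \<Omega> \<psi>])
  have B0: "poly_bounded B0" unfolding B0_def[abs_def]
    by (intro poly_bounded_sum poly_bounded_cmult poly_bounded_born0[OF \<Omega>])
  show SB: "amplitude (\<lambda>x. S x * B1 (x / c))"
    by (intro amplitude_mult amplitude_rescale S B1)
  have iQ: "integrable lborel (\<lambda>x. of_real (x\<^sup>2) * (time_fourier f x * time_fourier f (- x) * s x))" if s: "amplitude s" for s
  proof (rule spectrum_damped[OF f s], goal_cases)
    case (1 q1 q2 D)
    have "continuous_on UNIV (\<lambda>x. of_real (x\<^sup>2) * (time_fourier f x * time_fourier f (- x) * s x))"
      using 1(1) by (intro continuous_at_imp_continuous_on ballI) (rule has_vector_derivative_continuous)
    from borel_measurable_continuous_onI[OF this] have m: "(\<lambda>x. of_real (x\<^sup>2) * (time_fourier f x * time_fourier f (- x) * s x)) \<in> borel_measurable lborel" by simp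
    have i: "integrable lborel (\<lambda>x::real. D * (1 / (1 + x\<^sup>2)))"
      by (intro integrable_mult_right integrable_inverse_1_plus_square_UNIV)
    show ?case
      by (rule Bochner_Integration.integrable_bound[OF i m], rule AE_I2, simp only: real_norm_def, rule order_trans[OF 1(4) abs_ge_self])
  qed
  \<comment> \<open>All three coefficients must be integrable before the integral can be split into
    powers of \<epsilon>; this one is covered by its polynomial growth.\<close>
  have i0: "integrable lborel Q0" unfolding Q0_def[abs_def]
    by (rule integrable_spectrum_poly_bounded[OF f B0 S_bd amplitude_measurable[OF S]])
  have i1: "integrable lborel Q" unfolding Q_def by (rule iQ[OF SB])
  have i2: "integrable lborel Q2" unfolding Q2_def[abs_def] by (rule iQ) (intro amplitude_mult amplitude_rescale S B2)
  define J where "J q l = (LINT x|lborel. (if 0 < x then q x else 0) * exp (\<i> * of_real (x * (2 * l / c))))" for q l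
  have data: "data2 c \<Omega> \<chi>0 \<psi> q f \<epsilon> j l (\<rho> *\<^sub>R \<theta>)
    = eta q $ j / of_real pi * of_real (Re (J Q0 l + of_real \<epsilon> * J Q l + of_real (\<epsilon>\<^sup>2) * J Q2 l))" for \<epsilon> l
  proof -
    \<comment> \<open>The distance \<rho> in the far field phase and the height of the detector
      point combine into the path difference \<open>\<rho> - \<rho> * \<theta> $ 3\<close>,
      independent of l.\<close>
    have ph: "exp (\<i> * of_real (x / c * \<rho>)) * exp (\<i> * of_real (x / c * (2 * l - (\<rho> *\<^sub>R \<theta>) $ 3)))
      = exp (\<i> * of_real (x * ((\<rho> - \<rho> * \<theta> $ 3) / c))) * exp (\<i> * of_real (x * (2 * l / c)))" for x
      unfolding exp_add[symmetric] distrib_left[symmetric] of_real_add[symmetric]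
      by (rule arg_cong[where f="\<lambda>t. exp (\<i> * complex_of_real t)"]) (simp add: divide_inverse algebra_simps)
    let ?K = "\<lambda>x. (if 0 < x then Q0 x else 0) * exp (\<i> * of_real (x * (2 * l / c)))
      + of_real \<epsilon> * ((if 0 < x then Q x else 0) * exp (\<i> * of_real (x * (2 * l / c))))
      + of_real (\<epsilon>\<^sup>2) * ((if 0 < x then Q2 x else 0) * exp (\<i> * of_real (x * (2 * l / c))))"
    have pt: "indicator {0<..} x *\<^sub>R ((E2 c \<Omega> \<chi>0 \<psi> q f \<epsilon> x (\<rho> *\<^sub>R \<theta>) $ j - E_inc c q f x (\<rho> *\<^sub>R \<theta>) $ j)
        * time_fourier f (- x) * exp (\<i> * of_real (x / c * (2 * l - (\<rho> *\<^sub>R \<theta>) $ 3)))) = ?K x" for x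
    proof (cases "0 < x")
      case True
      define z where "z = exp (\<i> * complex_of_real (x * (2 * l / c)))"
      define e where "e = exp (\<i> * complex_of_real (x * ((\<rho> - \<rho> * \<theta> $ 3) / c)))"
      define k where "k = 1 / complex_of_real (4 * pi * \<rho> * c\<^sup>2)"
      define u where "u = exp (\<i> * complex_of_real (x / c * \<rho>))"
      define w where "w = exp (\<i> * of_real (x / c * (2 * l - (\<rho> *\<^sub>R \<theta>) $ 3)))"
      have uw: "u * w = e * z" using ph unfolding u_def w_def e_def z_def .
      have B: "(\<Sum>i\<in>UNIV. proj \<theta> j i * (time_fourier f x *
        (born0 \<Omega> ?C (?C *v ?p) \<theta> i (x / c) + of_real \<epsilon> * born1 \<Omega> ?C (?C *v ?p) ?P ?p \<theta> i (x / c) + of_real (\<epsilon>\<^sup>2) * born2 ?P ?p \<theta> i (x / c))))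
        = time_fourier f x * (B0 (x / c) + of_real \<epsilon> * B1 (x / c) + of_real (\<epsilon>\<^sup>2) * B2 (x / c))"
        unfolding B0_def B1_def B2_def
        by (simp only: sum_distrib_left distrib_left sum.distrib ac_simps)
      have "(E2 c \<Omega> \<chi>0 \<psi> q f \<epsilon> x (\<rho> *\<^sub>R \<theta>) $ j - E_inc c q f x (\<rho> *\<^sub>R \<theta>) $ j) * time_fourier f (- x) * w
        = - (of_real (x\<^sup>2) * u * k) * (time_fourier f x * (B0 (x / c) + of_real \<epsilon> * B1 (x / c) + of_real (\<epsilon>\<^sup>2) * B2 (x / c))) * time_fourier f (- x) * w"
        unfolding scattered_field_nth[OF \<Omega> \<psi> \<theta> \<rho>] B u_def k_def by simp
      also have "\<dots> = - (of_real (x\<^sup>2) * k) * (time_fourier f x * (B0 (x / c) + of_real \<epsilon> * B1 (x / c) + of_real (\<epsilon>\<^sup>2) * B2 (x / c))) * time_fourier f (- x) * (u * w)"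
        by (simp add: ac_simps)
      also have "\<dots> = Q0 x * z + of_real \<epsilon> * (Q x * z) + of_real (\<epsilon>\<^sup>2) * (Q2 x * z)"
        unfolding uw Q0_def Q_def Q2_def S_def e_def[symmetric] k_def[symmetric] by (simp add: algebra_simps)
      finally show ?thesis using True unfolding w_def z_def by simp
    qed simp
    have "(LINT x:{0<..}|lborel. (E2 c \<Omega> \<chi>0 \<psi> q f \<epsilon> x (\<rho> *\<^sub>R \<theta>) $ j - E_inc c q f x (\<rho> *\<^sub>R \<theta>) $ j)
        * time_fourier f (- x) * exp (\<i> * of_real (x / c * (2 * l - (\<rho> *\<^sub>R \<theta>) $ 3)))) = (LINT x|lborel. ?K x)"
      unfolding set_lebesgue_integral_def pt ..
    also have "\<dots> = J Q0 l + of_real \<epsilon> * J Q l + of_real (\<epsilon>\<^sup>2) * J Q2 l"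
      unfolding J_def
      by (rule has_bochner_integral_integral_eq)
        (intro has_bochner_integral_add has_bochner_integral_mult_right has_bochner_integral_integrable integrable_half_line_mult_exp i0 i1 i2)
    finally show ?thesis unfolding data2_def by simp
  qed
  have o: "(\<lambda>\<epsilon>. data2 c \<Omega> \<chi>0 \<psi> q f \<epsilon> j l (\<rho> *\<^sub>R \<theta>) - (data2 c \<Omega> \<chi>0 \<psi> q f 0 j l (\<rho> *\<^sub>R \<theta>) + of_real \<epsilon> * M j l (\<rho> *\<^sub>R \<theta>)))
    \<in> o[at_right 0](\<lambda>\<epsilon>. of_real \<epsilon>)"
    using M j det unfolding first_order_data_def by blast
  have eq: "data2 c \<Omega> \<chi>0 \<psi> q f \<epsilon> j l (\<rho> *\<^sub>R \<theta>) - (data2 c \<Omega> \<chi>0 \<psi> q f 0 j l (\<rho> *\<^sub>R \<theta>) + of_real \<epsilon> * M j l (\<rho> *\<^sub>R \<theta>))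
    = of_real \<epsilon> * (eta q $ j / of_real pi * of_real (Re (J Q l))) + of_real (\<epsilon>\<^sup>2) * (eta q $ j / of_real pi * of_real (Re (J Q2 l)))
      - of_real \<epsilon> * M j l (\<rho> *\<^sub>R \<theta>)" for \<epsilon>
    unfolding data by (simp add: algebra_simps power2_eq_square)
  have "M j l (\<rho> *\<^sub>R \<theta>) = eta q $ j / of_real pi * of_real (Re (J Q l))"
    by (rule first_order_coefficient) (rule o[unfolded eq])
  then show "M j l (\<rho> *\<^sub>R \<theta>) = eta q $ j / of_real pi * of_real (Re (LINT x|lborel. (if 0 < x then Q x else 0) * exp (\<i> * of_real (x * (2 * l / c)))))"
    unfolding J_def .
qed

lemma time_fourier_uminus: "time_fourier f (- x) = cnj (time_fourier f x)"
  unfolding time_fourier_def Bochner_Integration.integral_cnj[symmetric] by (simp add: exp_cnj)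

text \<open>Inverts the half-line transform at \<omega> and balances the constants:
  \<open>8 * pi * \<rho> * c\<close> times \<open>1 / pi\<close> from the data,
  \<open>pi * c / 2\<close> from the inversion and \<open>1 / (4 * pi * \<rho> * c\<^sup>2)\<close>
  from the far field give 1, and the two minus signs cancel.\<close>

lemma m_data_eq:
  fixes \<psi> :: "real^3 \<Rightarrow> complex^3^3"
  assumes c: "0 < c" and M: "first_order_data c \<Omega> \<chi>0 \<psi> q f d M" and j: "j \<in> {1, 2}" and det: "\<rho> *\<^sub>R \<theta> \<in> detector d"
    and \<Omega>: "open \<Omega>" "bounded \<Omega>" and f: "test_function f"
    and \<psi>: "\<And>i m. test_function (\<lambda>y. \<psi> y $ i $ m)" "\<And>i m. tsupp (\<lambda>y. \<psi> y $ i $ m) \<subseteq> \<Omega>"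
    and \<theta>: "norm \<theta> = 1" and \<rho>: "0 < \<rho>" and \<omega>: "0 < \<omega>" "time_fourier f \<omega> \<noteq> 0"
  shows "m_data c f M \<rho> j \<omega> \<theta> = eta q $ j *
    (\<Sum>i\<in>UNIV. proj \<theta> j i * born1 \<Omega> (chi0_mat \<chi>0) (chi0_mat \<chi>0 *v pol q) (\<lambda>i m y. \<psi> y $ i $ m) (pol q) \<theta> i (\<omega> / c))"
proof -
  define S where "S x = - (exp (\<i> * of_real (x * ((\<rho> - \<rho> * \<theta> $ 3) / c))) * (1 / complex_of_real (4 * pi * \<rho> * c\<^sup>2)))" for x
  define B1 where "B1 x = (\<Sum>i\<in>UNIV. proj \<theta> j i * born1 \<Omega> (chi0_mat \<chi>0) (chi0_mat \<chi>0 *v pol q) (\<lambda>i m y. \<psi> y $ i $ m) (pol q) \<theta> i x)" for x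
  define Q where "Q x = of_real (x\<^sup>2) * (time_fourier f x * time_fourier f (- x) * (S x * B1 (x / c)))" for x
  note D = first_order_data_unique[OF M j det \<Omega> f \<psi> \<theta> \<rho>, folded S_def B1_def, folded Q_def]
  have "(LINT l|lborel. of_real (Re (LINT x|lborel. (if 0 < x then Q x else 0) * exp (\<i> * of_real (x * (2 * l / c)))))
      * exp (- \<i> * of_real (\<omega> * (2 * l / c)))) = of_real (pi * c / 2) * Q \<omega>"
  proof (rule spectrum_damped[OF f D(2)], fold Q_def, goal_cases)
    case (1 q1 q2 K)
    have "(Q has_vector_derivative 0) (at 0)"
      unfolding Q_def[abs_def] by (intro square_mult_amplitude_derivative_0 amplitude_mult[OF amplitude_spectrum[OF f]] D(2))
    \<comment> \<open>\<open>spectrum_damped\<close> provides some derivative \<open>q1\<close>;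
      uniqueness of derivatives identifies its value at 0.\<close>
    then have "q1 0 = 0" using 1(1)[of 0] by (rule vector_derivative_unique_at[rotated])
    then show ?case
      by (intro half_line_real_part[OF 1(1-6)]) (simp_all add: Q_def c \<omega>)
  qed
  note I = this
  have ph: "exp (- \<i> * of_real (\<omega> / c * (2 * l - \<rho> * (\<theta> $ 3 - 1)))) = exp (- \<i> * of_real (\<omega> * (2 * l / c))) * exp (\<i> * of_real (\<omega> * (\<rho> * (\<theta> $ 3 - 1) / c)))" for l
    unfolding exp_add[symmetric] by (rule arg_cong[where f=exp]) (simp add: divide_inverse algebra_simps)
  define e where "e = exp (\<i> * complex_of_real (\<omega> * (\<rho> * (\<theta> $ 3 - 1) / c)))"
  have "(LINT l|lborel. M j l (\<rho> *\<^sub>R \<theta>) * exp (- \<i> * of_real (\<omega> / c * (2 * l - \<rho> * (\<theta> $ 3 - 1)))))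
    = (LINT l|lborel. (eta q $ j / of_real pi * e) * (of_real (Re (LINT x|lborel. (if 0 < x then Q x else 0) * exp (\<i> * of_real (x * (2 * l / c)))))
      * exp (- \<i> * of_real (\<omega> * (2 * l / c)))))"
    unfolding D(1) ph e_def[symmetric] by (simp only: ac_simps)
  also have "\<dots> = (eta q $ j / of_real pi * e) * (of_real (pi * c / 2) * Q \<omega>)"
    unfolding integral_mult_right_zero I ..
  finally have L: "(LINT l|lborel. M j l (\<rho> *\<^sub>R \<theta>) * exp (- \<i> * of_real (\<omega> / c * (2 * l - \<rho> * (\<theta> $ 3 - 1)))))
    = (eta q $ j / of_real pi * e) * (of_real (pi * c / 2) * Q \<omega>)" .
  \<comment> \<open>The phase built into \<open>m_data\<close> is inverse to that of
    \<open>S\<close>, so only the far field constant remains.\<close>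
  have eS: "e * S \<omega> = - (1 / complex_of_real (4 * pi * \<rho> * c\<^sup>2))"
  proof -
    have "e * exp (\<i> * of_real (\<omega> * ((\<rho> - \<rho> * \<theta> $ 3) / c))) = exp 0"
      unfolding e_def exp_add[symmetric] by (rule arg_cong[where f=exp]) (simp add: divide_inverse algebra_simps)
    then show ?thesis unfolding S_def by (simp add: mult.assoc[symmetric])
  qed
  define N where "N = (cmod (time_fourier f \<omega>))\<^sup>2"
  have N: "time_fourier f \<omega> * time_fourier f (- \<omega>) = of_real N" "N \<noteq> 0"
    using \<omega>(2) unfolding N_def time_fourier_uminus complex_norm_square by simp_all
  have "m_data c f M \<rho> j \<omega> \<theta> = - of_real (8 * pi * \<rho> * c / (\<omega>\<^sup>2 * N)) * ((eta q $ j / of_real pi * e) * (of_real (pi * c / 2) * Q \<omega>))"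
    unfolding m_data_def L N_def ..
  also have "\<dots> = - of_real (8 * pi * \<rho> * c / (\<omega>\<^sup>2 * N)) * (eta q $ j / of_real pi * (of_real (pi * c / 2) * (of_real (\<omega>\<^sup>2) * (of_real N * ((e * S \<omega>) * B1 (\<omega> / c))))))"
    unfolding Q_def N(1) by (simp only: ac_simps)
  also have "\<dots> = eta q $ j * B1 (\<omega> / c)"
    unfolding eS using c \<rho> \<omega>(1) N(2) by (simp add: field_simps power2_eq_square)
  finally show ?thesis unfolding B1_def .
qed

text \<open>The three summands of the bracket match the three kinds of terms in
  \<open>born1\<close>: a phase integral, Green forms with density from \<psi> multiplied from the
  left by \<open>C\<close>, and Green forms with weight from \<psi> applied to
  \<open>C *v p\<close>.\<close>

lemma born1_eq:
  fixes \<psi> :: "real^3 \<Rightarrow> complex^3^3"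
  assumes c: "0 < c" "0 < \<omega>" and \<Omega>: "open \<Omega>" "bounded \<Omega>"
    and \<psi>: "\<And>i m. test_function (\<lambda>y. \<psi> y $ i $ m)" "\<And>i m. tsupp (\<lambda>y. \<psi> y $ i $ m) \<subseteq> \<Omega>"
  shows "((space_fourier \<psi> ((\<omega> / c) *\<^sub>R (\<theta> + e3)) + C ** K_op c \<Omega> (space_fourier \<psi>) \<omega> \<theta>
      + K_dagger c \<Omega> (space_fourier \<psi>) \<omega> \<theta> ** C) *v p) $ i
    = born1 \<Omega> C (C *v p) (\<lambda>i m y. \<psi> y $ i $ m) p \<theta> i (\<omega> / c)"
proof -
  have F: "space_fourier \<psi> k $ i $ m = fourier (\<lambda>y. \<psi> y $ i $ m) k" for k i m
    by (simp add: space_fourier_def fourier_def planewave_def)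
  have v: "- ((\<omega> / c) *\<^sub>R (\<theta> + e3)) = (\<omega> / c) *\<^sub>R (- \<theta> - e3)"
    by (simp add: scaleR_diff_right scaleR_add_right)
  have 1: "space_fourier \<psi> ((\<omega> / c) *\<^sub>R (\<theta> + e3)) $ i $ m = phase_integral \<theta> (\<lambda>y. \<psi> y $ i $ m) (\<omega> / c)" for i m
    unfolding F fourier_def phase_integral_def v ..
  have 2: "K_op c \<Omega> (space_fourier \<psi>) \<omega> \<theta> $ l $ m = (\<Sum>j\<in>UNIV. green_form \<theta> (indicator \<Omega>) (\<lambda>y. \<psi> y $ j $ m) j l (\<omega> / c))" for l m
    unfolding green_form_def by (rule K_op_nth[OF \<Omega> c \<psi> F])
  have 3: "K_dagger c \<Omega> (space_fourier \<psi>) \<omega> \<theta> $ i $ m = (\<Sum>j\<in>UNIV. green_form \<theta> (\<lambda>y. \<psi> y $ i $ j) (indicator \<Omega>) m j (\<omega> / c))" for i m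
    unfolding green_form_def by (rule K_dagger_nth[OF \<Omega> c \<psi> F])
  show ?thesis
    unfolding born1_def matrix_vector_mult_def matrix_matrix_mult_def vec_lambda_beta vector_add_component 1 2 3
    by (simp add: sum_3 algebra_simps)
qed

theorem proposition10:
  fixes c d \<chi>0 \<omega> \<rho> :: real
    and \<Omega> :: "(real^3) set"
    and \<psi>11 \<psi>12 \<psi>22 \<psi>33 :: "real^3 \<Rightarrow> complex"
    and \<psi> :: "real^3 \<Rightarrow> complex^3^3"
    and q \<theta> v :: "real^3"
    and f :: "real \<Rightarrow> real"
    and M :: "3 \<Rightarrow> real \<Rightarrow> real^3 \<Rightarrow> complex"
    and j :: 3
  assumes "c > 0" and "d > 0"
    and "open \<Omega>" and "bounded \<Omega>"
    and "\<And>g. g \<in> {\<psi>11, \<psi>12, \<psi>22, \<psi>33} \<Longrightarrow> test_function g \<and> tsupp g \<subseteq> \<Omega>"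
    and \<psi>: "\<psi> = psi_mat \<psi>11 \<psi>12 \<psi>22 \<psi>33"
    and "test_function f"
    and "q $ 3 = 0"
    and "\<And>t. t \<le> 0 \<Longrightarrow> tsupp (E0 c q f t) \<inter> \<Omega> = {}"
    and "\<And>t x. t \<ge> 0 \<Longrightarrow> x \<in> detector d \<Longrightarrow> E0 c q f t x = 0"
    and M: "first_order_data c \<Omega> \<chi>0 \<psi> q f d M"
    and "\<omega> > 0" and "time_fourier f \<omega> \<noteq> 0"
    and "\<theta> \<in> upper_hemisphere"
    and "\<rho> > 0" and "\<rho> *\<^sub>R \<theta> \<in> detector d"
    and v: "v = (\<omega> / c) *\<^sub>R (\<theta> + e3)"
    and "j \<in> {1, 2}"
  shows "eta q $ j *
           ccross (cvec \<theta>) (ccross (cvec \<theta>)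
             ((space_fourier \<psi> v
               + chi0_mat \<chi>0 ** K_op c \<Omega> (space_fourier \<psi>) \<omega> \<theta>
               + K_dagger c \<Omega> (space_fourier \<psi>) \<omega> \<theta> ** chi0_mat \<chi>0) *v pol q)) $ j
         = m_data c f M \<rho> j \<omega> \<theta>"
proof -
  have \<theta>: "norm \<theta> = 1" using \<open>\<theta> \<in> upper_hemisphere\<close> by (simp add: upper_hemisphere_def)
  have ent: "test_function (\<lambda>y. \<psi> y $ i $ m) \<and> tsupp (\<lambda>y. \<psi> y $ i $ m) \<subseteq> \<Omega>" for i m
  proof -
    \<comment> \<open>The zero entries of \<psi> count as test functions as well, so that all nine
      entries are treated alike.\<close>
    have 0: "test_function (\<lambda>x::real^3. 0::complex) \<and> tsupp (\<lambda>x::real^3. 0::complex) \<subseteq> \<Omega>"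
      using test_function_0 by (simp add: tsupp_def)
    have \<psi>s: "test_function g \<and> tsupp g \<subseteq> \<Omega>" if "g = \<psi>11 \<or> g = \<psi>12 \<or> g = \<psi>22 \<or> g = \<psi>33" for g
      using assms(5)[of g] that by auto
    have "i = 1 \<or> i = 2 \<or> i = 3" "m = 1 \<or> m = 2 \<or> m = 3" by (rule exhaust_3)+
    then show ?thesis
      unfolding \<psi> psi_mat_def by (elim disjE) (simp_all add: vector_3 0 \<psi>s)
  qed
  show ?thesis
    unfolding ccross_ccross_nth v
      born1_eq[OF \<open>c > 0\<close> \<open>\<omega> > 0\<close> \<open>open \<Omega>\<close> \<open>bounded \<Omega>\<close> conjunct1[OF ent] conjunct2[OF ent]]
      m_data_eq[OF \<open>c > 0\<close> M \<open>j \<in> {1, 2}\<close> \<open>\<rho> *\<^sub>R \<theta> \<in> detector d\<close> \<open>open \<Omega>\<close> \<open>bounded \<Omega>\<close> \<open>test_function f\<close>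
        conjunct1[OF ent] conjunct2[OF ent] \<theta> \<open>\<rho> > 0\<close> \<open>\<omega> > 0\<close> \<open>time_fourier f \<omega> \<noteq> 0\<close>] ..
qed

end
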